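(* Let $C\subset U=U_q(\mathfrak g)$ be a right coideal subalgebra such that $C^0:=C\cap U^0$ is a Hopf subalgebra of $U$. Then there is a set $Z\subset C$ generating $C$ as an algebra such that for every $X\in Z$ all $E$-leading terms of $X$ lie in $U^{\geq0}$.
   Context: Let $\mathfrak g$ be a finite-dimensional complex semisimple Lie algebra with simple roots $\Pi$, root lattice $Q=\mathbb Z\Pi$, $Q_+=\mathbb N_0\Pi$ and invariant symmetric bilinear form $(\cdot,\cdot)$. Let $q\in\mathbb C^\times$ be not a root of unity, and let $U=U_q(\mathfrak g)$ be the Drinfeld--Jimbo quantum group over $\mathbb C$ (as in Jantzen's book), with generators $E_\alpha,F_\alpha$ ($\alpha\in\Pi$), $K_\mu$ ($\mu\in Q$), relations $K_\mu E_\alpha K_\mu^{-1}=q^{(\mu,\alpha)}E_\alpha$, $K_\mu F_\alpha K_\mu^{-1}=q^{-(\mu,\alpha)}F_\alpha$, $[E_\alpha,F_\beta]=\delta_{\alpha\beta}(K_\alpha-K_\alpha^{-1})/(q_\alpha-q_\alpha^{-1})$, the quantum Serre relations, and coproduct $\Delta(E_\alpha)=E_\alpha\otimes1+K_\alpha\otimes E_\alpha$, $\Delta(F_\alpha)=F_\alpha\otimes K_\alpha^{-1}+1\otimes F_\alpha$, $\Delta(K_\mu)=K_\mu\otimes K_\mu$. $U^+,U^-,U^0$ are the subalgebras generated by the $E_\alpha$, the $F_\alpha$, the $K_\mu$, respectively, and $U^{\ge0}=U^+U^0$; $U^+_\mu$ and $U^-_{-\gamma}$ ($\mu,\gamma\in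 Q_+$) are the weight spaces. A subalgebra $C\subset U$ is a right coideal subalgebra if $\Delta(C)\subset C\otimes U$. By the triangular decomposition every $X\in U$ is uniquely $X=\sum X_{\mu,\nu,\gamma}$ with $X_{\mu,\nu,\gamma}\in U^+_\mu K_\nu U^-_{-\gamma}$, $\mu,\gamma\in Q_+$, $\nu\in Q$. Let $\prec$ be the usual partial order on $Q$ ($\mu\preceq\mu'$ iff $\mu'-\mu\in Q_+$). Let $\mathcal E(X)$ be the set of $\prec$-maximal elements of $\{\mu\in Q_+\setminus\{0\}:\exists\,\nu\in Q,\gamma\in Q_+,\ X_{\mu,\nu,\gamma}\neq0\}$. For $\mu\in\mathcal E(X)$ the corresponding $E$-leading term of $X$ is $L_\mu(X)=\sum_{\nu,\gamma}X_{\mu,\nu,\gamma}$. *)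

theory Defs
  imports Complex_Main "HOL-Library.Poly_Mapping" "HOL-Library.Function_Algebras"
    "HOL-Algebra.Module" "HOL-Algebra.QuotRing"
begin

section \<open>Semisimple Lie algebras and their roots\<close>

locale complex_lie_algebra = vector_space scale
  for scale :: "complex \<Rightarrow> 'g::ab_group_add \<Rightarrow> 'g" (infixr \<open>*\<^sub>L\<close> 75) +
  fixes bracket :: "'g \<Rightarrow> 'g \<Rightarrow> 'g"
  assumes bracket_add_left: "bracket (x + y) z = bracket x z + bracket y z"
    and bracket_scale_left: "bracket (c *\<^sub>L x) z = c *\<^sub>L bracket x z"
    and bracket_add_right: "bracket z (x + y) = bracket z x + bracket z y"
    and bracket_scale_right: "bracket z (c *\<^sub>L x) = c *\<^sub>L bracket z x"
    and bracket_self: "bracket x x = 0"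
    and jacobi: "bracket x (bracket y z) + bracket y (bracket z x) + bracket z (bracket x y) = 0"
begin

definition finite_dimensional :: bool where
  "finite_dimensional \<longleftrightarrow> (\<exists>B. finite B \<and> span B = UNIV)"

definition bracket_space :: "'g set \<Rightarrow> 'g set \<Rightarrow> 'g set" where
  "bracket_space A B = span {bracket x y | x y. x \<in> A \<and> y \<in> B}"

definition lie_ideal :: "'g set \<Rightarrow> bool" where
  "lie_ideal I \<longleftrightarrow> subspace I \<and> (\<forall>x. \<forall>y\<in>I. bracket x y \<in> I)"

definition solvable :: "'g set \<Rightarrow> bool" where
  "solvable A \<longleftrightarrow> (\<exists>n. ((\<lambda>D. bracket_space D D) ^^ n) A = {0})"

definition semisimple :: bool where
  "semisimple \<longleftrightarrow> (\<forall>I. lie_ideal I \<and> solvable I \<longrightarrow> I = {0})"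

definition nilpotent :: "'g set \<Rightarrow> bool" where
  "nilpotent A \<longleftrightarrow> (\<exists>n. ((\<lambda>D. bracket_space A D) ^^ n) A = {0})"

definition cartan_subalgebra :: "'g set \<Rightarrow> bool" where
  "cartan_subalgebra H \<longleftrightarrow> subspace H \<and> (\<forall>x\<in>H. \<forall>y\<in>H. bracket x y \<in> H) \<and> nilpotent H \<and>
     (\<forall>x. (\<forall>y\<in>H. bracket x y \<in> H) \<longrightarrow> x \<in> H)"

text \<open>The dual of \<open>H\<close> is realised by functions that vanish outside \<open>H\<close>; addition of weights is
  pointwise addition.\<close>

definition dual_space :: "'g set \<Rightarrow> ('g \<Rightarrow> complex) set" where
  "dual_space H = {\<alpha>. (\<forall>x\<in>H. \<forall>y\<in>H. \<alpha> (x + y) = \<alpha> x + \<alpha> y) \<and>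
     (\<forall>c. \<forall>x\<in>H. \<alpha> (c *\<^sub>L x) = c * \<alpha> x) \<and> (\<forall>x. x \<notin> H \<longrightarrow> \<alpha> x = 0)}"

definition roots :: "'g set \<Rightarrow> ('g \<Rightarrow> complex) set" where
  "roots H = {\<alpha> \<in> dual_space H. \<alpha> \<noteq> 0 \<and> (\<exists>x. x \<noteq> 0 \<and> (\<forall>t\<in>H. bracket t x = \<alpha> t *\<^sub>L x))}"

end

section \<open>Simple roots, the root lattice and its invariant form\<close>

inductive_set pos_lattice :: "'w::ab_group_add set \<Rightarrow> 'w set" for S :: "'w set" where
  zero: "0 \<in> pos_lattice S"
| add_simple: "\<mu> \<in> pos_lattice S \<Longrightarrow> \<alpha> \<in> S \<Longrightarrow> \<mu> + \<alpha> \<in> pos_lattice S"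

definition lattice_of :: "'w::ab_group_add set \<Rightarrow> 'w set" where
  "lattice_of S = {\<mu> - \<nu> | \<mu> \<nu>. \<mu> \<in> pos_lattice S \<and> \<nu> \<in> pos_lattice S}"

definition weight_le :: "'w::ab_group_add set \<Rightarrow> 'w \<Rightarrow> 'w \<Rightarrow> bool" where
  "weight_le S \<mu> \<mu>' \<longleftrightarrow> \<mu>' - \<mu> \<in> pos_lattice S"

definition simple_roots :: "('g \<Rightarrow> complex) set \<Rightarrow> ('g \<Rightarrow> complex) set \<Rightarrow> bool" where
  "simple_roots \<Phi> S \<longleftrightarrow> S \<subseteq> \<Phi> \<and>
     \<not> module.dependent (\<lambda>(c::real) \<alpha> x. complex_of_real c * \<alpha> x) S \<and>
     (\<forall>\<beta>\<in>\<Phi>. \<beta> \<in> pos_lattice S \<or> - \<beta> \<in> pos_lattice S)"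

text \<open>Two roots lie in the same irreducible component iff they are linked by a chain of roots in
  which neighbours are not orthogonal. A root is short if it has minimal length in its component.\<close>

definition linked :: "'w set \<Rightarrow> ('w \<Rightarrow> 'w \<Rightarrow> int) \<Rightarrow> 'w \<Rightarrow> 'w \<Rightarrow> bool" where
  "linked \<Phi> form = (\<lambda>\<beta> \<gamma>. \<beta> \<in> \<Phi> \<and> \<gamma> \<in> \<Phi> \<and> form \<beta> \<gamma> \<noteq> 0)\<^sup>*\<^sup>*"

definition short_root :: "'w set \<Rightarrow> ('w \<Rightarrow> 'w \<Rightarrow> int) \<Rightarrow> 'w \<Rightarrow> bool" where
  "short_root \<Phi> form \<alpha> \<longleftrightarrow> \<alpha> \<in> \<Phi> \<and> (\<forall>\<beta>. linked \<Phi> form \<alpha> \<beta> \<longrightarrow> form \<alpha> \<alpha> \<le> form \<beta> \<beta>)"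

text \<open>The invariant form as normalised by Jantzen: the Weyl group invariant scalar product with
  \<open>(\<alpha>, \<alpha>) = 2\<close> for every short root \<open>\<alpha>\<close>. It is integral on the root lattice. Invariance is
  expressed by saying that for each root \<open>\<alpha>\<close> the orthogonal reflection
  \<open>\<beta> \<mapsto> \<beta> - 2 (\<alpha>, \<beta>) / (\<alpha>, \<alpha>) \<alpha>\<close> permutes the roots: a finite spanning set admits at most one
  reflection that maps \<open>\<alpha>\<close> to \<open>- \<alpha>\<close> and preserves the set, so this is the reflection \<open>s\<^sub>\<alpha>\<close> of the
  Weyl group.\<close>

definition invariant_form ::
  "('g \<Rightarrow> complex) set \<Rightarrow> ('g \<Rightarrow> complex) set \<Rightarrow> (('g \<Rightarrow> complex) \<Rightarrow> ('g \<Rightarrow> complex) \<Rightarrow> int) \<Rightarrow> bool"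
where
  "invariant_form \<Phi> S form \<longleftrightarrow>
     (\<forall>\<mu>\<in>lattice_of S. \<forall>\<nu>\<in>lattice_of S. form \<mu> \<nu> = form \<nu> \<mu>) \<and>
     (\<forall>\<mu>\<in>lattice_of S. \<forall>\<mu>'\<in>lattice_of S. \<forall>\<nu>\<in>lattice_of S.
        form (\<mu> + \<mu>') \<nu> = form \<mu> \<nu> + form \<mu>' \<nu>) \<and>
     (\<forall>\<mu>\<in>lattice_of S. \<mu> \<noteq> 0 \<longrightarrow> form \<mu> \<mu> > 0) \<and>
     (\<forall>\<alpha>\<in>\<Phi>. \<forall>\<beta>\<in>\<Phi>.
        (\<lambda>x. \<beta> x -
           complex_of_real (2 * real_of_int (form \<alpha> \<beta>) / real_of_int (form \<alpha> \<alpha>)) * \<alpha> x) \<in> \<Phi>) \<and>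
     (\<forall>\<alpha>. short_root \<Phi> form \<alpha> \<longrightarrow> form \<alpha> \<alpha> = 2)"

section \<open>Complex algebras\<close>

text \<open>A unital associative complex algebra is a record of type \<open>(complex, 'a) module\<close>, that is, a
  ring with scalar multiplication. The locale \<open>algebra\<close> of the library is restricted to commutative
  algebras.\<close>

text \<open>The monoid algebra on finitely supported functions. The free algebra is the case of the word
  monoid.\<close>

definition monoid_algebra ::
  "('m, 'x) monoid_scheme \<Rightarrow> (complex, 'm \<Rightarrow>\<^sub>0 complex) module" where
  "monoid_algebra M =
    \<lparr>carrier = {f. Poly_Mapping.keys f \<subseteq> carrier M},
     mult = (\<lambda>f g. \<Sum>a\<in>Poly_Mapping.keys f. \<Sum>b\<in>Poly_Mapping.keys g.
        Poly_Mapping.single (a \<otimes>\<^bsub>M\<^esub> b) (Poly_Mapping.lookup f a * Poly_Mapping.lookup g b)),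
     one = Poly_Mapping.single \<one>\<^bsub>M\<^esub> 1,
     zero = 0,
     add = (+),
     smult = (\<lambda>c. Poly_Mapping.map ((*) c))\<rparr>"

definition word_monoid :: "'x set \<Rightarrow> 'x list monoid" where
  "word_monoid X = \<lparr>carrier = lists X, mult = (@), one = []\<rparr>"

definition free_algebra :: "'x set \<Rightarrow> (complex, 'x list \<Rightarrow>\<^sub>0 complex) module" where
  "free_algebra X = monoid_algebra (word_monoid X)"

text \<open>The quotient of \<open>A\<close> by the two-sided ideal generated by \<open>R\<close>.\<close>

definition quotient_algebra ::
  "(complex, 'a) module \<Rightarrow> 'a set \<Rightarrow> (complex, 'a set) module" where
  "quotient_algebra A R = (let I = Idl\<^bsub>A\<^esub> R in
    \<lparr>carrier = carrier (A Quot I), mult = mult (A Quot I), one = one (A Quot I),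
     zero = zero (A Quot I), add = add (A Quot I),
     smult = (\<lambda>c Y. \<Union>y\<in>Y. I +>\<^bsub>A\<^esub> (c \<odot>\<^bsub>A\<^esub> y))\<rparr>)"

definition quotient_class :: "(complex, 'a) module \<Rightarrow> 'a set \<Rightarrow> 'a \<Rightarrow> 'a set" where
  "quotient_class A R x = (Idl\<^bsub>A\<^esub> R) +>\<^bsub>A\<^esub> x"

definition opposite_algebra :: "(complex, 'a) module \<Rightarrow> (complex, 'a) module" where
  "opposite_algebra A = A\<lparr>mult := (\<lambda>x y. y \<otimes>\<^bsub>A\<^esub> x)\<rparr>"

definition subalgebra :: "(complex, 'a) module \<Rightarrow> 'a set \<Rightarrow> bool" where
  "subalgebra A B \<longleftrightarrow> B \<subseteq> carrier A \<and> \<one>\<^bsub>A\<^esub> \<in> B \<and>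
     (\<forall>x\<in>B. \<forall>y\<in>B. x \<oplus>\<^bsub>A\<^esub> y \<in> B \<and> x \<otimes>\<^bsub>A\<^esub> y \<in> B) \<and> (\<forall>c. \<forall>x\<in>B. c \<odot>\<^bsub>A\<^esub> x \<in> B)"

definition generated_subalgebra :: "(complex, 'a) module \<Rightarrow> 'a set \<Rightarrow> 'a set" where
  "generated_subalgebra A X = \<Inter>{B. subalgebra A B \<and> X \<subseteq> B}"

definition linear_subspace :: "(complex, 'a) module \<Rightarrow> 'a set \<Rightarrow> bool" where
  "linear_subspace A V \<longleftrightarrow> V \<subseteq> carrier A \<and> \<zero>\<^bsub>A\<^esub> \<in> V \<and>
     (\<forall>x\<in>V. \<forall>y\<in>V. x \<oplus>\<^bsub>A\<^esub> y \<in> V) \<and> (\<forall>c. \<forall>x\<in>V. c \<odot>\<^bsub>A\<^esub> x \<in> V)"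

definition linear_span :: "(complex, 'a) module \<Rightarrow> 'a set \<Rightarrow> 'a set" where
  "linear_span A X = \<Inter>{V. linear_subspace A V \<and> X \<subseteq> V}"

text \<open>The algebra homomorphism from a free algebra to \<open>A\<close> that sends each letter \<open>x\<close> to \<open>f x\<close>, and
  the map it induces on a quotient of the free algebra. The latter is well defined if the former is
  constant on cosets.\<close>

definition free_lift ::
  "(complex, 'a) module \<Rightarrow> ('x \<Rightarrow> 'a) \<Rightarrow> ('x list \<Rightarrow>\<^sub>0 complex) \<Rightarrow> 'a" where
  "free_lift A f p = (\<Oplus>\<^bsub>A\<^esub>w\<in>Poly_Mapping.keys p.
     Poly_Mapping.lookup p w \<odot>\<^bsub>A\<^esub> foldr (\<lambda>x y. f x \<otimes>\<^bsub>A\<^esub> y) w \<one>\<^bsub>A\<^esub>)"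

definition induced_map ::
  "(complex, 'a) module \<Rightarrow> ('x \<Rightarrow> 'a) \<Rightarrow> ('x list \<Rightarrow>\<^sub>0 complex) set \<Rightarrow> 'a" where
  "induced_map A f Y = the_elem (free_lift A f ` Y)"

subsection \<open>Tensor products\<close>

text \<open>The monoid algebra of the multiplicative monoid of \<open>A \<times> B\<close> is the free vector space on
  \<open>A \<times> B\<close> with \<open>(a, b) (a', b') = (a a', b b')\<close>. The linear span of the bilinearity relations is
  already a two-sided ideal, so the quotient is the usual tensor product of vector spaces, with its
  usual product.\<close>

definition bilinear_relations ::
  "(complex, 'a) module \<Rightarrow> (complex, 'b) module \<Rightarrow> ('a \<times> 'b \<Rightarrow>\<^sub>0 complex) set" where
  "bilinear_relations A B = (let t = (\<lambda>a b. Poly_Mapping.single (a, b) (1::complex)) in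
     {t (a \<oplus>\<^bsub>A\<^esub> a') b - t a b - t a' b | a a' b.
        a \<in> carrier A \<and> a' \<in> carrier A \<and> b \<in> carrier B} \<union>
     {t a (b \<oplus>\<^bsub>B\<^esub> b') - t a b - t a b' | a b b'.
        a \<in> carrier A \<and> b \<in> carrier B \<and> b' \<in> carrier B} \<union>
     {t (c \<odot>\<^bsub>A\<^esub> a) b - Poly_Mapping.single (a, b) c | c a b. a \<in> carrier A \<and> b \<in> carrier B} \<union>
     {t a (c \<odot>\<^bsub>B\<^esub> b) - Poly_Mapping.single (a, b) c | c a b. a \<in> carrier A \<and> b \<in> carrier B})"

definition tensor_algebra ::
  "(complex, 'a) module \<Rightarrow> (complex, 'b) module \<Rightarrow> (complex, ('a \<times> 'b \<Rightarrow>\<^sub>0 complex) set) module"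
where
  "tensor_algebra A B = quotient_algebra (monoid_algebra (A \<times>\<times> B)) (bilinear_relations A B)"

definition pure_tensor ::
  "(complex, 'a) module \<Rightarrow> (complex, 'b) module \<Rightarrow> 'a \<Rightarrow> 'b \<Rightarrow> ('a \<times> 'b \<Rightarrow>\<^sub>0 complex) set" where
  "pure_tensor A B a b = quotient_class (monoid_algebra (A \<times>\<times> B)) (bilinear_relations A B)
     (Poly_Mapping.single (a, b) 1)"

text \<open>The subspace \<open>V \<otimes> W\<close> of \<open>A \<otimes> B\<close>.\<close>

definition tensor_subspace ::
  "(complex, 'a) module \<Rightarrow> (complex, 'b) module \<Rightarrow> 'a set \<Rightarrow> 'b set \<Rightarrow>
   ('a \<times> 'b \<Rightarrow>\<^sub>0 complex) set set" where
  "tensor_subspace A B V W =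
     linear_span (tensor_algebra A B) {pure_tensor A B a b | a b. a \<in> V \<and> b \<in> W}"

section \<open>The quantum group\<close>

definition q_int :: "complex \<Rightarrow> nat \<Rightarrow> complex" where
  "q_int v n = (v powi int n - v powi (- int n)) / (v - inverse v)"

definition q_fact :: "complex \<Rightarrow> nat \<Rightarrow> complex" where
  "q_fact v n = (\<Prod>i=1..n. q_int v i)"

definition q_binomial :: "complex \<Rightarrow> nat \<Rightarrow> nat \<Rightarrow> complex" where
  "q_binomial v n k = q_fact v n / (q_fact v k * q_fact v (n - k))"

datatype 'w generator = E_gen 'w | F_gen 'w | K_gen 'w

text \<open>\<open>S\<close> is the set of simple roots and \<open>form\<close> the invariant form on the root lattice.\<close>

locale quantum_group =
  fixes S :: "'w::ab_group_add set" and form :: "'w \<Rightarrow> 'w \<Rightarrow> int" and q :: complex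
begin

abbreviation Q where "Q \<equiv> lattice_of S"
abbreviation Q_pos where "Q_pos \<equiv> pos_lattice S"

definition generators :: "'w generator set" where
  "generators = E_gen ` S \<union> F_gen ` S \<union> K_gen ` Q"

definition q_simple :: "'w \<Rightarrow> complex" where
  "q_simple \<alpha> = q powi (form \<alpha> \<alpha> div 2)"

text \<open>\<open>1 - a\<^sub>\<alpha>\<^sub>\<beta>\<close> for the Cartan integer \<open>a\<^sub>\<alpha>\<^sub>\<beta> = 2 (\<alpha>, \<beta>) / (\<alpha>, \<alpha>)\<close>.\<close>

definition serre_exponent :: "'w \<Rightarrow> 'w \<Rightarrow> nat" where
  "serre_exponent \<alpha> \<beta> = nat (1 - 2 * form \<alpha> \<beta> div form \<alpha> \<alpha>)"

definition serre_element ::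
  "('w \<Rightarrow> 'w generator) \<Rightarrow> 'w \<Rightarrow> 'w \<Rightarrow> 'w generator list \<Rightarrow>\<^sub>0 complex" where
  "serre_element X \<alpha> \<beta> = (let n = serre_exponent \<alpha> \<beta> in
     \<Sum>s\<le>n. Poly_Mapping.single (replicate (n - s) (X \<alpha>) @ [X \<beta>] @ replicate s (X \<alpha>))
       ((- 1) ^ s * q_binomial (q_simple \<alpha>) n s))"

definition relations :: "('w generator list \<Rightarrow>\<^sub>0 complex) set" where
  "relations = (let m = Poly_Mapping.single in
     {m [K_gen 0] 1 - m [] 1} \<union>
     {m [K_gen \<mu>, K_gen \<nu>] 1 - m [K_gen (\<mu> + \<nu>)] 1 | \<mu> \<nu>. \<mu> \<in> Q \<and> \<nu> \<in> Q} \<union>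
     {m [K_gen \<mu>, E_gen \<alpha>, K_gen (- \<mu>)] 1 - m [E_gen \<alpha>] (q powi form \<mu> \<alpha>)
        | \<mu> \<alpha>. \<mu> \<in> Q \<and> \<alpha> \<in> S} \<union>
     {m [K_gen \<mu>, F_gen \<alpha>, K_gen (- \<mu>)] 1 - m [F_gen \<alpha>] (q powi (- form \<mu> \<alpha>))
        | \<mu> \<alpha>. \<mu> \<in> Q \<and> \<alpha> \<in> S} \<union>
     {m [E_gen \<alpha>, F_gen \<beta>] 1 - m [F_gen \<beta>, E_gen \<alpha>] 1 -
        (if \<alpha> = \<beta> then
           m [K_gen \<alpha>] (1 / (q_simple \<alpha> - inverse (q_simple \<alpha>))) -
           m [K_gen (- \<alpha>)] (1 / (q_simple \<alpha> - inverse (q_simple \<alpha>)))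
         else 0) | \<alpha> \<beta>. \<alpha> \<in> S \<and> \<beta> \<in> S} \<union>
     {serre_element E_gen \<alpha> \<beta> | \<alpha> \<beta>. \<alpha> \<in> S \<and> \<beta> \<in> S \<and> \<alpha> \<noteq> \<beta>} \<union>
     {serre_element F_gen \<alpha> \<beta> | \<alpha> \<beta>. \<alpha> \<in> S \<and> \<beta> \<in> S \<and> \<alpha> \<noteq> \<beta>})"

definition Uq :: "(complex, ('w generator list \<Rightarrow>\<^sub>0 complex) set) module" where
  "Uq = quotient_algebra (free_algebra generators) relations"

definition gen :: "'w generator \<Rightarrow> ('w generator list \<Rightarrow>\<^sub>0 complex) set" where
  "gen x = quotient_class (free_algebra generators) relations (Poly_Mapping.single [x] 1)"

abbreviation E where "E \<alpha> \<equiv> gen (E_gen \<alpha>)"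
abbreviation F where "F \<alpha> \<equiv> gen (F_gen \<alpha>)"
abbreviation K where "K \<mu> \<equiv> gen (K_gen \<mu>)"

subsection \<open>Hopf algebra structure\<close>

abbreviation tens (infix \<open>\<otimes>\<^sub>U\<close> 70) where "tens \<equiv> pure_tensor Uq Uq"

definition coproduct where
  "coproduct = induced_map (tensor_algebra Uq Uq) (\<lambda>x. case x of
      E_gen \<alpha> \<Rightarrow> (E \<alpha> \<otimes>\<^sub>U \<one>\<^bsub>Uq\<^esub>) \<oplus>\<^bsub>tensor_algebra Uq Uq\<^esub> (K \<alpha> \<otimes>\<^sub>U E \<alpha>)
    | F_gen \<alpha> \<Rightarrow> (F \<alpha> \<otimes>\<^sub>U K (- \<alpha>)) \<oplus>\<^bsub>tensor_algebra Uq Uq\<^esub> (\<one>\<^bsub>Uq\<^esub> \<otimes>\<^sub>U F \<alpha>)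
    | K_gen \<mu> \<Rightarrow> K \<mu> \<otimes>\<^sub>U K \<mu>)"

text \<open>The antipode is an algebra anti-homomorphism; its values on generators are forced by the
  coproduct.\<close>

definition antipode where
  "antipode = induced_map (opposite_algebra Uq) (\<lambda>x. case x of
      E_gen \<alpha> \<Rightarrow> \<ominus>\<^bsub>Uq\<^esub> (K (- \<alpha>) \<otimes>\<^bsub>Uq\<^esub> E \<alpha>)
    | F_gen \<alpha> \<Rightarrow> \<ominus>\<^bsub>Uq\<^esub> (F \<alpha> \<otimes>\<^bsub>Uq\<^esub> K \<alpha>)
    | K_gen \<mu> \<Rightarrow> K (- \<mu>))"

definition right_coideal_subalgebra where
  "right_coideal_subalgebra C \<longleftrightarrow> subalgebra Uq C \<and>
     (\<forall>x\<in>C. coproduct x \<in> tensor_subspace Uq Uq C (carrier Uq))"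

definition hopf_subalgebra where
  "hopf_subalgebra C \<longleftrightarrow> subalgebra Uq C \<and>
     (\<forall>x\<in>C. coproduct x \<in> tensor_subspace Uq Uq C C) \<and> (\<forall>x\<in>C. antipode x \<in> C)"

subsection \<open>Triangular decomposition and leading terms\<close>

definition U_plus where "U_plus = generated_subalgebra Uq (E ` S)"
definition U_minus where "U_minus = generated_subalgebra Uq (F ` S)"
definition U_zero where "U_zero = generated_subalgebra Uq (K ` Q)"

definition U_geq where
  "U_geq = linear_span Uq {x \<otimes>\<^bsub>Uq\<^esub> k | x k. x \<in> U_plus \<and> k \<in> U_zero}"

definition weight_space where
  "weight_space \<mu> = {x \<in> carrier Uq. \<forall>\<nu>\<in>Q.
     K \<nu> \<otimes>\<^bsub>Uq\<^esub> x \<otimes>\<^bsub>Uq\<^esub> K (- \<nu>) = (q powi form \<nu> \<mu>) \<odot>\<^bsub>Uq\<^esub> x}"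

definition triangular_space where
  "triangular_space \<mu> \<nu> \<gamma> = linear_span Uq {x \<otimes>\<^bsub>Uq\<^esub> K \<nu> \<otimes>\<^bsub>Uq\<^esub> y | x y.
     x \<in> U_plus \<inter> weight_space \<mu> \<and> y \<in> U_minus \<inter> weight_space (- \<gamma>)}"

definition triangular_decomposition where
  "triangular_decomposition X c \<longleftrightarrow>
     (\<forall>\<mu> \<nu> \<gamma>. if \<mu> \<in> Q_pos \<and> \<nu> \<in> Q \<and> \<gamma> \<in> Q_pos
        then c (\<mu>, \<nu>, \<gamma>) \<in> triangular_space \<mu> \<nu> \<gamma> else c (\<mu>, \<nu>, \<gamma>) = \<zero>\<^bsub>Uq\<^esub>) \<and>
     finite {i. c i \<noteq> \<zero>\<^bsub>Uq\<^esub>} \<and>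
     X = (\<Oplus>\<^bsub>Uq\<^esub>i\<in>{i. c i \<noteq> \<zero>\<^bsub>Uq\<^esub>}. c i)"

definition component where
  "component X = (THE c. triangular_decomposition X c)"

definition E_weights where
  "E_weights X = {\<mu> \<in> Q_pos - {0}. \<exists>\<nu>\<in>Q. \<exists>\<gamma>\<in>Q_pos. component X (\<mu>, \<nu>, \<gamma>) \<noteq> \<zero>\<^bsub>Uq\<^esub>}"

definition E_leading_weights where
  "E_leading_weights X =
     {\<mu> \<in> E_weights X. \<forall>\<mu>'\<in>E_weights X. weight_le S \<mu> \<mu>' \<longrightarrow> \<mu>' = \<mu>}"

definition E_leading_term where
  "E_leading_term \<mu> X =
     (\<Oplus>\<^bsub>Uq\<^esub>i\<in>{i. fst i = \<mu> \<and> component X i \<noteq> \<zero>\<^bsub>Uq\<^esub>}. component X i)"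

end

end

theory Submission
  imports Defs "HOL-Library.Multiset" "HOL-Library.Product_Plus"
begin

text \<open>Let the free algebra act on the space with basis \<open>E\<^sub>w K\<^sub>\<nu> F\<^sub>v\<close>, where \<open>w\<close> and \<open>v\<close> are words in the
  simple roots. Modulo the Serre relations this gives PBW coordinates on \<open>U\<close>, hence the triangular
  decomposition and the leading terms. By the right coideal property, \<open>(id \<otimes> \<phi>) \<Delta>\<close> maps \<open>C\<close> to
  itself for every linear functional \<open>\<phi>\<close>.

  Let \<open>X \<in> C\<close> have a leading term of weight \<open>\<mu>\<close> outside \<open>U\<^sup>\<ge>\<^sup>0\<close>, and let \<open>E\<^sub>i K\<^sub>\<nu> F\<^sub>j\<close> be one of its
  monomials with \<open>j\<close> of maximal length. Contracting \<open>X\<close> with the coordinate of \<open>K\<^sub>\<nu> F\<^sub>j\<close> gives \<open>x \<in> C\<close>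
  whose leading term of weight \<open>\<mu>\<close> lies in \<open>U\<^sup>\<ge>\<^sup>0\<close>. Contracting \<open>X\<close> with the coordinate of the
  matching \<open>E\<^sub>i K\<^sub>\<kappa>\<close> gives \<open>y \<in> C\<close> without \<open>E\<close>-letters, and contracting \<open>y\<close> once more gives some
  \<open>K\<^sub>\<lambda> \<in> C\<close>. Since \<open>C \<inter> U\<^sup>0\<close> is a Hopf subalgebra, \<open>K\<^sub>-\<^sub>\<lambda> \<in> C\<close>, so \<open>y\<close> can be shifted such that a
  multiple of \<open>x y\<close> cancels all terms \<open>E\<^sub>i K\<^sub>\<nu>\<^sub>' F\<^sub>v\<close> of \<open>X\<close> with \<open>\<nu>' - wt v = \<kappa>\<close> and creates no other
  such row. Now \<open>x\<close>, \<open>y\<close> and the difference are all simpler than \<open>X\<close>.\<close>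

section \<open>Linear algebra on finitely supported functions\<close>

text \<open>In a fixed weight \<mu> the coefficients of X form a matrix: row (i, \<kappa>) holds the
  monomials \<open>E_i K_\<nu> F_v\<close> with \<nu> - wt v = \<kappa>. The part of x in weight
  \<mu> is the column of the pivot (i, \<nu>, j), y is its row, and subtracting x y divided by the
  pivot coefficient is one step of Gaussian elimination. All entries of that column lie in rows with
  the same \<kappa>, so no row is created. The induction is lexicographic: number of E-weights,
  number of leading weights with F-letters in their term, number of rows in one such weight. The
  obstacle is that contracting leaves \<open>K_\<lambda> F_v\<close> with an unwanted common
  K-factor, while C need not contain inverses; only the Hopf hypothesis on the part of C in
  \<open>U_zero\<close> removes it. Leading terms need uniqueness of the triangular decomposition,
  hence the full PBW theorem. It comes from a module over the algebra without Serre relations. There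
  the Serre elements commute with the letters of opposite sign, so the Serre ideals in both outer
  factors can be divided out.\<close>

abbreviation keys :: "('a \<Rightarrow>\<^sub>0 'b::zero) \<Rightarrow> 'a set" where "keys \<equiv> Poly_Mapping.keys"
abbreviation lookup :: "('a \<Rightarrow>\<^sub>0 'b::zero) \<Rightarrow> 'a \<Rightarrow> 'b" where "lookup \<equiv> Poly_Mapping.lookup"
abbreviation single :: "'a \<Rightarrow> 'b \<Rightarrow> ('a \<Rightarrow>\<^sub>0 'b::zero)" where "single \<equiv> Poly_Mapping.single"

definition sc :: "complex \<Rightarrow> ('a \<Rightarrow>\<^sub>0 complex) \<Rightarrow> ('a \<Rightarrow>\<^sub>0 complex)" (infixr \<open>*\<^sub>C\<close> 75) where
  "c *\<^sub>C p = Poly_Mapping.map ((*) c) p"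

lemma lookup_sc [simp]: "lookup (c *\<^sub>C p) k = c * lookup p k"
  by (simp add: sc_def map.rep_eq when_def)

lemma sc_single [simp]: "c *\<^sub>C single k d = single k (c * d)"
  by (rule poly_mapping_eqI) (simp add: lookup_single when_def)

lemma sc_add [simp]: "c *\<^sub>C (p + r) = c *\<^sub>C p + c *\<^sub>C r"
  by (rule poly_mapping_eqI) (simp add: lookup_add algebra_simps)

lemma sc_add_left: "(c + d) *\<^sub>C p = c *\<^sub>C p + d *\<^sub>C p"
  by (rule poly_mapping_eqI) (simp add: lookup_add algebra_simps)

lemma sc_diff_left: "(c - d) *\<^sub>C p = c *\<^sub>C p - d *\<^sub>C p"
  by (rule poly_mapping_eqI) (simp add: lookup_minus algebra_simps)

lemma sc_diff [simp]: "c *\<^sub>C (p - r) = c *\<^sub>C p - c *\<^sub>C r"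
  by (rule poly_mapping_eqI) (simp add: lookup_minus algebra_simps)

lemma sc_uminus [simp]: "c *\<^sub>C (- p) = - (c *\<^sub>C p)"
  by (rule poly_mapping_eqI) simp

lemma sc_sc [simp]: "c *\<^sub>C d *\<^sub>C p = (c * d) *\<^sub>C p"
  by (rule poly_mapping_eqI) simp

lemma sc_one [simp]: "1 *\<^sub>C p = p"
  by (rule poly_mapping_eqI) simp

lemma sc_zero_left [simp]: "0 *\<^sub>C p = 0"
  by (rule poly_mapping_eqI) simp

lemma sc_zero [simp]: "c *\<^sub>C 0 = 0"
  by (rule poly_mapping_eqI) simp

lemma sc_minus_one: "(- c) *\<^sub>C p = - (c *\<^sub>C p)"
  by (rule poly_mapping_eqI) simp

lemma sc_sum: "c *\<^sub>C sum f X = (\<Sum>x\<in>X. c *\<^sub>C f x)"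
  by (rule poly_mapping_eqI) (simp add: lookup_sum sum_distrib_left)

lemma keys_sc: "keys (c *\<^sub>C p) \<subseteq> keys p"
  by (auto simp: in_keys_iff)

lemma sc_conv_mult: "c *\<^sub>C (p :: 'm::monoid_add \<Rightarrow>\<^sub>0 complex) = single 0 c * p"
  by (simp add: sc_def mult_map_scale_conv_mult)

lemma single_0_commute: "p * single (0::'m::monoid_add) c = single 0 c * (p :: 'm \<Rightarrow>\<^sub>0 complex)"
proof -
  have *: "p = (\<Sum>k\<in>keys p. single k (lookup p k))"
    by (rule poly_mapping_eqI)
      (simp add: lookup_sum lookup_single when_def sum.delta in_keys_iff)
  show ?thesis
    by (subst (1 2) *) (simp add: sum_distrib_left sum_distrib_right mult_single mult.commute)
qed

lemma sc_mult_left [simp]: "(c *\<^sub>C p) * r = c *\<^sub>C (p * (r :: 'm::monoid_add \<Rightarrow>\<^sub>0 complex))"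
  by (simp add: sc_conv_mult mult.assoc)

lemma sc_mult_right [simp]: "p * (c *\<^sub>C r) = c *\<^sub>C (p * (r :: 'm::monoid_add \<Rightarrow>\<^sub>0 complex))"
  by (metis sc_conv_mult mult.assoc single_0_commute)

definition lin :: "('k \<Rightarrow> ('a \<Rightarrow>\<^sub>0 complex)) \<Rightarrow> ('k \<Rightarrow>\<^sub>0 complex) \<Rightarrow> ('a \<Rightarrow>\<^sub>0 complex)" where
  "lin f p = (\<Sum>k\<in>keys p. lookup p k *\<^sub>C f k)"

lemma lin_superset: "finite X \<Longrightarrow> keys p \<subseteq> X \<Longrightarrow> lin f p = (\<Sum>k\<in>X. lookup p k *\<^sub>C f k)"
  unfolding lin_def by (rule sum.mono_neutral_left) (auto simp: in_keys_iff)

lemma lin_single [simp]: "lin f (single k c) = c *\<^sub>C f k"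
  by (simp add: lin_superset[of "{k}"])

lemma lin_add [simp]: "lin f (p + r) = lin f p + lin f r"
proof -
  have "keys (p + r) \<subseteq> keys p \<union> keys r" by (rule Poly_Mapping.keys_add)
  then show ?thesis
    by (simp add: lin_superset[of "keys p \<union> keys r"] lookup_add sc_add_left sum.distrib)
qed

lemma lin_sc [simp]: "lin f (c *\<^sub>C p) = c *\<^sub>C lin f p"
  using keys_sc[of c p] by (simp add: lin_superset[of "keys p"] sc_sum)

lemma lin_zero [simp]: "lin f 0 = 0"
  by (simp add: lin_def)

definition lmap :: "(('k \<Rightarrow>\<^sub>0 complex) \<Rightarrow> ('a \<Rightarrow>\<^sub>0 complex)) \<Rightarrow> bool" where
  "lmap g \<longleftrightarrow> (\<forall>x y. g (x + y) = g x + g y) \<and> (\<forall>c x. g (c *\<^sub>C x) = c *\<^sub>C g x)"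

lemma lmapI: "(\<And>x y. g (x + y) = g x + g y) \<Longrightarrow> (\<And>c x. g (c *\<^sub>C x) = c *\<^sub>C g x) \<Longrightarrow> lmap g"
  by (simp add: lmap_def)

lemma lmap_add: "lmap g \<Longrightarrow> g (x + y) = g x + g y" by (simp add: lmap_def)
lemma lmap_sc: "lmap g \<Longrightarrow> g (c *\<^sub>C x) = c *\<^sub>C g x" by (simp add: lmap_def)
lemma lmap_zero: "lmap g \<Longrightarrow> g 0 = 0" using lmap_sc[of g 0 0] by simp
lemma lmap_uminus: "lmap g \<Longrightarrow> g (- x) = - g x" using lmap_sc[of g "- 1" x] by (simp add: sc_minus_one)
lemma lmap_diff: "lmap g \<Longrightarrow> g (x - y) = g x - g y"
  using lmap_add[of g x "- y"] lmap_uminus[of g y] by simp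
lemma lmap_sum: "lmap g \<Longrightarrow> g (sum f X) = (\<Sum>x\<in>X. g (f x))"
  by (induction X rule: infinite_finite_induct) (simp_all add: lmap_zero[of g] lmap_add[of g])

lemma lmap_lin [intro!, simp]: "lmap (lin f)" by (simp add: lmap_def)
lemma lmap_comp: "lmap g \<Longrightarrow> lmap h \<Longrightarrow> lmap (\<lambda>x. g (h x))" by (simp add: lmap_def)
lemma lmap_id: "lmap (\<lambda>x. x)" by (simp add: lmap_def)
lemma lmap_minus: "lmap g \<Longrightarrow> lmap h \<Longrightarrow> lmap (\<lambda>x. g x - h x)" by (simp add: lmap_def)
lemma lmap_scale: "lmap g \<Longrightarrow> lmap (\<lambda>x. c *\<^sub>C g x)" by (simp add: lmap_def mult.commute)
lemma lmap_mult_left: "lmap (\<lambda>x. a * (x :: 'm::monoid_add \<Rightarrow>\<^sub>0 complex))"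
  by (simp add: lmap_def distrib_left)
lemma lmap_mult_right: "lmap (\<lambda>x. (x :: 'm::monoid_add \<Rightarrow>\<^sub>0 complex) * a)"
  by (simp add: lmap_def distrib_right)

lemma lin_sum: "lin f (sum g X) = (\<Sum>x\<in>X. lin f (g x))" by (rule lmap_sum[OF lmap_lin])

lemma lin_cong: "p = r \<Longrightarrow> (\<And>k. k \<in> keys r \<Longrightarrow> f k = g k) \<Longrightarrow> lin f p = lin g r"
  by (simp add: lin_def)

lemma lin_singles [simp]: "lin (\<lambda>k. single k 1) p = p"
  by (rule poly_mapping_eqI)
    (simp add: lin_def lookup_sum lookup_single when_def if_distrib sum.delta in_keys_iff cong: if_cong)

lemma lmap_lin_comp: "lmap g \<Longrightarrow> g (lin f p) = lin (\<lambda>k. g (f k)) p"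
  by (simp add: lin_def lmap_sum[of g] lmap_sc[of g])

lemma lmap_conv_lin: "lmap g \<Longrightarrow> g p = lin (\<lambda>k. g (single k 1)) p"
  using lmap_lin_comp[of g "\<lambda>k. single k 1" p] by simp

lemma lmap_eqI:
  assumes "lmap g" "lmap h" "\<And>k. k \<in> keys p \<Longrightarrow> g (single k 1) = h (single k 1)"
  shows "g p = h p"
  unfolding lmap_conv_lin[OF assms(1), of p] lmap_conv_lin[OF assms(2), of p]
  by (rule lin_cong) (simp_all add: assms(3))

lemma lin_fun_add: "lin (\<lambda>k. f k + g k) p = lin f p + lin g p"
  by (simp add: lin_def sum.distrib)

lemma lin_fun_sc: "lin (\<lambda>k. c *\<^sub>C g k) p = c *\<^sub>C lin g p"
  by (simp add: lin_def sc_sum mult.commute)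

lemma lin_fun_diff: "lin (\<lambda>k. f k - g k) p = lin f p - lin g p"
  by (simp add: lin_def sum_subtractf)

lemma lin_fun_zero [simp]: "lin (\<lambda>k. 0) p = 0"
  by (simp add: lin_def)

lemma lookup_lin: "lookup (lin f p) j = (\<Sum>k\<in>keys p. lookup p k * lookup (f k) j)"
  by (simp add: lin_def lookup_sum)

lemma keys_lin: "keys (lin f p) \<subseteq> (\<Union>k\<in>keys p. keys (f k))"
proof
  fix j assume "j \<in> keys (lin f p)"
  then have "(\<Sum>k\<in>keys p. lookup p k * lookup (f k) j) \<noteq> 0"
    by (simp add: in_keys_iff lookup_lin)
  then obtain k where "k \<in> keys p" "lookup p k * lookup (f k) j \<noteq> 0"
    by (meson sum.not_neutral_contains_not_neutral)
  then show "j \<in> (\<Union>k\<in>keys p. keys (f k))" by (auto simp: in_keys_iff)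
qed

definition lsub :: "('k \<Rightarrow>\<^sub>0 complex) set \<Rightarrow> bool" where
  "lsub V \<longleftrightarrow> 0 \<in> V \<and> (\<forall>x\<in>V. \<forall>y\<in>V. x + y \<in> V) \<and> (\<forall>c. \<forall>x\<in>V. c *\<^sub>C x \<in> V)"

lemma lsub_add: "lsub V \<Longrightarrow> x \<in> V \<Longrightarrow> y \<in> V \<Longrightarrow> x + y \<in> V" by (simp add: lsub_def)
lemma lsub_sc: "lsub V \<Longrightarrow> x \<in> V \<Longrightarrow> c *\<^sub>C x \<in> V" by (simp add: lsub_def)
lemma lsub_zero: "lsub V \<Longrightarrow> 0 \<in> V" by (simp add: lsub_def)
lemma lsub_diff: "lsub V \<Longrightarrow> x \<in> V \<Longrightarrow> y \<in> V \<Longrightarrow> x - y \<in> V"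
  using lsub_add[of V x "(- 1) *\<^sub>C y"] lsub_sc[of V y "- 1"] by (simp add: sc_minus_one)
lemma lsub_sum: "lsub V \<Longrightarrow> (\<And>i. i \<in> X \<Longrightarrow> f i \<in> V) \<Longrightarrow> sum f X \<in> V"
  by (induction X rule: infinite_finite_induct) (auto simp: lsub_zero lsub_add)
lemma lsub_lin: "lsub V \<Longrightarrow> (\<And>k. k \<in> keys p \<Longrightarrow> f k \<in> V) \<Longrightarrow> lin f p \<in> V"
  unfolding lin_def by (intro lsub_sum lsub_sc)

lemma lsub_kernel: "lmap g \<Longrightarrow> lsub {x. g x = 0}"
  by (simp add: lsub_def lmap_add[of g] lmap_zero[of g] lmap_sc[of g])

lemma lsub_keys: "lsub {p. keys p \<subseteq> X}"
proof -
  have "keys (x + y) \<subseteq> X" if "keys x \<subseteq> X" "keys y \<subseteq> X" for x y :: "'a \<Rightarrow>\<^sub>0 complex"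
    using that Poly_Mapping.keys_add[of x y] by blast
  moreover have "keys (c *\<^sub>C x) \<subseteq> X" if "keys x \<subseteq> X" for c and x :: "'a \<Rightarrow>\<^sub>0 complex"
    using that keys_sc[of c x] by blast
  ultimately show ?thesis by (simp add: lsub_def)
qed

definition keep :: "('k \<Rightarrow> bool) \<Rightarrow> ('k \<Rightarrow>\<^sub>0 complex) \<Rightarrow> ('k \<Rightarrow>\<^sub>0 complex)" where
  "keep P = lin (\<lambda>k. if P k then single k 1 else 0)"

lemma lmap_keep [intro!, simp]: "lmap (keep P)" by (simp add: keep_def)

lemma lookup_keep [simp]: "lookup (keep P p) k = (if P k then lookup p k else 0)"
proof -
  have "lookup (keep P p) k = (\<Sum>j\<in>keys p. if j = k then (if P k then lookup p k else 0) else 0)"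
    unfolding keep_def lookup_lin by (rule sum.cong) (auto simp: lookup_single when_def)
  then show ?thesis by (auto simp: in_keys_iff)
qed

lemma keys_keep [simp]: "keys (keep P p) = {k \<in> keys p. P k}"
  by (auto simp: in_keys_iff split: if_splits)

lemma keep_single [simp]: "keep P (single k c) = (if P k then single k c else 0)"
  by (simp add: keep_def)

lemma keep_all: "(\<And>k. k \<in> keys p \<Longrightarrow> P k) \<Longrightarrow> keep P p = p"
  by (rule poly_mapping_eqI) (auto simp: in_keys_iff)

lemma keep_none: "(\<And>k. k \<in> keys p \<Longrightarrow> \<not> P k) \<Longrightarrow> keep P p = 0"
  by (rule poly_mapping_eqI) (auto simp: in_keys_iff)

subsection \<open>Word algebras\<close>

text \<open>With concatenation as addition, the convolution product on finitely supported functions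
  is the product of the free algebra, and functions on pairs of words give the tensor square of a
  free algebra.\<close>

instantiation list :: (type) monoid_add
begin
definition "0 = []"
definition "xs + ys = xs @ ys" for xs ys :: "'a list"
instance by standard (simp_all add: zero_list_def plus_list_def)
end

lemma one_word: "(1 :: 'x list \<Rightarrow>\<^sub>0 complex) = single [] 1"
  by (simp add: single_one[symmetric] zero_list_def del: single_one)

lemma mult_word [simp]: "single w c * single w' d = single (w @ w') (c * d :: complex)"
  by (simp add: mult_single plus_list_def)

abbreviation ltr :: "'x \<Rightarrow> 'x list \<Rightarrow>\<^sub>0 complex" where "ltr x \<equiv> single [x] 1"

lemma lmap_mult_eqI:
  fixes g :: "('m::monoid_add \<Rightarrow>\<^sub>0 complex) \<Rightarrow> ('n::monoid_add \<Rightarrow>\<^sub>0 complex)"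
  assumes "lmap g"
    and "\<And>k l. k \<in> keys p \<Longrightarrow> l \<in> keys r \<Longrightarrow> g (single (k + l) 1) = g (single k 1) * g (single l 1)"
  shows "g (p * r) = g p * g r"
proof (rule lmap_eqI[of "\<lambda>p. g (p * r)" "\<lambda>p. g p * g r"])
  show "lmap (\<lambda>p. g (p * r))" "lmap (\<lambda>p. g p * g r)"
    using lmap_comp[OF assms(1) lmap_mult_right] lmap_comp[OF lmap_mult_right assms(1)] by blast+
  fix k assume k: "k \<in> keys p"
  show "g (single k 1 * r) = g (single k 1) * g r"
  proof (rule lmap_eqI[of "\<lambda>r. g (single k 1 * r)" "\<lambda>r. g (single k 1) * g r"])
    show "lmap (\<lambda>r. g (single k 1 * r))" "lmap (\<lambda>r. g (single k 1) * g r)"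
      using lmap_comp[OF assms(1) lmap_mult_left] lmap_comp[OF lmap_mult_left assms(1)] by blast+
  qed (use assms(2) k in \<open>simp add: mult_single\<close>)
qed

definition word_hom :: "('x \<Rightarrow> ('m::monoid_add \<Rightarrow>\<^sub>0 complex)) \<Rightarrow> ('x list \<Rightarrow>\<^sub>0 complex) \<Rightarrow> ('m \<Rightarrow>\<^sub>0 complex)" where
  "word_hom f = lin (\<lambda>w. prod_list (map f w))"

lemma lmap_word_hom [intro!, simp]: "lmap (word_hom f)" by (simp add: word_hom_def)

lemma word_hom_word: "word_hom f (single w c) = c *\<^sub>C prod_list (map f w)" by (simp add: word_hom_def)

lemma word_hom_ltr [simp]: "word_hom f (single [x] c) = c *\<^sub>C f x" by (simp add: word_hom_def)

lemma word_hom_mult [simp]: "word_hom f (p * r) = word_hom f p * word_hom f r"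
  by (rule lmap_mult_eqI) (simp_all add: word_hom_def plus_list_def)

lemma word_hom_one [simp]: "word_hom f 1 = 1" by (simp add: one_word word_hom_word)

definition word_antihom :: "('x \<Rightarrow> ('m::monoid_add \<Rightarrow>\<^sub>0 complex)) \<Rightarrow> ('x list \<Rightarrow>\<^sub>0 complex) \<Rightarrow> ('m \<Rightarrow>\<^sub>0 complex)" where
  "word_antihom f = lin (\<lambda>w. prod_list (map f (rev w)))"

lemma lmap_word_antihom [intro!, simp]: "lmap (word_antihom f)" by (simp add: word_antihom_def)

lemma word_antihom_word: "word_antihom f (single w c) = c *\<^sub>C prod_list (map f (rev w))" by (simp add: word_antihom_def)

lemma word_antihom_mult [simp]: "word_antihom f (p * r) = word_antihom f r * word_antihom f p"
proof (rule lmap_eqI[of "\<lambda>p. word_antihom f (p * r)" "\<lambda>p. word_antihom f r * word_antihom f p"])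
  show "lmap (\<lambda>p. word_antihom f (p * r))" "lmap (\<lambda>p. word_antihom f r * word_antihom f p)"
    using lmap_comp[OF lmap_word_antihom lmap_mult_right] lmap_comp[OF lmap_mult_left lmap_word_antihom] by blast+
  fix k
  show "word_antihom f (single k 1 * r) = word_antihom f r * word_antihom f (single k 1)"
  proof (rule lmap_eqI[of "\<lambda>r. word_antihom f (single k 1 * r)" "\<lambda>r. word_antihom f r * word_antihom f (single k 1)"])
    show "lmap (\<lambda>r. word_antihom f (single k 1 * r))" "lmap (\<lambda>r. word_antihom f r * word_antihom f (single k 1))"
      using lmap_comp[OF lmap_word_antihom lmap_mult_left] lmap_comp[OF lmap_mult_right lmap_word_antihom] by blast+
  qed (simp add: word_antihom_word)
qed

lemma word_antihom_one [simp]: "word_antihom f 1 = 1" by (simp add: one_word word_antihom_word)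

section \<open>Quantum Serre elements\<close>

subsection \<open>Congruences modulo a two-sided ideal\<close>

text \<open>Straightening computations are done once modulo an abstract two-sided ideal. The
  instances are annihilators of modules (\<open>act_ideal\<close>, \<open>NF_ideal\<close>) and
  kernels of the maps to the quantum group and to its tensor square.\<close>

locale cong_ideal =
  fixes J :: "('m::monoid_add \<Rightarrow>\<^sub>0 complex) set"
  assumes zero_mem: "0 \<in> J"
    and add_mem: "x \<in> J \<Longrightarrow> y \<in> J \<Longrightarrow> x + y \<in> J"
    and left_mem: "x \<in> J \<Longrightarrow> a * x \<in> J"
    and right_mem: "x \<in> J \<Longrightarrow> x * a \<in> J"
begin

definition eqv (infix \<open>\<approx>\<close> 50) where "x \<approx> y \<longleftrightarrow> x - y \<in> J"

lemma uminus_mem: "x \<in> J \<Longrightarrow> - x \<in> J"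
  using left_mem[of x "- 1"] by simp

lemma sc_mem: "x \<in> J \<Longrightarrow> c *\<^sub>C x \<in> J"
  by (simp add: sc_conv_mult left_mem)

lemma eqv_refl [simp]: "x \<approx> x" by (simp add: eqv_def zero_mem)

lemma eqv_eq: "x = y \<Longrightarrow> x \<approx> y" by simp

lemma eqv_sym: "x \<approx> y \<Longrightarrow> y \<approx> x"
  unfolding eqv_def using uminus_mem[of "x - y"] by simp

lemma eqv_trans [trans]: "x \<approx> y \<Longrightarrow> y \<approx> z \<Longrightarrow> x \<approx> z"
  unfolding eqv_def using add_mem[of "x - y" "y - z"] by simp

lemma eqv_add: "x \<approx> y \<Longrightarrow> x' \<approx> y' \<Longrightarrow> x + x' \<approx> y + y'"
  unfolding eqv_def using add_mem[of "x - y" "x' - y'"] by (simp add: algebra_simps)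

lemma eqv_diff: "x \<approx> y \<Longrightarrow> x' \<approx> y' \<Longrightarrow> x - x' \<approx> y - y'"
  unfolding eqv_def using add_mem[of "x - y" "- (x' - y')"] uminus_mem[of "x' - y'"]
  by (simp add: algebra_simps)

lemma eqv_left: "x \<approx> y \<Longrightarrow> a * x \<approx> a * y"
  unfolding eqv_def using left_mem[of "x - y" a] by (simp add: right_diff_distrib)

lemma eqv_right: "x \<approx> y \<Longrightarrow> x * a \<approx> y * a"
  unfolding eqv_def using right_mem[of "x - y" a] by (simp add: left_diff_distrib)

lemma eqv_mult: "x \<approx> y \<Longrightarrow> x' \<approx> y' \<Longrightarrow> x * x' \<approx> y * y'"
  using eqv_left eqv_right eqv_trans by blast

lemma eqv_sc: "x \<approx> y \<Longrightarrow> c *\<^sub>C x \<approx> c *\<^sub>C y"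
  unfolding eqv_def using sc_mem[of "x - y" c] by simp

lemma eqv_sum: "(\<And>i. i \<in> X \<Longrightarrow> f i \<approx> g i) \<Longrightarrow> sum f X \<approx> sum g X"
  by (induction X rule: infinite_finite_induct) (simp_all add: eqv_add)

lemma eqv_zero_iff: "x \<approx> 0 \<longleftrightarrow> x \<in> J" by (simp add: eqv_def)

end

subsection \<open>Quantum Serre elements as iterated commutators\<close>

text \<open>The iterated \<open>q\<close>-commutators \<open>x\<^sub>0 = y\<close>, \<open>x\<^sub>k\<^sub>+\<^sub>1 = a x\<^sub>k - t p\<^sup>k x\<^sub>k a\<close>. The quantum Serre element of a
  pair of simple roots \<open>\<alpha>, \<beta>\<close> is \<open>x\<^sub>n\<close> for \<open>p = q\<^sup>(\<^sup>\<alpha>\<^sup>,\<^sup>\<alpha>\<^sup>)\<close>, \<open>t = q\<^sup>(\<^sup>\<alpha>\<^sup>,\<^sup>\<beta>\<^sup>)\<close> and the \<open>n\<close> with \<open>t\<^sup>2 p\<^sup>n\<^sup>-\<^sup>1 = 1\<close>.\<close>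

primrec qad :: "complex \<Rightarrow> complex \<Rightarrow> ('m::monoid_add \<Rightarrow>\<^sub>0 complex) \<Rightarrow> ('m \<Rightarrow>\<^sub>0 complex) \<Rightarrow> nat \<Rightarrow> ('m \<Rightarrow>\<^sub>0 complex)"
where
  "qad t p a y 0 = y"
| "qad t p a y (Suc k) = a * qad t p a y k - (t * p ^ k) *\<^sub>C (qad t p a y k * a)"

text \<open>These are the coefficients of the product of the factors 1 + t p^i X for i < k; up to
  sign they are the coefficients of the iterated commutator.\<close>

fun qad_coeff :: "complex \<Rightarrow> complex \<Rightarrow> nat \<Rightarrow> nat \<Rightarrow> complex" where
  "qad_coeff t p k 0 = 1"
| "qad_coeff t p 0 (Suc s) = 0"
| "qad_coeff t p (Suc k) (Suc s) = qad_coeff t p k (Suc s) + t * p ^ k * qad_coeff t p k s"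

lemma qad_coeff_zero: "s > k \<Longrightarrow> qad_coeff t p k s = 0"
  by (induction t p k s rule: qad_coeff.induct) auto

lemma qad_conv_sum:
  "qad t p a y k = (\<Sum>s\<le>k. ((- 1) ^ s * qad_coeff t p k s) *\<^sub>C (a ^ (k - s) * y * a ^ s))"
proof (induction k)
  case (Suc k)
  have 1: "a * qad t p a y k =
    (\<Sum>s\<le>Suc k. ((- 1) ^ s * qad_coeff t p k s) *\<^sub>C (a ^ (Suc k - s) * y * a ^ s))"
    by (simp add: Suc sum_distrib_left qad_coeff_zero)
       (rule sum.cong, simp_all add: Suc_diff_le mult.assoc)
  have 2: "(t * p ^ k) *\<^sub>C (qad t p a y k * a) = - (\<Sum>s\<le>Suc k. (if s = 0 then 0 else
     ((- 1) ^ s * (t * p ^ k * qad_coeff t p k (s - 1))) *\<^sub>C (a ^ (Suc k - s) * y * a ^ s)))"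
    unfolding sum.atMost_Suc_shift
    by (simp add: Suc sum_distrib_right sc_sum mult.assoc power_Suc2 sc_minus_one sum_negf
          mult.left_commute mult.commute del: power_Suc)
  show ?case
    unfolding qad.simps 1 2 minus_minus diff_minus_eq_add sum.distrib[symmetric]
    by (rule sum.cong) (auto simp: sc_add_left[symmetric] algebra_simps gr0_conv_Suc split: nat.splits
       elim!: qad_coeff.elims intro!: arg_cong2[where f = sc])
qed simp

lemma q_int_nonzero:
  assumes "v \<noteq> 0" "\<And>n. n > 0 \<Longrightarrow> v ^ n \<noteq> 1" "n > 0"
  shows "q_int v n \<noteq> 0"
proof -
  have *: "x - inverse x \<noteq> 0" if "x \<noteq> 0" "x\<^sup>2 \<noteq> 1" for x :: complex
    using that by (auto simp: field_simps power2_eq_square)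
  have "v - inverse v \<noteq> 0" using * assms(1) assms(2)[of 2] by auto
  moreover have "v ^ n - inverse (v ^ n) \<noteq> 0"
    using *[of "v ^ n"] assms(1) assms(2)[of "2 * n"] assms(3) by (auto simp: power_mult[symmetric] mult.commute)
  ultimately show ?thesis by (simp add: q_int_def power_int_minus)
qed

text \<open>The q-Pascal rule, from [k+1] = v^-(r+1) [k-r] + v^(k-r) [r+1]. The bound r < k keeps
  the subtraction of r + 1 from k untruncated.\<close>

lemma q_binomial_Suc:
  assumes v: "v \<noteq> 0" "\<And>n. n > 0 \<Longrightarrow> v ^ n \<noteq> 1" and "r < k"
  shows "q_binomial v (Suc k) (Suc r) =
    v powi (- int (Suc r)) * q_binomial v k (Suc r) + v powi (int k - int r) * q_binomial v k r"
proof -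
  have nz: "q_fact v m \<noteq> 0" for m
    using q_int_nonzero[OF v] by (auto simp: q_fact_def)
  have fs: "q_fact v (Suc m) = q_fact v m * q_int v (Suc m)" for m
    by (simp add: q_fact_def)
  obtain m where m: "k = Suc (r + m)" using assms(3) less_iff_Suc_add by auto
  have v1: "v - inverse v \<noteq> 0"
    using v(1) v(2)[of 2] by (auto simp: field_simps power2_eq_square)
  have "q_int v (Suc k) = v powi (- int (Suc r)) * q_int v (k - r) + v powi (int k - int r) * q_int v (Suc r)"
  proof -
    have e: "v powi i * v powi j = v powi (i + j)" for i j using v(1) by (simp add: power_int_add)
    have "v powi (- int (Suc r)) * (v powi int (k - r) - v powi (- int (k - r)))
        + v powi (int k - int r) * (v powi int (Suc r) - v powi (- int (Suc r)))
        = v powi int (Suc k) - v powi (- int (Suc k))"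
      unfolding right_diff_distrib e using assms(3) by (simp add: of_nat_diff add.commute)
    then show ?thesis
      unfolding q_int_def by (simp add: add_divide_distrib[symmetric])
  qed
  then have "q_binomial v (Suc k) (Suc r) = q_fact v k *
     (v powi (- int (Suc r)) * q_int v (k - r) + v powi (int k - int r) * q_int v (Suc r)) /
     (q_fact v (Suc r) * q_fact v (k - r))"
    by (simp add: q_binomial_def fs)
  also have "\<dots> = v powi (- int (Suc r)) * q_binomial v k (Suc r) + v powi (int k - int r) * q_binomial v k r"
  proof -
    have "k - r = Suc m" "k - Suc r = m" using m by auto
    then show ?thesis
      unfolding q_binomial_def using nz[of r] nz[of m] nz[of "Suc r"] nz[of "Suc m"]
      by (simp add: fs field_simps)
  qed
  finally show ?thesis .
qed

text \<open>The q-binomial theorem: the coefficient is t^s p^(s(s-1)/2) times a Gaussian binomial in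
  p. For p = v^2 the latter is v^(s(k-s)) times the symmetric binomial, and s(s-1) + s(k-s) =
  s(k-1).\<close>

lemma qad_coeff_eq:
  assumes v: "v \<noteq> 0" "\<And>n. n > 0 \<Longrightarrow> v ^ n \<noteq> 1" and "s \<le> k"
  shows "qad_coeff t (v\<^sup>2) k s = t ^ s * v powi (int s * (int k - 1)) * q_binomial v k s"
  using assms(3)
proof (induction k arbitrary: s)
  case 0
  then show ?case by (simp add: q_binomial_def q_fact_def)
next
  case (Suc k)
  have nz: "q_fact v m \<noteq> 0" for m
    using q_int_nonzero[OF v] by (auto simp: q_fact_def)
  have e: "v powi i * v powi j = v powi (i + j)" for i j using v(1) by (simp add: power_int_add)
  have e2: "(v\<^sup>2) ^ k = v powi (2 * int k)" 
    using power_int_of_nat[of v "2 * k"] by (simp add: power_mult)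
  show ?case
  proof (cases s)
    case 0
    have "q_fact v 0 = 1" by (simp add: q_fact_def)
    then show ?thesis using 0 nz by (simp add: q_binomial_def)
  next
    case (Suc r)
    show ?thesis
    proof (cases "r = k")
      case True
      have "v powi (2 * int k) * v powi (int k * (int k - 1)) = v powi ((1 + int k) * int k)"
        unfolding e by (simp add: algebra_simps)
      moreover have "q_binomial v m m = 1" for m
        using nz[of m] by (simp add: q_binomial_def q_fact_def[of v 0])
      ultimately show ?thesis using Suc True Suc.IH[of k]
        by (simp add: qad_coeff_zero e2 mult_ac)
    next
      case False
      then have r: "r < k" "Suc r \<le> k" "r \<le> k" using Suc Suc.prems by auto
      have 1: "v powi (int (Suc r) * (int k - 1)) = v powi (int (Suc r) * (int (Suc k) - 1)) * v powi (- int (Suc r))"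
        unfolding e by (simp add: algebra_simps)
      have 2: "v powi (2 * int k) * v powi (int r * (int k - 1)) =
          v powi (int (Suc r) * (int (Suc k) - 1)) * v powi (int k - int r)"
        unfolding e by (simp add: algebra_simps)
      have "qad_coeff t (v\<^sup>2) (Suc k) (Suc r) =
         t ^ Suc r * (v powi (int (Suc r) * (int k - 1)) * q_binomial v k (Suc r)
          + v powi (2 * int k) * v powi (int r * (int k - 1)) * q_binomial v k r)"
        using Suc.IH[OF r(2)] Suc.IH[OF r(3)] by (simp add: e2 algebra_simps)
      also have "\<dots> = t ^ Suc r * v powi (int (Suc r) * (int (Suc k) - 1)) * q_binomial v (Suc k) (Suc r)"
        by (simp only: 1 2 q_binomial_Suc[OF v r(1)] distrib_left mult.assoc)
      finally show ?thesis using Suc by simp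
    qed
  qed
qed

lemma q_binomial_inverse: "q_binomial (inverse v) n k = q_binomial v n k"
proof -
  have "q_int (inverse v) m = q_int v m" for m
  proof -
    have "q_int (inverse v) m = (- (v powi int m - v powi (- int m))) / (- (v - inverse v))"
      by (simp add: q_int_def power_int_minus power_inverse)
    then show ?thesis unfolding minus_divide_divide by (simp add: q_int_def)
  qed
  then show ?thesis by (simp add: q_binomial_def q_fact_def)
qed

text \<open>At k = m + 1 the prefactor of \<open>qad_coeff_eq\<close> is a power of t v^m, which is
  1. This identifies quantum Serre elements with iterated commutators.\<close>

lemma qad_coeff_q_binomial:
  assumes v: "v \<noteq> 0" "\<And>n. n > 0 \<Longrightarrow> v ^ n \<noteq> 1" and t: "t * v ^ m = 1" and s: "s \<le> Suc m"
  shows "qad_coeff t (v\<^sup>2) (Suc m) s = q_binomial v (Suc m) s"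
proof -
  have "v powi (int s * (int (Suc m) - 1)) = (v ^ m) ^ s"
    by (simp add: power_mult[symmetric] mult.commute flip: of_nat_mult)
  then have "t ^ s * v powi (int s * (int (Suc m) - 1)) = (t * v ^ m) ^ s"
    by (simp only: power_mult_distrib)
  then have "t ^ s * v powi (int s * (int (Suc m) - 1)) = 1" by (simp add: t)
  then show ?thesis using qad_coeff_eq[OF v s, of t] by simp
qed

text \<open>Symmetric q-binomials do not change under v \<mapsto> 1/v. The antipode needs this:
  reversing a product inverts the parameters of the commutators.\<close>

lemma qad_inverse:
  assumes v: "v \<noteq> 0" "\<And>n. n > 0 \<Longrightarrow> v ^ n \<noteq> 1" and t: "t * v ^ m = 1"
  shows "qad (inverse t) (inverse (v\<^sup>2)) a y (Suc m) = qad t (v\<^sup>2) a y (Suc m)"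
proof -
  have "qad_coeff (inverse t) ((inverse v)\<^sup>2) (Suc m) s = qad_coeff t (v\<^sup>2) (Suc m) s" if "s \<le> Suc m" for s
  proof -
    have "inverse t * inverse v ^ m = inverse (t * v ^ m)" by (simp add: power_inverse)
    then have "qad_coeff (inverse t) ((inverse v)\<^sup>2) (Suc m) s = q_binomial (inverse v) (Suc m) s"
      using v t that by (intro qad_coeff_q_binomial) (auto simp: power_inverse)
    then show ?thesis using qad_coeff_q_binomial[OF v t that] by (simp add: q_binomial_inverse)
  qed
  then show ?thesis unfolding qad_conv_sum power_inverse[symmetric]
    by (intro sum.cong refl) (simp del: qad_coeff.simps)
qed

subsection \<open>Serre elements of sums of q-commuting elements\<close>

fun gbin :: "complex \<Rightarrow> nat \<Rightarrow> nat \<Rightarrow> complex" where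
  "gbin p k 0 = 1"
| "gbin p 0 (Suc j) = 0"
| "gbin p (Suc k) (Suc j) = gbin p k (Suc j) + p ^ (k - j) * gbin p k j"

lemma gbin_zero: "j > k \<Longrightarrow> gbin p k j = 0"
  by (induction p k j rule: gbin.induct) auto

text \<open>The other Pascal rule for the Gaussian binomials; the power of p sits at the opposite
  summand compared with the defining recursion.\<close>

lemma gbin_Suc': "gbin p (Suc k) (Suc j) = p ^ Suc j * gbin p k (Suc j) + gbin p k j"
proof (induction k arbitrary: j)
  case 0
  then show ?case by (cases j) auto
next
  case (Suc k)
  show ?case
  proof (cases j)
    case 0
    let ?g = "gbin p k (Suc 0)"
    have g: "gbin p (Suc k) (Suc 0) = ?g + p ^ k" by simp
    have g': "gbin p (Suc k) (Suc 0) = p * ?g + 1" using Suc[of 0] by simp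
    have "gbin p (Suc (Suc k)) (Suc 0) = gbin p (Suc k) (Suc 0) + p * p ^ k" by simp
    also have "\<dots> = p * (?g + p ^ k) + 1" unfolding g' by (simp add: algebra_simps)
    finally show ?thesis using 0 g by simp
  next
    case (Suc i)
    consider "i < k" | "i = k" | "i > k" by linarith
    then show ?thesis
    proof cases
      case 1
      then obtain d where d: "k = Suc (i + d)" using less_iff_Suc_add by auto
      let ?a = "gbin p k (Suc j)" and ?b = "gbin p k j" and ?c = "gbin p k i"
      have r1: "gbin p (Suc k) (Suc j) = ?a + p ^ d * ?b"
        using d Suc by simp
      have r2: "gbin p (Suc k) j = ?b + p ^ Suc d * ?c"
        using d Suc by simp
      have "Suc k - j = Suc d" using d Suc by simp
      then have "gbin p (Suc (Suc k)) (Suc j) = gbin p (Suc k) (Suc j) + p ^ Suc d * gbin p (Suc k) j"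
        using gbin.simps(3)[of p "Suc k" j] by presburger
      also have "\<dots> = (p ^ Suc j * ?a + ?b) + p ^ Suc d * (p ^ j * ?b + ?c)"
        using Suc.IH[of j] Suc.IH[of i] Suc by metis
      also have "\<dots> = p ^ Suc j * (?a + p ^ d * ?b) + (?b + p ^ Suc d * ?c)"
        by (simp add: algebra_simps)
      finally show ?thesis unfolding r1 r2 .
    next
      case 2
      then show ?thesis using Suc.IH[of j] Suc.IH[of i] unfolding Suc
        by (simp add: gbin_zero algebra_simps)
    next
      case 3
      then show ?thesis unfolding Suc by (simp add: gbin_zero)
    qed
  qed
qed

text \<open>The coefficient of a^(k-j) times the j-th commutator of b, b' when the commutators of a
  + b, a' + b' are expanded (\<open>qad_sum_expansion\<close>).\<close>

definition ccoeff :: "complex \<Rightarrow> complex \<Rightarrow> nat \<Rightarrow> nat \<Rightarrow> complex" where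
  "ccoeff t p k j = gbin p k j * (\<Prod>i=j..<k. 1 - t\<^sup>2 * p ^ i)"

lemma ccoeff_Suc_0: "ccoeff t p (Suc k) 0 = ccoeff t p k 0 * (1 - (t * p ^ k) * (t * p ^ 0))"
  by (simp add: ccoeff_def power2_eq_square algebra_simps)

text \<open>Both Pascal rules enter: the defining one for the part free of t^2, the mirrored one for
  the part with t^2.\<close>

lemma ccoeff_Suc_Suc:
  assumes "j \<le> k"
  shows "ccoeff t p (Suc k) (Suc j) =
    ccoeff t p k (Suc j) * (1 - (t * p ^ k) * (t * p ^ Suc j)) + p ^ (k - j) * ccoeff t p k j"
proof (cases "j = k")
  case True
  then show ?thesis by (simp add: ccoeff_def gbin_zero)
next
  case False
  then have j: "j < k" using assms by simp
  let ?P = "\<Prod>i=Suc j..<k. 1 - t\<^sup>2 * p ^ i"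
  have P1: "(\<Prod>i=Suc j..<Suc k. 1 - t\<^sup>2 * p ^ i) = ?P * (1 - t\<^sup>2 * p ^ k)"
    using j by simp
  have P2: "(\<Prod>i=j..<k. 1 - t\<^sup>2 * p ^ i) = (1 - t\<^sup>2 * p ^ j) * ?P"
    using j by (rule prod.atLeast_Suc_lessThan)
  have pk: "p ^ (k - j) * p ^ j = p ^ k" using j by (simp flip: power_add)
  have "gbin p (Suc k) (Suc j) * (1 - t\<^sup>2 * p ^ k)
     = gbin p (Suc k) (Suc j) - t\<^sup>2 * p ^ k * gbin p (Suc k) (Suc j)" by (simp add: algebra_simps)
  also have "\<dots> = gbin p k (Suc j) + p ^ (k - j) * gbin p k j
     - t\<^sup>2 * p ^ k * (p ^ Suc j * gbin p k (Suc j) + gbin p k j)"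
    using gbin_Suc'[of p k j] by (simp only: gbin.simps)
  also have "\<dots> = gbin p k (Suc j) * (1 - (t * p ^ k) * (t * p ^ Suc j))
     + p ^ (k - j) * gbin p k j * (1 - t\<^sup>2 * p ^ j)"
    by (simp add: algebra_simps power2_eq_square pk[symmetric])
  finally have "gbin p (Suc k) (Suc j) * (1 - t\<^sup>2 * p ^ k) * ?P = \<dots> * ?P" by simp
  then show ?thesis unfolding ccoeff_def P1 P2 by (simp only: algebra_simps)
qed

text \<open>The product contains the factor with i = n, which is zero by the Serre
  condition.\<close>

lemma ccoeff_last: "t\<^sup>2 * p ^ n = 1 \<Longrightarrow> j \<le> n \<Longrightarrow> ccoeff t p (Suc n) j = 0"
  by (simp add: ccoeff_def)

lemma ccoeff_diag: "ccoeff t p n n = 1"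
proof -
  have "gbin p n n = 1" by (induction n) (simp_all add: gbin_zero)
  then show ?thesis by (simp add: ccoeff_def)
qed

context cong_ideal
begin

lemma qad_left_commute:
  assumes a: "b * a \<approx> p' *\<^sub>C (a * b)" and y: "b * y \<approx> t' *\<^sub>C (y * b)"
  shows "b * qad t p a y k \<approx> (t' * p' ^ k) *\<^sub>C (qad t p a y k * b)"
proof (induction k)
  case (Suc k)
  let ?x = "qad t p a y k" and ?z = "t * p ^ k" and ?z' = "t' * p' ^ k"
  have "b * qad t p a y (Suc k) = (b * a) * ?x - ?z *\<^sub>C ((b * ?x) * a)"
    by (simp add: algebra_simps)
  also have "\<dots> \<approx> (p' *\<^sub>C (a * b)) * ?x - ?z *\<^sub>C ((?z' *\<^sub>C (?x * b)) * a)"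
    by (intro eqv_diff eqv_right eqv_sc a Suc)
  also have "\<dots> = p' *\<^sub>C (a * (b * ?x)) - (?z * ?z') *\<^sub>C (?x * (b * a))"
    by (simp add: algebra_simps)
  also have "\<dots> \<approx> p' *\<^sub>C (a * (?z' *\<^sub>C (?x * b))) - (?z * ?z') *\<^sub>C (?x * (p' *\<^sub>C (a * b)))"
    by (intro eqv_diff eqv_left eqv_sc a Suc)
  also have "\<dots> = (t' * p' ^ Suc k) *\<^sub>C (qad t p a y (Suc k) * b)"
    by (simp add: algebra_simps)
  finally show ?case .
qed (simp add: y)

lemma qad_right_commute:
  assumes a: "a * b \<approx> p' *\<^sub>C (b * a)" and y: "y * b \<approx> t' *\<^sub>C (b * y)"
  shows "qad t p a y k * b \<approx> (t' * p' ^ k) *\<^sub>C (b * qad t p a y k)"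
proof (induction k)
  case (Suc k)
  let ?x = "qad t p a y k" and ?z = "t * p ^ k" and ?z' = "t' * p' ^ k"
  have "qad t p a y (Suc k) * b = a * (?x * b) - ?z *\<^sub>C (?x * (a * b))"
    by (simp add: algebra_simps)
  also have "\<dots> \<approx> a * (?z' *\<^sub>C (b * ?x)) - ?z *\<^sub>C (?x * (p' *\<^sub>C (b * a)))"
    by (intro eqv_diff eqv_left eqv_sc a Suc)
  also have "\<dots> = ?z' *\<^sub>C ((a * b) * ?x) - (?z * p') *\<^sub>C ((?x * b) * a)"
    by (simp add: algebra_simps)
  also have "\<dots> \<approx> ?z' *\<^sub>C ((p' *\<^sub>C (b * a)) * ?x) - (?z * p') *\<^sub>C ((?z' *\<^sub>C (b * ?x)) * a)"
    by (intro eqv_diff eqv_right eqv_sc a Suc)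
  also have "\<dots> = (t' * p' ^ Suc k) *\<^sub>C (b * qad t p a y (Suc k))"
    by (simp add: algebra_simps)
  finally show ?case .
qed (simp add: y)

lemma power_left_commute:
  assumes a: "b * a \<approx> p *\<^sub>C (a * b)"
  shows "b * a ^ k \<approx> (p ^ k) *\<^sub>C (a ^ k * b)"
proof (induction k)
  case (Suc k)
  have "b * a ^ Suc k = (b * a) * a ^ k" by (simp add: mult.assoc)
  also have "\<dots> \<approx> (p *\<^sub>C (a * b)) * a ^ k" by (intro eqv_right a)
  also have "\<dots> = p *\<^sub>C (a * (b * a ^ k))" by (simp add: mult.assoc)
  also have "\<dots> \<approx> p *\<^sub>C (a * ((p ^ k) *\<^sub>C (a ^ k * b)))" by (intro eqv_sc eqv_left Suc)
  also have "\<dots> = (p ^ Suc k) *\<^sub>C (a ^ Suc k * b)" by (simp add: mult.assoc)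
  finally show ?case .
qed simp

text \<open>Induction on k: one more commutator acts on each term a^(k-j) x_j, and moving a to the
  left of x_j and b to the left of the powers of a gives exactly the recursion of
  \<open>ccoeff\<close>.\<close>

lemma qad_sum_expansion:
  assumes ba: "b * a \<approx> p *\<^sub>C (a * b)" and ba': "b * a' \<approx> t *\<^sub>C (a' * b)"
    and b'a: "b' * a \<approx> t *\<^sub>C (a * b')"
  shows "qad t p (a + b) (a' + b') k \<approx> qad t p a a' k +
    (\<Sum>j\<le>k. ccoeff t p k j *\<^sub>C (a ^ (k - j) * qad t p b b' j))"
proof (induction k)
  case 0
  then show ?case by (simp add: ccoeff_def)
next
  case (Suc k)
  let ?xa = "qad t p a a' k" and ?xb = "qad t p b b'" and ?z = "t * p ^ k"
  let ?T = "\<lambda>j. a ^ (k - j) * ?xb j"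
  let ?c = "ccoeff t p k"
  let ?S = "\<Sum>j\<le>k. ?c j *\<^sub>C ?T j"
  have "qad t p (a + b) (a' + b') (Suc k) \<approx> (a + b) * (?xa + ?S) - ?z *\<^sub>C ((?xa + ?S) * (a + b))"
    unfolding qad.simps by (intro eqv_diff eqv_left eqv_right eqv_sc Suc)
  also have "\<dots> = qad t p a a' (Suc k) + (b * ?xa - ?z *\<^sub>C (?xa * b))
     + (\<Sum>j\<le>k. ?c j *\<^sub>C ((a * ?T j - ?z *\<^sub>C (?T j * a)) + (b * ?T j - ?z *\<^sub>C (?T j * b))))"
    by (simp add: distrib_left distrib_right sum_distrib_left sum_distrib_right sc_sum
        sum.distrib sum_subtractf algebra_simps)
  \<comment> \<open>b q-commutes with the k-th commutator of a, a' with factor t p^k, so this mixed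
    bracket cancels. In each remaining term, a produces an element of index j and b one of index j +
    1.\<close>
  also have "\<dots> \<approx> qad t p a a' (Suc k) + (?z *\<^sub>C (?xa * b) - ?z *\<^sub>C (?xa * b))
     + (\<Sum>j\<le>k. ?c j *\<^sub>C ((1 - ?z * (t * p ^ j)) *\<^sub>C (a ^ (Suc k - j) * ?xb j)
          + p ^ (k - j) *\<^sub>C (a ^ (k - j) * ?xb (Suc j))))"
  proof (intro eqv_add eqv_diff eqv_sum eqv_sc eqv_refl qad_left_commute ba ba')
    fix j assume "j \<in> {..k}"
    then obtain m where m: "k = j + m" using le_iff_add by auto
    have "a * ?T j - ?z *\<^sub>C (?T j * a) = a ^ (Suc k - j) * ?xb j - ?z *\<^sub>C (a ^ (k - j) * (?xb j * a))"
      using m by (simp add: Suc_diff_le mult.assoc)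
    also have "\<dots> \<approx> a ^ (Suc k - j) * ?xb j - ?z *\<^sub>C (a ^ (k - j) * ((t * p ^ j) *\<^sub>C (a * ?xb j)))"
      by (intro eqv_diff eqv_refl eqv_left eqv_sc qad_right_commute ba b'a)
    also have "\<dots> = (1 - ?z * (t * p ^ j)) *\<^sub>C (a ^ (Suc k - j) * ?xb j)"
      using m by (simp add: Suc_diff_le mult.assoc sc_diff_left power_commutes flip: mult.assoc)
    finally show "a * ?T j - ?z *\<^sub>C (?T j * a) \<approx> (1 - ?z * (t * p ^ j)) *\<^sub>C (a ^ (Suc k - j) * ?xb j)" .
    have "b * ?T j - ?z *\<^sub>C (?T j * b) = (b * a ^ (k - j)) * ?xb j - ?z *\<^sub>C (?T j * b)"
      by (simp add: mult.assoc)
    also have "\<dots> \<approx> (p ^ (k - j) *\<^sub>C (a ^ (k - j) * b)) * ?xb j - ?z *\<^sub>C (?T j * b)"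
      by (intro eqv_diff eqv_refl eqv_right power_left_commute ba)
    also have "\<dots> = p ^ (k - j) *\<^sub>C (a ^ (k - j) * ?xb (Suc j))"
      using m by (simp add: algebra_simps power_add)
    finally show "b * ?T j - ?z *\<^sub>C (?T j * b) \<approx> p ^ (k - j) *\<^sub>C (a ^ (k - j) * ?xb (Suc j))" .
  qed
  also have "\<dots> = qad t p a a' (Suc k) + (\<Sum>j\<le>k. (?c j * (1 - ?z * (t * p ^ j))) *\<^sub>C (a ^ (Suc k - j) * ?xb j))
     + (\<Sum>j\<le>k. (p ^ (k - j) * ?c j) *\<^sub>C (a ^ (k - j) * ?xb (Suc j)))"
    by (simp add: sum.distrib mult.commute del: qad.simps)
  also have "(\<Sum>j\<le>k. (?c j * (1 - ?z * (t * p ^ j))) *\<^sub>C (a ^ (Suc k - j) * ?xb j))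
    = (\<Sum>j\<le>Suc k. (?c j * (1 - ?z * (t * p ^ j))) *\<^sub>C (a ^ (Suc k - j) * ?xb j))"
    by (simp add: ccoeff_def gbin_zero)
  also have "\<dots> = (ccoeff t p (Suc k) 0) *\<^sub>C (a ^ Suc k * ?xb 0) +
     (\<Sum>j\<le>k. (?c (Suc j) * (1 - ?z * (t * p ^ Suc j))) *\<^sub>C (a ^ (k - j) * ?xb (Suc j)))"
    unfolding sum.atMost_Suc_shift by (simp add: ccoeff_Suc_0 del: qad.simps(2) power_Suc)
  also have "qad t p a a' (Suc k) + \<dots> + (\<Sum>j\<le>k. (p ^ (k - j) * ?c j) *\<^sub>C (a ^ (k - j) * ?xb (Suc j)))
    = qad t p a a' (Suc k) + (\<Sum>j\<le>Suc k. ccoeff t p (Suc k) j *\<^sub>C (a ^ (Suc k - j) * ?xb j))"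
    unfolding sum.atMost_Suc_shift
    by (simp add: ccoeff_Suc_Suc sc_add_left sum.distrib add.assoc del: qad.simps(2) power_Suc)
  finally show ?case .
qed

text \<open>Serre elements are additive on q-commuting summands, since only the coefficient with j =
  n + 1 survives. This is how Serre relations pass through the coproduct.\<close>

lemma qad_sum_mem:
  assumes ba: "b * a \<approx> p *\<^sub>C (a * b)" and ba': "b * a' \<approx> t *\<^sub>C (a' * b)"
    and b'a: "b' * a \<approx> t *\<^sub>C (a * b')"
    and tp: "t\<^sup>2 * p ^ n = 1" and A: "qad t p a a' (Suc n) \<in> J" and B: "qad t p b b' (Suc n) \<in> J"
  shows "qad t p (a + b) (a' + b') (Suc n) \<in> J"
proof -
  have "qad t p (a + b) (a' + b') (Suc n) \<approx> qad t p a a' (Suc n) + qad t p b b' (Suc n)"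
    using qad_sum_expansion[OF ba ba' b'a, of "Suc n"]
    by (simp add: ccoeff_last[OF tp] ccoeff_diag del: qad.simps)
  also have "\<dots> \<approx> 0" unfolding eqv_zero_iff by (intro add_mem A B)
  finally show ?thesis by (simp add: eqv_zero_iff)
qed

lemma qad_commutator:
  assumes "e * f \<approx> f * e" "y * f \<approx> f * y"
  shows "qad t p e y k * f \<approx> f * qad t p e y k"
proof (induction k)
  case (Suc k)
  let ?x = "qad t p e y k" and ?z = "t * p ^ k"
  have "qad t p e y (Suc k) * f = e * (?x * f) - ?z *\<^sub>C (?x * (e * f))" by (simp add: algebra_simps)
  also have "\<dots> \<approx> e * (f * ?x) - ?z *\<^sub>C (?x * (f * e))"
    by (intro eqv_diff eqv_left eqv_sc assms Suc)
  also have "\<dots> = (e * f) * ?x - ?z *\<^sub>C ((?x * f) * e)" by (simp add: algebra_simps)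
  also have "\<dots> \<approx> (f * e) * ?x - ?z *\<^sub>C ((f * ?x) * e)"
    by (intro eqv_diff eqv_right eqv_sc assms Suc)
  also have "\<dots> = f * qad t p e y (Suc k)" by (simp add: algebra_simps)
  finally show ?case .
qed (simp add: assms)

text \<open>The case where f pairs with the repeated letter. By induction the commutator of x_(k+1)
  with f is a scalar times \<open>km\<close> x_k; the \<open>kp\<close> parts cancel because
  \<open>kp\<close> passes x_k with exactly the factor t p^k.\<close>

lemma qad_commutator_first:
  assumes ef: "e * f - f * e \<approx> d *\<^sub>C (kp - km)" and yf: "y * f \<approx> f * y"
    and kpe: "kp * e \<approx> p *\<^sub>C (e * kp)" and kpy: "kp * y \<approx> t *\<^sub>C (y * kp)"
    and kme: "e * km \<approx> p *\<^sub>C (km * e)" and kmy: "y * km \<approx> t *\<^sub>C (km * y)"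
    and tp: "t\<^sup>2 * p ^ n = 1"
  shows "qad t p e y (Suc n) * f \<approx> f * qad t p e y (Suc n)"
proof -
  let ?x = "qad t p e y"
  \<comment> \<open>Closed form of the recursion g_(k+1) = p g_k + d (t^2 p^(2k+2) - 1) that the
    commutators satisfy. It vanishes at k = n because t^2 p^n = 1.\<close>
  let ?g = "\<lambda>k. d * ((t\<^sup>2 * p ^ k - 1) * (\<Sum>i<Suc k. p ^ i))"
  have step: "?x (Suc k) * f - f * ?x (Suc k) \<approx>
      (e * w - (t * p ^ k) *\<^sub>C (w * e)) + (d * (t\<^sup>2 * p ^ k * p ^ k - 1)) *\<^sub>C (km * ?x k)"
    if w: "?x k * f - f * ?x k \<approx> w" for k w
  proof -
    let ?z = "t * p ^ k"
    have "?x (Suc k) * f - f * ?x (Suc k) =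
       (e * (?x k * f - f * ?x k) - ?z *\<^sub>C ((?x k * f - f * ?x k) * e))
        + ((e * f - f * e) * ?x k - ?z *\<^sub>C (?x k * (e * f - f * e)))"
      by (simp add: algebra_simps)
    also have "\<dots> \<approx> (e * w - ?z *\<^sub>C (w * e))
        + ((d *\<^sub>C (kp - km)) * ?x k - ?z *\<^sub>C (?x k * (d *\<^sub>C (kp - km))))"
      by (intro eqv_add eqv_diff eqv_left eqv_right eqv_sc w ef)
    also have "\<dots> = (e * w - ?z *\<^sub>C (w * e))
        + (d *\<^sub>C (kp * ?x k) - d *\<^sub>C (km * ?x k) - (d * ?z) *\<^sub>C (?x k * kp) + (d * ?z) *\<^sub>C (?x k * km))"
      by (simp add: algebra_simps)
    also have "\<dots> \<approx> (e * w - ?z *\<^sub>C (w * e))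
        + (d *\<^sub>C (?z *\<^sub>C (?x k * kp)) - d *\<^sub>C (km * ?x k) - (d * ?z) *\<^sub>C (?x k * kp)
           + (d * ?z) *\<^sub>C (?z *\<^sub>C (km * ?x k)))"
      by (intro eqv_add eqv_diff eqv_sc eqv_refl qad_left_commute[OF kpe kpy]
           qad_right_commute[OF kme kmy])
    also have "\<dots> = (e * w - ?z *\<^sub>C (w * e)) + (d * (t\<^sup>2 * p ^ k * p ^ k - 1)) *\<^sub>C (km * ?x k)"
      by (simp add: sc_diff_left right_diff_distrib power2_eq_square mult_ac)
    finally show ?thesis .
  qed
  have main: "?x (Suc k) * f - f * ?x (Suc k) \<approx> ?g k *\<^sub>C (km * ?x k)" for k
  proof (induction k)
    case 0
    have "?x 0 * f - f * ?x 0 \<approx> 0" using yf by (simp add: eqv_def)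
    from step[OF this] show ?case by (simp add: right_diff_distrib)
  next
    case (Suc k)
    let ?z = "t * p ^ Suc k"
    have "?x (Suc (Suc k)) * f - f * ?x (Suc (Suc k)) \<approx>
        (e * (?g k *\<^sub>C (km * ?x k)) - ?z *\<^sub>C ((?g k *\<^sub>C (km * ?x k)) * e))
         + (d * (t\<^sup>2 * p ^ Suc k * p ^ Suc k - 1)) *\<^sub>C (km * ?x (Suc k))" by (rule step[OF Suc])
    also have "\<dots> = ?g k *\<^sub>C ((e * km) * ?x k - ?z *\<^sub>C (km * (?x k * e)))
         + (d * (t\<^sup>2 * p ^ Suc k * p ^ Suc k - 1)) *\<^sub>C (km * ?x (Suc k))"
      by (simp add: mult.assoc mult_ac del: qad.simps)
    also have "\<dots> \<approx> ?g k *\<^sub>C ((p *\<^sub>C (km * e)) * ?x k - ?z *\<^sub>C (km * (?x k * e)))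
         + (d * (t\<^sup>2 * p ^ Suc k * p ^ Suc k - 1)) *\<^sub>C (km * ?x (Suc k))"
      by (intro eqv_add eqv_sc eqv_diff eqv_right eqv_refl kme)
    also have "\<dots> = (?g k * p) *\<^sub>C (km * ?x (Suc k))
         + (d * (t\<^sup>2 * p ^ Suc k * p ^ Suc k - 1)) *\<^sub>C (km * ?x (Suc k))"
      by (simp add: algebra_simps)
    also have "\<dots> = (?g k * p + d * (t\<^sup>2 * p ^ Suc k * p ^ Suc k - 1)) *\<^sub>C (km * ?x (Suc k))"
      by (simp add: sc_add_left del: qad.simps)
    also have "?g k * p + d * (t\<^sup>2 * p ^ Suc k * p ^ Suc k - 1) = ?g (Suc k)"
    proof -
      define s where "s = (\<Sum>i<Suc k. p ^ i)"
      have h1: "(\<Sum>i<Suc (Suc k). p ^ i) = s + p ^ Suc k" by (simp add: s_def)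
      have "(\<Sum>i<Suc (Suc k). p ^ i) = 1 + p * s"
        unfolding s_def by (subst sum.lessThan_Suc_shift) (simp add: sum_distrib_left distrib_left)
      then have h2: "s + p ^ Suc k = 1 + p * s" using h1 by simp
      have "?g (Suc k) = d * (t\<^sup>2 * p ^ Suc k * (s + p ^ Suc k) - (s + p ^ Suc k))"
        unfolding h1 by (simp add: algebra_simps)
      also have "\<dots> = d * (t\<^sup>2 * p ^ Suc k * (s + p ^ Suc k) - (1 + p * s))"
        unfolding h2 ..
      also have "\<dots> = d * ((t\<^sup>2 * p ^ k - 1) * s) * p + d * (t\<^sup>2 * p ^ Suc k * p ^ Suc k - 1)"
        by (simp add: algebra_simps)
      finally show ?thesis unfolding s_def ..
    qed
    finally show ?case .
  qed
  show ?thesis using main[of n] tp by (simp add: eqv_def del: qad.simps)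
qed

text \<open>The case where f pairs with the single letter. The \<open>km\<close> part already
  cancels in x_1; afterwards each step multiplies by 1 - t^2 p^k, and the factor with k = n is
  zero.\<close>

lemma qad_commutator_second:
  assumes ef: "e * f \<approx> f * e" and yf: "y * f - f * y \<approx> d *\<^sub>C (kp - km)"
    and kpe: "kp * e \<approx> t *\<^sub>C (e * kp)" and kme: "e * km \<approx> t *\<^sub>C (km * e)"
    and tp: "t\<^sup>2 * p ^ n = 1"
  shows "qad t p e y (Suc n) * f \<approx> f * qad t p e y (Suc n)"
proof -
  let ?x = "qad t p e y"
  let ?g = "\<lambda>k. d * (\<Prod>i<k. 1 - t\<^sup>2 * p ^ i)"
  have step: "?x (Suc k) * f - f * ?x (Suc k) \<approx> e * w - (t * p ^ k) *\<^sub>C (w * e)"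
    if w: "?x k * f - f * ?x k \<approx> w" for k w
  proof -
    let ?z = "t * p ^ k"
    have "?x (Suc k) * f - f * ?x (Suc k) =
       (e * (?x k * f - f * ?x k) - ?z *\<^sub>C ((?x k * f - f * ?x k) * e))
        + ((e * f - f * e) * ?x k - ?z *\<^sub>C (?x k * (e * f - f * e)))"
      by (simp add: algebra_simps)
    also have "\<dots> \<approx> (e * w - ?z *\<^sub>C (w * e)) + (0 * ?x k - ?z *\<^sub>C (?x k * 0))"
      using ef by (intro eqv_add eqv_diff eqv_left eqv_right eqv_sc w) (simp_all add: eqv_def)
    finally show ?thesis by simp
  qed
  have main: "?x (Suc k) * f - f * ?x (Suc k) \<approx> ?g (Suc k) *\<^sub>C (e ^ Suc k * kp)" for k
  proof (induction k)
    case 0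
    have "?x 0 * f - f * ?x 0 \<approx> d *\<^sub>C (kp - km)" using yf by simp
    from step[OF this]
    have "?x (Suc 0) * f - f * ?x (Suc 0) \<approx>
       d *\<^sub>C (e * kp) - d *\<^sub>C (e * km) - (d * t) *\<^sub>C (kp * e) + (d * t) *\<^sub>C (km * e)"
      by (simp add: algebra_simps)
    also have "\<dots> \<approx> d *\<^sub>C (e * kp) - d *\<^sub>C (t *\<^sub>C (km * e)) - (d * t) *\<^sub>C (t *\<^sub>C (e * kp)) + (d * t) *\<^sub>C (km * e)"
      by (intro eqv_add eqv_diff eqv_sc kme kpe eqv_refl)
    also have "\<dots> = ?g (Suc 0) *\<^sub>C (e ^ Suc 0 * kp)"
      by (simp add: sc_diff_left right_diff_distrib power2_eq_square mult_ac)
    finally show ?case .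
  next
    case (Suc k)
    let ?w = "?g (Suc k) *\<^sub>C (e ^ Suc k * kp)"
    have "?x (Suc (Suc k)) * f - f * ?x (Suc (Suc k)) \<approx> e * ?w - (t * p ^ Suc k) *\<^sub>C (?w * e)"
      by (rule step[OF Suc])
    also have "\<dots> = e * ?w - (t * p ^ Suc k * ?g (Suc k)) *\<^sub>C (e ^ Suc k * (kp * e))"
      by (simp add: mult.assoc)
    also have "\<dots> \<approx> e * ?w - (t * p ^ Suc k * ?g (Suc k)) *\<^sub>C (e ^ Suc k * (t *\<^sub>C (e * kp)))"
      by (intro eqv_diff eqv_refl eqv_sc eqv_left kpe)
    also have "\<dots> = ?g (Suc k) *\<^sub>C (e ^ Suc (Suc k) * kp) -
        (t * t * p ^ Suc k * ?g (Suc k)) *\<^sub>C (e ^ Suc (Suc k) * kp)"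
    proof -
      have "e * (e ^ Suc k * kp) = e ^ Suc (Suc k) * kp" by (simp add: mult.assoc)
      moreover have "e ^ Suc k * (e * kp) = e ^ Suc (Suc k) * kp"
        by (simp add: power_Suc2 mult.assoc del: power_Suc)
      ultimately show ?thesis by (simp add: mult_ac del: power_Suc)
    qed
    also have "\<dots> = ?g (Suc (Suc k)) *\<^sub>C (e ^ Suc (Suc k) * kp)"
      unfolding sc_diff_left[symmetric]
      by (rule arg_cong2[where f = sc]) (simp_all add: algebra_simps power2_eq_square)
    finally show ?case .
  qed
  have g: "?g (Suc n) = 0" using tp by simp
  have "?x (Suc n) * f - f * ?x (Suc n) \<approx> 0" using main[of n] unfolding g sc_zero_left .
  then show ?thesis by (simp add: eqv_def del: qad.simps)
qed

end

section \<open>Monoid algebras and their quotients as records\<close>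

lemma monoid_algebra_simps [simp]:
  "carrier (monoid_algebra M) = {f. keys f \<subseteq> carrier M}"
  "one (monoid_algebra M) = single \<one>\<^bsub>M\<^esub> 1"
  "zero (monoid_algebra M) = 0"
  "add (monoid_algebra M) = (+)"
  "smult (monoid_algebra M) c p = c *\<^sub>C p"
  by (simp_all add: monoid_algebra_def sc_def)

lemma monoid_algebra_mult:
  "f \<otimes>\<^bsub>monoid_algebra M\<^esub> g = lin (\<lambda>a. lin (\<lambda>b. single (a \<otimes>\<^bsub>M\<^esub> b) 1) g) f"
  by (simp add: monoid_algebra_def lin_def sc_sum)

lemma lsub_carrier_monoid_algebra: "lsub (carrier (monoid_algebra M))"
  by (simp add: lsub_keys)

lemma lin_lin: "lin f (lin g p) = lin (\<lambda>k. lin f (g k)) p"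
  by (rule lmap_lin_comp) simp

context monoid
begin

lemma monoid_algebra_closed:
  assumes "f \<in> carrier (monoid_algebra G)" "g \<in> carrier (monoid_algebra G)"
  shows "f \<otimes>\<^bsub>monoid_algebra G\<^esub> g \<in> carrier (monoid_algebra G)"
  unfolding monoid_algebra_mult using assms
  by (intro lsub_lin lsub_carrier_monoid_algebra) (auto simp: subset_iff)

lemma monoid_algebra_ring: "ring (monoid_algebra G)"
proof (rule ringI)
  have closed: "x + y \<in> carrier (monoid_algebra G)"
    if "x \<in> carrier (monoid_algebra G)" "y \<in> carrier (monoid_algebra G)" for x y
    using that lsub_add[OF lsub_carrier_monoid_algebra] by blast
  show "abelian_group (monoid_algebra G)"
  proof (rule abelian_groupI)
    fix x assume x: "x \<in> carrier (monoid_algebra G)"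
    then have "- x \<in> carrier (monoid_algebra G)" by simp
    then show "\<exists>y\<in>carrier (monoid_algebra G). y \<oplus>\<^bsub>monoid_algebra G\<^esub> x = \<zero>\<^bsub>monoid_algebra G\<^esub>"
      by (intro bexI[of _ "- x"]) simp_all
  qed (use closed in \<open>simp_all add: add_ac\<close>)
  show "monoid (monoid_algebra G)"
  proof (rule monoidI)
    fix x y z
    assume "x \<in> carrier (monoid_algebra G)" "y \<in> carrier (monoid_algebra G)" "z \<in> carrier (monoid_algebra G)"
    then show "x \<otimes>\<^bsub>monoid_algebra G\<^esub> y \<otimes>\<^bsub>monoid_algebra G\<^esub> z
      = x \<otimes>\<^bsub>monoid_algebra G\<^esub> (y \<otimes>\<^bsub>monoid_algebra G\<^esub> z)"
      unfolding monoid_algebra_mult lin_lin lin_single sc_one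
      by (intro lin_cong refl) (auto simp: subset_iff m_assoc)
  next
    fix x assume x: "x \<in> carrier (monoid_algebra G)"
    have "lin (\<lambda>b. single (\<one> \<otimes> b) 1) x = lin (\<lambda>b. single b 1) x"
      using x by (intro lin_cong) (auto simp: subset_iff)
    then show "\<one>\<^bsub>monoid_algebra G\<^esub> \<otimes>\<^bsub>monoid_algebra G\<^esub> x = x"
      by (simp add: monoid_algebra_mult)
    have "lin (\<lambda>a. single (a \<otimes> \<one>) 1) x = lin (\<lambda>a. single a 1) x"
      using x by (intro lin_cong) (auto simp: subset_iff)
    then show "x \<otimes>\<^bsub>monoid_algebra G\<^esub> \<one>\<^bsub>monoid_algebra G\<^esub> = x"
      by (simp add: monoid_algebra_mult)
  qed (use monoid_algebra_closed in simp_all)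
qed (simp_all add: monoid_algebra_mult lin_fun_add)

lemma monoid_algebra_scalar_left:
  assumes "f \<in> carrier (monoid_algebra G)"
  shows "single \<one> c \<otimes>\<^bsub>monoid_algebra G\<^esub> f = c *\<^sub>C f"
proof -
  have "lin (\<lambda>b. single (\<one> \<otimes> b) 1) f = lin (\<lambda>b. single b 1) f"
    using assms by (intro lin_cong) (auto simp: subset_iff)
  then show ?thesis by (simp add: monoid_algebra_mult)
qed

end

text \<open>Used twice: with words in the generators for the quantum group, and with the
  multiplicative monoid of pairs for its tensor square.\<close>

locale monoid_algebra_quotient = monoid G for G (structure) +
  fixes R :: "('a \<Rightarrow>\<^sub>0 complex) set"
  assumes R_carrier: "R \<subseteq> carrier (monoid_algebra G)"
begin

abbreviation MA where "MA \<equiv> monoid_algebra G"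
abbreviation MQ where "MQ \<equiv> quotient_algebra MA R"
abbreviation cls where "cls \<equiv> quotient_class MA R"

sublocale MA: ring MA by (rule monoid_algebra_ring)

lemma ideal_R: "ideal (Idl\<^bsub>MA\<^esub> R) MA"
  by (rule MA.genideal_ideal[OF R_carrier])

sublocale I: ideal "Idl\<^bsub>MA\<^esub> R" MA by (rule ideal_R)

lemma carrier_MQ: "carrier MQ = cls ` carrier MA"
  by (auto simp: quotient_algebra_def quotient_class_def Let_def FactRing_def A_RCOSETS_def')

lemma ring_MQ: "ring MQ"
proof -
  interpret Q: ring "MA Quot (Idl\<^bsub>MA\<^esub> R)" by (rule I.quotient_is_ring)
  have [simp]: "carrier MQ = carrier (MA Quot (Idl\<^bsub>MA\<^esub> R))" "monoid.mult MQ = monoid.mult (MA Quot (Idl\<^bsub>MA\<^esub> R))"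
    "one MQ = one (MA Quot (Idl\<^bsub>MA\<^esub> R))" "zero MQ = zero (MA Quot (Idl\<^bsub>MA\<^esub> R))"
    "add MQ = add (MA Quot (Idl\<^bsub>MA\<^esub> R))"
    by (simp_all add: quotient_algebra_def Let_def)
  show ?thesis
  proof (rule ringI)
    show "abelian_group MQ"
    proof (rule abelian_groupI)
      fix x assume x: "x \<in> carrier MQ"
      then show "\<exists>y\<in>carrier MQ. y \<oplus>\<^bsub>MQ\<^esub> x = \<zero>\<^bsub>MQ\<^esub>"
        by (intro bexI[of _ "\<ominus>\<^bsub>MA Quot (Idl\<^bsub>MA\<^esub> R)\<^esub> x"]) (simp_all add: Q.l_neg)
    qed (simp_all add: Q.a_ac)
    show "monoid MQ" by (rule monoidI) (simp_all add: Q.m_assoc)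
  qed (simp_all add: Q.l_distr Q.r_distr)
qed

lemma cls_closed [simp]: "x \<in> carrier MA \<Longrightarrow> cls x \<in> carrier MQ"
  by (simp add: carrier_MQ)

lemma minus_MA: "x \<in> carrier MA \<Longrightarrow> y \<in> carrier MA \<Longrightarrow> x \<ominus>\<^bsub>MA\<^esub> y = x - y"
proof -
  assume x: "x \<in> carrier MA" and y: "y \<in> carrier MA"
  have "- y \<in> carrier MA" using y by simp
  then have "\<ominus>\<^bsub>MA\<^esub> y = - y"
    using y MA.minus_equality[of "- y" y] by simp
  then show ?thesis by (simp add: a_minus_def)
qed

lemma cls_eq_iff:
  assumes "x \<in> carrier MA" "y \<in> carrier MA"
  shows "cls x = cls y \<longleftrightarrow> x - y \<in> Idl\<^bsub>MA\<^esub> R"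
  using MA.quotient_eq_iff_same_a_r_cos[OF ideal_R assms] minus_MA[OF assms]
  by (simp add: quotient_class_def)

lemma cls_add: "x \<in> carrier MA \<Longrightarrow> y \<in> carrier MA \<Longrightarrow> cls x \<oplus>\<^bsub>MQ\<^esub> cls y = cls (x + y)"
  using I.a_rcos_sum[of x y]
  by (simp add: quotient_algebra_def quotient_class_def Let_def FactRing_def)

lemma cls_mult: "x \<in> carrier MA \<Longrightarrow> y \<in> carrier MA \<Longrightarrow> cls x \<otimes>\<^bsub>MQ\<^esub> cls y = cls (x \<otimes>\<^bsub>MA\<^esub> y)"
  using I.rcoset_mult_add[of x y]
  by (simp add: quotient_algebra_def quotient_class_def Let_def FactRing_def)

lemma cls_one: "\<one>\<^bsub>MQ\<^esub> = cls (single \<one> 1)"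
  by (simp add: quotient_algebra_def quotient_class_def Let_def FactRing_def)

lemma cls_zero: "\<zero>\<^bsub>MQ\<^esub> = cls 0"
proof -
  have "Idl\<^bsub>MA\<^esub> R +>\<^bsub>MA\<^esub> \<zero>\<^bsub>MA\<^esub> = Idl\<^bsub>MA\<^esub> R"
    using MA.a_coset_add_zero[OF I.a_subset] by simp
  then show ?thesis
    by (simp add: quotient_algebra_def quotient_class_def Let_def FactRing_def)
qed

lemma mem_cls: "y \<in> cls x \<longleftrightarrow> (\<exists>i\<in>Idl\<^bsub>MA\<^esub> R. y = i + x)"
  by (auto simp: quotient_class_def a_r_coset_def')

text \<open>Scalar multiplication on the quotient is a union over all members of a coset. The cosets
  in this union coincide because multiplying by c is multiplying by \<open>single \<one> c\<close>,
  which preserves the ideal.\<close>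

lemma cls_sc: 
  assumes x: "x \<in> carrier MA"
  shows "c \<odot>\<^bsub>MQ\<^esub> cls x = cls (c *\<^sub>C x)"
proof -
  have sc: "c *\<^sub>C y \<in> carrier MA" if "y \<in> carrier MA" for y
    using that lsub_sc[OF lsub_carrier_monoid_algebra] by blast
  have "cls (c *\<^sub>C y) = cls (c *\<^sub>C x)" if yx: "y \<in> cls x" for y
  proof -
    obtain i where i: "i \<in> Idl\<^bsub>MA\<^esub> R" "y = i + x" using yx[unfolded mem_cls] by blast
    have iM: "i \<in> carrier MA" using i(1) I.a_Hcarr by blast
    have y: "y \<in> carrier MA" using iM x i(2) lsub_add[OF lsub_carrier_monoid_algebra] by blast
    have "single \<one> c \<otimes>\<^bsub>MA\<^esub> i \<in> Idl\<^bsub>MA\<^esub> R"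
      by (rule I.I_l_closed[OF i(1)]) simp
    then have "c *\<^sub>C i \<in> Idl\<^bsub>MA\<^esub> R" using monoid_algebra_scalar_left[OF iM] by simp
    moreover have "c *\<^sub>C y - c *\<^sub>C x = c *\<^sub>C i" by (simp add: i(2))
    ultimately show ?thesis unfolding cls_eq_iff[OF sc[OF y] sc[OF x]] by simp
  qed
  then have "(\<Union>y\<in>cls x. cls (c *\<^sub>C y)) = (\<Union>y\<in>cls x. cls (c *\<^sub>C x))" by (rule SUP_cong[OF refl])
  also have "\<dots> = cls (c *\<^sub>C x)"
  proof -
    have "x \<in> cls x" unfolding mem_cls by (rule bexI[of _ 0]) (use I.zero_closed in simp_all)
    then show ?thesis by (intro SUP_const) blast
  qed
  finally show ?thesis
    by (simp add: quotient_algebra_def Let_def quotient_class_def)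
qed

text \<open>N may reach outside the carrier, since it is intersected with it. Hence any congruence
  ideal of the whole function type that contains the relations can serve as N.\<close>

lemma Idl_minimal:
  assumes zero: "0 \<in> N"
    and add: "\<And>x y. x \<in> N \<Longrightarrow> y \<in> N \<Longrightarrow> x \<in> carrier MA \<Longrightarrow> y \<in> carrier MA \<Longrightarrow> x + y \<in> N"
    and left: "\<And>a x. x \<in> N \<Longrightarrow> a \<in> carrier MA \<Longrightarrow> x \<in> carrier MA \<Longrightarrow> a \<otimes>\<^bsub>MA\<^esub> x \<in> N"
    and right: "\<And>a x. x \<in> N \<Longrightarrow> a \<in> carrier MA \<Longrightarrow> x \<in> carrier MA \<Longrightarrow> x \<otimes>\<^bsub>MA\<^esub> a \<in> N"
    and R: "R \<subseteq> N"
  shows "Idl\<^bsub>MA\<^esub> R \<subseteq> N"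
proof -
  have "ideal (N \<inter> carrier MA) MA"
  proof (rule idealI)
    show "subgroup (N \<inter> carrier MA) (add_monoid MA)"
    proof (rule MA.add.subgroupI)
      fix a assume a: "a \<in> N \<inter> carrier MA"
      have "single \<one> (- 1) \<otimes>\<^bsub>MA\<^esub> a = - a"
        using a monoid_algebra_scalar_left[of a "- 1"] by (simp add: sc_minus_one)
      moreover have "single \<one> (- 1) \<otimes>\<^bsub>MA\<^esub> a \<in> N" using a by (intro left) auto
      moreover have "\<ominus>\<^bsub>MA\<^esub> a = - a"
        using a MA.minus_equality[of "- a" a] by simp
      ultimately show "\<ominus>\<^bsub>MA\<^esub> a \<in> N \<inter> carrier MA" using a by auto
    next
      fix a b assume "a \<in> N \<inter> carrier MA" "b \<in> N \<inter> carrier MA"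
      then show "a \<oplus>\<^bsub>MA\<^esub> b \<in> N \<inter> carrier MA"
        using add[of a b] MA.a_closed[of a b] by simp
    qed (use zero in auto)
  qed (use left right MA.m_closed in \<open>auto simp: MA.ring_axioms\<close>)
  then have "Idl\<^bsub>MA\<^esub> R \<subseteq> N \<inter> carrier MA"
    by (rule MA.genideal_minimal) (use R R_carrier in blast)
  then show ?thesis by blast
qed

lemma R_subset_Idl: "R \<subseteq> Idl\<^bsub>MA\<^esub> R"
  by (rule MA.genideal_self[OF R_carrier])

end

section \<open>Free algebras and the maps on them determined by letters\<close>

lemma monoid_word_monoid: "monoid (word_monoid X)"
  by (rule monoidI) (auto simp: word_monoid_def)

lemma free_algebra_simps [simp]:
  "carrier (free_algebra X) = {f. keys f \<subseteq> lists X}"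
  "one (free_algebra X) = 1"
  "zero (free_algebra X) = 0"
  "add (free_algebra X) = (+)"
  "smult (free_algebra X) c p = c *\<^sub>C p"
  by (simp_all add: free_algebra_def word_monoid_def one_word)

lemma free_algebra_mult [simp]: "monoid.mult (free_algebra X) = (*)"
proof (intro ext)
  fix f g :: "'a list \<Rightarrow>\<^sub>0 complex"
  have "f \<otimes>\<^bsub>free_algebra X\<^esub> g = lin (\<lambda>a. lin (\<lambda>b. single (a @ b) 1) g) f"
    by (simp add: free_algebra_def monoid_algebra_mult word_monoid_def)
  also have "(\<lambda>a. lin (\<lambda>b. single (a @ b) 1) g) = (\<lambda>a. single a 1 * g)"
    using lmap_conv_lin[OF lmap_mult_left, of _ g] by (intro ext) simp
  also have "lin (\<lambda>a. single a 1 * g) f = f * g"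
    using lmap_conv_lin[OF lmap_mult_right, of f g] by simp
  finally show "f \<otimes>\<^bsub>free_algebra X\<^esub> g = f * g" .
qed

lemma finsum_hom:
  assumes "abelian_monoid M" "finite X"
    and zero: "g 0 = \<zero>\<^bsub>M\<^esub>" and closed: "\<And>x. x \<in> V \<Longrightarrow> g x \<in> carrier M" and V: "lsub V"
    and add: "\<And>x y. x \<in> V \<Longrightarrow> y \<in> V \<Longrightarrow> g (x + y) = g x \<oplus>\<^bsub>M\<^esub> g y"
    and "\<And>i. i \<in> X \<Longrightarrow> f i \<in> V"
  shows "(\<Oplus>\<^bsub>M\<^esub>i\<in>X. g (f i)) = g (sum f X)"
proof -
  interpret abelian_monoid M by fact
  from assms(2,7) show ?thesis
  proof (induction X rule: finite_induct)
    case (insert i X)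
    then show ?case
      by (simp add: finsum_insert closed add lsub_sum[OF V] Pi_def)
  qed (simp add: zero)
qed

text \<open>Recovers the record-level lift from a map g that is already known to be a homomorphism
  on the carrier. The target is only an additive monoid as far as its own laws go, so that tensor
  and opposite algebras fit in.\<close>

lemma free_lift_eq:
  assumes M: "abelian_monoid M"
    and zero: "g 0 = \<zero>\<^bsub>M\<^esub>" and one: "g 1 = \<one>\<^bsub>M\<^esub>"
    and closed: "\<And>x. x \<in> carrier (free_algebra X) \<Longrightarrow> g x \<in> carrier M"
    and add: "\<And>x y. x \<in> carrier (free_algebra X) \<Longrightarrow> y \<in> carrier (free_algebra X) \<Longrightarrow>
      g (x + y) = g x \<oplus>\<^bsub>M\<^esub> g y"
    and mult: "\<And>x y. x \<in> carrier (free_algebra X) \<Longrightarrow> y \<in> carrier (free_algebra X) \<Longrightarrow>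
      g (x * y) = g x \<otimes>\<^bsub>M\<^esub> g y"
    and sc: "\<And>c x. x \<in> carrier (free_algebra X) \<Longrightarrow> g (c *\<^sub>C x) = c \<odot>\<^bsub>M\<^esub> g x"
    and ltr: "\<And>x. x \<in> X \<Longrightarrow> g (ltr x) = f x"
    and p: "p \<in> carrier (free_algebra X)"
  shows "free_lift M f p = g p"
proof -
  interpret abelian_monoid M by fact
  have word: "foldr (\<lambda>x y. f x \<otimes>\<^bsub>M\<^esub> y) w \<one>\<^bsub>M\<^esub> = g (single w 1)" if "w \<in> lists X" for w
    using that
  proof (induction w)
    case (Cons x w)
    have "single (x # w) 1 = ltr x * single w 1" by simp
    then have "g (single (x # w) 1) = g (ltr x) \<otimes>\<^bsub>M\<^esub> g (single w 1)"
      using mult[of "ltr x" "single w 1"] Cons.prems Cons.hyps by simp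
    then show ?case using Cons ltr by simp
  qed (simp add: one flip: one_word)
  have "free_lift M f p = (\<Oplus>\<^bsub>M\<^esub>w\<in>keys p. g (lookup p w *\<^sub>C single w 1))"
    unfolding free_lift_def
  proof (rule finsum_cong')
    fix w assume "w \<in> keys p"
    then have w: "w \<in> lists X" using p by auto
    then show "lookup p w \<odot>\<^bsub>M\<^esub> foldr (\<lambda>x y. f x \<otimes>\<^bsub>M\<^esub> y) w \<one>\<^bsub>M\<^esub> = g (lookup p w *\<^sub>C single w 1)"
      using word[OF w] sc[of "single w 1" "lookup p w"] by simp
  qed (use p closed in \<open>auto intro!: closed\<close>)
  also have "\<dots> = g (\<Sum>w\<in>keys p. lookup p w *\<^sub>C single w 1)"
  proof (rule finsum_hom[OF M _ zero closed lsub_keys add])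
    fix w assume "w \<in> keys p"
    then show "lookup p w *\<^sub>C single w 1 \<in> {p. keys p \<subseteq> lists X}" using p by auto
  qed (use closed in simp_all)
  also have "(\<Sum>w\<in>keys p. lookup p w *\<^sub>C single w 1) = p"
    by (rule lin_singles[of p, unfolded lin_def])
  finally show ?thesis .
qed

lemma induced_map_eq:
  assumes "Y \<noteq> {}" "\<And>y. y \<in> Y \<Longrightarrow> free_lift M f y = u"
  shows "induced_map M f Y = u"
proof -
  have "free_lift M f ` Y = {u}" using assms by auto
  then show ?thesis by (simp add: induced_map_def)
qed

section \<open>Normal forms modulo a homogeneous subspace of words\<close>

definition lspan :: "('k \<Rightarrow>\<^sub>0 complex) set \<Rightarrow> ('k \<Rightarrow>\<^sub>0 complex) set" where
  "lspan X = \<Inter>{V. lsub V \<and> X \<subseteq> V}"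

lemma lsub_lspan: "lsub (lspan X)"
  by (auto simp: lspan_def lsub_def)

lemma lspan_superset: "x \<in> X \<Longrightarrow> x \<in> lspan X"
  by (auto simp: lspan_def)

lemma lspan_minimal: "lsub V \<Longrightarrow> X \<subseteq> V \<Longrightarrow> lspan X \<subseteq> V"
  by (auto simp: lspan_def)

lemma vector_space_sc: "vector_space (sc :: complex \<Rightarrow> ('k \<Rightarrow>\<^sub>0 complex) \<Rightarrow> _)"
  by unfold_locales (simp_all add: sc_add_left)

text \<open>Linear algebra instead of a rewriting system: project onto a complement of W spanned by
  words, then cut each image of a word down to the degree of that word.\<close>

lemma normal_form_exists:
  fixes W :: "('x list \<Rightarrow>\<^sub>0 complex) set" and gr :: "'x list \<Rightarrow> 'd"
  assumes W: "lsub W" and hom: "\<And>p m. p \<in> W \<Longrightarrow> keep (\<lambda>w. gr w = m) p \<in> W"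
  obtains nf where "lmap nf" "\<And>p. p \<in> W \<Longrightarrow> nf p = 0" "\<And>p. p - nf p \<in> W"
    "\<And>w w'. w' \<in> keys (nf (single w 1)) \<Longrightarrow> gr w' = gr w"
    "\<And>p w. w \<in> keys (nf p) \<Longrightarrow> nf (single w 1) = single w 1"
proof -
  interpret vector_space "sc :: complex \<Rightarrow> ('x list \<Rightarrow>\<^sub>0 complex) \<Rightarrow> _" by (rule vector_space_sc)
  interpret vp: vector_space_pair "sc :: complex \<Rightarrow> ('x list \<Rightarrow>\<^sub>0 complex) \<Rightarrow> _"
    "sc :: complex \<Rightarrow> ('x list \<Rightarrow>\<^sub>0 complex) \<Rightarrow> _" ..
  have sub: "subspace X \<longleftrightarrow> lsub X" for X by (auto simp: subspace_def lsub_def)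
  define ws where "ws = Set.range (\<lambda>w :: 'x list. single w (1::complex))"
  obtain B0 where B0: "B0 \<subseteq> W" "independent B0" "W \<subseteq> span B0"
    by (rule maximal_independent_subset[of W]) blast
  \<comment> \<open>A basis of W is completed to a basis of the whole space by words only; these
    become the reduced words.\<close>
  obtain B where B: "B0 \<subseteq> B" "B \<subseteq> B0 \<union> ws" "independent B" "B0 \<union> ws \<subseteq> span B"
    by (rule maximal_independent_subset_extend[of B0 "B0 \<union> ws"]) (use B0 in blast)+
  have spanB: "p \<in> span B" for p
  proof -
    have "lin (\<lambda>w. single w 1) p \<in> span B"
      unfolding lin_def using B(4) by (intro span_sum span_scale) (auto simp: ws_def)
    then show ?thesis by simp
  qed
  obtain g where g: "Vector_Spaces.linear sc sc g" "\<And>x. x \<in> B \<Longrightarrow> g x = (if x \<in> B0 then 0 else x)"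
    using vp.linear_independent_extend[OF B(3), of "\<lambda>x. if x \<in> B0 then 0 else x"] by blast
  have lg: "lmap g"
    using g(1) by (simp add: lmap_def Vector_Spaces.linear_iff)
  have gW: "g p = 0" if "p \<in> W" for p
  proof -
    have "p \<in> span B0" using that B0(3) by blast
    moreover have "span B0 \<subseteq> {x. g x = 0}"
      by (rule span_minimal) (use g(2) B(1) lsub_kernel[OF lg] sub in auto)
    ultimately show ?thesis by blast
  qed
  have g_diff: "p - g p \<in> W" for p
  proof -
    have "lsub {p. p - g p \<in> W}"
      unfolding lsub_def using W lg
      by (auto simp: lsub_zero lmap_zero[OF lg] lmap_add[OF lg] lmap_sc[OF lg] add_diff_add lsub_add
          simp flip: sc_diff intro: lsub_sc)
    moreover have "B \<subseteq> {p. p - g p \<in> W}"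
      using g(2) B0(1) lsub_zero[OF W] by auto
    ultimately have "span B \<subseteq> {p. p - g p \<in> W}" by (intro span_minimal) (simp_all add: sub)
    then show ?thesis using spanB by blast
  qed
  define red where "red = {w. g (single w 1) = single w 1}"
  have keys_g: "keys (g p) \<subseteq> red" for p
  proof -
    have "lsub {p. keys (g p) \<subseteq> red}"
      using lmap_comp[OF lmap_id lg] lsub_keys[of red] unfolding lsub_def
      by (simp add: lmap_zero[OF lg] lmap_add[OF lg] lmap_sc[OF lg])
    moreover have "B \<subseteq> {p. keys (g p) \<subseteq> red}"
    proof
      fix b assume b: "b \<in> B"
      show "b \<in> {p. keys (g p) \<subseteq> red}"
      proof (cases "b \<in> B0")
        case False
        then obtain w where "b = single w 1" using b B(2) by (auto simp: ws_def)
        then show ?thesis using g(2)[OF b] False by (simp add: red_def)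
      qed (use g(2)[OF b] in simp)
    qed
    ultimately have "span B \<subseteq> {p. keys (g p) \<subseteq> red}" by (intro span_minimal) (simp_all add: sub)
    then show ?thesis using spanB by blast
  qed
  \<comment> \<open>The projection g may mix degrees. Keeping only the degree of the given word
    changes it by elements of W, because W is homogeneous, and reduced words stay fixed.\<close>
  define nf where "nf = lin (\<lambda>w. keep (\<lambda>w'. gr w' = gr w) (g (single w 1)))"
  have nf_hom: "nf p = keep (\<lambda>w'. gr w' = m) (g p)" if "\<And>w. w \<in> keys p \<Longrightarrow> gr w = m" for p m
    by (rule lmap_eqI) (use that in \<open>simp_all add: nf_def lmap_comp[OF lmap_keep lg]\<close>)
  have nf_diff: "p - nf p \<in> W" for p
  proof -
    have "p - nf p = lin (\<lambda>w. single w 1 - keep (\<lambda>w'. gr w' = gr w) (g (single w 1))) p"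
      by (simp add: lin_fun_diff nf_def)
    also have "\<dots> = lin (\<lambda>w. keep (\<lambda>w'. gr w' = gr w) (single w 1 - g (single w 1))) p"
      by (simp add: lmap_diff[OF lmap_keep])
    also have "\<dots> \<in> W" using W by (rule lsub_lin) (intro hom g_diff)
    finally show ?thesis .
  qed
  show ?thesis
  proof
    show lnf: "lmap nf" by (simp add: nf_def)
    show "nf p = 0" if p: "p \<in> W" for p
    proof -
      have fin: "finite (gr ` keys p)" by simp
      \<comment> \<open>On a homogeneous argument \<open>nf\<close> is a truncation of g, and g
        kills W; so p is split into its homogeneous parts, which lie in W again.\<close>
      have "p = (\<Sum>m\<in>gr ` keys p. keep (\<lambda>w. gr w = m) p)"
        by (rule poly_mapping_eqI) (auto simp: lookup_sum sum.delta[OF fin] in_keys_iff image_iff)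
      then have "nf p = (\<Sum>m\<in>gr ` keys p. nf (keep (\<lambda>w. gr w = m) p))"
        using arg_cong[of p _ nf] lmap_sum[OF lnf] by metis
      also have "\<dots> = (\<Sum>m\<in>gr ` keys p. 0)"
      proof (rule sum.cong[OF refl])
        fix m
        have "nf (keep (\<lambda>w. gr w = m) p) = keep (\<lambda>w. gr w = m) (g (keep (\<lambda>w. gr w = m) p))"
          by (rule nf_hom) simp
        then show "nf (keep (\<lambda>w. gr w = m) p) = 0" by (simp add: gW hom p lmap_zero[OF lmap_keep])
      qed
      finally show ?thesis by simp
    qed
    show "p - nf p \<in> W" for p by (rule nf_diff)
    show "gr w' = gr w" if "w' \<in> keys (nf (single w 1))" for w w'
      using that by (simp add: nf_def)
    show "nf (single w 1) = single w 1" if "w \<in> keys (nf p)" for p w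
    proof -
      have "w \<in> red"
        using that keys_lin[of _ p] keys_g unfolding nf_def by fastforce
      then show ?thesis by (simp add: nf_def red_def)
    qed
  qed
qed

section \<open>The PBW theorem\<close>

lemma pos_lattice_add:
  assumes "\<mu> \<in> pos_lattice S" "\<nu> \<in> pos_lattice S"
  shows "\<mu> + \<nu> \<in> pos_lattice S"
  using assms(2)
proof (induction \<nu> rule: pos_lattice.induct)
  case (add_simple \<nu> \<alpha>)
  then show ?case using pos_lattice.add_simple[of "\<mu> + \<nu>" S \<alpha>] by (simp add: add.assoc)
qed (simp add: assms)

lemma lattice_of_add: "\<mu> \<in> lattice_of S \<Longrightarrow> \<nu> \<in> lattice_of S \<Longrightarrow> \<mu> + \<nu> \<in> lattice_of S"
proof -
  assume "\<mu> \<in> lattice_of S" "\<nu> \<in> lattice_of S"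
  then obtain a b c d where "\<mu> = a - b" "\<nu> = c - d"
    and *: "a \<in> pos_lattice S" "b \<in> pos_lattice S" "c \<in> pos_lattice S" "d \<in> pos_lattice S"
    unfolding lattice_of_def by auto
  then have "\<mu> + \<nu> = (a + c) - (b + d)" by (simp add: algebra_simps)
  then show ?thesis unfolding lattice_of_def using * pos_lattice_add by blast
qed

lemma lattice_of_uminus: "\<mu> \<in> lattice_of S \<Longrightarrow> - \<mu> \<in> lattice_of S"
proof -
  assume "\<mu> \<in> lattice_of S"
  then obtain a b where "\<mu> = a - b" "a \<in> pos_lattice S" "b \<in> pos_lattice S"
    unfolding lattice_of_def by auto
  moreover from this have "- \<mu> = b - a" by simp
  ultimately show ?thesis unfolding lattice_of_def by blast
qed

lemma pos_lattice_subset: "\<mu> \<in> pos_lattice S \<Longrightarrow> \<mu> \<in> lattice_of S"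
proof -
  assume "\<mu> \<in> pos_lattice S"
  moreover have "\<mu> = \<mu> - 0" by simp
  ultimately show ?thesis unfolding lattice_of_def using pos_lattice.zero by blast
qed

lemma pos_lattice_simple: "\<alpha> \<in> S \<Longrightarrow> \<alpha> \<in> pos_lattice S"
  using pos_lattice.add_simple[OF pos_lattice.zero] by fastforce

text \<open>The triple \<open>(w, \<nu>, v)\<close> stands for the monomial \<open>E\<^sub>w K\<^sub>\<nu> F\<^sub>v\<close>.\<close>

type_synonym 'w pbw = "'w list \<times> 'w \<times> 'w list \<Rightarrow>\<^sub>0 complex"

definition tens3 :: "('w list \<Rightarrow>\<^sub>0 complex) \<Rightarrow> 'w \<Rightarrow> ('w list \<Rightarrow>\<^sub>0 complex) \<Rightarrow> 'w pbw" where
  "tens3 p \<nu> r = lin (\<lambda>w. lin (\<lambda>v. single (w, \<nu>, v) 1) r) p"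

lemma tens3_single [simp]: "tens3 (single w 1) \<nu> (single v 1) = single (w, \<nu>, v) 1"
  by (simp add: tens3_def)

lemma lmap_tens3_left: "lmap (\<lambda>p. tens3 p \<nu> r)" by (simp add: tens3_def)

lemma lmap_tens3_right: "lmap (\<lambda>r. tens3 p \<nu> r)"
  by (simp add: lmap_def tens3_def lin_fun_add lin_fun_sc)

lemma tens3_zero [simp]: "tens3 0 \<nu> r = 0" "tens3 p \<nu> 0 = 0"
  by (simp_all add: tens3_def)

lemma keys_tens3: "keys (tens3 p \<nu> r) \<subseteq> {(w, \<nu>, v) | w v. w \<in> keys p \<and> v \<in> keys r}"
  unfolding tens3_def using keys_lin[of "\<lambda>w. lin (\<lambda>v. single (w, \<nu>, v) 1) r" p]
    keys_lin[of "\<lambda>v. single (_, \<nu>, v) 1" r] by fastforce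

lemma lookup_tens3: "lookup (tens3 p \<nu> r) (w, \<nu>', v) = (if \<nu>' = \<nu> then lookup p w * lookup r v else 0)"
proof -
  have inner: "lookup (lin (\<lambda>v. single (a, \<nu>, v) 1) r) (w, \<nu>', v) = (if a = w \<and> \<nu>' = \<nu> then lookup r v else 0)" for a
  proof -
    have "lookup (lin (\<lambda>v. single (a, \<nu>, v) 1) r) (w, \<nu>', v) =
        (\<Sum>b\<in>keys r. if b = v then (if a = w \<and> \<nu>' = \<nu> then lookup r v else 0) else 0)"
      unfolding lookup_lin by (rule sum.cong) (auto simp: lookup_single when_def)
    then show ?thesis by (auto simp: in_keys_iff)
  qed
  have "lookup (tens3 p \<nu> r) (w, \<nu>', v) =
      (\<Sum>a\<in>keys p. if a = w then (if \<nu>' = \<nu> then lookup p w * lookup r v else 0) else 0)"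
    unfolding tens3_def lookup_lin[of _ p] inner by (rule sum.cong) auto
  then show ?thesis by (auto simp: in_keys_iff)
qed

text \<open>What the quantum group argument uses of the root system; \<open>cartan\<close> and
  \<open>form_even\<close> are derived from invariance at the end. \<open>ht\<close> is the height,
  which shows that \<open>Q_pos\<close> contains no nonzero element together with its
  negative.\<close>

locale qgroup = quantum_group S form q
  for S :: "'w::ab_group_add set" and form :: "'w \<Rightarrow> 'w \<Rightarrow> int" and q :: complex +
  fixes ht :: "'w \<Rightarrow> real"
  assumes form_sym: "\<mu> \<in> Q \<Longrightarrow> \<nu> \<in> Q \<Longrightarrow> form \<mu> \<nu> = form \<nu> \<mu>"
    and form_add: "\<mu> \<in> Q \<Longrightarrow> \<mu>' \<in> Q \<Longrightarrow> \<nu> \<in> Q \<Longrightarrow> form (\<mu> + \<mu>') \<nu> = form \<mu> \<nu> + form \<mu>' \<nu>"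
    and form_pos: "\<mu> \<in> Q \<Longrightarrow> \<mu> \<noteq> 0 \<Longrightarrow> form \<mu> \<mu> > 0"
    and ht_add: "ht (\<mu> + \<nu>) = ht \<mu> + ht \<nu>"
    and ht_simple: "\<alpha> \<in> S \<Longrightarrow> ht \<alpha> = 1"
    and cartan: "\<alpha> \<in> S \<Longrightarrow> \<beta> \<in> S \<Longrightarrow> \<alpha> \<noteq> \<beta> \<Longrightarrow> \<exists>m::nat. 2 * form \<alpha> \<beta> = - int m * form \<alpha> \<alpha>"
    and form_even: "\<alpha> \<in> S \<Longrightarrow> even (form \<alpha> \<alpha>)"
    and q_nonzero: "q \<noteq> 0"
    and q_not_root: "n > 0 \<Longrightarrow> q ^ n \<noteq> 1"
begin

subsection \<open>Lattice and characters\<close>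

lemma Q_add: "\<mu> \<in> Q \<Longrightarrow> \<nu> \<in> Q \<Longrightarrow> \<mu> + \<nu> \<in> Q" by (rule lattice_of_add)
lemma Q_uminus: "\<mu> \<in> Q \<Longrightarrow> - \<mu> \<in> Q" by (rule lattice_of_uminus)
lemma Q_diff: "\<mu> \<in> Q \<Longrightarrow> \<nu> \<in> Q \<Longrightarrow> \<mu> - \<nu> \<in> Q" using Q_add Q_uminus by fastforce
lemma Q_zero: "0 \<in> Q" by (simp add: pos_lattice_subset pos_lattice.zero)
lemma Q_simple: "\<alpha> \<in> S \<Longrightarrow> \<alpha> \<in> Q" by (simp add: pos_lattice_subset pos_lattice_simple)
lemma Q_pos_sub: "\<mu> \<in> Q_pos \<Longrightarrow> \<mu> \<in> Q" by (rule pos_lattice_subset)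

lemmas Q_closed = Q_add Q_uminus Q_diff Q_zero Q_simple

abbreviation wt :: "'w list \<Rightarrow> 'w" where "wt \<equiv> sum_list"

lemma wt_Q_pos: "w \<in> lists S \<Longrightarrow> wt w \<in> Q_pos"
  by (induction w) (auto simp: pos_lattice.zero pos_lattice_add pos_lattice_simple)

lemma wt_Q: "w \<in> lists S \<Longrightarrow> wt w \<in> Q" by (simp add: Q_pos_sub wt_Q_pos)

lemma ht_zero: "ht 0 = 0" using ht_add[of 0 0] by simp
lemma ht_uminus: "ht (- \<mu>) = - ht \<mu>" using ht_add[of \<mu> "- \<mu>"] ht_zero by simp
lemma ht_pos: "\<mu> \<in> Q_pos \<Longrightarrow> ht \<mu> \<ge> 0"
  by (induction rule: pos_lattice.induct) (simp_all add: ht_zero ht_add ht_simple)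
lemma ht_pos_zero: "\<mu> \<in> Q_pos \<Longrightarrow> ht \<mu> = 0 \<Longrightarrow> \<mu> = 0"
proof (induction rule: pos_lattice.induct)
  case (add_simple \<mu> \<alpha>)
  then show ?case using ht_pos[of \<mu>] by (simp add: ht_add ht_simple)
qed simp
lemma neg_simple_not_pos: "\<alpha> \<in> S \<Longrightarrow> - \<alpha> \<notin> Q_pos"
  using ht_pos[of "- \<alpha>"] ht_simple[of \<alpha>] by (auto simp: ht_uminus)
lemma Q_pos_pointed: "\<mu> \<in> Q_pos \<Longrightarrow> - \<mu> \<in> Q_pos \<Longrightarrow> \<mu> = 0"
  using ht_pos[of \<mu>] ht_pos[of "- \<mu>"] ht_pos_zero by (simp add: ht_uminus)

lemma form_add_right: "\<mu> \<in> Q \<Longrightarrow> \<nu> \<in> Q \<Longrightarrow> \<nu>' \<in> Q \<Longrightarrow> form \<mu> (\<nu> + \<nu>') = form \<mu> \<nu> + form \<mu> \<nu>'"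
  using form_add[of \<nu> \<nu>' \<mu>] by (simp add: form_sym Q_closed)
lemma form_zero_left: "\<nu> \<in> Q \<Longrightarrow> form 0 \<nu> = 0" using form_add[of 0 0 \<nu>] by (simp add: Q_closed)
lemma form_zero_right: "\<nu> \<in> Q \<Longrightarrow> form \<nu> 0 = 0"
  using form_add_right[of \<nu> 0 0] by (simp add: Q_closed)
lemma form_uminus_left: "\<mu> \<in> Q \<Longrightarrow> \<nu> \<in> Q \<Longrightarrow> form (- \<mu>) \<nu> = - form \<mu> \<nu>"
  using form_add[of \<mu> "- \<mu>" \<nu>] by (simp add: Q_closed form_zero_left)
lemma form_uminus_right: "\<mu> \<in> Q \<Longrightarrow> \<nu> \<in> Q \<Longrightarrow> form \<nu> (- \<mu>) = - form \<nu> \<mu>"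
  using form_add_right[of \<nu> \<mu> "- \<mu>"] by (simp add: Q_closed form_zero_right)

definition chr :: "'w \<Rightarrow> 'w \<Rightarrow> complex" where "chr \<mu> \<nu> = q powi form \<mu> \<nu>"

lemma chr_nonzero [simp]: "chr \<mu> \<nu> \<noteq> 0" by (simp add: chr_def q_nonzero)
lemma chr_sym: "\<mu> \<in> Q \<Longrightarrow> \<nu> \<in> Q \<Longrightarrow> chr \<mu> \<nu> = chr \<nu> \<mu>" by (simp add: chr_def form_sym)
lemma chr_add_left: "\<mu> \<in> Q \<Longrightarrow> \<mu>' \<in> Q \<Longrightarrow> \<nu> \<in> Q \<Longrightarrow> chr (\<mu> + \<mu>') \<nu> = chr \<mu> \<nu> * chr \<mu>' \<nu>"
  by (simp add: chr_def form_add power_int_add q_nonzero)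
lemma chr_add_right: "\<mu> \<in> Q \<Longrightarrow> \<nu> \<in> Q \<Longrightarrow> \<nu>' \<in> Q \<Longrightarrow> chr \<mu> (\<nu> + \<nu>') = chr \<mu> \<nu> * chr \<mu> \<nu>'"
  by (simp add: chr_def form_add_right power_int_add q_nonzero)
lemma chr_zero_left: "\<nu> \<in> Q \<Longrightarrow> chr 0 \<nu> = 1" by (simp add: chr_def form_zero_left)
lemma chr_zero_right: "\<nu> \<in> Q \<Longrightarrow> chr \<nu> 0 = 1" by (simp add: chr_def form_zero_right)
lemma chr_uminus_left: "\<mu> \<in> Q \<Longrightarrow> \<nu> \<in> Q \<Longrightarrow> chr (- \<mu>) \<nu> = inverse (chr \<mu> \<nu>)"
  by (simp add: chr_def form_uminus_left power_int_minus)
lemma chr_uminus_right: "\<mu> \<in> Q \<Longrightarrow> \<nu> \<in> Q \<Longrightarrow> chr \<nu> (- \<mu>) = inverse (chr \<nu> \<mu>)"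
  by (simp add: chr_def form_uminus_right power_int_minus)

lemma q_powi_eq_1: "q powi k = 1 \<Longrightarrow> k = 0"
proof (rule ccontr)
  assume *: "q powi k = 1" "k \<noteq> 0"
  have "q ^ nat \<bar>k\<bar> = 1"
  proof (cases "k \<ge> 0")
    case True
    then show ?thesis using * by (simp add: power_int_def)
  next
    case False
    then show ?thesis using * by (simp add: power_int_def power_inverse)
  qed
  then show False using q_not_root[of "nat \<bar>k\<bar>"] * by simp
qed

text \<open>Test with \<nu> = \<mu> - \<mu>': positivity of the form and q not being a root of unity
  force \<mu> - \<mu>' = 0. Thus conjugation by the K's separates weights.\<close>

lemma chr_separates:
  assumes "\<mu> \<in> Q" "\<mu>' \<in> Q" "\<And>\<nu>. \<nu> \<in> Q \<Longrightarrow> chr \<nu> \<mu> = chr \<nu> \<mu>'"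
  shows "\<mu> = \<mu>'"
proof (rule ccontr)
  assume ne: "\<mu> \<noteq> \<mu>'"
  let ?\<nu> = "\<mu> - \<mu>'"
  have \<nu>: "?\<nu> \<in> Q" using assms by (simp add: Q_closed)
  have "chr ?\<nu> ?\<nu> = chr ?\<nu> \<mu> * inverse (chr ?\<nu> \<mu>')"
    using chr_add_right[of ?\<nu> \<mu> "- \<mu>'"] assms(1,2) \<nu> by (simp add: Q_closed chr_uminus_right)
  also have "\<dots> = 1" using assms(3)[OF \<nu>] by simp
  finally have "form ?\<nu> ?\<nu> = 0" using q_powi_eq_1 by (simp add: chr_def)
  then show False using form_pos[OF \<nu>] ne by simp
qed

subsection \<open>Serre elements\<close>

text \<open>Here m is minus the Cartan integer and v = \<open>q_simple \<alpha>\<close>. Evenness of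
  (\<alpha>, \<alpha>) gives \<open>chr \<alpha> \<alpha>\<close> = v^2, and
  \<open>chr \<alpha> \<beta>\<close> = v^-m. The last conclusion serves the antipode.\<close>

lemma serre_exponent_Suc:
  assumes "\<alpha> \<in> S" "\<beta> \<in> S" "\<alpha> \<noteq> \<beta>"
  obtains m where "serre_exponent \<alpha> \<beta> = Suc m" "(chr \<alpha> \<beta>)\<^sup>2 * chr \<alpha> \<alpha> ^ m = 1"
    "\<And>X. serre_element X \<alpha> \<beta> = qad (chr \<alpha> \<beta>) (chr \<alpha> \<alpha>) (ltr (X \<alpha>)) (ltr (X \<beta>)) (Suc m)"
    "\<And>a y :: 'w generator list \<Rightarrow>\<^sub>0 complex. qad (inverse (chr \<alpha> \<beta>)) (inverse (chr \<alpha> \<alpha>)) a y (Suc m)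
       = qad (chr \<alpha> \<beta>) (chr \<alpha> \<alpha>) a y (Suc m)"
proof -
  obtain m :: nat where m: "2 * form \<alpha> \<beta> = - int m * form \<alpha> \<alpha>" using cartan[OF assms] by blast
  have "\<alpha> \<noteq> 0" using ht_simple[OF assms(1)] ht_zero by auto
  then have pos: "form \<alpha> \<alpha> > 0" using form_pos assms(1) by (simp add: Q_closed)
  then have n: "serre_exponent \<alpha> \<beta> = Suc m"
    by (simp add: serre_exponent_def m del: minus_mult_minus mult_minus_left)
  let ?v = "q_simple \<alpha>"
  obtain l where l: "form \<alpha> \<alpha> = 2 * l" using form_even[OF assms(1)] by blast
  have vl: "?v = q powi l" by (simp add: q_simple_def l)
  have lpos: "l > 0" using pos l by simp
  have v0: "?v \<noteq> 0" by (simp add: vl q_nonzero)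
  have vroot: "?v ^ n \<noteq> 1" if "n > 0" for n
  proof
    assume "?v ^ n = 1"
    then have "q powi (l * int n) = 1" by (simp add: vl power_int_mult)
    then show False using q_powi_eq_1 that lpos by fastforce
  qed
  have p: "chr \<alpha> \<alpha> = ?v\<^sup>2"
    by (simp add: chr_def l vl power_int_mult[symmetric] mult.commute flip: power_int_numeral)
  have f: "form \<alpha> \<beta> = - int m * l" using m l by simp
  have tv: "chr \<alpha> \<beta> * ?v ^ m = 1"
  proof -
    have "?v ^ m = q powi (l * int m)" by (simp add: vl power_int_mult)
    then show ?thesis by (simp add: chr_def f power_int_add[symmetric] q_nonzero mult.commute)
  qed
  have "(chr \<alpha> \<beta>)\<^sup>2 * chr \<alpha> \<alpha> ^ m = (chr \<alpha> \<beta> * ?v ^ m)\<^sup>2"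
    by (simp add: p power_mult_distrib power_mult[symmetric] mult.commute)
  then have tp: "(chr \<alpha> \<beta>)\<^sup>2 * chr \<alpha> \<alpha> ^ m = 1" using tv by simp
  have pw: "ltr x ^ k = single (replicate k x) (1::complex)" for x :: "'w generator" and k
    by (induction k) (simp_all add: one_word)
  have co: "qad_coeff (chr \<alpha> \<beta>) (chr \<alpha> \<alpha>) (Suc m) s = q_binomial ?v (Suc m) s" if "s \<le> Suc m" for s
    unfolding p by (rule qad_coeff_q_binomial[OF v0 vroot tv that])
  have "serre_element X \<alpha> \<beta> = qad (chr \<alpha> \<beta>) (chr \<alpha> \<alpha>) (ltr (X \<alpha>)) (ltr (X \<beta>)) (Suc m)" for X
    unfolding serre_element_def n Let_def qad_conv_sum by (intro sum.cong refl) (simp add: pw co)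
  then show ?thesis using that[OF n tp] qad_inverse[OF v0 vroot tv] unfolding p by blast
qed

end

section \<open>The relations other than the Serre relations, and Serre elements modulo them\<close>

context qgroup
begin

abbreviation lE where "lE \<alpha> \<equiv> ltr (E_gen \<alpha>)"
abbreviation lF where "lF \<alpha> \<equiv> ltr (F_gen \<alpha>)"
abbreviation lK where "lK \<mu> \<equiv> ltr (K_gen \<mu>)"

definition dco :: "'w \<Rightarrow> complex" where
  "dco \<alpha> = 1 / (q_simple \<alpha> - inverse (q_simple \<alpha>))"

text \<open>The Serre relations are left out on purpose: Serre elements do not act as zero on the
  space with free words below, yet their commutation with the opposite letters already follows from
  these relations.\<close>

inductive_set base_relations :: "('w generator list \<Rightarrow>\<^sub>0 complex) set" where
  K_zero_rel: "lK 0 - 1 \<in> base_relations"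
| K_mult_rel: "\<mu> \<in> Q \<Longrightarrow> \<nu> \<in> Q \<Longrightarrow> lK \<mu> * lK \<nu> - lK (\<mu> + \<nu>) \<in> base_relations"
| K_E_rel: "\<mu> \<in> Q \<Longrightarrow> \<alpha> \<in> S \<Longrightarrow> lK \<mu> * lE \<alpha> * lK (- \<mu>) - chr \<mu> \<alpha> *\<^sub>C lE \<alpha> \<in> base_relations"
| K_F_rel: "\<mu> \<in> Q \<Longrightarrow> \<alpha> \<in> S \<Longrightarrow>
    lK \<mu> * lF \<alpha> * lK (- \<mu>) - inverse (chr \<mu> \<alpha>) *\<^sub>C lF \<alpha> \<in> base_relations"
| E_F_rel: "\<alpha> \<in> S \<Longrightarrow> \<beta> \<in> S \<Longrightarrow> lE \<alpha> * lF \<beta> - lF \<beta> * lE \<alpha> -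
    (if \<alpha> = \<beta> then dco \<alpha> *\<^sub>C (lK \<alpha> - lK (- \<alpha>)) else 0) \<in> base_relations"

lemma relations_eq:
  "relations = base_relations \<union> {serre_element E_gen \<alpha> \<beta> | \<alpha> \<beta>. \<alpha> \<in> S \<and> \<beta> \<in> S \<and> \<alpha> \<noteq> \<beta>} \<union>
     {serre_element F_gen \<alpha> \<beta> | \<alpha> \<beta>. \<alpha> \<in> S \<and> \<beta> \<in> S \<and> \<alpha> \<noteq> \<beta>}"
proof -
  have "base_relations =
     {lK 0 - 1} \<union>
     {lK \<mu> * lK \<nu> - lK (\<mu> + \<nu>) | \<mu> \<nu>. \<mu> \<in> Q \<and> \<nu> \<in> Q} \<union>
     {lK \<mu> * lE \<alpha> * lK (- \<mu>) - chr \<mu> \<alpha> *\<^sub>C lE \<alpha> | \<mu> \<alpha>. \<mu> \<in> Q \<and> \<alpha> \<in> S} \<union>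
     {lK \<mu> * lF \<alpha> * lK (- \<mu>) - inverse (chr \<mu> \<alpha>) *\<^sub>C lF \<alpha> | \<mu> \<alpha>. \<mu> \<in> Q \<and> \<alpha> \<in> S} \<union>
     {lE \<alpha> * lF \<beta> - lF \<beta> * lE \<alpha> - (if \<alpha> = \<beta> then dco \<alpha> *\<^sub>C (lK \<alpha> - lK (- \<alpha>)) else 0)
        | \<alpha> \<beta>. \<alpha> \<in> S \<and> \<beta> \<in> S}" (is "_ = ?R")
  proof (rule equalityI; rule subsetI)
    fix x assume "x \<in> base_relations"
    then show "x \<in> ?R" by cases (simp_all only: Un_iff mem_Collect_eq singleton_iff, blast+)
  next
    fix x assume "x \<in> ?R"
    then show "x \<in> base_relations"
      unfolding Un_iff mem_Collect_eq singleton_iff by (elim disjE exE conjE) (simp_all only: base_relations.intros)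
  qed
  then show ?thesis
    unfolding relations_def Let_def chr_def dco_def
    by (simp add: one_word power_int_minus)
qed

end

locale qrel = qgroup S form q ht + cong_ideal J
  for S :: "'w::ab_group_add set" and form q ht and J :: "('w generator list \<Rightarrow>\<^sub>0 complex) set" +
  assumes base: "base_relations \<subseteq> J"
begin

lemma K_zero: "lK 0 \<approx> 1"
  unfolding eqv_def by (rule subsetD[OF base K_zero_rel])

lemma K_mult: "\<mu> \<in> Q \<Longrightarrow> \<nu> \<in> Q \<Longrightarrow> lK \<mu> * lK \<nu> \<approx> lK (\<mu> + \<nu>)"
  unfolding eqv_def by (rule subsetD[OF base K_mult_rel])

lemma K_inv: "\<mu> \<in> Q \<Longrightarrow> lK (- \<mu>) * lK \<mu> \<approx> 1"
  using eqv_trans[OF K_mult[of "- \<mu>" \<mu>]] K_zero by (simp add: Q_closed)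

lemma K_inv': "\<mu> \<in> Q \<Longrightarrow> lK \<mu> * lK (- \<mu>) \<approx> 1"
  using eqv_trans[OF K_mult[of \<mu> "- \<mu>"]] K_zero by (simp add: Q_closed)

lemma conj_commute:
  assumes "\<mu> \<in> Q" "lK \<mu> * x * lK (- \<mu>) \<approx> c *\<^sub>C x"
  shows "lK \<mu> * x \<approx> c *\<^sub>C (x * lK \<mu>)"
proof -
  have "lK \<mu> * x * 1 \<approx> lK \<mu> * x * (lK (- \<mu>) * lK \<mu>)"
    using assms(1) by (intro eqv_left eqv_sym[OF K_inv])
  also have "\<dots> = (lK \<mu> * x * lK (- \<mu>)) * lK \<mu>" by (simp only: mult.assoc)
  also have "\<dots> \<approx> (c *\<^sub>C x) * lK \<mu>" by (intro eqv_right assms)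
  finally show ?thesis by simp
qed

lemma K_E: "\<mu> \<in> Q \<Longrightarrow> \<alpha> \<in> S \<Longrightarrow> lK \<mu> * lE \<alpha> \<approx> chr \<mu> \<alpha> *\<^sub>C (lE \<alpha> * lK \<mu>)"
  by (rule conj_commute) (simp_all only: eqv_def subsetD[OF base K_E_rel])

lemma K_F: "\<mu> \<in> Q \<Longrightarrow> \<alpha> \<in> S \<Longrightarrow> lK \<mu> * lF \<alpha> \<approx> inverse (chr \<mu> \<alpha>) *\<^sub>C (lF \<alpha> * lK \<mu>)"
  by (rule conj_commute) (simp_all only: eqv_def subsetD[OF base K_F_rel])

lemma E_F: "\<alpha> \<in> S \<Longrightarrow> \<beta> \<in> S \<Longrightarrow>
   lE \<alpha> * lF \<beta> - lF \<beta> * lE \<alpha> \<approx> (if \<alpha> = \<beta> then dco \<alpha> *\<^sub>C (lK \<alpha> - lK (- \<alpha>)) else 0)"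
  unfolding eqv_def by (rule subsetD[OF base E_F_rel])

lemma commute_swap: "c \<noteq> 0 \<Longrightarrow> x * y \<approx> inverse c *\<^sub>C (y * x) \<Longrightarrow> y * x \<approx> c *\<^sub>C (x * y)"
  using eqv_sym[OF eqv_sc[of "x * y" "inverse c *\<^sub>C (y * x)" c]] by simp

lemma E_K_neg: "\<mu> \<in> Q \<Longrightarrow> \<alpha> \<in> S \<Longrightarrow> lE \<alpha> * lK (- \<mu>) \<approx> chr \<mu> \<alpha> *\<^sub>C (lK (- \<mu>) * lE \<alpha>)"
  by (rule commute_swap) (use K_E[of "- \<mu>" \<alpha>] in \<open>simp_all add: Q_closed chr_uminus_left\<close>)

lemma F_K: "\<mu> \<in> Q \<Longrightarrow> \<alpha> \<in> S \<Longrightarrow> lF \<alpha> * lK \<mu> \<approx> chr \<mu> \<alpha> *\<^sub>C (lK \<mu> * lF \<alpha>)"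
  by (rule commute_swap) (use K_F[of \<mu> \<alpha>] in simp_all)

lemma K_neg_F: "\<mu> \<in> Q \<Longrightarrow> \<alpha> \<in> S \<Longrightarrow> lK (- \<mu>) * lF \<alpha> \<approx> chr \<mu> \<alpha> *\<^sub>C (lF \<alpha> * lK (- \<mu>))"
  using K_F[of "- \<mu>" \<alpha>] by (simp add: Q_closed chr_uminus_left)

lemma E_F_same: "\<alpha> \<in> S \<Longrightarrow> lE \<alpha> * lF \<alpha> - lF \<alpha> * lE \<alpha> \<approx> dco \<alpha> *\<^sub>C (lK \<alpha> - lK (- \<alpha>))"
  using E_F[of \<alpha> \<alpha>] by simp

lemma F_E_same: "\<alpha> \<in> S \<Longrightarrow> lF \<alpha> * lE \<alpha> - lE \<alpha> * lF \<alpha> \<approx> dco \<alpha> *\<^sub>C (lK (- \<alpha>) - lK \<alpha>)"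
  using eqv_sc[OF E_F_same[of \<alpha>], of "- 1"]
  by (simp add: sc_minus_one del: mult_word sc_single)

lemma E_F_different: "\<alpha> \<in> S \<Longrightarrow> \<beta> \<in> S \<Longrightarrow> \<alpha> \<noteq> \<beta> \<Longrightarrow> lE \<alpha> * lF \<beta> \<approx> lF \<beta> * lE \<alpha>"
  using E_F[of \<alpha> \<beta>] by (simp add: eqv_def)

text \<open>Three cases: F with index \<alpha> pairs with the repeated letter, with index \<beta>
  with the single letter, and any other F commutes with both letters.\<close>

lemma serre_E_commute:
  assumes "\<alpha> \<in> S" "\<beta> \<in> S" "\<alpha> \<noteq> \<beta>" "\<gamma> \<in> S"
  shows "serre_element E_gen \<alpha> \<beta> * lF \<gamma> \<approx> lF \<gamma> * serre_element E_gen \<alpha> \<beta>"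
proof -
  obtain m where m: "(chr \<alpha> \<beta>)\<^sup>2 * chr \<alpha> \<alpha> ^ m = 1"
    and s: "serre_element E_gen \<alpha> \<beta> = qad (chr \<alpha> \<beta>) (chr \<alpha> \<alpha>) (lE \<alpha>) (lE \<beta>) (Suc m)"
    using serre_exponent_Suc[OF assms(1-3)] by metis
  have Q: "\<alpha> \<in> Q" "\<beta> \<in> Q" using assms by (simp_all add: Q_closed)
  have sym: "chr \<beta> \<alpha> = chr \<alpha> \<beta>" using Q by (simp add: chr_sym)
  consider "\<gamma> = \<alpha>" | "\<gamma> = \<beta>" | "\<gamma> \<noteq> \<alpha>" "\<gamma> \<noteq> \<beta>" by blast
  then show ?thesis
  proof cases
    case 1
    show ?thesis unfolding s 1
      by (rule qad_commutator_first[OF E_F_same _ K_E K_E E_K_neg _ m])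
        (use assms Q E_K_neg[of \<alpha> \<beta>] E_F_different[of \<beta> \<alpha>] in auto)
  next
    case 2
    show ?thesis unfolding s 2
      by (rule qad_commutator_second[OF _ E_F_same _ _ m])
        (use assms Q K_E[of \<beta> \<alpha>] E_K_neg[of \<beta> \<alpha>] E_F_different[of \<alpha> \<beta>] in \<open>auto simp: sym\<close>)
  next
    case 3
    then show ?thesis unfolding s
      using assms by (intro qad_commutator E_F_different) auto
  qed
qed

text \<open>The same computation with the roles of K and its inverse exchanged: now
  \<open>K_-\<mu>\<close> is what passes F with the factor \<open>chr\<close>.\<close>

lemma serre_F_commute:
  assumes "\<alpha> \<in> S" "\<beta> \<in> S" "\<alpha> \<noteq> \<beta>" "\<gamma> \<in> S"
  shows "serre_element F_gen \<alpha> \<beta> * lE \<gamma> \<approx> lE \<gamma> * serre_element F_gen \<alpha> \<beta>"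
proof -
  obtain m where m: "(chr \<alpha> \<beta>)\<^sup>2 * chr \<alpha> \<alpha> ^ m = 1"
    and s: "serre_element F_gen \<alpha> \<beta> = qad (chr \<alpha> \<beta>) (chr \<alpha> \<alpha>) (lF \<alpha>) (lF \<beta>) (Suc m)"
    using serre_exponent_Suc[OF assms(1-3)] by metis
  have Q: "\<alpha> \<in> Q" "\<beta> \<in> Q" using assms by (simp_all add: Q_closed)
  have sym: "chr \<beta> \<alpha> = chr \<alpha> \<beta>" using Q by (simp add: chr_sym)
  consider "\<gamma> = \<alpha>" | "\<gamma> = \<beta>" | "\<gamma> \<noteq> \<alpha>" "\<gamma> \<noteq> \<beta>" by blast
  then show ?thesis
  proof cases
    case 1
    show ?thesis unfolding s 1
      by (rule qad_commutator_first[OF F_E_same _ K_neg_F K_neg_F F_K _ m])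
        (use assms Q F_K[of \<alpha> \<beta>] eqv_sym[OF E_F_different[of \<alpha> \<beta>]] in auto)
  next
    case 2
    show ?thesis unfolding s 2
      by (rule qad_commutator_second[OF _ F_E_same _ _ m])
        (use assms Q K_neg_F[of \<beta> \<alpha>] F_K[of \<beta> \<alpha>] eqv_sym[OF E_F_different[of \<beta> \<alpha>]] in \<open>auto simp: sym\<close>)
  next
    case 3
    then show ?thesis unfolding s
      using assms by (intro qad_commutator eqv_sym[OF E_F_different]) auto
  qed
qed

end

subsection \<open>The action on the PBW space\<close>

context qgroup
begin

definition actE :: "'w \<Rightarrow> 'w pbw \<Rightarrow> 'w pbw" where
  "actE \<alpha> = lin (\<lambda>(w, \<nu>, v). single (\<alpha> # w, \<nu>, v) 1)"

text \<open>The scalar comes from moving \<open>K_\<kappa>\<close> past the E-word w.\<close>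

definition actK :: "'w \<Rightarrow> 'w pbw \<Rightarrow> 'w pbw" where
  "actK \<kappa> = lin (\<lambda>(w, \<nu>, v). single (w, \<kappa> + \<nu>, v) (chr \<kappa> (wt w)))"

text \<open>\<open>F\<^sub>\<beta>\<close> is moved to the right past the \<open>E\<close>-letters with the relation for \<open>[E\<^sub>\<alpha>, F\<^sub>\<beta>]\<close>.\<close>

primrec actF_basis :: "'w \<Rightarrow> 'w list \<Rightarrow> 'w \<Rightarrow> 'w list \<Rightarrow> 'w pbw" where
  "actF_basis \<beta> [] \<nu> v = single ([], \<nu>, \<beta> # v) (chr \<beta> \<nu>)"
| "actF_basis \<beta> (\<alpha> # w) \<nu> v = actE \<alpha> (actF_basis \<beta> w \<nu> v) -
     (if \<alpha> = \<beta> then dco \<alpha> *\<^sub>C (actK \<alpha> (single (w, \<nu>, v) 1) - actK (- \<alpha>) (single (w, \<nu>, v) 1)) else 0)"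

definition actF :: "'w \<Rightarrow> 'w pbw \<Rightarrow> 'w pbw" where
  "actF \<beta> = lin (\<lambda>(w, \<nu>, v). actF_basis \<beta> w \<nu> v)"

text \<open>Letters outside \<open>generators\<close> act as zero, so the action does not see the
  words that \<open>rho\<close> removes.\<close>

definition act_ltr :: "'w generator \<Rightarrow> 'w pbw \<Rightarrow> 'w pbw" where
  "act_ltr x z = (if x \<in> generators then
     (case x of E_gen \<alpha> \<Rightarrow> actE \<alpha> z | F_gen \<beta> \<Rightarrow> actF \<beta> z | K_gen \<kappa> \<Rightarrow> actK \<kappa> z) else 0)"

definition act :: "('w generator list \<Rightarrow>\<^sub>0 complex) \<Rightarrow> 'w pbw \<Rightarrow> 'w pbw" where
  "act p z = lin (\<lambda>w. foldr act_ltr w z) p"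

lemma lmap_actE [intro!, simp]: "lmap (actE \<alpha>)" by (simp add: actE_def)
lemma lmap_actK [intro!, simp]: "lmap (actK \<alpha>)" by (simp add: actK_def)
lemma lmap_actF [intro!, simp]: "lmap (actF \<alpha>)" by (simp add: actF_def)

lemma actE_single [simp]: "actE \<alpha> (single (w, \<nu>, v) c) = single (\<alpha> # w, \<nu>, v) c"
  by (simp add: actE_def)
lemma actK_single [simp]: "actK \<kappa> (single (w, \<nu>, v) c) = single (w, \<kappa> + \<nu>, v) (c * chr \<kappa> (wt w))"
  by (simp add: actK_def)
lemma actF_single [simp]: "actF \<beta> (single (w, \<nu>, v) c) = c *\<^sub>C actF_basis \<beta> w \<nu> v"
  by (simp add: actF_def)

lemma generators_simps [simp]: "E_gen \<alpha> \<in> generators \<longleftrightarrow> \<alpha> \<in> S" "F_gen \<alpha> \<in> generators \<longleftrightarrow> \<alpha> \<in> S"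
  "K_gen \<mu> \<in> generators \<longleftrightarrow> \<mu> \<in> Q"
  by (auto simp: generators_def)

lemma act_ltr_simps [simp]:
  "\<alpha> \<in> S \<Longrightarrow> act_ltr (E_gen \<alpha>) = actE \<alpha>" "\<alpha> \<in> S \<Longrightarrow> act_ltr (F_gen \<alpha>) = actF \<alpha>"
  "\<mu> \<in> Q \<Longrightarrow> act_ltr (K_gen \<mu>) = actK \<mu>" "x \<notin> generators \<Longrightarrow> act_ltr x z = 0"
  by (auto simp: act_ltr_def fun_eq_iff)

lemma lmap_act_ltr [intro!, simp]: "lmap (act_ltr x)"
proof (cases "x \<in> generators")
  case True
  then show ?thesis by (cases x) simp_all
next
  case False
  then show ?thesis by (simp add: lmap_def)
qed

lemma lmap_foldr_act: "lmap (foldr act_ltr w)"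
proof (induction w)
  case Nil
  then show ?case by (simp add: lmap_def)
next
  case (Cons x w)
  show ?case using lmap_comp[OF lmap_act_ltr[of x] Cons] by (simp add: comp_def)
qed

lemma lmap_act_left: "lmap (\<lambda>p. act p z)" by (simp add: act_def)

lemma lmap_act [intro!, simp]: "lmap (act p)"
  unfolding act_def using lmap_foldr_act by (auto simp: lmap_def lin_fun_add lin_fun_sc)

lemma act_single: "act (single w c) z = c *\<^sub>C foldr act_ltr w z" by (simp add: act_def)
lemma act_ltr [simp]: "act (single [x] c) z = c *\<^sub>C act_ltr x z" by (simp add: act_def)
lemma act_one [simp]: "act 1 z = z" by (simp add: act_def one_word)
lemma act_add: "act (p + r) z = act p z + act r z" by (rule lmap_add[OF lmap_act_left])
lemma act_diff: "act (p - r) z = act p z - act r z" by (rule lmap_diff[OF lmap_act_left])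
lemma act_sc: "act (c *\<^sub>C p) z = c *\<^sub>C act p z" by (rule lmap_sc[OF lmap_act_left])

lemma act_mult: "act (p * r) z = act p (act r z)"
proof (rule lmap_eqI[of "\<lambda>p. act (p * r) z" "\<lambda>p. act p (act r z)"])
  fix w
  show "act (single w 1 * r) z = act (single w 1) (act r z)"
    by (rule lmap_eqI[of "\<lambda>r. act (single w 1 * r) z" "\<lambda>r. act (single w 1) (act r z)"])
      (rule lmap_comp[OF lmap_act_left lmap_mult_left] lmap_comp[OF lmap_act lmap_act_left] |
        simp add: act_single)+
qed (rule lmap_comp[OF lmap_act_left lmap_mult_right] lmap_act_left)+

definition valid :: "'w list \<times> 'w \<times> 'w list \<Rightarrow> bool" where
  "valid = (\<lambda>(w, \<nu>, v). w \<in> lists S \<and> \<nu> \<in> Q \<and> v \<in> lists S)"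

text \<open>Characters are bilinear only on the root lattice, so the module identities are claimed
  only for triples with letters in S and middle entry in Q.\<close>

definition PBW :: "'w pbw set" where "PBW = {z. keys z \<subseteq> {k. valid k}}"

lemma lsub_PBW: "lsub PBW" by (simp add: PBW_def lsub_keys)

lemma single_PBW: "w \<in> lists S \<Longrightarrow> \<nu> \<in> Q \<Longrightarrow> v \<in> lists S \<Longrightarrow> single (w, \<nu>, v) c \<in> PBW"
  by (simp add: PBW_def valid_def)

lemma lin_PBW:
  assumes "z \<in> PBW" "lmap g" "\<And>w \<nu> v. w \<in> lists S \<Longrightarrow> \<nu> \<in> Q \<Longrightarrow> v \<in> lists S \<Longrightarrow> g (single (w, \<nu>, v) 1) \<in> V"
    "lsub V"
  shows "g z \<in> V"
  unfolding lmap_conv_lin[OF assms(2), of z]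
  by (rule lsub_lin[OF assms(4)]) (use assms(1,3) in \<open>force simp: PBW_def valid_def\<close>)

lemma lmap_eq_PBW:
  assumes "z \<in> PBW" "lmap g" "lmap h"
    "\<And>w \<nu> v. w \<in> lists S \<Longrightarrow> \<nu> \<in> Q \<Longrightarrow> v \<in> lists S \<Longrightarrow> g (single (w, \<nu>, v) 1) = h (single (w, \<nu>, v) 1)"
  shows "g z = h z"
  by (rule lmap_eqI[OF assms(2,3)]) (use assms(1,4) in \<open>force simp: PBW_def valid_def\<close>)

lemma actE_PBW: "\<alpha> \<in> S \<Longrightarrow> z \<in> PBW \<Longrightarrow> actE \<alpha> z \<in> PBW"
  by (rule lin_PBW[of _ "actE \<alpha>"]) (auto simp: single_PBW lsub_PBW)

lemma actK_PBW: "\<kappa> \<in> Q \<Longrightarrow> z \<in> PBW \<Longrightarrow> actK \<kappa> z \<in> PBW"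
  by (rule lin_PBW[of _ "actK \<kappa>"]) (auto simp: single_PBW lsub_PBW Q_closed)

lemma actF_basis_PBW: "\<beta> \<in> S \<Longrightarrow> w \<in> lists S \<Longrightarrow> \<nu> \<in> Q \<Longrightarrow> v \<in> lists S \<Longrightarrow> actF_basis \<beta> w \<nu> v \<in> PBW"
proof (induction w)
  case (Cons \<alpha> w)
  have "actK \<alpha> (single (w, \<nu>, v) 1) \<in> PBW" "actK (- \<alpha>) (single (w, \<nu>, v) 1) \<in> PBW"
    using Cons.prems by (intro actK_PBW single_PBW; simp add: Q_closed)+
  then show ?case using Cons
    by (auto intro!: lsub_diff[OF lsub_PBW] lsub_sc[OF lsub_PBW] actE_PBW simp del: actK_single)
qed (simp add: single_PBW)

lemma actF_PBW: "\<beta> \<in> S \<Longrightarrow> z \<in> PBW \<Longrightarrow> actF \<beta> z \<in> PBW"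
  by (rule lin_PBW[of _ "actF \<beta>"]) (auto simp: actF_basis_PBW lsub_PBW)

lemma act_ltr_PBW: "z \<in> PBW \<Longrightarrow> act_ltr x z \<in> PBW"
  by (cases x; cases "x \<in> generators") (auto simp: actE_PBW actF_PBW actK_PBW lsub_zero[OF lsub_PBW])

lemma act_PBW: "z \<in> PBW \<Longrightarrow> act p z \<in> PBW"
proof -
  assume z: "z \<in> PBW"
  have "foldr act_ltr w z \<in> PBW" for w by (induction w) (simp_all add: z act_ltr_PBW)
  then show ?thesis unfolding act_def by (intro lsub_lin lsub_PBW)
qed

definition act_ideal :: "('w generator list \<Rightarrow>\<^sub>0 complex) set" where
  "act_ideal = {p. \<forall>z\<in>PBW. act p z = 0}"

lemma cong_ideal_act_ideal: "cong_ideal act_ideal"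
  by unfold_locales
    (auto simp: act_ideal_def act_add act_mult lmap_zero[OF lmap_act] act_PBW lmap_zero[OF lmap_act_left])

lemma actK_actK: "\<mu> \<in> Q \<Longrightarrow> \<nu> \<in> Q \<Longrightarrow> z \<in> PBW \<Longrightarrow> actK \<mu> (actK \<nu> z) = actK (\<mu> + \<nu>) z"
  by (rule lmap_eq_PBW[of _ "\<lambda>z. actK \<mu> (actK \<nu> z)"])
    (auto intro!: lmap_comp[OF lmap_actK lmap_actK] simp: chr_add_left wt_Q add.assoc mult.commute)

lemma actK_zero: "z \<in> PBW \<Longrightarrow> actK 0 z = z"
  by (rule lmap_eq_PBW[of _ "actK 0" "\<lambda>z. z"]) (auto simp: lmap_id chr_zero_left wt_Q)

lemma actK_actE: "\<mu> \<in> Q \<Longrightarrow> \<alpha> \<in> S \<Longrightarrow> z \<in> PBW \<Longrightarrow> actK \<mu> (actE \<alpha> z) = chr \<mu> \<alpha> *\<^sub>C actE \<alpha> (actK \<mu> z)"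
  by (rule lmap_eq_PBW[of _ "\<lambda>z. actK \<mu> (actE \<alpha> z)" "\<lambda>z. chr \<mu> \<alpha> *\<^sub>C actE \<alpha> (actK \<mu> z)"])
    (auto intro!: lmap_comp[OF lmap_actK lmap_actE] lmap_scale[OF lmap_comp[OF lmap_actE lmap_actK]]
       simp: chr_add_right wt_Q Q_closed mult_ac)

lemma actF_actE:
  "actF \<beta> (actE \<alpha> z) = actE \<alpha> (actF \<beta> z) -
     (if \<alpha> = \<beta> then dco \<alpha> *\<^sub>C (actK \<alpha> z - actK (- \<alpha>) z) else 0)"
proof (rule lmap_eqI[of "\<lambda>z. actF \<beta> (actE \<alpha> z)"])
  show "lmap (\<lambda>z. actF \<beta> (actE \<alpha> z))" by (rule lmap_comp[OF lmap_actF lmap_actE])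
  have "lmap (\<lambda>z. if \<alpha> = \<beta> then dco \<alpha> *\<^sub>C (actK \<alpha> z - actK (- \<alpha>) z) else 0)"
    by (cases "\<alpha> = \<beta>") (auto intro!: lmap_scale lmap_minus simp: lmap_def[of "\<lambda>_. 0"])
  then show "lmap (\<lambda>z. actE \<alpha> (actF \<beta> z) -
     (if \<alpha> = \<beta> then dco \<alpha> *\<^sub>C (actK \<alpha> z - actK (- \<alpha>) z) else 0))"
    by (rule lmap_minus[OF lmap_comp[OF lmap_actE lmap_actF]])
next
  fix k show "actF \<beta> (actE \<alpha> (single k 1)) = actE \<alpha> (actF \<beta> (single k 1)) -
     (if \<alpha> = \<beta> then dco \<alpha> *\<^sub>C (actK \<alpha> (single k 1) - actK (- \<alpha>) (single k 1)) else 0)"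
    by (cases k) simp
qed

text \<open>Induction on the E-word. Its head is pulled out with \<open>actF_actE\<close>; the
  correction term consists of K's and therefore commutes with \<open>K_\<mu>\<close>, and the two
  characters of the head cancel only against it when \<alpha> = \<beta>.\<close>

lemma actK_actF: 
  assumes "\<mu> \<in> Q" "\<beta> \<in> S" "z \<in> PBW"
  shows "actK \<mu> (actF \<beta> z) = inverse (chr \<mu> \<beta>) *\<^sub>C actF \<beta> (actK \<mu> z)"
proof (rule lmap_eq_PBW[OF assms(3), of "\<lambda>z. actK \<mu> (actF \<beta> z)" "\<lambda>z. inverse (chr \<mu> \<beta>) *\<^sub>C actF \<beta> (actK \<mu> z)"])
  fix w \<nu> v assume "w \<in> lists S" "\<nu> \<in> Q" "v \<in> lists S"
  then show "actK \<mu> (actF \<beta> (single (w, \<nu>, v) 1)) =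
      inverse (chr \<mu> \<beta>) *\<^sub>C actF \<beta> (actK \<mu> (single (w, \<nu>, v) 1))"
  proof (induction w)
    case Nil
    then show ?case using assms
      by (simp add: chr_zero_right chr_add_right chr_sym[of \<mu> \<beta>] Q_closed field_simps)
  next
    case (Cons \<alpha> w)
    let ?z = "single (w, \<nu>, v) (1::complex)"
    have z: "?z \<in> PBW" "actF \<beta> ?z \<in> PBW" and Q: "\<alpha> \<in> Q" "\<alpha> \<in> S" "wt w \<in> Q"
      using Cons assms by (auto simp: single_PBW Q_closed actF_basis_PBW wt_Q)
    have KK: "actK \<mu> (actK \<kappa> ?z) = actK \<kappa> (actK \<mu> ?z)" if "\<kappa> \<in> Q" for \<kappa>
      using actK_actK[OF assms(1) that z(1)] actK_actK[OF that assms(1) z(1)] by (simp only: add.commute)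
    have IH: "actK \<mu> (actF \<beta> ?z) = inverse (chr \<mu> \<beta>) *\<^sub>C actF \<beta> (actK \<mu> ?z)"
      using Cons by simp
    let ?D = "\<lambda>y. if \<alpha> = \<beta> then dco \<alpha> *\<^sub>C (actK \<alpha> y - actK (- \<alpha>) y) else 0"
    have D: "actK \<mu> (?D ?z) = ?D (actK \<mu> ?z)"
    proof (cases "\<alpha> = \<beta>")
      case True
      have KK': "actK \<mu> (actK (- \<alpha>) ?z) = actK (- \<alpha>) (actK \<mu> ?z)"
        by (rule KK) (simp add: Q Q_closed)
      show ?thesis
        by (simp only: True[symmetric] if_True simp_thms lmap_sc[OF lmap_actK] lmap_diff[OF lmap_actK] KK[OF Q(1)] KK')
    qed (simp add: lmap_zero[OF lmap_actK])
    have "actK \<mu> (actF \<beta> (actE \<alpha> ?z)) = actK \<mu> (actE \<alpha> (actF \<beta> ?z)) - actK \<mu> (?D ?z)"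
      unfolding actF_actE by (rule lmap_diff[OF lmap_actK])
    also have "\<dots> = (chr \<mu> \<alpha> * inverse (chr \<mu> \<beta>)) *\<^sub>C actE \<alpha> (actF \<beta> (actK \<mu> ?z)) - ?D (actK \<mu> ?z)"
      unfolding D actK_actE[OF assms(1) Q(2) z(2)] IH by (simp only: lmap_sc[OF lmap_actE] sc_sc)
    also have "\<dots> = (chr \<mu> \<alpha> * inverse (chr \<mu> \<beta>)) *\<^sub>C (actE \<alpha> (actF \<beta> (actK \<mu> ?z)) - ?D (actK \<mu> ?z))"
      by (simp del: actK_single)
    also have "\<dots> = inverse (chr \<mu> \<beta>) *\<^sub>C actF \<beta> (chr \<mu> \<alpha> *\<^sub>C actE \<alpha> (actK \<mu> ?z))"
      unfolding actF_actE[symmetric] lmap_sc[OF lmap_actF] sc_sc by (simp only: mult.commute)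
    also have "\<dots> = inverse (chr \<mu> \<beta>) *\<^sub>C actF \<beta> (actK \<mu> (actE \<alpha> ?z))"
      unfolding actK_actE[OF assms(1) Q(2) z(1)] ..
    finally show ?case by (simp only: actE_single)
  qed
qed (rule lmap_comp[OF lmap_actK lmap_actF] lmap_scale[OF lmap_comp[OF lmap_actF lmap_actK]])+

end

context qgroup
begin

text \<open>The space with free words in both outer factors is a module over the algebra defined
  without Serre relations.\<close>

lemma qrel_act_ideal: "qrel S form q ht act_ideal"
proof -
  interpret cong_ideal act_ideal by (rule cong_ideal_act_ideal)
  have "base_relations \<subseteq> act_ideal"
  proof
    fix p assume "p \<in> base_relations"
    then show "p \<in> act_ideal"
    proof cases
      case K_zero_rel
      then show ?thesis by (simp add: act_ideal_def act_diff Q_closed actK_zero)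
    next
      case (K_mult_rel \<mu> \<nu>)
      then show ?thesis by (simp add: act_ideal_def act_diff act_mult Q_closed actK_actK del: mult_word)
    next
      case (K_E_rel \<mu> \<alpha>)
      then show ?thesis
        by (simp add: act_ideal_def act_diff act_mult act_sc Q_closed actK_actE actK_PBW actK_actK actK_zero
            del: mult_word sc_single)
    next
      case (K_F_rel \<mu> \<alpha>)
      then show ?thesis
        by (simp add: act_ideal_def act_diff act_mult act_sc Q_closed actK_actF actK_PBW actK_actK actK_zero
            del: mult_word sc_single)
    next
      case (E_F_rel \<alpha> \<beta>)
      then show ?thesis
        by (simp add: act_ideal_def act_diff act_mult act_sc Q_closed actF_actE act_add lmap_zero[OF lmap_act_left]
            del: mult_word sc_single sc_diff)
    qed
  qed
  then show ?thesis by unfold_locales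
qed

lemma act_serre_E_commute:
  assumes "\<alpha> \<in> S" "\<beta> \<in> S" "\<alpha> \<noteq> \<beta>" "\<gamma> \<in> S" "z \<in> PBW"
  shows "act (serre_element E_gen \<alpha> \<beta>) (actF \<gamma> z) = actF \<gamma> (act (serre_element E_gen \<alpha> \<beta>) z)"
proof -
  interpret A: qrel S form q ht act_ideal by (rule qrel_act_ideal)
  show ?thesis
    using A.serre_E_commute[OF assms(1-4), unfolded A.eqv_def, unfolded act_ideal_def mem_Collect_eq] assms(4,5)
    by (simp add: act_diff act_mult)
qed

lemma act_serre_F_commute:
  assumes "\<alpha> \<in> S" "\<beta> \<in> S" "\<alpha> \<noteq> \<beta>" "\<gamma> \<in> S" "z \<in> PBW"
  shows "act (serre_element F_gen \<alpha> \<beta>) (actE \<gamma> z) = actE \<gamma> (act (serre_element F_gen \<alpha> \<beta>) z)"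
proof -
  interpret A: qrel S form q ht act_ideal by (rule qrel_act_ideal)
  show ?thesis
    using A.serre_F_commute[OF assms(1-4), unfolded A.eqv_def, unfolded act_ideal_def mem_Collect_eq] assms(4,5)
    by (simp add: act_diff act_mult)
qed

subsection \<open>Serre ideal and normal forms of words\<close>

text \<open>The pattern common to both Serre families, as an element of the free algebra on the
  simple roots. Replacing letters by E's or F's gives the Serre elements
  (\<open>relabel_wserre\<close>).\<close>

definition wserre :: "'w \<Rightarrow> 'w \<Rightarrow> 'w list \<Rightarrow>\<^sub>0 complex" where
  "wserre \<alpha> \<beta> = (let n = serre_exponent \<alpha> \<beta> in
     \<Sum>s\<le>n. single (replicate (n - s) \<alpha> @ [\<beta>] @ replicate s \<alpha>)
       ((- 1) ^ s * q_binomial (q_simple \<alpha>) n s))"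

definition serre_generators :: "('w list \<Rightarrow>\<^sub>0 complex) set" where
  "serre_generators = {single w 1 * wserre \<alpha> \<beta> * single w' 1 | w \<alpha> \<beta> w'.
     w \<in> lists S \<and> \<alpha> \<in> S \<and> \<beta> \<in> S \<and> \<alpha> \<noteq> \<beta> \<and> w' \<in> lists S}"

definition serre_ideal :: "('w list \<Rightarrow>\<^sub>0 complex) set" where
  "serre_ideal = lspan serre_generators"

lemma lsub_serre_ideal: "lsub serre_ideal" by (simp add: serre_ideal_def lsub_lspan)

lemma serre_ideal_induct:
  assumes "p \<in> serre_ideal" "lsub V"
    "\<And>w \<alpha> \<beta> w'. w \<in> lists S \<Longrightarrow> \<alpha> \<in> S \<Longrightarrow> \<beta> \<in> S \<Longrightarrow> \<alpha> \<noteq> \<beta> \<Longrightarrow> w' \<in> lists S \<Longrightarrow>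
       single w 1 * wserre \<alpha> \<beta> * single w' 1 \<in> V"
  shows "p \<in> V"
  using lspan_minimal[OF assms(2), of serre_generators] assms(1,3)
  unfolding serre_ideal_def serre_generators_def by blast

lemma serre_ideal_gen: "w \<in> lists S \<Longrightarrow> \<alpha> \<in> S \<Longrightarrow> \<beta> \<in> S \<Longrightarrow> \<alpha> \<noteq> \<beta> \<Longrightarrow> w' \<in> lists S \<Longrightarrow>
    single w 1 * wserre \<alpha> \<beta> * single w' 1 \<in> serre_ideal"
  unfolding serre_ideal_def serre_generators_def by (rule lspan_superset) blast

lemma lsub_vimage: "lmap g \<Longrightarrow> lsub V \<Longrightarrow> lsub {p. g p \<in> V}"
  by (simp add: lsub_def lmap_add[of g] lmap_sc[of g] lmap_zero[of g])

lemma serre_ideal_left: "p \<in> serre_ideal \<Longrightarrow> u \<in> lists S \<Longrightarrow> single u 1 * p \<in> serre_ideal"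
proof -
  assume p: "p \<in> serre_ideal" and u: "u \<in> lists S"
  have "p \<in> {p. single u 1 * p \<in> serre_ideal}"
    by (rule serre_ideal_induct[OF p lsub_vimage[OF lmap_mult_left lsub_serre_ideal]])
      (use serre_ideal_gen[of "u @ _"] u in \<open>simp flip: mult.assoc\<close>)
  then show ?thesis by simp
qed

lemma keys_wserre: "w \<in> keys (wserre \<alpha> \<beta>) \<Longrightarrow> mset w = add_mset \<beta> (replicate_mset (serre_exponent \<alpha> \<beta>) \<alpha>)"
proof -
  assume "w \<in> keys (wserre \<alpha> \<beta>)"
  then obtain s where "s \<le> serre_exponent \<alpha> \<beta>"
    "w = replicate (serre_exponent \<alpha> \<beta> - s) \<alpha> @ [\<beta>] @ replicate s \<alpha>"
    unfolding wserre_def Let_def using keys_sum by (fastforce split: if_splits)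
  then show ?thesis
    by (auto simp: multiset_eq_iff)
qed

lemma keys_wserre_lists:
  assumes "w \<in> keys (wserre \<alpha> \<beta>)" "\<alpha> \<in> S" "\<beta> \<in> S"
  shows "w \<in> lists S"
proof -
  have "set_mset (mset w) \<subseteq> {\<alpha>, \<beta>}"
    unfolding keys_wserre[OF assms(1)] by (auto split: if_splits)
  then show ?thesis using assms(2,3) by auto
qed

text \<open>Every generator is homogeneous for the multiset of its letters. This grading is finer
  than weight and length, so the normal form preserves both, and also the set of letters.\<close>

lemma serre_ideal_homogeneous: "p \<in> serre_ideal \<Longrightarrow> keep (\<lambda>w. mset w = m) p \<in> serre_ideal"
proof -
  assume p: "p \<in> serre_ideal"
  have "p \<in> {p. keep (\<lambda>w. mset w = m) p \<in> serre_ideal}"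
  proof (rule serre_ideal_induct[OF p lsub_vimage[OF lmap_keep lsub_serre_ideal]])
    fix w \<alpha> \<beta> w' assume a: "w \<in> lists S" "\<alpha> \<in> S" "\<beta> \<in> S" "\<alpha> \<noteq> \<beta>" "w' \<in> lists S"
    let ?p = "single w 1 * wserre \<alpha> \<beta> * single w' 1"
    let ?m = "mset w + add_mset \<beta> (replicate_mset (serre_exponent \<alpha> \<beta>) \<alpha>) + mset w'"
    have k: "mset u = ?m" if u: "u \<in> keys ?p" for u
    proof -
      obtain a b where ab: "u = a + b" "a \<in> keys (single w 1 * wserre \<alpha> \<beta>)" "b \<in> keys (single w' (1::complex))"
        using u Poly_Mapping.keys_mult[of "single w 1 * wserre \<alpha> \<beta>" "single w' 1"] by blast
      obtain c d where cd: "a = c + d" "c \<in> keys (single w (1::complex))" "d \<in> keys (wserre \<alpha> \<beta>)"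
        using ab(2) Poly_Mapping.keys_mult[of "single w 1" "wserre \<alpha> \<beta>"] by blast
      then show ?thesis using ab keys_wserre[of d] by (simp add: plus_list_def)
    qed
    show "?p \<in> {p. keep (\<lambda>w. mset w = m) p \<in> serre_ideal}"
    proof (cases "m = ?m")
      case True
      then have "keep (\<lambda>w. mset w = m) ?p = ?p" using k by (intro keep_all) auto
      then show ?thesis using serre_ideal_gen[OF a] by simp
    next
      case False
      then have "keep (\<lambda>w. mset w = m) ?p = 0" using k by (intro keep_none) auto
      then show ?thesis using lsub_zero[OF lsub_serre_ideal] by simp
    qed
  qed
  then show ?thesis by simp
qed

definition is_normal_form :: "(('w list \<Rightarrow>\<^sub>0 complex) \<Rightarrow> ('w list \<Rightarrow>\<^sub>0 complex)) \<Rightarrow> bool" where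
  "is_normal_form nf \<longleftrightarrow> lmap nf \<and> (\<forall>p\<in>serre_ideal. nf p = 0) \<and> (\<forall>p. p - nf p \<in> serre_ideal) \<and>
     (\<forall>w w'. w' \<in> keys (nf (single w 1)) \<longrightarrow> mset w' = mset w) \<and>
     (\<forall>p w. w \<in> keys (nf p) \<longrightarrow> nf (single w 1) = single w 1)"

definition nf :: "('w list \<Rightarrow>\<^sub>0 complex) \<Rightarrow> ('w list \<Rightarrow>\<^sub>0 complex)" where
  "nf = (SOME nf. is_normal_form nf)"

lemma nf_props: "lmap nf \<and> (\<forall>p\<in>serre_ideal. nf p = 0) \<and> (\<forall>p. p - nf p \<in> serre_ideal) \<and>
     (\<forall>w w'. w' \<in> keys (nf (single w 1)) \<longrightarrow> mset w' = mset w) \<and>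
     (\<forall>p w. w \<in> keys (nf p) \<longrightarrow> nf (single w 1) = single w 1)"
proof -
  have "\<exists>nf. is_normal_form nf"
    unfolding is_normal_form_def
    by (rule normal_form_exists[OF lsub_serre_ideal serre_ideal_homogeneous]) blast+
  then have "is_normal_form nf" unfolding nf_def by (rule someI_ex)
  then show ?thesis by (simp add: is_normal_form_def)
qed

lemma lmap_nf [intro!, simp]: "lmap nf" using nf_props by blast
lemma nf_serre_ideal: "p \<in> serre_ideal \<Longrightarrow> nf p = 0" using nf_props by blast
lemma nf_diff: "p - nf p \<in> serre_ideal" using nf_props by blast
lemma nf_mset: "w' \<in> keys (nf (single w 1)) \<Longrightarrow> mset w' = mset w" using nf_props by blast
lemma nf_keys: "w \<in> keys (nf p) \<Longrightarrow> nf (single w 1) = single w 1" using nf_props by blast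

lemma nf_lists: "w \<in> lists S \<Longrightarrow> w' \<in> keys (nf (single w 1)) \<Longrightarrow> w' \<in> lists S"
  using nf_mset[of w' w] by (metis in_lists_conv_set set_mset_mset)
lemma nf_wt: "w' \<in> keys (nf (single w 1)) \<Longrightarrow> wt w' = wt w"
  using nf_mset[of w' w] by (metis sum_mset_sum_list)
lemma nf_length: "w' \<in> keys (nf (single w 1)) \<Longrightarrow> length w' = length w"
  using nf_mset[of w' w] by (metis size_mset)

lemma nf_idem: "nf (nf p) = nf p"
  using nf_serre_ideal[OF nf_diff[of p]] by (simp add: lmap_diff[OF lmap_nf])

text \<open>The normal form of the empty word is a multiple of it; the multiple is 1 because Serre
  generators involve only nonempty words.\<close>

lemma nf_Nil [simp]: "nf (single [] 1) = single [] 1"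
proof -
  have "keys (nf (single [] 1)) \<subseteq> {[]}" using nf_mset[of _ "[]"] by auto
  then obtain c where c: "nf (single [] 1) = single [] c"
    by (metis (no_types, lifting) keys_single lookup_single_eq poly_mapping_eqI in_keys_iff
         lookup_single_not_eq singletonD subsetD)
  have "lookup p [] = 0" if "p \<in> serre_ideal" for p
  proof -
    have "p \<in> {p. keys p \<subseteq> - {[]}}"
    proof (rule serre_ideal_induct[OF that lsub_keys])
      fix w \<alpha> \<beta> w'
      show "single w 1 * wserre \<alpha> \<beta> * single w' 1 \<in> {p. keys p \<subseteq> - {[]}}"
        using keys_wserre[of "[]" \<alpha> \<beta>] Poly_Mapping.keys_mult[of "single w 1 * wserre \<alpha> \<beta>" "single w' 1"]
          Poly_Mapping.keys_mult[of "single w 1" "wserre \<alpha> \<beta>"] by (fastforce simp: plus_list_def)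
    qed
    then show ?thesis by (auto simp: in_keys_iff)
  qed
  from this[OF nf_diff[of "single [] 1"]] show ?thesis by (simp add: c lookup_minus)
qed

lemma nf_mult_left: "u \<in> lists S \<Longrightarrow> nf (single u 1 * nf p) = nf (single u 1 * p)"
  using nf_serre_ideal[OF serre_ideal_left[OF nf_diff[of p], of u]]
  by (simp add: right_diff_distrib lmap_diff[OF lmap_nf])

subsection \<open>Normal forms on the PBW space\<close>

text \<open>Divides out the Serre ideal in the E-factor and in the F-factor at once, the K-factor
  being untouched.\<close>

definition NF :: "'w pbw \<Rightarrow> 'w pbw" where
  "NF = lin (\<lambda>(w, \<nu>, v). tens3 (nf (single w 1)) \<nu> (nf (single v 1)))"

lemma lmap_NF [intro!, simp]: "lmap NF" by (simp add: NF_def)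

lemma NF_single: "NF (single (w, \<nu>, v) c) = c *\<^sub>C tens3 (nf (single w 1)) \<nu> (nf (single v 1))"
  by (simp add: NF_def)

lemma lmap2_eqI:
  assumes "\<And>r. lmap (\<lambda>p. g p r)" "\<And>p. lmap (g p)" "\<And>r. lmap (\<lambda>p. h p r)" "\<And>p. lmap (h p)"
    "\<And>k l. k \<in> keys p \<Longrightarrow> l \<in> keys r \<Longrightarrow> g (single k 1) (single l 1) = h (single k 1) (single l 1)"
  shows "g p r = h p r"
  by (rule lmap_eqI[OF assms(1,3)], rule lmap_eqI[OF assms(2,4)], rule assms(5))

lemma NF_tens3: "NF (tens3 p \<nu> r) = tens3 (nf p) \<nu> (nf r)"
  by (rule lmap2_eqI)
    (auto intro: lmap_comp[OF lmap_NF lmap_tens3_left] lmap_comp[OF lmap_NF lmap_tens3_right]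
      lmap_comp[OF lmap_tens3_left lmap_nf] lmap_comp[OF lmap_tens3_right lmap_nf] simp: NF_single)

lemma actE_tens3: "actE \<alpha> (tens3 p \<nu> r) = tens3 (ltr \<alpha> * p) \<nu> r"
  by (rule lmap2_eqI)
    (auto intro: lmap_comp[OF lmap_actE lmap_tens3_left] lmap_comp[OF lmap_actE lmap_tens3_right]
      lmap_comp[OF lmap_tens3_left lmap_mult_left] lmap_tens3_right)

lemma NF_actE: "\<alpha> \<in> S \<Longrightarrow> NF (actE \<alpha> (NF z)) = NF (actE \<alpha> z)"
  by (rule lmap_eqI[OF lmap_comp[OF lmap_NF lmap_comp[OF lmap_actE lmap_NF]] lmap_comp[OF lmap_NF lmap_actE]])
    (use nf_mult_left[of "[\<alpha>]" "single _ 1"] in \<open>auto simp: NF_single actE_tens3 NF_tens3 nf_idem\<close>)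

lemma actK_tens3:
  assumes "\<And>u. u \<in> keys p \<Longrightarrow> wt u = \<mu>"
  shows "actK \<kappa> (tens3 p \<nu> r) = chr \<kappa> \<mu> *\<^sub>C tens3 p (\<kappa> + \<nu>) r"
  by (rule lmap2_eqI)
    (auto intro: lmap_comp[OF lmap_actK lmap_tens3_left] lmap_comp[OF lmap_actK lmap_tens3_right]
      lmap_scale[OF lmap_tens3_left] lmap_scale[OF lmap_tens3_right] simp: assms)

text \<open>The scalar in \<open>actK\<close> depends only on the weight of the E-word, and
  \<open>nf\<close> preserves weights.\<close>

lemma NF_actK: "NF (actK \<kappa> z) = actK \<kappa> (NF z)"
proof (rule lmap_eqI[OF lmap_comp[OF lmap_NF lmap_actK] lmap_comp[OF lmap_actK lmap_NF]])
  fix k :: "'w list \<times> 'w \<times> 'w list"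
  obtain w \<nu> v where k: "k = (w, \<nu>, v)" by (cases k)
  show "NF (actK \<kappa> (single k 1)) = actK \<kappa> (NF (single k 1))"
    using actK_tens3[of "nf (single w 1)" "wt w" \<kappa> \<nu> "nf (single v 1)"] nf_wt[of _ w]
    by (simp add: k NF_single)
qed

lemma NF_PBW: "z \<in> PBW \<Longrightarrow> NF z \<in> PBW"
proof (rule lin_PBW[OF _ lmap_NF _ lsub_PBW])
  fix w \<nu> v assume *: "w \<in> lists S" "\<nu> \<in> Q" "v \<in> lists S"
  have "keys (tens3 (nf (single w 1)) \<nu> (nf (single v 1))) \<subseteq> {k. valid k}"
    using keys_tens3[of "nf (single w 1)" \<nu> "nf (single v 1)"] nf_lists[OF *(1)] nf_lists[OF *(3)] *(2)
    by (force simp: valid_def)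
  then show "NF (single (w, \<nu>, v) 1) \<in> PBW"
    by (simp add: NF_single PBW_def)
qed

lemma foldr_act_E: "u \<in> lists S \<Longrightarrow> foldr act_ltr (map E_gen u) (single (w, \<nu>, v) c) = single (u @ w, \<nu>, v) c"
  by (induction u) auto

lemma foldr_act_F: "u \<in> lists S \<Longrightarrow> \<nu> \<in> Q \<Longrightarrow>
   foldr act_ltr (map F_gen u) (single ([], \<nu>, v) c) = single ([], \<nu>, u @ v) (c * chr (wt u) \<nu>)"
  by (induction u) (auto simp: chr_zero_left chr_add_left Q_closed wt_Q mult_ac)

lemma serre_element_conv: "serre_element X \<alpha> \<beta> = lin (\<lambda>u. single (map X u) 1) (wserre \<alpha> \<beta>)"
  by (simp add: serre_element_def wserre_def Let_def lin_sum)

lemma act_serre_E: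
  assumes "\<alpha> \<in> S" "\<beta> \<in> S"
  shows "act (serre_element E_gen \<alpha> \<beta>) (single (w, \<nu>, v) 1) = tens3 (wserre \<alpha> \<beta> * single w 1) \<nu> (single v 1)"
proof -
  have "act (serre_element E_gen \<alpha> \<beta>) (single (w, \<nu>, v) 1)
     = lin (\<lambda>u. act (single (map E_gen u) 1) (single (w, \<nu>, v) 1)) (wserre \<alpha> \<beta>)"
    unfolding serre_element_conv by (rule lmap_lin_comp[OF lmap_act_left])
  also have "\<dots> = lin (\<lambda>u. tens3 (single u 1 * single w 1) \<nu> (single v 1)) (wserre \<alpha> \<beta>)"
  proof (rule lin_cong[OF refl])
    fix u assume "u \<in> keys (wserre \<alpha> \<beta>)"
    then have "u \<in> lists S"
      using assms keys_wserre_lists by blast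
    then show "act (single (map E_gen u) 1) (single (w, \<nu>, v) 1) = tens3 (single u 1 * single w 1) \<nu> (single v 1)"
      by (simp add: act_single foldr_act_E)
  qed
  also have "\<dots> = tens3 (wserre \<alpha> \<beta> * single w 1) \<nu> (single v 1)"
    by (rule lmap_conv_lin[OF lmap_comp[OF lmap_tens3_left lmap_mult_right], symmetric])
  finally show ?thesis .
qed

text \<open>Moving an F-word past \<open>K_\<nu>\<close> costs a scalar that depends only on the
  weight of the word, which is the same for all words of the Serre element.\<close>

lemma act_serre_F:
  assumes "\<alpha> \<in> S" "\<beta> \<in> S" "\<nu> \<in> Q"
  shows "\<exists>c. act (serre_element F_gen \<alpha> \<beta>) (single ([], \<nu>, v) 1) = c *\<^sub>C tens3 (single [] 1) \<nu> (wserre \<alpha> \<beta> * single v 1)"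
proof -
  define \<mu> where "\<mu> = \<beta> + sum_mset (replicate_mset (serre_exponent \<alpha> \<beta>) \<alpha>)"
  have "act (serre_element F_gen \<alpha> \<beta>) (single ([], \<nu>, v) 1)
     = lin (\<lambda>u. act (single (map F_gen u) 1) (single ([], \<nu>, v) 1)) (wserre \<alpha> \<beta>)"
    unfolding serre_element_conv by (rule lmap_lin_comp[OF lmap_act_left])
  also have "\<dots> = lin (\<lambda>u. chr \<mu> \<nu> *\<^sub>C tens3 (single [] 1) \<nu> (single u 1 * single v 1)) (wserre \<alpha> \<beta>)"
  proof (rule lin_cong[OF refl])
    fix u assume u: "u \<in> keys (wserre \<alpha> \<beta>)"
    then have "u \<in> lists S"
      using assms keys_wserre_lists by blast
    moreover have "wt u = \<mu>" using keys_wserre[OF u] unfolding \<mu>_def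
      by (metis sum_mset.add_mset sum_mset_sum_list)
    ultimately show "act (single (map F_gen u) 1) (single ([], \<nu>, v) 1)
       = chr \<mu> \<nu> *\<^sub>C tens3 (single [] 1) \<nu> (single u 1 * single v 1)"
      using assms by (simp add: act_single foldr_act_F)
  qed
  also have "\<dots> = chr \<mu> \<nu> *\<^sub>C tens3 (single [] 1) \<nu> (wserre \<alpha> \<beta> * single v 1)"
    by (rule lmap_conv_lin[OF lmap_scale[OF lmap_comp[OF lmap_tens3_right lmap_mult_right]], symmetric])
  finally show ?thesis by blast
qed

lemma nf_wserre: "w \<in> lists S \<Longrightarrow> \<alpha> \<in> S \<Longrightarrow> \<beta> \<in> S \<Longrightarrow> \<alpha> \<noteq> \<beta> \<Longrightarrow> nf (wserre \<alpha> \<beta> * single w 1) = 0"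
  using nf_serre_ideal[OF serre_ideal_gen[of "[]" \<alpha> \<beta> w]] by (simp flip: one_word)

lemma NF_serre_E:
  assumes "\<alpha> \<in> S" "\<beta> \<in> S" "\<alpha> \<noteq> \<beta>" "z \<in> PBW"
  shows "NF (act (serre_element E_gen \<alpha> \<beta>) z) = 0"
  by (rule lmap_eq_PBW[OF assms(4) lmap_comp[OF lmap_NF lmap_act], of "\<lambda>_. 0"])
    (simp_all add: act_serre_E assms NF_tens3 nf_wserre lmap_def)

subsection \<open>Stability of the kernel of the normal form\<close>

text \<open>The candidate for showing that the kernel of \<open>NF\<close> is stable under F: it
  suffices that elements spanning this kernel belong to it.\<close>

definition null_F :: "'w \<Rightarrow> 'w pbw set" where
  "null_F \<beta> = {z \<in> PBW. NF z = 0 \<and> NF (actF \<beta> z) = 0}"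

lemma lsub_null_F: "lsub (null_F \<beta>)"
  using lsub_PBW lmap_comp[OF lmap_NF lmap_actF, of \<beta>] lmap_NF
  unfolding lsub_def null_F_def lmap_def by (auto simp: lmap_zero[OF lmap_NF] lmap_zero[OF lmap_actF])

lemma null_F_actE:
  assumes "\<alpha> \<in> S" "z \<in> null_F \<beta>"
  shows "actE \<alpha> z \<in> null_F \<beta>"
proof -
  have z: "z \<in> PBW" "NF z = 0" "NF (actF \<beta> z) = 0" using assms(2) by (auto simp: null_F_def)
  have "NF (actE \<alpha> z) = 0" "NF (actE \<alpha> (actF \<beta> z)) = 0"
    using NF_actE[OF assms(1), of z] NF_actE[OF assms(1), of "actF \<beta> z"] z
    by (simp_all add: lmap_zero[OF lmap_actE] lmap_zero[OF lmap_NF])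
  then show ?thesis using z assms(1)
    by (simp add: null_F_def actE_PBW actF_actE lmap_diff[OF lmap_NF] lmap_sc[OF lmap_NF] NF_actK
        lmap_zero[OF lmap_actK] lmap_zero[OF lmap_NF])
qed

text \<open>Letters in front of the Serre element are handled by \<open>null_F_actE\<close>. Without
  them the vector is the image of a monomial under the action of an E-Serre element, which commutes
  with F.\<close>

lemma null_F_serre_left:
  assumes "\<beta> \<in> S" "p \<in> serre_ideal" "\<nu> \<in> Q" "v \<in> lists S"
  shows "tens3 p \<nu> (single v 1) \<in> null_F \<beta>"
proof -
  have "p \<in> {p. tens3 p \<nu> (single v 1) \<in> null_F \<beta>}"
  proof (rule serre_ideal_induct[OF assms(2) lsub_vimage[OF lmap_tens3_left lsub_null_F]])
    fix w \<alpha> \<alpha>' w' assume a: "w \<in> lists S" "\<alpha> \<in> S" "\<alpha>' \<in> S" "\<alpha> \<noteq> \<alpha>'" "w' \<in> lists S"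
    from a(1) have "tens3 (single w 1 * wserre \<alpha> \<alpha>' * single w' 1) \<nu> (single v 1) \<in> null_F \<beta>"
    proof (induction w)
      case Nil
      let ?z = "single (w', \<nu>, v) (1::complex)"
      have z: "?z \<in> PBW" using a assms by (simp add: single_PBW)
      have "act (serre_element E_gen \<alpha> \<alpha>') ?z \<in> null_F \<beta>"
        using z act_serre_E_commute[OF a(2-4) assms(1) z, symmetric] a assms(1)
        by (simp add: null_F_def act_PBW NF_serre_E actF_PBW del: actF_single)
      then show ?case using a by (simp add: act_serre_E flip: one_word)
    next
      case (Cons \<gamma> w)
      then have "actE \<gamma> (tens3 (single w 1 * wserre \<alpha> \<alpha>' * single w' 1) \<nu> (single v 1)) \<in> null_F \<beta>"
        by (intro null_F_actE) auto
      then show ?case by (simp add: actE_tens3 flip: mult.assoc)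
    qed
    then show "single w 1 * wserre \<alpha> \<alpha>' * single w' 1 \<in> {p. tens3 p \<nu> (single v 1) \<in> null_F \<beta>}" by simp
  qed
  then show ?thesis by simp
qed

lemma actF_tens3_Nil: "actF \<beta> (tens3 (single [] 1) \<nu> r) = chr \<beta> \<nu> *\<^sub>C tens3 (single [] 1) \<nu> (ltr \<beta> * r)"
  by (rule lmap_eqI[OF lmap_comp[OF lmap_actF lmap_tens3_right]
        lmap_scale[OF lmap_comp[OF lmap_tens3_right lmap_mult_left]]]) simp

lemma serre_ideal_lists: "p \<in> serre_ideal \<Longrightarrow> keys p \<subseteq> lists S"
proof -
  assume p: "p \<in> serre_ideal"
  have "p \<in> {p. keys p \<subseteq> lists S}"
  proof (rule serre_ideal_induct[OF p lsub_keys])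
    fix w \<alpha> \<beta> w' assume a: "w \<in> lists S" "\<alpha> \<in> S" "\<beta> \<in> S" "\<alpha> \<noteq> \<beta>" "w' \<in> lists S"
    have "keys (wserre \<alpha> \<beta>) \<subseteq> lists S"
      using keys_wserre_lists a by blast
    then show "single w 1 * wserre \<alpha> \<beta> * single w' 1 \<in> {p. keys p \<subseteq> lists S}"
      using Poly_Mapping.keys_mult[of "single w 1 * wserre \<alpha> \<beta>" "single w' 1"]
        Poly_Mapping.keys_mult[of "single w 1" "wserre \<alpha> \<beta>"] a by (fastforce simp: plus_list_def)
  qed
  then show ?thesis by simp
qed

text \<open>With empty E-word, F just prefixes a letter to the F-word up to a scalar, and the Serre
  ideal is stable under that; E-letters are added by \<open>null_F_actE\<close>.\<close>

lemma null_F_serre_right: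
  assumes "\<beta> \<in> S" "r \<in> serre_ideal" "\<nu> \<in> Q" "w \<in> lists S"
  shows "tens3 (single w 1) \<nu> r \<in> null_F \<beta>"
  using assms(4)
proof (induction w)
  case Nil
  have "keys (tens3 (single [] 1) \<nu> r) \<subseteq> {k. valid k}"
    using keys_tens3[of "single [] 1" \<nu> r] serre_ideal_lists[OF assms(2)] assms(3) by (force simp: valid_def)
  moreover have "nf (ltr \<beta> * r) = 0"
    using serre_ideal_left[OF assms(2), of "[\<beta>]"] assms(1) by (simp add: nf_serre_ideal)
  ultimately show ?case
    using assms by (simp add: null_F_def PBW_def actF_tens3_Nil NF_tens3 nf_serre_ideal lmap_sc[OF lmap_NF])
next
  case (Cons \<gamma> w)
  then have "actE \<gamma> (tens3 (single w 1) \<nu> r) \<in> null_F \<beta>" by (intro null_F_actE) auto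
  then show ?case by (simp add: actE_tens3)
qed

lemma NF_kernel_null_F:
  assumes "\<beta> \<in> S" "z \<in> PBW" "NF z = 0"
  shows "z \<in> null_F \<beta>"
proof -
  have "z - NF z \<in> null_F \<beta>"
  proof (rule lin_PBW[OF assms(2) lmap_minus[OF lmap_id lmap_NF] _ lsub_null_F])
    fix w \<nu> v assume a: "w \<in> lists S" "\<nu> \<in> Q" "v \<in> lists S"
    \<comment> \<open>The kernel is spanned by vectors z - NF z, and each such vector splits into
      one with a Serre relation on the left and one with a Serre relation on the right.\<close>
    have *: "single (w, \<nu>, v) 1 - NF (single (w, \<nu>, v) 1) =
        tens3 (single w 1 - nf (single w 1)) \<nu> (single v 1) + tens3 (nf (single w 1)) \<nu> (single v 1 - nf (single v 1))"
      by (simp add: NF_single lmap_diff[OF lmap_tens3_left] lmap_diff[OF lmap_tens3_right])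
    have "tens3 (nf (single w 1)) \<nu> (single v 1 - nf (single v 1)) \<in> null_F \<beta>"
      unfolding lmap_conv_lin[OF lmap_tens3_left, of "nf (single w 1)"]
      by (rule lsub_lin[OF lsub_null_F], rule null_F_serre_right) (use assms a nf_lists nf_diff in auto)
    then show "single (w, \<nu>, v) 1 - NF (single (w, \<nu>, v) 1) \<in> null_F \<beta>"
      unfolding * using assms a by (intro lsub_add[OF lsub_null_F] null_F_serre_left nf_diff) auto
  qed
  then show ?thesis using assms by simp
qed

lemma NF_kernel_act:
  assumes "z \<in> PBW" "NF z = 0"
  shows "NF (act p z) = 0"
proof -
  have ltr: "NF (act_ltr x y) = 0" if "y \<in> PBW" "NF y = 0" for x y
  proof (cases "x \<in> generators")
    case True
    show ?thesis
    proof (cases x)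
      case (E_gen \<alpha>)
      then show ?thesis using True NF_actE[of \<alpha> y] that
        by (simp add: lmap_zero[OF lmap_actE] lmap_zero[OF lmap_NF])
    next
      case (F_gen \<beta>)
      then show ?thesis using True NF_kernel_null_F[of \<beta> y] that by (simp add: null_F_def)
    next
      case (K_gen \<mu>)
      then show ?thesis using True that by (simp add: NF_actK lmap_zero[OF lmap_actK])
    qed
  qed (simp add: lmap_zero[OF lmap_NF])
  have "foldr act_ltr w z \<in> PBW \<and> NF (foldr act_ltr w z) = 0" for w
    by (induction w) (simp_all add: assms ltr act_ltr_PBW)
  then show ?thesis
    unfolding act_def lmap_lin_comp[OF lmap_NF] by simp
qed

text \<open>The annihilator of the quotient of the PBW space by the kernel of \<open>NF\<close>,
  which is a module by \<open>NF_kernel_act\<close>.\<close>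

definition NF_ideal :: "('w generator list \<Rightarrow>\<^sub>0 complex) set" where
  "NF_ideal = {p. \<forall>z\<in>PBW. NF (act p z) = 0}"

lemma cong_ideal_NF_ideal: "cong_ideal NF_ideal"
  by unfold_locales
    (auto simp: NF_ideal_def act_add act_mult act_PBW lmap_zero[OF lmap_act_left] NF_kernel_act
      lmap_add[OF lmap_NF] lmap_zero[OF lmap_NF])

text \<open>For an F-Serre element induct on the E-word: it commutes with the E-letters, and on a
  vector without E-letters it becomes a Serre relation in the F-factor.\<close>

lemma relations_NF_ideal: "relations \<subseteq> NF_ideal"
proof -
  interpret A: qrel S form q ht act_ideal by (rule qrel_act_ideal)
  have "base_relations \<subseteq> NF_ideal"
    using A.base by (auto simp: act_ideal_def NF_ideal_def lmap_zero[OF lmap_NF])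
  moreover have "serre_element E_gen \<alpha> \<beta> \<in> NF_ideal" if "\<alpha> \<in> S" "\<beta> \<in> S" "\<alpha> \<noteq> \<beta>" for \<alpha> \<beta>
    using that by (simp add: NF_ideal_def NF_serre_E)
  moreover have "serre_element F_gen \<alpha> \<beta> \<in> NF_ideal" if s: "\<alpha> \<in> S" "\<beta> \<in> S" "\<alpha> \<noteq> \<beta>" for \<alpha> \<beta>
  proof -
    have *: "NF (act (serre_element F_gen \<alpha> \<beta>) (single (w, \<nu>, v) 1)) = 0"
      if "w \<in> lists S" "\<nu> \<in> Q" "v \<in> lists S" for w \<nu> v
      using that
    proof (induction w)
      case Nil
      then show ?case using act_serre_F[OF s(1,2), of \<nu> v] s
        nf_wserre[OF Nil(2) s] by (auto simp: NF_tens3 lmap_sc[OF lmap_NF])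
    next
      case (Cons \<gamma> w)
      let ?z = "single (w, \<nu>, v) (1::complex)"
      have g: "\<gamma> \<in> S" "?z \<in> PBW" using Cons by (auto simp: single_PBW)
      have "NF (act (serre_element F_gen \<alpha> \<beta>) (actE \<gamma> ?z)) = NF (actE \<gamma> (act (serre_element F_gen \<alpha> \<beta>) ?z))"
        using act_serre_F_commute[OF s g] by simp
      also have "\<dots> = 0"
        using NF_actE[OF g(1), of "act (serre_element F_gen \<alpha> \<beta>) ?z"] Cons
        by (simp add: lmap_zero[OF lmap_actE] lmap_zero[OF lmap_NF])
      finally show ?case by simp
    qed
    have "NF (act (serre_element F_gen \<alpha> \<beta>) z) = 0" if "z \<in> PBW" for z
      by (rule lmap_eq_PBW[OF that lmap_comp[OF lmap_NF lmap_act], of "\<lambda>_. 0"])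
        (simp_all add: * lmap_def)
    then show ?thesis by (simp add: NF_ideal_def)
  qed
  ultimately show ?thesis unfolding relations_eq by blast
qed

end

context qgroup
begin

subsection \<open>The quantum group and its PBW coordinates\<close>

lemma relations_carrier: "relations \<subseteq> carrier (free_algebra generators)"
proof -
  define V where "V = {p :: 'w generator list \<Rightarrow>\<^sub>0 complex. keys p \<subseteq> lists generators}"
  have V: "lsub V" "V = carrier (free_algebra generators)" by (simp_all add: V_def lsub_keys)
  have sV: "single w c \<in> V" if "w \<in> lists generators" for w c using that by (simp add: V_def)
  have "p \<in> V" if "p \<in> base_relations" for p
    using that
    by cases (auto intro!: lsub_diff[OF V(1)] sV lsub_zero[OF V(1)] simp: one_word Q_closed)
  then have "p \<in> carrier (free_algebra generators)" if "p \<in> base_relations" for p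
    using that V(2) by blast
  moreover have "serre_element X \<alpha> \<beta> \<in> carrier (free_algebra generators)"
    if "\<alpha> \<in> S" "\<beta> \<in> S" "X ` S \<subseteq> generators" for X \<alpha> \<beta>
  proof -
    have "map X u \<in> lists generators" if "u \<in> keys (wserre \<alpha> \<beta>)" for u
      using keys_wserre_lists[OF that] \<open>\<alpha> \<in> S\<close> \<open>\<beta> \<in> S\<close> \<open>X ` S \<subseteq> generators\<close> by (auto simp: image_subset_iff)
    then show ?thesis
      unfolding serre_element_conv using keys_lin[of "\<lambda>u. single (map X u) 1" "wserre \<alpha> \<beta>"] by fastforce
  qed
  moreover have "E_gen ` S \<subseteq> generators" "F_gen ` S \<subseteq> generators" by auto
  ultimately show ?thesis unfolding relations_eq by blast
qed

lemma Uq_quotient: "monoid_algebra_quotient (word_monoid generators) relations"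
  unfolding monoid_algebra_quotient_def monoid_algebra_quotient_axioms_def
  using relations_carrier monoid_word_monoid by (simp add: free_algebra_def word_monoid_def)

text \<open>Discards words with letters that are not generators. Composed with it, the quotient map
  is total on the function type and still a homomorphism, which spares carrier conditions.\<close>

definition rho :: "('w generator list \<Rightarrow>\<^sub>0 complex) \<Rightarrow> ('w generator list \<Rightarrow>\<^sub>0 complex)" where
  "rho = keep (\<lambda>w. w \<in> lists generators)"

lemma lmap_rho [intro!, simp]: "lmap rho" by (simp add: rho_def)

lemma rho_mult: "rho (p * r) = rho p * rho r"
  by (rule lmap_mult_eqI) (auto simp: rho_def plus_list_def)

lemma rho_one [simp]: "rho 1 = 1" by (simp add: rho_def one_word)

lemma rho_carrier: "rho p \<in> carrier (free_algebra generators)" by (auto simp: rho_def)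

lemma rho_id: "p \<in> carrier (free_algebra generators) \<Longrightarrow> rho p = p"
  unfolding rho_def by (rule keep_all) auto

definition cl :: "('w generator list \<Rightarrow>\<^sub>0 complex) \<Rightarrow> ('w generator list \<Rightarrow>\<^sub>0 complex) set" where
  "cl p = quotient_class (free_algebra generators) relations (rho p)"

lemma rho_mem: "rho p \<in> carrier (monoid_algebra (word_monoid generators))"
  using rho_carrier by (simp add: free_algebra_def)

lemma ring_Uq: "ring Uq"
proof -
  interpret U: monoid_algebra_quotient "word_monoid generators" relations by (rule Uq_quotient)
  show ?thesis using U.ring_MQ by (simp add: Uq_def free_algebra_def)
qed

lemma carrier_Uq: "carrier Uq = Set.range cl"
proof -
  interpret U: monoid_algebra_quotient "word_monoid generators" relations by (rule Uq_quotient)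
  have "U.cls p \<in> Set.range cl" if "p \<in> carrier (free_algebra generators)" for p
    using rho_id[OF that] by (metis cl_def free_algebra_def rangeI)
  then show ?thesis
    using U.carrier_MQ rho_mem by (auto simp: Uq_def cl_def free_algebra_def)
qed

lemma cl_closed [simp]: "cl p \<in> carrier Uq" by (simp add: carrier_Uq)

lemma cl_add: "cl (p + r) = cl p \<oplus>\<^bsub>Uq\<^esub> cl r"
proof -
  interpret U: monoid_algebra_quotient "word_monoid generators" relations by (rule Uq_quotient)
  show ?thesis using U.cls_add[OF rho_mem rho_mem, of p r]
    by (simp add: Uq_def cl_def free_algebra_def lmap_add[OF lmap_rho])
qed

lemma cl_mult: "cl (p * r) = cl p \<otimes>\<^bsub>Uq\<^esub> cl r"
proof -
  interpret U: monoid_algebra_quotient "word_monoid generators" relations by (rule Uq_quotient)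
  have "rho p \<otimes>\<^bsub>monoid_algebra (word_monoid generators)\<^esub> rho r = rho (p * r)"
    using free_algebra_mult[of generators] by (simp add: free_algebra_def rho_mult)
  then show ?thesis using U.cls_mult[OF rho_mem rho_mem, of p r]
    by (simp add: Uq_def cl_def free_algebra_def)
qed

lemma cl_sc: "cl (c *\<^sub>C p) = c \<odot>\<^bsub>Uq\<^esub> cl p"
proof -
  interpret U: monoid_algebra_quotient "word_monoid generators" relations by (rule Uq_quotient)
  show ?thesis using U.cls_sc[OF rho_mem, of c p]
    by (simp add: Uq_def cl_def free_algebra_def lmap_sc[OF lmap_rho])
qed

lemma cl_zero: "cl 0 = \<zero>\<^bsub>Uq\<^esub>"
proof -
  interpret U: monoid_algebra_quotient "word_monoid generators" relations by (rule Uq_quotient)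
  show ?thesis using U.cls_zero by (simp add: Uq_def cl_def free_algebra_def lmap_zero[OF lmap_rho])
qed

lemma cl_one: "cl 1 = \<one>\<^bsub>Uq\<^esub>"
proof -
  interpret U: monoid_algebra_quotient "word_monoid generators" relations by (rule Uq_quotient)
  show ?thesis using U.cls_one by (simp add: Uq_def cl_def free_algebra_def one_word[symmetric] word_monoid_def)
qed

lemma gen_eq: "x \<in> generators \<Longrightarrow> gen x = cl (ltr x)"
  by (simp add: gen_def cl_def rho_def)

lemma cl_eq_iff_Idl: "cl p = cl r \<longleftrightarrow> rho p - rho r \<in> Idl\<^bsub>free_algebra generators\<^esub> relations"
proof -
  interpret U: monoid_algebra_quotient "word_monoid generators" relations by (rule Uq_quotient)
  show ?thesis using U.cls_eq_iff[OF rho_mem rho_mem, of p r] by (simp add: cl_def free_algebra_def)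
qed

definition cl_ideal :: "('w generator list \<Rightarrow>\<^sub>0 complex) set" where
  "cl_ideal = {p. cl p = \<zero>\<^bsub>Uq\<^esub>}"

lemma cong_ideal_cl_ideal: "cong_ideal cl_ideal"
proof -
  interpret U: ring Uq by (rule ring_Uq)
  show ?thesis by unfold_locales (simp_all add: cl_ideal_def cl_zero cl_add cl_mult)
qed

lemma cl_eq_iff_ideal: "cl p = cl r \<longleftrightarrow> p - r \<in> cl_ideal"
  unfolding cl_ideal_def mem_Collect_eq cl_zero[symmetric] cl_eq_iff_Idl
  by (simp add: lmap_diff[OF lmap_rho] lmap_zero[OF lmap_rho])

lemma relations_cl_ideal: "relations \<subseteq> cl_ideal"
proof
  fix p assume p: "p \<in> relations"
  interpret U: monoid_algebra_quotient "word_monoid generators" relations by (rule Uq_quotient)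
  have "p \<in> Idl\<^bsub>free_algebra generators\<^esub> relations"
    using U.R_subset_Idl p by (auto simp: free_algebra_def)
  moreover have "rho p = p" using p relations_carrier by (intro rho_id) blast
  ultimately show "p \<in> cl_ideal"
    using cl_eq_iff_Idl[of p 0] by (simp add: cl_ideal_def cl_zero lmap_zero[OF lmap_rho])
qed

lemma qrel_cl_ideal: "qrel S form q ht cl_ideal"
proof -
  interpret cong_ideal cl_ideal by (rule cong_ideal_cl_ideal)
  show ?thesis using relations_cl_ideal by unfold_locales (auto simp: relations_eq)
qed

lemma act_rho: "act (rho p) z = act p z"
proof (rule lmap_eqI[OF lmap_comp[OF lmap_act_left lmap_rho] lmap_act_left])
  fix w
  have "foldr act_ltr w z = 0" if "w \<notin> lists generators"
    using that
  proof (induction w)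
    case (Cons x w)
    then show ?case
      by (cases "w \<in> lists generators") (simp_all add: lmap_zero[OF lmap_act_ltr] del: in_lists_conv_set)
  qed simp
  then show "act (rho (single w 1)) z = act (single w 1) z"
    by (simp add: rho_def act_single lmap_zero[OF lmap_act_left])
qed

definition e0 :: "'w pbw" where "e0 = single ([], 0, []) 1"

lemma e0_PBW: "e0 \<in> PBW" by (simp add: e0_def single_PBW Q_closed)

definition cf :: "('w generator list \<Rightarrow>\<^sub>0 complex) \<Rightarrow> 'w pbw" where "cf p = NF (act p e0)"

text \<open>The PBW coordinates \<open>cf\<close> apply an element to \<open>e0\<close>, the vector
  standing for 1, and normalise the result.\<close>

lemma lmap_cf [intro!, simp]: "lmap cf"
  unfolding cf_def[abs_def] by (rule lmap_comp[OF lmap_NF lmap_act_left])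

lemma cf_PBW: "cf p \<in> PBW" by (simp add: cf_def NF_PBW act_PBW e0_PBW)

lemma cf_valid: "(w, \<nu>, v) \<in> keys (cf p) \<Longrightarrow> w \<in> lists S \<and> \<nu> \<in> Q \<and> v \<in> lists S"
  using cf_PBW[of p] by (auto simp: PBW_def valid_def)

lemma cf_reduced:
  assumes "(w, \<nu>, v) \<in> keys (cf p)"
  shows "nf (single w 1) = single w 1" "nf (single v 1) = single v 1"
proof -
  let ?f = "\<lambda>(w, \<nu>, v). tens3 (nf (single w 1)) \<nu> (nf (single v 1))"
  have "(w, \<nu>, v) \<in> (\<Union>k\<in>keys (act p e0). keys (?f k))"
    by (rule subsetD[OF keys_lin]) (use assms in \<open>simp add: cf_def NF_def\<close>)
  then obtain k where k: "(w, \<nu>, v) \<in> keys (?f k)" by (rule UN_E)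
  obtain w' \<nu>' v' where k': "k = (w', \<nu>', v')" by (cases k)
  have "w \<in> keys (nf (single w' 1))" "v \<in> keys (nf (single v' 1))"
    using k keys_tens3[of "nf (single w' 1)" \<nu>' "nf (single v' 1)"] unfolding k' by auto
  then show "nf (single w 1) = single w 1" "nf (single v 1) = single v 1" by (auto intro: nf_keys)
qed

text \<open>The independence half of PBW: elements of the defining ideal annihilate the normalised
  module, so they have zero coordinates.\<close>

lemma cl_eq_imp_cf_eq:
  assumes "cl p = cl r"
  shows "cf p = cf r"
proof -
  interpret U: monoid_algebra_quotient "word_monoid generators" relations by (rule Uq_quotient)
  interpret N: cong_ideal NF_ideal by (rule cong_ideal_NF_ideal)
  have "Idl\<^bsub>free_algebra generators\<^esub> relations \<subseteq> NF_ideal"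
    unfolding free_algebra_def
    by (rule U.Idl_minimal)
      (use relations_NF_ideal free_algebra_mult[of generators] in
        \<open>simp_all add: free_algebra_def N.zero_mem N.add_mem N.left_mem N.right_mem\<close>)
  then have "rho p - rho r \<in> NF_ideal" using assms cl_eq_iff_Idl by blast
  then have "cf (rho p - rho r) = 0" by (simp add: NF_ideal_def cf_def e0_PBW)
  then show ?thesis by (simp add: lmap_diff[OF lmap_cf]) (simp add: cf_def act_rho)
qed

definition relabel :: "('a \<Rightarrow> 'b) \<Rightarrow> ('a list \<Rightarrow>\<^sub>0 complex) \<Rightarrow> ('b list \<Rightarrow>\<^sub>0 complex)" where
  "relabel X = lin (\<lambda>w. single (map X w) 1)"

lemma lmap_relabel [intro!, simp]: "lmap (relabel X)" by (simp add: relabel_def)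
lemma relabel_single [simp]: "relabel X (single w c) = single (map X w) c" by (simp add: relabel_def)
lemma relabel_mult: "relabel X (p * r) = relabel X p * relabel X r"
  by (rule lmap_mult_eqI) (auto simp: plus_list_def)
lemma relabel_wserre: "relabel X (wserre \<alpha> \<beta>) = serre_element X \<alpha> \<beta>"
  by (simp add: relabel_def serre_element_conv)

definition EKF :: "'w list \<Rightarrow> 'w \<Rightarrow> 'w list \<Rightarrow> 'w generator list \<Rightarrow>\<^sub>0 complex" where
  "EKF w \<nu> v = single (map E_gen w @ [K_gen \<nu>] @ map F_gen v) 1"

text \<open>Turns coordinates back into a representative; up to classes it is inverse to
  \<open>cf\<close> on reduced coordinates.\<close>

definition sig :: "'w pbw \<Rightarrow> ('w generator list \<Rightarrow>\<^sub>0 complex)" where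
  "sig = lin (\<lambda>(w, \<nu>, v). EKF w \<nu> v)"

lemma lmap_sig [intro!, simp]: "lmap sig" by (simp add: sig_def)
lemma sig_single: "sig (single (w, \<nu>, v) c) = c *\<^sub>C EKF w \<nu> v" by (simp add: sig_def)

lemma EKF_Cons: "EKF (\<alpha> # w) \<nu> v = lE \<alpha> * EKF w \<nu> v" by (simp add: EKF_def)

lemma EKF_mult: "EKF w \<nu> v = single (map E_gen w) 1 * lK \<nu> * single (map F_gen v) 1"
  by (simp add: EKF_def)

lemma sig_tens3: "sig (tens3 p \<nu> r) = relabel E_gen p * lK \<nu> * relabel F_gen r"
  by (rule lmap2_eqI[where g = "\<lambda>p r. sig (tens3 p \<nu> r)" and h = "\<lambda>p r. relabel E_gen p * lK \<nu> * relabel F_gen r"])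
    (auto intro: lmap_comp[OF lmap_sig lmap_tens3_left] lmap_comp[OF lmap_sig lmap_tens3_right]
      lmap_comp[OF lmap_mult_left lmap_relabel]
      lmap_comp[OF lmap_comp[OF lmap_mult_right lmap_mult_right] lmap_relabel]
      simp: sig_single EKF_mult)

lemma act_EKF: "w \<in> lists S \<Longrightarrow> \<nu> \<in> Q \<Longrightarrow> v \<in> lists S \<Longrightarrow> act (EKF w \<nu> v) e0 = single (w, \<nu>, v) 1"
  by (simp add: EKF_def act_single e0_def foldr_act_F foldr_act_E chr_zero_right wt_Q Q_closed
      del: in_lists_conv_set)

lemma cf_EKF: "w \<in> lists S \<Longrightarrow> \<nu> \<in> Q \<Longrightarrow> v \<in> lists S \<Longrightarrow> cf (EKF w \<nu> v) = tens3 (nf (single w 1)) \<nu> (nf (single v 1))"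
  by (simp add: cf_def act_EKF NF_single del: in_lists_conv_set)

lemma cf_sig: "z \<in> PBW \<Longrightarrow> cf (sig z) = NF z"
  by (rule lmap_eq_PBW[OF _ lmap_comp[OF lmap_cf lmap_sig] lmap_NF])
    (simp_all add: sig_single cf_EKF NF_single)

end

section \<open>Straightening into PBW monomials, the spanning half of PBW\<close>

context qrel
begin

lemma K_EKF:
  "w \<in> lists S \<Longrightarrow> \<nu> \<in> Q \<Longrightarrow> \<kappa> \<in> Q \<Longrightarrow> lK \<kappa> * EKF w \<nu> v \<approx> chr \<kappa> (wt w) *\<^sub>C EKF w (\<kappa> + \<nu>) v"
proof (induction w)
  case Nil
  have "lK \<kappa> * EKF [] \<nu> v = (lK \<kappa> * lK \<nu>) * single (map F_gen v) 1" by (simp add: EKF_def)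
  also have "\<dots> \<approx> lK (\<kappa> + \<nu>) * single (map F_gen v) 1" using Nil by (intro eqv_right K_mult)
  finally show ?case using Nil by (simp add: EKF_def chr_zero_right)
next
  case (Cons \<alpha> w)
  have "lK \<kappa> * EKF (\<alpha> # w) \<nu> v = (lK \<kappa> * lE \<alpha>) * EKF w \<nu> v" by (simp add: EKF_Cons mult.assoc del: mult_word)
  also have "\<dots> \<approx> (chr \<kappa> \<alpha> *\<^sub>C (lE \<alpha> * lK \<kappa>)) * EKF w \<nu> v" using Cons by (intro eqv_right K_E) auto
  also have "\<dots> = chr \<kappa> \<alpha> *\<^sub>C (lE \<alpha> * (lK \<kappa> * EKF w \<nu> v))" by (simp add: mult.assoc del: mult_word sc_single)
  also have "\<dots> \<approx> chr \<kappa> \<alpha> *\<^sub>C (lE \<alpha> * (chr \<kappa> (wt w) *\<^sub>C EKF w (\<kappa> + \<nu>) v))"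
    using Cons by (intro eqv_sc eqv_left Cons.IH) auto
  also have "\<dots> = chr \<kappa> (wt (\<alpha> # w)) *\<^sub>C EKF (\<alpha> # w) (\<kappa> + \<nu>) v"
    using Cons by (simp add: EKF_Cons chr_add_right wt_Q Q_closed del: mult_word in_lists_conv_set)
  finally show ?case .
qed

lemma K_sig: "\<kappa> \<in> Q \<Longrightarrow> z \<in> PBW \<Longrightarrow> lK \<kappa> * sig z \<approx> sig (actK \<kappa> z)"
proof -
  assume k: "\<kappa> \<in> Q" and z: "z \<in> PBW"
  have "lsub J" by (simp add: lsub_def zero_mem add_mem sc_mem)
  then have "lK \<kappa> * sig z - sig (actK \<kappa> z) \<in> J"
    by (rule lin_PBW[OF z lmap_minus[OF lmap_comp[OF lmap_mult_left lmap_sig] lmap_comp[OF lmap_sig lmap_actK]], rotated])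
      (use K_EKF[OF _ _ k] in \<open>simp add: sig_single eqv_def\<close>)
  then show ?thesis by (simp add: eqv_def)
qed

lemma E_sig: "lE \<alpha> * sig z = sig (actE \<alpha> z)"
  by (rule lmap_eqI[OF lmap_comp[OF lmap_mult_left lmap_sig] lmap_comp[OF lmap_sig lmap_actE]])
    (auto simp: sig_single EKF_Cons)

lemma F_EKF:
  "w \<in> lists S \<Longrightarrow> \<nu> \<in> Q \<Longrightarrow> v \<in> lists S \<Longrightarrow> \<beta> \<in> S \<Longrightarrow> lF \<beta> * EKF w \<nu> v \<approx> sig (actF_basis \<beta> w \<nu> v)"
proof (induction w)
  case Nil
  have "lF \<beta> * EKF [] \<nu> v = (lF \<beta> * lK \<nu>) * single (map F_gen v) 1" by (simp add: EKF_def)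
  also have "\<dots> \<approx> (chr \<nu> \<beta> *\<^sub>C (lK \<nu> * lF \<beta>)) * single (map F_gen v) 1"
    using Nil by (intro eqv_right F_K)
  also have "\<dots> = sig (actF_basis \<beta> [] \<nu> v)"
    using Nil by (simp add: sig_single EKF_def chr_sym[of \<nu> \<beta>] Q_closed)
  finally show ?case .
next
  case (Cons \<alpha> w)
  let ?z = "single (w, \<nu>, v) (1::complex)"
  have z: "?z \<in> PBW" and a: "\<alpha> \<in> S" "\<alpha> \<in> Q" using Cons by (auto simp: single_PBW Q_closed)
  let ?D = "\<lambda>x y. if \<alpha> = \<beta> then dco \<alpha> *\<^sub>C (x - y) else 0"
  have sz: "sig ?z = EKF w \<nu> v" by (simp add: sig_single)
  have "lF \<beta> * EKF (\<alpha> # w) \<nu> v = lE \<alpha> * (lF \<beta> * EKF w \<nu> v) - (lE \<alpha> * lF \<beta> - lF \<beta> * lE \<alpha>) * EKF w \<nu> v"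
    by (simp add: EKF_Cons mult.assoc left_diff_distrib del: mult_word)
  also have "\<dots> \<approx> lE \<alpha> * sig (actF_basis \<beta> w \<nu> v) - ?D (lK \<alpha>) (lK (- \<alpha>)) * EKF w \<nu> v"
    using Cons a by (intro eqv_diff eqv_left eqv_right Cons.IH E_F) auto
  also have "\<dots> = sig (actE \<alpha> (actF_basis \<beta> w \<nu> v)) - ?D (lK \<alpha> * sig ?z) (lK (- \<alpha>) * sig ?z)"
    unfolding sz by (simp add: E_sig left_diff_distrib del: mult_word sc_single)
  also have "\<dots> \<approx> sig (actE \<alpha> (actF_basis \<beta> w \<nu> v)) - ?D (sig (actK \<alpha> ?z)) (sig (actK (- \<alpha>) ?z))"
    using K_sig[OF a(2) z] K_sig[of "- \<alpha>", OF _ z] a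
    by (intro eqv_diff eqv_refl) (auto intro!: eqv_sc eqv_diff simp: Q_closed simp del: actK_single)
  also have "\<dots> = sig (actF_basis \<beta> (\<alpha> # w) \<nu> v)"
    by (simp add: lmap_diff[OF lmap_sig] lmap_sc[OF lmap_sig] lmap_zero[OF lmap_sig] del: actK_single)
  finally show ?case .
qed

lemma F_sig: "\<beta> \<in> S \<Longrightarrow> z \<in> PBW \<Longrightarrow> lF \<beta> * sig z \<approx> sig (actF \<beta> z)"
proof -
  assume k: "\<beta> \<in> S" and z: "z \<in> PBW"
  have "lsub J" by (simp add: lsub_def zero_mem add_mem sc_mem)
  then have "lF \<beta> * sig z - sig (actF \<beta> z) \<in> J"
    by (rule lin_PBW[OF z lmap_minus[OF lmap_comp[OF lmap_mult_left lmap_sig] lmap_comp[OF lmap_sig lmap_actF]], rotated])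
      (use F_EKF[OF _ _ _ k] in \<open>simp add: sig_single eqv_def\<close>)
  then show ?thesis by (simp add: eqv_def)
qed

lemma word_sig:
  assumes "z \<in> PBW" "w \<in> lists generators"
  shows "single w 1 * sig z \<approx> sig (foldr act_ltr w z)"
  using assms(2)
proof (induction w)
  case Nil
  then show ?case by (simp flip: one_word)
next
  case (Cons x w)
  let ?y = "foldr act_ltr w z"
  have y: "?y \<in> PBW" using act_PBW[OF assms(1), of "single w 1"] by (simp add: act_single)
  have "single (x # w) 1 * sig z = ltr x * (single w 1 * sig z)" by (simp flip: mult.assoc)
  also have "\<dots> \<approx> ltr x * sig ?y" using Cons by (intro eqv_left) auto
  also have "\<dots> \<approx> sig (act_ltr x ?y)"
    using Cons y by (cases x) (auto simp: E_sig F_sig K_sig)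
  finally show ?case by simp
qed

text \<open>Since \<open>sig\<close> intertwines left multiplication with the action, evaluating at
  \<open>e0\<close> rewrites p as a combination of ordered monomials. No Serre relation enters
  here.\<close>

lemma act_sig: "p \<in> carrier (free_algebra generators) \<Longrightarrow> p \<approx> sig (act p e0)"
proof -
  assume p: "p \<in> carrier (free_algebra generators)"
  have J: "lsub J" by (simp add: lsub_def zero_mem add_mem sc_mem)
  have "single w 1 \<approx> sig (act (single w 1) e0)" if "w \<in> lists generators" for w
  proof -
    have "single w 1 * 1 \<approx> single w 1 * lK 0" by (intro eqv_left eqv_sym[OF K_zero])
    also have "\<dots> = single w 1 * sig e0" by (simp add: e0_def sig_single EKF_def)
    also have "\<dots> \<approx> sig (act (single w 1) e0)" using word_sig[OF e0_PBW that] by (simp add: act_single)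
    finally show ?thesis by simp
  qed
  then have "lin (\<lambda>w. single w 1 - sig (act (single w 1) e0)) p \<in> J"
    using p by (intro lsub_lin[OF J]) (auto simp: eqv_def)
  also have "lin (\<lambda>w. single w 1 - sig (act (single w 1) e0)) p = p - sig (act p e0)"
    by (rule lmap_conv_lin[OF lmap_minus[OF lmap_id lmap_comp[OF lmap_sig lmap_act_left]], symmetric])
  finally show ?thesis by (simp add: eqv_def)
qed

text \<open>Once the Serre elements lie in J, normalising the outer words changes the ordered
  representative only by elements of J.\<close>

lemma sig_NF:
  assumes serre: "\<And>X \<alpha> \<beta>. X \<in> {E_gen, F_gen} \<Longrightarrow> \<alpha> \<in> S \<Longrightarrow> \<beta> \<in> S \<Longrightarrow> \<alpha> \<noteq> \<beta> \<Longrightarrow> serre_element X \<alpha> \<beta> \<in> J"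
  shows "sig z \<approx> sig (NF z)"
proof -
  have J: "lsub J" by (simp add: lsub_def zero_mem add_mem sc_mem)
  have rel: "relabel X p \<in> J" if X: "X \<in> {E_gen, F_gen}" and p: "p \<in> serre_ideal" for X p
  proof -
    have "p \<in> {p. relabel X p \<in> J}"
      by (rule serre_ideal_induct[OF p lsub_vimage[OF lmap_relabel J]])
        (use serre[OF X] in \<open>simp add: relabel_mult relabel_wserre left_mem right_mem\<close>)
    then show ?thesis by simp
  qed
  have "sig (single k 1 - NF (single k 1)) \<in> J" for k
  proof -
    obtain w \<nu> v where k: "k = (w, \<nu>, v)" by (cases k)
    have *: "single k 1 - NF (single k 1) =
        tens3 (single w 1 - nf (single w 1)) \<nu> (single v 1) + tens3 (nf (single w 1)) \<nu> (single v 1 - nf (single v 1))"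
      by (simp add: k NF_single lmap_diff[OF lmap_tens3_left] lmap_diff[OF lmap_tens3_right])
    show ?thesis unfolding * lmap_add[OF lmap_sig] sig_tens3
      by (intro add_mem right_mem rel left_mem nf_diff) auto
  qed
  then have "lin (\<lambda>k. sig (single k 1 - NF (single k 1))) z \<in> J" by (intro lsub_lin[OF J])
  also have "lin (\<lambda>k. sig (single k 1 - NF (single k 1))) z = sig (z - NF z)"
    by (rule lmap_conv_lin[OF lmap_comp[OF lmap_sig lmap_minus[OF lmap_id lmap_NF]], symmetric])
  finally show ?thesis by (simp add: eqv_def lmap_diff[OF lmap_sig])
qed

end

context qgroup
begin

lemma cl_rho: "cl (rho p) = cl p"
  by (simp add: cl_def rho_id[OF rho_carrier])

lemma cf_rho: "cf (rho p) = cf p" by (simp add: cf_def act_rho)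

lemma cl_sig_cf: "cl (sig (cf p)) = cl p"
proof -
  interpret C: qrel S form q ht cl_ideal by (rule qrel_cl_ideal)
  have "C.eqv (rho p) (sig (act (rho p) e0))" by (rule C.act_sig[OF rho_carrier])
  also have "C.eqv \<dots> (sig (cf (rho p)))"
    unfolding cf_def by (rule C.sig_NF) (use relations_cl_ideal in \<open>unfold relations_eq, blast\<close>)
  finally have "cl (rho p) = cl (sig (cf (rho p)))" by (simp add: C.eqv_def cl_eq_iff_ideal)
  then show ?thesis by (simp add: cl_rho cf_rho)
qed

text \<open>The PBW theorem in the form used from here on: coordinates are well defined by
  independence and determine the class by spanning.\<close>

lemma cl_eq_iff: "cl p = cl r \<longleftrightarrow> cf p = cf r"
  by (metis cl_eq_imp_cf_eq cl_sig_cf)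

end

section \<open>Coproduct and antipode\<close>

context cong_ideal
begin

lemma qad_cong:
  assumes "a \<approx> a'" "y \<approx> y'"
  shows "qad t p a y k \<approx> qad t p a' y' k"
  by (induction k) (auto intro!: eqv_diff eqv_mult eqv_sc assms)

text \<open>Twisting a and y by q-commuting factors g and h pulls these out in front. The factor t0
  is the same for a past h and for y past g, so both halves of each commutator acquire the same
  scalar.\<close>

lemma qad_twist:
  assumes ag: "a * g \<approx> p0 *\<^sub>C (g * a)" and ah: "a * h \<approx> t0 *\<^sub>C (h * a)" and yg: "y * g \<approx> t0 *\<^sub>C (g * y)"
    and hg: "h * g \<approx> g * h"
  shows "\<exists>c. qad t p (g * a) (h * y) k \<approx> c *\<^sub>C (g ^ k * h * qad t p a y k)"
proof (induction k)
  case 0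
  show ?case by (rule exI[of _ 1]) simp
next
  case (Suc k)
  let ?x = "qad t p a y k" and ?z = "t * p ^ k" and ?X = "qad t p (g * a) (h * y)"
  obtain c where c: "?X k \<approx> c *\<^sub>C (g ^ k * h * ?x)" using Suc by blast
  have agk: "a * g ^ k \<approx> p0 ^ k *\<^sub>C (g ^ k * a)" by (rule power_left_commute[OF ag])
  have xg: "?x * g \<approx> (t0 * p0 ^ k) *\<^sub>C (g * ?x)"
    by (rule qad_right_commute[OF ag yg])
  have gh: "g ^ k * h * g \<approx> g ^ Suc k * h"
  proof -
    have "g ^ k * h * g = g ^ k * (h * g)" by (simp add: mult.assoc)
    also have "\<dots> \<approx> g ^ k * (g * h)" by (intro eqv_left hg)
    also have "\<dots> = g ^ Suc k * h" by (simp add: power_commutes mult.assoc flip: mult.assoc)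
    finally show ?thesis .
  qed
  have "?X (Suc k) \<approx> g * a * (c *\<^sub>C (g ^ k * h * ?x)) - ?z *\<^sub>C ((c *\<^sub>C (g ^ k * h * ?x)) * (g * a))"
    unfolding qad.simps by (intro eqv_diff eqv_left eqv_right eqv_sc c)
  also have "\<dots> = c *\<^sub>C (g * ((a * g ^ k) * (h * ?x))) - (c * ?z) *\<^sub>C (g ^ k * (h * ((?x * g) * a)))"
    by (simp add: mult.assoc mult.commute)
  also have "\<dots> \<approx> c *\<^sub>C (g * ((p0 ^ k *\<^sub>C (g ^ k * a)) * (h * ?x)))
      - (c * ?z) *\<^sub>C (g ^ k * (h * (((t0 * p0 ^ k) *\<^sub>C (g * ?x)) * a)))"
    by (intro eqv_diff eqv_left eqv_right eqv_sc agk xg)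
  also have "\<dots> = (c * p0 ^ k) *\<^sub>C (g * (g ^ k * ((a * h) * ?x)))
      - (c * t0 * p0 ^ k * ?z) *\<^sub>C ((g ^ k * h * g) * (?x * a))"
    by (simp add: mult.assoc mult_ac)
  also have "\<dots> \<approx> (c * p0 ^ k) *\<^sub>C (g * (g ^ k * ((t0 *\<^sub>C (h * a)) * ?x)))
      - (c * t0 * p0 ^ k * ?z) *\<^sub>C ((g ^ Suc k * h) * (?x * a))"
    by (intro eqv_diff eqv_left eqv_right eqv_sc ah gh)
  also have "\<dots> = (c * t0 * p0 ^ k) *\<^sub>C (g ^ Suc k * h * qad t p a y (Suc k))"
    by (simp add: mult.assoc mult_ac right_diff_distrib)
  finally show ?case by blast
qed

end

lemma lmap_qad:
  assumes "lmap \<phi>" "\<And>x y. \<phi> (x * y) = \<phi> x * \<phi> y"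
  shows "\<phi> (qad t p a y k) = qad t p (\<phi> a) (\<phi> y) k"
  by (induction k) (simp_all add: lmap_diff[OF assms(1)] lmap_sc[OF assms(1)] assms(2))

text \<open>Reversing a x - z x a gives x a - z a x, which is -z times a commutator with parameter
  1/z.\<close>

lemma word_antihom_qad:
  assumes "t \<noteq> 0" "p \<noteq> 0"
  shows "\<exists>c. word_antihom f (qad t p a y k) = c *\<^sub>C qad (inverse t) (inverse p) (word_antihom f a) (word_antihom f y) k"
proof (induction k)
  case 0
  show ?case by (rule exI[of _ 1]) simp
next
  case (Suc k)
  let ?X = "qad (inverse t) (inverse p) (word_antihom f a) (word_antihom f y)" and ?z = "t * p ^ k"
  obtain c where c: "word_antihom f (qad t p a y k) = c *\<^sub>C ?X k" using Suc by blast
  have z: "?z * (inverse t * inverse p ^ k) = 1" using assms by (simp add: power_inverse field_simps)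
  have "word_antihom f (qad t p a y (Suc k)) = c *\<^sub>C (?X k * word_antihom f a) - (?z * c) *\<^sub>C (word_antihom f a * ?X k)"
    by (simp add: lmap_diff[OF lmap_word_antihom] lmap_sc[OF lmap_word_antihom] c)
  also have "\<dots> = (- ?z * c) *\<^sub>C ?X (Suc k)"
    using z by (simp add: sc_minus_one mult_ac)
  finally show ?case by blast
qed

context qgroup
begin

lemma opposite_abelian: "abelian_monoid (opposite_algebra Uq)"
proof -
  interpret U: ring Uq by (rule ring_Uq)
  have "add_monoid (opposite_algebra Uq) = add_monoid Uq" by (simp add: opposite_algebra_def)
  then show ?thesis using U.a_comm_monoid unfolding abelian_monoid_def by simp
qed

lemma mem_cl: "y \<in> cl p \<longleftrightarrow> y - rho p \<in> Idl\<^bsub>free_algebra generators\<^esub> relations"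
proof -
  interpret U: monoid_algebra_quotient "word_monoid generators" relations by (rule Uq_quotient)
  show ?thesis
    unfolding cl_def free_algebra_def U.mem_cls by (metis add_diff_cancel_right' diff_add_cancel)
qed

lemma Idl_carrier: "Idl\<^bsub>free_algebra generators\<^esub> relations \<subseteq> carrier (free_algebra generators)"
proof -
  interpret U: monoid_algebra_quotient "word_monoid generators" relations by (rule Uq_quotient)
  show ?thesis unfolding free_algebra_def by (rule U.I.a_subset)
qed

text \<open>\<open>induced_map\<close> takes the single element of the image of a whole coset. It is
  computed by any g that equals the lift on the carrier and is constant modulo a congruence ideal N
  that contains the relations.\<close>

lemma induced_map_cl:
  assumes lift: "\<And>y. y \<in> carrier (free_algebra generators) \<Longrightarrow> free_lift M f y = g y"
    and N: "cong_ideal N" "relations \<subseteq> N"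
    and g: "\<And>x y. x - y \<in> N \<Longrightarrow> g x = g y"
    and p: "p \<in> carrier (free_algebra generators)"
  shows "induced_map M f (cl p) = g p"
proof (rule induced_map_eq)
  interpret U: monoid_algebra_quotient "word_monoid generators" relations by (rule Uq_quotient)
  interpret N: cong_ideal N by (rule N)
  have I: "Idl\<^bsub>free_algebra generators\<^esub> relations \<subseteq> N"
    unfolding free_algebra_def
    by (rule U.Idl_minimal)
      (use N(2) free_algebra_mult[of generators] in
        \<open>simp_all add: free_algebra_def N.zero_mem N.add_mem N.left_mem N.right_mem\<close>)
  have "0 \<in> Idl\<^bsub>free_algebra generators\<^esub> relations"
    using U.I.zero_closed by (simp add: free_algebra_def)
  then have "p \<in> cl p" using mem_cl[of p p] rho_id[OF p] by simp
  then show "cl p \<noteq> {}" by blast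
  fix y assume y: "y \<in> cl p"
  then have d: "y - p \<in> Idl\<^bsub>free_algebra generators\<^esub> relations" using mem_cl rho_id[OF p] by simp
  have "y = (y - p) + p" by simp
  moreover have "(y - p) + p \<in> carrier (free_algebra generators)"
    using lsub_add[OF lsub_keys, of "y - p" "lists generators" p] d Idl_carrier p by simp blast
  ultimately have "y \<in> carrier (free_algebra generators)" by simp
  then show "free_lift M f y = g p" using lift g d I by auto
qed

lemma cl_uminus: "cl (- p) = \<ominus>\<^bsub>Uq\<^esub> cl p"
proof -
  interpret U: ring Uq by (rule ring_Uq)
  have "cl (- p) \<oplus>\<^bsub>Uq\<^esub> cl p = \<zero>\<^bsub>Uq\<^esub>" by (simp add: cl_zero flip: cl_add)
  then show ?thesis using U.minus_equality by simp
qed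

definition anti_ltr :: "'w generator \<Rightarrow> 'w generator list \<Rightarrow>\<^sub>0 complex" where
  "anti_ltr x = (case x of E_gen \<alpha> \<Rightarrow> - (lK (- \<alpha>) * lE \<alpha>) | F_gen \<alpha> \<Rightarrow> - (lF \<alpha> * lK \<alpha>) | K_gen \<mu> \<Rightarrow> lK (- \<mu>))"

lemma word_antihom_ltr [simp]: "word_antihom f (single [x] c) = c *\<^sub>C f x" by (simp add: word_antihom_word)
lemma word_antihom_diff: "word_antihom f (x - y) = word_antihom f x - word_antihom f y" by (rule lmap_diff[OF lmap_word_antihom])
lemma word_antihom_sc: "word_antihom f (c *\<^sub>C x) = c *\<^sub>C word_antihom f x" by (rule lmap_sc[OF lmap_word_antihom])

lemma anti_ltr_simps [simp]: "anti_ltr (E_gen \<alpha>) = - (lK (- \<alpha>) * lE \<alpha>)"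
  "anti_ltr (F_gen \<alpha>) = - (lF \<alpha> * lK \<alpha>)" "anti_ltr (K_gen \<mu>) = lK (- \<mu>)"
  by (simp_all add: anti_ltr_def)

end

context qrel
begin

lemma K_commute: "\<mu> \<in> Q \<Longrightarrow> \<nu> \<in> Q \<Longrightarrow> lK \<mu> * lK \<nu> \<approx> lK \<nu> * lK \<mu>"
  using eqv_trans[of "lK \<mu> * lK \<nu>" "lK (\<mu> + \<nu>)" "lK \<nu> * lK \<mu>"] K_mult[of \<mu> \<nu>]
    eqv_sym[OF K_mult[of \<nu> \<mu>]] by (simp only: add.commute)

lemma commute_scaled: "x * k \<approx> c *\<^sub>C (k * x) \<Longrightarrow> x * (d *\<^sub>C k) \<approx> c *\<^sub>C ((d *\<^sub>C k) * x)"
  using eqv_sc[of "x * k" "c *\<^sub>C (k * x)" d] by (simp add: mult.commute)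

lemma commute_scaled2: "h * g \<approx> g * h \<Longrightarrow> (d *\<^sub>C h) * (e *\<^sub>C g) \<approx> (e *\<^sub>C g) * (d *\<^sub>C h)"
  using eqv_sc[of "h * g" "g * h" "d * e"] by (simp add: mult.commute)

lemma anti_K_conj:
  assumes "\<mu> \<in> Q" and x: "lK \<mu> * x \<approx> c *\<^sub>C (x * lK \<mu>)"
  shows "lK \<mu> * x * lK (- \<mu>) \<approx> c *\<^sub>C x"
proof -
  have "lK \<mu> * x * lK (- \<mu>) \<approx> (c *\<^sub>C (x * lK \<mu>)) * lK (- \<mu>)" by (intro eqv_right x)
  also have "\<dots> = c *\<^sub>C (x * (lK \<mu> * lK (- \<mu>)))" by (simp add: mult.assoc del: mult_word)
  also have "\<dots> \<approx> c *\<^sub>C (x * 1)" using assms(1) by (intro eqv_sc eqv_left K_inv')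
  finally show ?thesis by simp
qed

lemma K_KE: "\<mu> \<in> Q \<Longrightarrow> \<nu> \<in> Q \<Longrightarrow> \<alpha> \<in> S \<Longrightarrow> lK \<mu> * (lK \<nu> * lE \<alpha>) \<approx> chr \<mu> \<alpha> *\<^sub>C ((lK \<nu> * lE \<alpha>) * lK \<mu>)"
proof -
  assume a: "\<mu> \<in> Q" "\<nu> \<in> Q" "\<alpha> \<in> S"
  have "lK \<mu> * (lK \<nu> * lE \<alpha>) = (lK \<mu> * lK \<nu>) * lE \<alpha>" by (simp only: mult.assoc)
  also have "\<dots> \<approx> (lK \<nu> * lK \<mu>) * lE \<alpha>" using a by (intro eqv_right K_commute)
  also have "\<dots> = lK \<nu> * (lK \<mu> * lE \<alpha>)" by (simp only: mult.assoc)
  also have "\<dots> \<approx> lK \<nu> * (chr \<mu> \<alpha> *\<^sub>C (lE \<alpha> * lK \<mu>))" using a by (intro eqv_left K_E)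
  finally show ?thesis by (simp only: mult.assoc sc_mult_right)
qed

lemma K_FK: "\<mu> \<in> Q \<Longrightarrow> \<nu> \<in> Q \<Longrightarrow> \<alpha> \<in> S \<Longrightarrow> lK \<mu> * (lF \<alpha> * lK \<nu>) \<approx> inverse (chr \<mu> \<alpha>) *\<^sub>C ((lF \<alpha> * lK \<nu>) * lK \<mu>)"
proof -
  assume a: "\<mu> \<in> Q" "\<nu> \<in> Q" "\<alpha> \<in> S"
  have "lK \<mu> * (lF \<alpha> * lK \<nu>) = (lK \<mu> * lF \<alpha>) * lK \<nu>" by (simp only: mult.assoc)
  also have "\<dots> \<approx> (inverse (chr \<mu> \<alpha>) *\<^sub>C (lF \<alpha> * lK \<mu>)) * lK \<nu>" using a by (intro eqv_right K_F)
  also have "\<dots> = inverse (chr \<mu> \<alpha>) *\<^sub>C (lF \<alpha> * (lK \<mu> * lK \<nu>))" by (simp only: mult.assoc sc_mult_left)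
  also have "\<dots> \<approx> inverse (chr \<mu> \<alpha>) *\<^sub>C (lF \<alpha> * (lK \<nu> * lK \<mu>))" using a by (intro eqv_sc eqv_left K_commute)
  finally show ?thesis by (simp only: mult.assoc)
qed

lemma anti_base: "p \<in> base_relations \<Longrightarrow> word_antihom anti_ltr p \<in> J"
proof -
  assume "p \<in> base_relations"
  then show ?thesis
  proof cases
    case K_zero_rel
    then show ?thesis using K_zero by (simp add: eqv_def word_antihom_diff)
  next
    case (K_mult_rel \<mu> \<nu>)
    have "- \<nu> + - \<mu> = - (\<mu> + \<nu>)" by simp
    then have "lK (- \<nu>) * lK (- \<mu>) \<approx> lK (- (\<mu> + \<nu>))"
      using K_mult[of "- \<nu>" "- \<mu>"] K_mult_rel by (simp only: Q_closed)
    then show ?thesis using K_mult_rel by (simp add: eqv_def word_antihom_diff del: mult_word)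
  next
    case (K_E_rel \<mu> \<alpha>)
    have "lK \<mu> * (lK (- \<alpha>) * lE \<alpha>) * lK (- \<mu>) \<approx> chr \<mu> \<alpha> *\<^sub>C (lK (- \<alpha>) * lE \<alpha>)"
      using K_E_rel by (intro anti_K_conj K_KE) (simp_all add: Q_closed)
    from uminus_mem[OF this[unfolded eqv_def]] show ?thesis using K_E_rel
      by (simp add: word_antihom_diff word_antihom_sc mult.assoc del: mult_word sc_single)
  next
    case (K_F_rel \<mu> \<alpha>)
    have "lK \<mu> * (lF \<alpha> * lK \<alpha>) * lK (- \<mu>) \<approx> inverse (chr \<mu> \<alpha>) *\<^sub>C (lF \<alpha> * lK \<alpha>)"
      using K_F_rel by (intro anti_K_conj K_FK) (simp_all add: Q_closed)
    from uminus_mem[OF this[unfolded eqv_def]] show ?thesis using K_F_rel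
      by (simp add: word_antihom_diff word_antihom_sc mult.assoc del: mult_word sc_single)
  next
    case (E_F_rel \<alpha> \<beta>)
    have Q: "\<alpha> \<in> Q" "\<beta> \<in> Q" "- \<alpha> \<in> Q" using E_F_rel by (simp_all add: Q_closed)
    \<comment> \<open>Both orders of the product are reduced to the same scalar and the same
      K-factor \<open>?X\<close>, so their difference is a multiple of the EF-commutator. That is
      nonzero only for \<alpha> = \<beta>, where the scalar is 1 and \<open>?X\<close> is congruent
      to 1.\<close>
    let ?X = "lK \<beta> * lK (- \<alpha>)" and ?c = "chr \<alpha> \<beta> * inverse (chr \<alpha> \<alpha>)"
    let ?D = "if \<alpha> = \<beta> then dco \<alpha> *\<^sub>C (lK \<alpha> - lK (- \<alpha>)) else 0"
    have 1: "lF \<beta> * lK \<beta> * (lK (- \<alpha>) * lE \<alpha>) \<approx> ?c *\<^sub>C (lF \<beta> * lE \<alpha> * ?X)"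
    proof -
      have "lF \<beta> * lK \<beta> * (lK (- \<alpha>) * lE \<alpha>) = lF \<beta> * (lK \<beta> * (lK (- \<alpha>) * lE \<alpha>))" by (simp only: mult.assoc)
      also have "\<dots> \<approx> lF \<beta> * (chr \<beta> \<alpha> *\<^sub>C ((lK (- \<alpha>) * lE \<alpha>) * lK \<beta>))"
        using E_F_rel Q by (intro eqv_left K_KE)
      also have "\<dots> = chr \<beta> \<alpha> *\<^sub>C (lF \<beta> * ((lK (- \<alpha>) * lE \<alpha>) * lK \<beta>))" by (simp only: sc_mult_right)
      also have "\<dots> \<approx> chr \<beta> \<alpha> *\<^sub>C (lF \<beta> * ((chr (- \<alpha>) \<alpha> *\<^sub>C (lE \<alpha> * lK (- \<alpha>))) * lK \<beta>))"
        using E_F_rel Q by (intro eqv_sc eqv_left eqv_right K_E)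
      also have "\<dots> = ?c *\<^sub>C (lF \<beta> * (lE \<alpha> * (lK (- \<alpha>) * lK \<beta>)))"
        using Q by (simp add: mult.assoc chr_uminus_left chr_sym[of \<beta> \<alpha>] del: mult_word sc_single)
      also have "\<dots> \<approx> ?c *\<^sub>C (lF \<beta> * (lE \<alpha> * ?X))" using Q by (intro eqv_sc eqv_left K_commute)
      finally show ?thesis by (simp only: mult.assoc)
    qed
    have 2: "lK (- \<alpha>) * lE \<alpha> * (lF \<beta> * lK \<beta>) \<approx> ?c *\<^sub>C (lE \<alpha> * lF \<beta> * ?X)"
    proof -
      have "lK (- \<alpha>) * lE \<alpha> * (lF \<beta> * lK \<beta>) \<approx> (chr (- \<alpha>) \<alpha> *\<^sub>C (lE \<alpha> * lK (- \<alpha>))) * (lF \<beta> * lK \<beta>)"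
        using E_F_rel Q by (intro eqv_right K_E)
      also have "\<dots> = chr (- \<alpha>) \<alpha> *\<^sub>C (lE \<alpha> * ((lK (- \<alpha>) * lF \<beta>) * lK \<beta>))"
        by (simp only: mult.assoc sc_mult_left)
      also have "\<dots> \<approx> chr (- \<alpha>) \<alpha> *\<^sub>C (lE \<alpha> * ((chr \<alpha> \<beta> *\<^sub>C (lF \<beta> * lK (- \<alpha>))) * lK \<beta>))"
        using E_F_rel Q by (intro eqv_sc eqv_left eqv_right K_neg_F)
      also have "\<dots> = ?c *\<^sub>C (lE \<alpha> * (lF \<beta> * (lK (- \<alpha>) * lK \<beta>)))"
        using Q by (simp add: mult.assoc chr_uminus_left mult.commute del: mult_word sc_single)
      also have "\<dots> \<approx> ?c *\<^sub>C (lE \<alpha> * (lF \<beta> * ?X))" using Q by (intro eqv_sc eqv_left K_commute)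
      finally show ?thesis by (simp only: mult.assoc)
    qed
    have "lF \<beta> * lK \<beta> * (lK (- \<alpha>) * lE \<alpha>) - lK (- \<alpha>) * lE \<alpha> * (lF \<beta> * lK \<beta>)
       \<approx> ?c *\<^sub>C (lF \<beta> * lE \<alpha> * ?X) - ?c *\<^sub>C (lE \<alpha> * lF \<beta> * ?X)" by (intro eqv_diff 1 2)
    also have "\<dots> = (- ?c) *\<^sub>C ((lE \<alpha> * lF \<beta> - lF \<beta> * lE \<alpha>) * ?X)"
      by (simp add: left_diff_distrib sc_minus_one del: mult_word sc_single)
    also have "\<dots> \<approx> (- ?c) *\<^sub>C (?D * ?X)" using E_F_rel by (intro eqv_sc eqv_right E_F)
    also have "\<dots> \<approx> - ?D"
    proof (cases "\<alpha> = \<beta>")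
      case True
      have "(- ?c) *\<^sub>C (?D * ?X) = - (?D * (lK \<alpha> * lK (- \<alpha>)))" using True by (simp add: sc_minus_one del: mult_word sc_single)
      also have "\<dots> \<approx> - (?D * 1)"
        using eqv_diff[OF eqv_refl[of 0] eqv_left[OF K_inv'[OF Q(1)], of ?D]] by (simp del: mult_word sc_single)
      finally show ?thesis by simp
    qed simp
    finally have "lF \<beta> * lK \<beta> * (lK (- \<alpha>) * lE \<alpha>) - lK (- \<alpha>) * lE \<alpha> * (lF \<beta> * lK \<beta>) + ?D \<in> J"
      by (simp add: eqv_def del: mult_word sc_single)
    moreover have "word_antihom anti_ltr p =
        lF \<beta> * lK \<beta> * (lK (- \<alpha>) * lE \<alpha>) - lK (- \<alpha>) * lE \<alpha> * (lF \<beta> * lK \<beta>) + ?D"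
      unfolding E_F_rel(1) by (simp add: word_antihom_diff word_antihom_sc lmap_zero[OF lmap_word_antihom] del: mult_word sc_single)
    ultimately show ?thesis by simp
  qed
qed

text \<open>The antihomomorphism inverts the commutator parameters, \<open>qad_inverse\<close>
  restores them, and \<open>qad_twist\<close> removes the K-factors of the images. For F the image F
  K is first rewritten as a multiple of K F.\<close>

lemma anti_serre:
  assumes "\<alpha> \<in> S" "\<beta> \<in> S" "\<alpha> \<noteq> \<beta>" "X \<in> {E_gen, F_gen}" "serre_element X \<alpha> \<beta> \<in> J"
  shows "word_antihom anti_ltr (serre_element X \<alpha> \<beta>) \<in> J"
proof -
  obtain m where s: "\<And>X. serre_element X \<alpha> \<beta> = qad (chr \<alpha> \<beta>) (chr \<alpha> \<alpha>) (ltr (X \<alpha>)) (ltr (X \<beta>)) (Suc m)"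
    and inv: "\<And>a y :: 'w generator list \<Rightarrow>\<^sub>0 complex. qad (inverse (chr \<alpha> \<beta>)) (inverse (chr \<alpha> \<alpha>)) a y (Suc m)
       = qad (chr \<alpha> \<beta>) (chr \<alpha> \<alpha>) a y (Suc m)"
    using serre_exponent_Suc[OF assms(1-3)] by metis
  have Q: "\<alpha> \<in> Q" "\<beta> \<in> Q" using assms by (simp_all add: Q_closed)
  have sym: "chr \<beta> \<alpha> = chr \<alpha> \<beta>" using Q by (simp add: chr_sym)
  obtain c where c: "word_antihom anti_ltr (serre_element X \<alpha> \<beta>) =
      c *\<^sub>C qad (chr \<alpha> \<beta>) (chr \<alpha> \<alpha>) (anti_ltr (X \<alpha>)) (anti_ltr (X \<beta>)) (Suc m)"
    using word_antihom_qad[of "chr \<alpha> \<beta>" "chr \<alpha> \<alpha>" anti_ltr "ltr (X \<alpha>)" "ltr (X \<beta>)" "Suc m"] s inv by (auto simp del: qad.simps)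
  have tw: "qad (chr \<alpha> \<beta>) (chr \<alpha> \<alpha>) (g * ltr (X \<alpha>)) (h * ltr (X \<beta>)) (Suc m) \<in> J"
    if gh: "ltr (X \<alpha>) * g \<approx> chr \<alpha> \<alpha> *\<^sub>C (g * ltr (X \<alpha>))" "ltr (X \<alpha>) * h \<approx> chr \<alpha> \<beta> *\<^sub>C (h * ltr (X \<alpha>))"
      "ltr (X \<beta>) * g \<approx> chr \<alpha> \<beta> *\<^sub>C (g * ltr (X \<beta>))" "h * g \<approx> g * h" for g h
  proof -
    obtain d where "qad (chr \<alpha> \<beta>) (chr \<alpha> \<alpha>) (g * ltr (X \<alpha>)) (h * ltr (X \<beta>)) (Suc m) \<approx>
       d *\<^sub>C (g ^ Suc m * h * serre_element X \<alpha> \<beta>)"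
      unfolding s using qad_twist[OF gh] by blast
    also have "\<dots> \<approx> 0" unfolding eqv_zero_iff by (intro sc_mem left_mem assms)
    finally show ?thesis by (simp add: eqv_zero_iff)
  qed
  have "qad (chr \<alpha> \<beta>) (chr \<alpha> \<alpha>) (anti_ltr (X \<alpha>)) (anti_ltr (X \<beta>)) (Suc m) \<in> J"
  proof (cases "X = E_gen")
    case True
    have "qad (chr \<alpha> \<beta>) (chr \<alpha> \<alpha>) ((- 1) *\<^sub>C lK (- \<alpha>) * ltr (X \<alpha>)) ((- 1) *\<^sub>C lK (- \<beta>) * ltr (X \<beta>)) (Suc m) \<in> J"
      using E_K_neg[of \<alpha> \<alpha>] E_K_neg[of \<beta> \<alpha>] E_K_neg[of \<alpha> \<beta>] K_commute[of "- \<beta>" "- \<alpha>"] Q assms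
      unfolding True by (intro tw[unfolded True] commute_scaled commute_scaled2) (simp_all only: sym Q_closed)
    then show ?thesis unfolding True by (simp add: sc_minus_one del: mult_word sc_single qad.simps)
  next
    case False
    then have X: "X = F_gen" using assms by blast
    have swap: "anti_ltr (F_gen \<gamma>) \<approx> (- chr \<gamma> \<gamma>) *\<^sub>C lK \<gamma> * lF \<gamma>" if "\<gamma> \<in> S" for \<gamma>
      using eqv_sc[OF F_K[of \<gamma> \<gamma>], of "- 1"] that by (simp add: sc_minus_one Q_closed del: mult_word sc_single)
    have "qad (chr \<alpha> \<beta>) (chr \<alpha> \<alpha>) ((- chr \<alpha> \<alpha>) *\<^sub>C lK \<alpha> * ltr (X \<alpha>)) ((- chr \<beta> \<beta>) *\<^sub>C lK \<beta> * ltr (X \<beta>)) (Suc m) \<in> J"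
      using F_K[of \<alpha> \<alpha>] F_K[of \<beta> \<alpha>] F_K[of \<alpha> \<beta>] K_commute[of \<beta> \<alpha>] Q assms
      unfolding X by (intro tw[unfolded X] commute_scaled commute_scaled2) (simp_all only: sym Q_closed)
    then have "qad (chr \<alpha> \<beta>) (chr \<alpha> \<alpha>) ((- chr \<alpha> \<alpha>) *\<^sub>C lK \<alpha> * lF \<alpha>) ((- chr \<beta> \<beta>) *\<^sub>C lK \<beta> * lF \<beta>) (Suc m) \<approx> 0"
      unfolding eqv_zero_iff X .
    from eqv_trans[OF qad_cong[OF swap[OF assms(1)] swap[OF assms(2)]] this]
    show ?thesis unfolding X eqv_zero_iff .
  qed
  then show ?thesis unfolding c by (rule sc_mem)
qed

end

context qgroup
begin

text \<open>The only value of the antipode that is used. As \<open>antipode\<close> is read off from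
  a whole coset, even this value requires that the antihomomorphism respects every relation.\<close>

lemma antipode_K:
  assumes "\<mu> \<in> Q"
  shows "antipode (cl (lK \<mu>)) = cl (lK (- \<mu>))"
proof -
  interpret U: ring Uq by (rule ring_Uq)
  interpret C: qrel S form q ht cl_ideal by (rule qrel_cl_ideal)
  let ?g = "\<lambda>p. cl (word_antihom anti_ltr p)"
  let ?N = "{p. word_antihom anti_ltr p \<in> cl_ideal}"
  have N: "cong_ideal ?N"
    by unfold_locales
      (simp_all add: C.zero_mem C.add_mem C.left_mem C.right_mem lmap_zero[OF lmap_word_antihom] lmap_add[OF lmap_word_antihom])
  have "relations \<subseteq> ?N"
    using C.anti_base C.anti_serre[of _ _ E_gen] C.anti_serre[of _ _ F_gen] relations_cl_ideal
    unfolding relations_eq by blast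
  then have "antipode (cl (lK \<mu>)) = ?g (lK \<mu>)"
    unfolding antipode_def
  proof (rule induced_map_cl[OF _ N, rotated])
    fix x y assume "x - y \<in> ?N"
    then show "?g x = ?g y" by (simp add: cl_eq_iff_ideal word_antihom_diff)
  next
    show "lK \<mu> \<in> carrier (free_algebra generators)" using assms by simp
  next
    fix y assume y: "y \<in> carrier (free_algebra generators)"
    show "free_lift (opposite_algebra Uq) (case_generator (\<lambda>\<alpha>. \<ominus>\<^bsub>Uq\<^esub> (K (- \<alpha>) \<otimes>\<^bsub>Uq\<^esub> E \<alpha>))
        (\<lambda>\<alpha>. \<ominus>\<^bsub>Uq\<^esub> (F \<alpha> \<otimes>\<^bsub>Uq\<^esub> K \<alpha>)) (\<lambda>\<mu>. K (- \<mu>))) y = ?g y"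
    proof (rule free_lift_eq[OF opposite_abelian _ _ _ _ _ _ _ y])
      fix x :: "'w generator" assume "x \<in> generators"
      then show "?g (ltr x) = (case x of E_gen \<alpha> \<Rightarrow> \<ominus>\<^bsub>Uq\<^esub> (K (- \<alpha>) \<otimes>\<^bsub>Uq\<^esub> E \<alpha>)
          | F_gen \<alpha> \<Rightarrow> \<ominus>\<^bsub>Uq\<^esub> (F \<alpha> \<otimes>\<^bsub>Uq\<^esub> K \<alpha>) | K_gen \<mu> \<Rightarrow> K (- \<mu>))"
        by (cases x) (simp_all add: gen_eq Q_closed cl_uminus cl_mult del: mult_word)
    qed (simp_all add: opposite_algebra_def cl_zero cl_one cl_add cl_mult cl_sc lmap_zero[OF lmap_word_antihom]
        lmap_add[OF lmap_word_antihom] word_antihom_sc)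
  qed
  then show ?thesis by simp
qed

end

subsection \<open>The coproduct on representatives\<close>

text \<open>The embedding p \<mapsto> p \<otimes> 1 into functions on pairs of words;
  \<open>Rgt\<close> is the other embedding. Computations with the coproduct take place there,
  before any quotient is formed.\<close>

definition Lft :: "('x list \<Rightarrow>\<^sub>0 complex) \<Rightarrow> ('x list \<times> 'x list \<Rightarrow>\<^sub>0 complex)" where
  "Lft = lin (\<lambda>w. single (w, []) 1)"

definition Rgt :: "('x list \<Rightarrow>\<^sub>0 complex) \<Rightarrow> ('x list \<times> 'x list \<Rightarrow>\<^sub>0 complex)" where
  "Rgt = lin (\<lambda>w. single ([], w) 1)"

lemma lmap_Lft [intro!, simp]: "lmap Lft" by (simp add: Lft_def)
lemma lmap_Rgt [intro!, simp]: "lmap Rgt" by (simp add: Rgt_def)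

lemma mult_word_pair [simp]:
  "single (w, w') c * single (u, u') d = single (w @ u, w' @ u') (c * d :: complex)"
  by (simp add: mult_single plus_list_def)

lemma Lft_single: "Lft (single w c) = single (w, []) c" by (simp add: Lft_def)
lemma Rgt_single: "Rgt (single w c) = single ([], w) c" by (simp add: Rgt_def)

lemma one_word_pair: "(1 :: 'x list \<times> 'y list \<Rightarrow>\<^sub>0 complex) = single ([], []) 1"
  by (simp add: single_one[symmetric] zero_prod_def zero_list_def del: single_one)

lemma Lft_mult: "Lft (p * r) = Lft p * Lft r"
  by (rule lmap_mult_eqI) (auto simp: Lft_single plus_list_def)
lemma Rgt_mult: "Rgt (p * r) = Rgt p * Rgt r"
  by (rule lmap_mult_eqI) (auto simp: Rgt_single plus_list_def)
lemma Lft_one [simp]: "Lft 1 = 1" by (simp add: one_word one_word_pair Lft_single)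
lemma Rgt_one [simp]: "Rgt 1 = 1" by (simp add: one_word one_word_pair Rgt_single)

lemma Rgt_Lft: "Rgt r * Lft p = Lft p * Rgt r"
proof (rule lmap_eqI[OF lmap_comp[OF lmap_mult_left lmap_Lft] lmap_comp[OF lmap_mult_right lmap_Lft]])
  fix w
  show "Rgt r * Lft (single w 1) = Lft (single w 1) * Rgt r"
    by (rule lmap_eqI[OF lmap_comp[OF lmap_mult_right lmap_Rgt] lmap_comp[OF lmap_mult_left lmap_Rgt]])
      (simp add: Lft_single Rgt_single)
qed

lemma Rgt_Lft_assoc: "Rgt r * (Lft p * z) = Lft p * (Rgt r * z)"
  by (simp add: Rgt_Lft flip: mult.assoc)

lemma Lft_Rgt_single: "Lft (single w c) * Rgt (single u d) = single (w, u) (c * d)"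
  by (simp add: Lft_single Rgt_single)

context qgroup
begin

definition coprod_ltr :: "'w generator \<Rightarrow> ('w generator list \<times> 'w generator list \<Rightarrow>\<^sub>0 complex)" where
  "coprod_ltr x = (case x of E_gen \<alpha> \<Rightarrow> Lft (lE \<alpha>) + Lft (lK \<alpha>) * Rgt (lE \<alpha>)
     | F_gen \<alpha> \<Rightarrow> Lft (lF \<alpha>) * Rgt (lK (- \<alpha>)) + Rgt (lF \<alpha>)
     | K_gen \<mu> \<Rightarrow> Lft (lK \<mu>) * Rgt (lK \<mu>))"

lemma coprod_ltr_simps [simp]:
  "coprod_ltr (E_gen \<alpha>) = Lft (lE \<alpha>) + Lft (lK \<alpha>) * Rgt (lE \<alpha>)"
  "coprod_ltr (F_gen \<alpha>) = Lft (lF \<alpha>) * Rgt (lK (- \<alpha>)) + Rgt (lF \<alpha>)"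
  "coprod_ltr (K_gen \<mu>) = Lft (lK \<mu>) * Rgt (lK \<mu>)"
  by (simp_all add: coprod_ltr_def)

definition Dl :: "('w generator list \<Rightarrow>\<^sub>0 complex) \<Rightarrow> ('w generator list \<times> 'w generator list \<Rightarrow>\<^sub>0 complex)" where
  "Dl = word_hom coprod_ltr"

lemma lmap_Dl [intro!, simp]: "lmap Dl" by (simp add: Dl_def)
lemma Dl_mult: "Dl (p * r) = Dl p * Dl r" by (simp add: Dl_def)
lemma Dl_one [simp]: "Dl 1 = 1" by (simp add: Dl_def)
lemma Dl_ltr [simp]: "Dl (single [x] c) = c *\<^sub>C coprod_ltr x" by (simp add: Dl_def)

end

text \<open>The ideal J abstracts the kernel of the map to the tensor square of the quantum group:
  it absorbs the relations in either leg.\<close>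

locale qrel_tensor = I: qrel S form q ht I + J: cong_ideal J
  for S :: "'w::ab_group_add set" and form q ht and I :: "('w generator list \<Rightarrow>\<^sub>0 complex) set"
    and J :: "('w generator list \<times> 'w generator list \<Rightarrow>\<^sub>0 complex) set" +
  assumes Lft_mem: "p \<in> I \<Longrightarrow> Lft p \<in> J" and Rgt_mem: "p \<in> I \<Longrightarrow> Rgt p \<in> J"
begin

lemma Lft_eqv: "I.eqv p r \<Longrightarrow> J.eqv (Lft p) (Lft r)"
  using Lft_mem[of "p - r"] by (simp add: I.eqv_def J.eqv_def lmap_diff[OF lmap_Lft])

lemma Rgt_eqv: "I.eqv p r \<Longrightarrow> J.eqv (Rgt p) (Rgt r)"
  using Rgt_mem[of "p - r"] by (simp add: I.eqv_def J.eqv_def lmap_diff[OF lmap_Rgt])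

notation J.eqv (infix \<open>\<approx>\<close> 50)

lemma Lft_commute: "I.eqv (x * y) (c *\<^sub>C (y * x)) \<Longrightarrow> Lft x * Lft y \<approx> c *\<^sub>C (Lft y * Lft x)"
  using Lft_eqv[of "x * y" "c *\<^sub>C (y * x)"] by (simp only: Lft_mult lmap_sc[OF lmap_Lft])

lemma Rgt_commute: "I.eqv (x * y) (c *\<^sub>C (y * x)) \<Longrightarrow> Rgt x * Rgt y \<approx> c *\<^sub>C (Rgt y * Rgt x)"
  using Rgt_eqv[of "x * y" "c *\<^sub>C (y * x)"] by (simp only: Rgt_mult lmap_sc[OF lmap_Rgt])

lemma Dl_base: "p \<in> I.base_relations \<Longrightarrow> I.Dl p \<in> J"
proof -
  assume "p \<in> I.base_relations"
  then show ?thesis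
  proof cases
    case K_zero_rel
    have "Lft (I.lK 0) * Rgt (I.lK 0) \<approx> Lft 1 * Rgt 1"
      by (intro J.eqv_mult Lft_eqv Rgt_eqv I.K_zero)
    then show ?thesis using K_zero_rel by (simp add: J.eqv_def lmap_diff[OF I.lmap_Dl])
  next
    case (K_mult_rel \<mu> \<nu>)
    have "Lft (I.lK \<mu> * I.lK \<nu>) * Rgt (I.lK \<mu> * I.lK \<nu>) \<approx> Lft (I.lK (\<mu> + \<nu>)) * Rgt (I.lK (\<mu> + \<nu>))"
      using K_mult_rel by (intro J.eqv_mult Lft_eqv Rgt_eqv I.K_mult)
    then show ?thesis using K_mult_rel
      by (simp add: J.eqv_def lmap_diff[OF I.lmap_Dl] I.Dl_mult Lft_mult Rgt_mult mult.assoc Rgt_Lft_assoc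
          del: mult_word)
  next
    case (K_E_rel \<mu> \<alpha>)
    have "I.Dl (I.lK \<mu> * I.lE \<alpha> * I.lK (- \<mu>)) =
        Lft (I.lK \<mu> * I.lE \<alpha> * I.lK (- \<mu>)) * Rgt (I.lK \<mu> * I.lK (- \<mu>))
        + Lft (I.lK \<mu> * I.lK \<alpha> * I.lK (- \<mu>)) * Rgt (I.lK \<mu> * I.lE \<alpha> * I.lK (- \<mu>))"
      by (simp add: I.Dl_mult Lft_mult Rgt_mult distrib_left distrib_right mult.assoc Rgt_Lft_assoc Rgt_Lft del: mult_word)
    also have "\<dots> \<approx> Lft (I.chr \<mu> \<alpha> *\<^sub>C I.lE \<alpha>) * Rgt 1 + Lft (1 *\<^sub>C I.lK \<alpha>) * Rgt (I.chr \<mu> \<alpha> *\<^sub>C I.lE \<alpha>)"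
      using K_E_rel I.K_commute[of \<mu> \<alpha>]
      by (intro J.eqv_add J.eqv_mult Lft_eqv Rgt_eqv I.anti_K_conj I.K_E I.K_inv')
         (simp_all add: I.Q_closed del: mult_word)
    also have "\<dots> = I.Dl (I.chr \<mu> \<alpha> *\<^sub>C I.lE \<alpha>)"
      by (simp add: lmap_sc[OF lmap_Lft] lmap_sc[OF lmap_Rgt] lmap_sc[OF I.lmap_Dl] del: sc_single)
    finally show ?thesis using K_E_rel by (simp add: J.eqv_def lmap_diff[OF I.lmap_Dl] del: mult_word sc_single)
  next
    case (K_F_rel \<mu> \<alpha>)
    have "I.Dl (I.lK \<mu> * I.lF \<alpha> * I.lK (- \<mu>)) =
        Lft (I.lK \<mu> * I.lF \<alpha> * I.lK (- \<mu>)) * Rgt (I.lK \<mu> * I.lK (- \<alpha>) * I.lK (- \<mu>))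
        + Lft (I.lK \<mu> * I.lK (- \<mu>)) * Rgt (I.lK \<mu> * I.lF \<alpha> * I.lK (- \<mu>))"
      by (simp add: I.Dl_mult Lft_mult Rgt_mult distrib_left distrib_right mult.assoc Rgt_Lft_assoc Rgt_Lft del: mult_word)
    also have "\<dots> \<approx> Lft (inverse (I.chr \<mu> \<alpha>) *\<^sub>C I.lF \<alpha>) * Rgt (1 *\<^sub>C I.lK (- \<alpha>))
        + Lft 1 * Rgt (inverse (I.chr \<mu> \<alpha>) *\<^sub>C I.lF \<alpha>)"
      using K_F_rel I.K_commute[of \<mu> "- \<alpha>"]
      by (intro J.eqv_add J.eqv_mult Lft_eqv Rgt_eqv I.anti_K_conj I.K_F I.K_inv')
         (simp_all add: I.Q_closed del: mult_word)
    also have "\<dots> = I.Dl (inverse (I.chr \<mu> \<alpha>) *\<^sub>C I.lF \<alpha>)"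
      by (simp add: lmap_sc[OF lmap_Lft] lmap_sc[OF lmap_Rgt] lmap_sc[OF I.lmap_Dl] del: sc_single)
    finally show ?thesis using K_F_rel by (simp add: J.eqv_def lmap_diff[OF I.lmap_Dl] del: mult_word sc_single)
  next
    case (E_F_rel \<alpha> \<beta>)
    have Q: "\<alpha> \<in> I.Q" "\<beta> \<in> I.Q" using E_F_rel by (simp_all add: I.Q_closed)
    let ?D = "\<lambda>x y. if \<alpha> = \<beta> then I.dco \<alpha> *\<^sub>C (x - y) else 0"
    let ?E1 = "Lft (I.lE \<alpha>)" and ?E2 = "Rgt (I.lE \<alpha>)" and ?F1 = "Lft (I.lF \<beta>)" and ?F2 = "Rgt (I.lF \<beta>)"
    let ?Ka = "Lft (I.lK \<alpha>)" and ?Kb = "Rgt (I.lK (- \<beta>))"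
    \<comment> \<open>The mixed terms of the commutator of the two coproducts cancel: passing K by F
      in the first leg and E by K in the second gives mutually inverse scalars.\<close>
    have comm: "?Ka * ?F1 * (?E2 * ?Kb) \<approx> ?F1 * ?Ka * (?Kb * ?E2)"
    proof -
      have "?Ka * ?F1 * (?E2 * ?Kb) \<approx> (inverse (I.chr \<alpha> \<beta>) *\<^sub>C (?F1 * ?Ka)) * (I.chr \<beta> \<alpha> *\<^sub>C (?Kb * ?E2))"
        using E_F_rel Q by (intro J.eqv_mult Lft_commute Rgt_commute I.K_F I.E_K_neg)
      also have "\<dots> = ?F1 * ?Ka * (?Kb * ?E2)" using Q by (simp add: I.chr_sym[of \<beta> \<alpha>])
      finally show ?thesis .
    qed
    have e1: "I.Dl (I.lE \<alpha> * I.lF \<beta> - I.lF \<beta> * I.lE \<alpha>) =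
        Lft (I.lE \<alpha> * I.lF \<beta> - I.lF \<beta> * I.lE \<alpha>) * ?Kb + (?Ka * ?F1 * (?E2 * ?Kb) - ?F1 * ?Ka * (?Kb * ?E2))
        + ?Ka * Rgt (I.lE \<alpha> * I.lF \<beta> - I.lF \<beta> * I.lE \<alpha>)"
      by (simp add: lmap_diff[OF I.lmap_Dl] lmap_diff[OF lmap_Lft] lmap_diff[OF lmap_Rgt] I.Dl_mult
          Lft_mult Rgt_mult Rgt_Lft_assoc Rgt_Lft algebra_simps del: mult_word)
    have e2: "Lft (I.lE \<alpha> * I.lF \<beta> - I.lF \<beta> * I.lE \<alpha>) * ?Kb + (?Ka * ?F1 * (?E2 * ?Kb) - ?F1 * ?Ka * (?Kb * ?E2))
        + ?Ka * Rgt (I.lE \<alpha> * I.lF \<beta> - I.lF \<beta> * I.lE \<alpha>) \<approx>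
      Lft (?D (I.lK \<alpha>) (I.lK (- \<alpha>))) * ?Kb + (?F1 * ?Ka * (?Kb * ?E2) - ?F1 * ?Ka * (?Kb * ?E2))
        + ?Ka * Rgt (?D (I.lK \<alpha>) (I.lK (- \<alpha>)))"
      using E_F_rel
      by (intro J.eqv_add[OF J.eqv_add[OF J.eqv_right[OF Lft_eqv[OF I.E_F]] J.eqv_diff[OF comm J.eqv_refl]]
            J.eqv_left[OF Rgt_eqv[OF I.E_F]]])
    have e3: "Lft (?D (I.lK \<alpha>) (I.lK (- \<alpha>))) * ?Kb + (?F1 * ?Ka * (?Kb * ?E2) - ?F1 * ?Ka * (?Kb * ?E2))
        + ?Ka * Rgt (?D (I.lK \<alpha>) (I.lK (- \<alpha>))) = I.Dl (?D (I.lK \<alpha>) (I.lK (- \<alpha>)))"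
      by (simp add: lmap_diff[OF I.lmap_Dl] lmap_diff[OF lmap_Lft] lmap_diff[OF lmap_Rgt]
          lmap_sc[OF I.lmap_Dl] lmap_sc[OF lmap_Lft] lmap_sc[OF lmap_Rgt] lmap_zero[OF I.lmap_Dl]
          lmap_zero[OF lmap_Lft] lmap_zero[OF lmap_Rgt] algebra_simps del: sc_single)
    from J.eqv_trans[OF J.eqv_eq[OF e1] J.eqv_trans[OF e2 J.eqv_eq[OF e3]]] show ?thesis unfolding E_F_rel(1) J.eqv_def lmap_diff[OF I.lmap_Dl, symmetric] .
  qed
qed

text \<open>Both summands of the coproduct of a letter q-commute with the parameters needed in
  \<open>qad_sum_mem\<close>. The Serre element of each summand lies in J, one directly and the
  other after removing K-factors with \<open>qad_twist\<close>.\<close>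

lemma Dl_serre:
  assumes "\<alpha> \<in> S" "\<beta> \<in> S" "\<alpha> \<noteq> \<beta>" "X \<in> {E_gen, F_gen}" "I.serre_element X \<alpha> \<beta> \<in> I"
  shows "I.Dl (I.serre_element X \<alpha> \<beta>) \<in> J"
proof -
  obtain m where tp: "(I.chr \<alpha> \<beta>)\<^sup>2 * I.chr \<alpha> \<alpha> ^ m = 1"
    and s: "\<And>X. I.serre_element X \<alpha> \<beta> = qad (I.chr \<alpha> \<beta>) (I.chr \<alpha> \<alpha>) (ltr (X \<alpha>)) (ltr (X \<beta>)) (Suc m)"
    using I.serre_exponent_Suc[OF assms(1-3)] by metis
  let ?qad = "\<lambda>a y :: 'w generator list \<times> 'w generator list \<Rightarrow>\<^sub>0 complex. qad (I.chr \<alpha> \<beta>) (I.chr \<alpha> \<alpha>) a y (Suc m)"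
  have Q: "\<alpha> \<in> I.Q" "\<beta> \<in> I.Q" using assms by (simp_all add: I.Q_closed)
  have sym: "I.chr \<beta> \<alpha> = I.chr \<alpha> \<beta>" using Q by (simp add: I.chr_sym)
  have D: "I.Dl (I.serre_element X \<alpha> \<beta>) = ?qad (I.coprod_ltr (X \<alpha>)) (I.coprod_ltr (X \<beta>))"
    unfolding s by (subst lmap_qad[OF I.lmap_Dl I.Dl_mult]) simp
  have L: "?qad (Lft (ltr (X \<alpha>))) (Lft (ltr (X \<beta>))) \<in> J"
    using Lft_mem[OF assms(5)] unfolding s by (subst (asm) lmap_qad[OF lmap_Lft Lft_mult])
  have R: "?qad (Rgt (ltr (X \<alpha>))) (Rgt (ltr (X \<beta>))) \<in> J"
    using Rgt_mem[OF assms(5)] unfolding s by (subst (asm) lmap_qad[OF lmap_Rgt Rgt_mult])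
  have tw: "?qad (g * a) (h * y) \<in> J"
    if "?qad a y \<in> J" "a * g = g * a" "a * h = h * a" "y * g = g * y" "h * g \<approx> g * h" for a y g h
  proof -
    have "a * g \<approx> 1 *\<^sub>C (g * a)" "a * h \<approx> 1 *\<^sub>C (h * a)" "y * g \<approx> 1 *\<^sub>C (g * y)"
      using that by simp_all
    from J.qad_twist[OF this that(5)]
    obtain d where "?qad (g * a) (h * y) \<approx> d *\<^sub>C (g ^ Suc m * h * ?qad a y)" by blast
    also have "\<dots> \<approx> 0" unfolding J.eqv_zero_iff by (intro J.sc_mem J.left_mem that)
    finally show ?thesis by (simp add: J.eqv_zero_iff)
  qed
  show ?thesis
  proof (cases "X = E_gen")
    case True
    show ?thesis unfolding D unfolding True I.coprod_ltr_simps
    proof (rule J.qad_sum_mem[OF _ _ _ tp L[unfolded True]])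
      show "?qad (Lft (I.lK \<alpha>) * Rgt (I.lE \<alpha>)) (Lft (I.lK \<beta>) * Rgt (I.lE \<beta>)) \<in> J"
        by (rule tw[OF R[unfolded True]])
          (use Lft_eqv[OF I.K_commute[OF Q(2,1)]] in \<open>simp_all add: Rgt_Lft Lft_mult del: mult_word\<close>)
      have *: "Lft (I.lK \<mu>) * Rgt (I.lE \<mu>) * Lft (I.lE \<gamma>) \<approx> I.chr \<mu> \<gamma> *\<^sub>C (Lft (I.lE \<gamma>) * (Lft (I.lK \<mu>) * Rgt (I.lE \<mu>)))"
        if "\<mu> \<in> I.Q" "\<gamma> \<in> S" for \<mu> \<gamma>
        using J.eqv_right[OF Lft_commute[OF I.K_E[OF that]], of "Rgt (I.lE \<mu>)"]
        by (simp add: mult.assoc Rgt_Lft del: mult_word)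
      show "Lft (I.lK \<alpha>) * Rgt (I.lE \<alpha>) * Lft (I.lE \<alpha>) \<approx> I.chr \<alpha> \<alpha> *\<^sub>C (Lft (I.lE \<alpha>) * (Lft (I.lK \<alpha>) * Rgt (I.lE \<alpha>)))"
        "Lft (I.lK \<alpha>) * Rgt (I.lE \<alpha>) * Lft (I.lE \<beta>) \<approx> I.chr \<alpha> \<beta> *\<^sub>C (Lft (I.lE \<beta>) * (Lft (I.lK \<alpha>) * Rgt (I.lE \<alpha>)))"
        "Lft (I.lK \<beta>) * Rgt (I.lE \<beta>) * Lft (I.lE \<alpha>) \<approx> I.chr \<alpha> \<beta> *\<^sub>C (Lft (I.lE \<alpha>) * (Lft (I.lK \<beta>) * Rgt (I.lE \<beta>)))"
        using *[of \<alpha> \<alpha>] *[of \<alpha> \<beta>] *[of \<beta> \<alpha>] Q assms by (simp_all only: sym)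
    qed
  next
    case False
    then have X: "X = F_gen" using assms by blast
    \<comment> \<open>The summands are exchanged because \<open>qad_sum_mem\<close> is asymmetric:
      for F it is the summand with the K-factor that must be moved past 1 \<otimes> F.\<close>
    have swap: "Lft (I.lF \<gamma>) * Rgt (I.lK (- \<gamma>)) + Rgt (I.lF \<gamma>) = Rgt (I.lF \<gamma>) + Rgt (I.lK (- \<gamma>)) * Lft (I.lF \<gamma>)" for \<gamma>
      by (simp add: Rgt_Lft add.commute)
    show ?thesis unfolding D unfolding X I.coprod_ltr_simps swap
    proof (rule J.qad_sum_mem[OF _ _ _ tp R[unfolded X]])
      show "?qad (Rgt (I.lK (- \<alpha>)) * Lft (I.lF \<alpha>)) (Rgt (I.lK (- \<beta>)) * Lft (I.lF \<beta>)) \<in> J"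
        by (rule tw[OF L[unfolded X]])
          (use Rgt_eqv[OF I.K_commute[OF I.Q_uminus[OF Q(2)] I.Q_uminus[OF Q(1)]]] in \<open>simp_all add: Rgt_Lft Rgt_mult del: mult_word\<close>)
      have *: "Rgt (I.lK (- \<mu>)) * Lft (I.lF \<mu>) * Rgt (I.lF \<gamma>) \<approx> I.chr \<mu> \<gamma> *\<^sub>C (Rgt (I.lF \<gamma>) * (Rgt (I.lK (- \<mu>)) * Lft (I.lF \<mu>)))"
        if "\<mu> \<in> I.Q" "\<gamma> \<in> S" for \<mu> \<gamma>
        using J.eqv_left[OF Rgt_commute[OF I.K_neg_F[OF that]], of "Lft (I.lF \<mu>)"]
        by (simp add: mult.assoc Rgt_Lft Rgt_Lft_assoc del: mult_word)
      show "Rgt (I.lK (- \<alpha>)) * Lft (I.lF \<alpha>) * Rgt (I.lF \<alpha>) \<approx> I.chr \<alpha> \<alpha> *\<^sub>C (Rgt (I.lF \<alpha>) * (Rgt (I.lK (- \<alpha>)) * Lft (I.lF \<alpha>)))"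
        "Rgt (I.lK (- \<alpha>)) * Lft (I.lF \<alpha>) * Rgt (I.lF \<beta>) \<approx> I.chr \<alpha> \<beta> *\<^sub>C (Rgt (I.lF \<beta>) * (Rgt (I.lK (- \<alpha>)) * Lft (I.lF \<alpha>)))"
        "Rgt (I.lK (- \<beta>)) * Lft (I.lF \<beta>) * Rgt (I.lF \<alpha>) \<approx> I.chr \<alpha> \<beta> *\<^sub>C (Rgt (I.lF \<alpha>) * (Rgt (I.lK (- \<beta>)) * Lft (I.lF \<beta>)))"
        using *[of \<alpha> \<alpha>] *[of \<alpha> \<beta>] *[of \<beta> \<alpha>] Q assms by (simp_all only: sym)
    qed
  qed
qed

end

subsection \<open>The tensor square\<close>

context qgroup
begin

abbreviation UU where "UU \<equiv> Uq \<times>\<times> Uq"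
abbreviation bil where "bil \<equiv> bilinear_relations Uq Uq"
abbreviation TU where "TU \<equiv> tensor_algebra Uq Uq"

lemma UU_monoid: "monoid UU"
proof -
  interpret U: ring Uq by (rule ring_Uq)
  show ?thesis by (intro DirProd_monoid U.monoid_axioms)
qed

lemma bil_carrier: "bil \<subseteq> carrier (monoid_algebra UU)"
proof -
  interpret U: ring Uq by (rule ring_Uq)
  define V where "V = carrier (monoid_algebra UU)"
  have V: "lsub V" by (simp only: V_def lsub_carrier_monoid_algebra)
  have s: "single (a, b) c \<in> V" if "a \<in> carrier Uq" "b \<in> carrier Uq" for a b c
    using that by (simp add: V_def)
  have sm: "c \<odot>\<^bsub>Uq\<^esub> a \<in> carrier Uq" if "a \<in> carrier Uq" for a c
    using that carrier_Uq by (auto simp flip: cl_sc)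
  show ?thesis unfolding bilinear_relations_def Let_def V_def[symmetric]
    by (auto intro!: lsub_diff[OF V] s sm)
qed

lemma TU_quotient: "monoid_algebra_quotient UU bil"
  unfolding monoid_algebra_quotient_def monoid_algebra_quotient_axioms_def
  using UU_monoid bil_carrier by blast

text \<open>The tensor square is a quotient of the formal combinations of pairs of classes; this is
  the passage from pairs of words to such combinations.\<close>

definition khat :: "('w generator list \<times> 'w generator list \<Rightarrow>\<^sub>0 complex) \<Rightarrow> _" where
  "khat = lin (\<lambda>(w, w'). single (cl (single w 1), cl (single w' 1)) 1)"

definition kap :: "('w generator list \<times> 'w generator list \<Rightarrow>\<^sub>0 complex) \<Rightarrow> _" where
  "kap z = quotient_class (monoid_algebra UU) bil (khat z)"

lemma lmap_khat [intro!, simp]: "lmap khat" by (simp add: khat_def)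

lemma khat_carrier: "khat z \<in> carrier (monoid_algebra UU)"
proof -
  have "keys (khat z) \<subseteq> carrier UU"
    using keys_lin[of "\<lambda>(w, w'). single (cl (single w 1), cl (single w' 1)) 1" z]
    unfolding khat_def by (fastforce split: prod.splits)
  then show ?thesis by simp
qed

lemma khat_mult: "khat (z * z') = khat z \<otimes>\<^bsub>monoid_algebra UU\<^esub> khat z'"
proof -
  let ?m = "\<lambda>x y. x \<otimes>\<^bsub>monoid_algebra UU\<^esub> y"
  have l1: "lmap (\<lambda>x. ?m x y)" for y by (simp add: monoid_algebra_mult)
  have l2: "lmap (\<lambda>y. ?m x y)" for x
    by (simp add: monoid_algebra_mult lmap_def lin_fun_add lin_fun_sc)
  show ?thesis
    by (rule lmap2_eqI[of "\<lambda>z z'. khat (z * z')" "\<lambda>z z'. ?m (khat z) (khat z')",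
          OF lmap_comp[OF lmap_khat lmap_mult_right] lmap_comp[OF lmap_khat lmap_mult_left]
            lmap_comp[OF l1 lmap_khat] lmap_comp[OF l2 lmap_khat]])
      (auto simp: khat_def monoid_algebra_mult mult_single plus_list_def cl_mult[symmetric])
qed

lemma kap_add: "kap (z + z') = kap z \<oplus>\<^bsub>TU\<^esub> kap z'"
proof -
  interpret T: monoid_algebra_quotient UU bil by (rule TU_quotient)
  show ?thesis using T.cls_add[OF khat_carrier khat_carrier, of z z']
    by (simp add: kap_def tensor_algebra_def lmap_add[OF lmap_khat])
qed

lemma kap_mult: "kap (z * z') = kap z \<otimes>\<^bsub>TU\<^esub> kap z'"
proof -
  interpret T: monoid_algebra_quotient UU bil by (rule TU_quotient)
  show ?thesis using T.cls_mult[OF khat_carrier khat_carrier, of z z']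
    by (simp add: kap_def tensor_algebra_def khat_mult)
qed

lemma kap_sc: "kap (c *\<^sub>C z) = c \<odot>\<^bsub>TU\<^esub> kap z"
proof -
  interpret T: monoid_algebra_quotient UU bil by (rule TU_quotient)
  show ?thesis using T.cls_sc[OF khat_carrier, of c z]
    by (simp add: kap_def tensor_algebra_def lmap_sc[OF lmap_khat])
qed

lemma kap_zero: "kap 0 = \<zero>\<^bsub>TU\<^esub>"
proof -
  interpret T: monoid_algebra_quotient UU bil by (rule TU_quotient)
  show ?thesis using T.cls_zero by (simp add: kap_def tensor_algebra_def lmap_zero[OF lmap_khat])
qed

lemma kap_one: "kap 1 = \<one>\<^bsub>TU\<^esub>"
proof -
  interpret T: monoid_algebra_quotient UU bil by (rule TU_quotient)
  show ?thesis using T.cls_one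
    by (simp add: kap_def tensor_algebra_def one_word_pair khat_def cl_one flip: one_word)
qed

lemma ring_TU: "ring TU"
proof -
  interpret T: monoid_algebra_quotient UU bil by (rule TU_quotient)
  show ?thesis using T.ring_MQ by (simp add: tensor_algebra_def)
qed

lemma kap_closed: "kap z \<in> carrier TU"
proof -
  interpret T: monoid_algebra_quotient UU bil by (rule TU_quotient)
  show ?thesis using T.cls_closed[OF khat_carrier, of z] by (simp add: kap_def tensor_algebra_def)
qed

text \<open>The bilinearity relations make both sides bilinear in p and r, so the comparison reduces
  to words, where it is immediate.\<close>

lemma pure_tensor_eq: "cl p \<otimes>\<^sub>U cl r = kap (Lft p * Rgt r)"
proof -
  interpret T: monoid_algebra_quotient UU bil by (rule TU_quotient)
  interpret TR: ring TU by (rule ring_TU)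
  have sc: "single (a, b) c \<in> carrier T.MA" if "a \<in> carrier Uq" "b \<in> carrier Uq" for a b c
    using that by simp
  have eqI: "T.cls x = T.cls y" if "x \<in> carrier T.MA" "y \<in> carrier T.MA" "x - y \<in> bil" for x y
    using that T.cls_eq_iff T.R_subset_Idl by blast
  have plus1: "cl (p + p') \<otimes>\<^sub>U cl r = (cl p \<otimes>\<^sub>U cl r) \<oplus>\<^bsub>TU\<^esub> (cl p' \<otimes>\<^sub>U cl r)" for p p' r
  proof -
    have "single (cl (p + p'), cl r) 1 - (single (cl p, cl r) 1 + single (cl p', cl r) 1) \<in> bil"
      unfolding bilinear_relations_def Let_def diff_diff_eq[symmetric] cl_add
      using cl_closed by blast
    from eqI[OF _ _ this] show ?thesis
      using T.cls_add[of "single (cl p, cl r) 1" "single (cl p', cl r) 1"]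
        lsub_add[OF lsub_carrier_monoid_algebra, OF sc sc]
      by (simp add: pure_tensor_def tensor_algebra_def)
  qed
  have plus2: "cl r \<otimes>\<^sub>U cl (p + p') = (cl r \<otimes>\<^sub>U cl p) \<oplus>\<^bsub>TU\<^esub> (cl r \<otimes>\<^sub>U cl p')" for p p' r
  proof -
    have "single (cl r, cl (p + p')) 1 - (single (cl r, cl p) 1 + single (cl r, cl p') 1) \<in> bil"
      unfolding bilinear_relations_def Let_def diff_diff_eq[symmetric] cl_add
      using cl_closed by blast
    from eqI[OF _ _ this] show ?thesis
      using T.cls_add[of "single (cl r, cl p) 1" "single (cl r, cl p') 1"]
        lsub_add[OF lsub_carrier_monoid_algebra, OF sc sc]
      by (simp add: pure_tensor_def tensor_algebra_def)
  qed
  have sc1: "cl (c *\<^sub>C p) \<otimes>\<^sub>U cl r = c \<odot>\<^bsub>TU\<^esub> (cl p \<otimes>\<^sub>U cl r)" for c p r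
  proof -
    have "single (cl (c *\<^sub>C p), cl r) 1 - single (cl p, cl r) c \<in> bil"
      unfolding bilinear_relations_def Let_def cl_sc using cl_closed by blast
    from eqI[OF _ _ this] show ?thesis
      using T.cls_sc[of "single (cl p, cl r) 1" c]
      by (simp add: pure_tensor_def tensor_algebra_def)
  qed
  have sc2: "cl r \<otimes>\<^sub>U cl (c *\<^sub>C p) = c \<odot>\<^bsub>TU\<^esub> (cl r \<otimes>\<^sub>U cl p)" for c p r
  proof -
    have "single (cl r, cl (c *\<^sub>C p)) 1 - single (cl r, cl p) c \<in> bil"
      unfolding bilinear_relations_def Let_def cl_sc using cl_closed by blast
    from eqI[OF _ _ this] show ?thesis
      using T.cls_sc[of "single (cl r, cl p) 1" c]
      by (simp add: pure_tensor_def tensor_algebra_def)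
  qed
  have k: "kap (0 *\<^sub>C z) = 0 \<odot>\<^bsub>TU\<^esub> kap z" for z by (rule kap_sc)
  have pt_closed: "cl p \<otimes>\<^sub>U cl r \<in> carrier TU" for p r
    using T.cls_closed[OF sc[OF cl_closed cl_closed], of p r 1] by (simp add: pure_tensor_def tensor_algebra_def)
  have zero1: "cl 0 \<otimes>\<^sub>U cl r = \<zero>\<^bsub>TU\<^esub>" for r
    using plus1[of 0 0 r] pt_closed[of 0 r] by simp
  have zero2: "cl r \<otimes>\<^sub>U cl 0 = \<zero>\<^bsub>TU\<^esub>" for r
    using plus2[of r 0 0] pt_closed[of r 0] by simp
  have word: "cl (single w 1) \<otimes>\<^sub>U cl (single u 1) = kap (Lft (single w 1) * Rgt (single u 1))" for w u
    by (simp add: pure_tensor_def kap_def khat_def Lft_Rgt_single)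
  have D2: "cl (single w 1) \<otimes>\<^sub>U cl r = kap (Lft (single w 1) * Rgt r)" for w r
  proof -
    have "lsub {r. cl (single w 1) \<otimes>\<^sub>U cl r = kap (Lft (single w 1) * Rgt r)}"
      by (simp add: lsub_def zero2 plus2 sc2 kap_zero kap_add kap_sc lmap_zero[OF lmap_Rgt]
          lmap_add[OF lmap_Rgt] lmap_sc[OF lmap_Rgt] distrib_left)
    from lsub_lin[OF this, of r "\<lambda>u. single u 1"] word show ?thesis by simp
  qed
  have "lsub {p. cl p \<otimes>\<^sub>U cl r = kap (Lft p * Rgt r)}"
    by (simp add: lsub_def zero1 plus1 sc1 kap_zero kap_add kap_sc lmap_zero[OF lmap_Lft]
        lmap_add[OF lmap_Lft] lmap_sc[OF lmap_Lft] distrib_right)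
  from lsub_lin[OF this, of p "\<lambda>w. single w 1"] D2 show ?thesis by simp
qed

definition kap_ideal where "kap_ideal = {z. kap z = \<zero>\<^bsub>TU\<^esub>}"

lemma cong_ideal_kap_ideal: "cong_ideal kap_ideal"
proof -
  interpret TR: ring TU by (rule ring_TU)
  show ?thesis by unfold_locales (simp_all add: kap_ideal_def kap_zero kap_add kap_mult kap_closed)
qed

lemma qrel_tensor_kap: "qrel_tensor S form q ht cl_ideal kap_ideal"
proof -
  interpret C: qrel S form q ht cl_ideal by (rule qrel_cl_ideal)
  interpret J: cong_ideal kap_ideal by (rule cong_ideal_kap_ideal)
  show ?thesis
  proof unfold_locales
    fix p assume "p \<in> cl_ideal"
    then have "cl p = cl 0" by (simp add: cl_ideal_def cl_zero)
    then have "cl p \<otimes>\<^sub>U cl 1 = cl 0 \<otimes>\<^sub>U cl 1" "cl 1 \<otimes>\<^sub>U cl p = cl 1 \<otimes>\<^sub>U cl 0" by simp_all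
    then show "Lft p \<in> kap_ideal" "Rgt p \<in> kap_ideal"
      unfolding pure_tensor_eq by (simp_all add: kap_ideal_def kap_zero lmap_zero[OF lmap_Lft] lmap_zero[OF lmap_Rgt])
  qed
qed

lemma coproduct_eq:
  assumes "p \<in> carrier (free_algebra generators)"
  shows "coproduct (cl p) = kap (Dl p)"
proof -
  interpret TR: ring TU by (rule ring_TU)
  interpret QT: qrel_tensor S form q ht cl_ideal kap_ideal by (rule qrel_tensor_kap)
  let ?g = "\<lambda>p. kap (Dl p)"
  let ?N = "{p. Dl p \<in> kap_ideal}"
  have N: "cong_ideal ?N"
    by unfold_locales
      (simp_all add: QT.J.zero_mem QT.J.add_mem QT.J.left_mem QT.J.right_mem lmap_zero[OF lmap_Dl]
        lmap_add[OF lmap_Dl] Dl_mult)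
  have "relations \<subseteq> ?N"
    using QT.Dl_base QT.Dl_serre[of _ _ E_gen] QT.Dl_serre[of _ _ F_gen] relations_cl_ideal
    unfolding relations_eq by blast
  then show "coproduct (cl p) = ?g p"
    unfolding coproduct_def
  proof (rule induced_map_cl[OF _ N, rotated])
    fix x y assume "x - y \<in> ?N"
    then have "kap (Dl (x - y) + Dl y) = kap (Dl y)"
      by (simp add: kap_ideal_def kap_add kap_closed)
    then show "?g x = ?g y" by (simp add: lmap_diff[OF lmap_Dl])
  next
    fix y assume y: "y \<in> carrier (free_algebra generators)"
    show "free_lift TU (case_generator (\<lambda>\<alpha>. E \<alpha> \<otimes>\<^sub>U \<one>\<^bsub>Uq\<^esub> \<oplus>\<^bsub>TU\<^esub> K \<alpha> \<otimes>\<^sub>U E \<alpha>)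
        (\<lambda>\<alpha>. F \<alpha> \<otimes>\<^sub>U K (- \<alpha>) \<oplus>\<^bsub>TU\<^esub> \<one>\<^bsub>Uq\<^esub> \<otimes>\<^sub>U F \<alpha>) (\<lambda>\<mu>. K \<mu> \<otimes>\<^sub>U K \<mu>)) y = ?g y"
    proof (rule free_lift_eq[OF TR.abelian_monoid_axioms _ _ _ _ _ _ _ y])
      fix x :: "'w generator" assume "x \<in> generators"
      then show "?g (ltr x) = (case x of E_gen \<alpha> \<Rightarrow> E \<alpha> \<otimes>\<^sub>U \<one>\<^bsub>Uq\<^esub> \<oplus>\<^bsub>TU\<^esub> K \<alpha> \<otimes>\<^sub>U E \<alpha>
          | F_gen \<alpha> \<Rightarrow> F \<alpha> \<otimes>\<^sub>U K (- \<alpha>) \<oplus>\<^bsub>TU\<^esub> \<one>\<^bsub>Uq\<^esub> \<otimes>\<^sub>U F \<alpha> | K_gen \<mu> \<Rightarrow> K \<mu> \<otimes>\<^sub>U K \<mu>)"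
        by (cases x) (simp_all add: gen_eq Q_closed pure_tensor_eq kap_add flip: cl_one)
    qed (simp_all add: kap_zero kap_one kap_add kap_mult kap_sc kap_closed lmap_zero[OF lmap_Dl]
        lmap_add[OF lmap_Dl] lmap_sc[OF lmap_Dl] Dl_mult)
  qed (rule assms)
qed

end

subsection \<open>Contracting the coproduct with functionals\<close>

context qgroup
begin

text \<open>A linear functional on the quantum group, written on representatives.\<close>

definition functional :: "(('w generator list \<Rightarrow>\<^sub>0 complex) \<Rightarrow> complex) \<Rightarrow> bool" where
  "functional \<phi> \<longleftrightarrow> (\<forall>x y. \<phi> (x + y) = \<phi> x + \<phi> y) \<and> (\<forall>c x. \<phi> (c *\<^sub>C x) = c * \<phi> x) \<and>
     (\<forall>x y. cl x = cl y \<longrightarrow> \<phi> x = \<phi> y)"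

lemma functional_add: "functional \<phi> \<Longrightarrow> \<phi> (x + y) = \<phi> x + \<phi> y" unfolding functional_def by blast
lemma functional_sc: "functional \<phi> \<Longrightarrow> \<phi> (c *\<^sub>C x) = c * \<phi> x" unfolding functional_def by blast
lemma functional_cl: "functional \<phi> \<Longrightarrow> cl x = cl y \<Longrightarrow> \<phi> x = \<phi> y" unfolding functional_def by blast
lemma functional_left: "functional \<phi> \<Longrightarrow> functional (\<lambda>p. \<phi> (a * p))"
  by (auto simp: functional_def distrib_left cl_mult intro: functional_cl[of \<phi>])

definition contract ::
  "(('w generator list \<Rightarrow>\<^sub>0 complex) \<Rightarrow> complex) \<Rightarrow> ('w generator list \<times> 'w generator list \<Rightarrow>\<^sub>0 complex) \<Rightarrow>
   ('w generator list \<Rightarrow>\<^sub>0 complex)" where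
  "contract \<phi> = lin (\<lambda>(w, w'). single w (\<phi> (single w' 1)))"

lemma lmap_contract [intro!, simp]: "lmap (contract \<phi>)" by (simp add: contract_def)

lemma contract_Lft: "contract \<phi> (Lft a * z) = a * contract \<phi> z"
proof (rule lmap_eqI[OF lmap_comp[OF lmap_contract lmap_mult_left] lmap_comp[OF lmap_mult_left lmap_contract]])
  fix k :: "'w generator list \<times> 'w generator list"
  obtain w w' where k: "k = (w, w')" by (cases k)
  show "contract \<phi> (Lft a * single k 1) = a * contract \<phi> (single k 1)"
    unfolding k
    by (rule lmap_eqI[OF lmap_comp[OF lmap_comp[OF lmap_contract lmap_mult_right] lmap_Lft] lmap_mult_right])
      (simp add: Lft_single contract_def)
qed

lemma contract_Rgt:
  assumes "functional \<phi>"
  shows "contract \<phi> (Rgt b * z) = contract (\<lambda>p. \<phi> (b * p)) z"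
proof (rule lmap_eqI[OF lmap_comp[OF lmap_contract lmap_mult_left] lmap_contract])
  fix k :: "'w generator list \<times> 'w generator list"
  obtain w w' where k: "k = (w, w')" by (cases k)
  have "lmap (\<lambda>b. single w (\<phi> (b * single w' 1)))"
    by (rule lmapI) (simp_all add: distrib_right functional_add[OF assms] functional_sc[OF assms] single_add)
  from lmap_eqI[OF lmap_comp[OF lmap_comp[OF lmap_contract lmap_mult_right] lmap_Rgt] this]
  show "contract \<phi> (Rgt b * single k 1) = contract (\<lambda>p. \<phi> (b * p)) (single k 1)"
    unfolding k by (simp add: Rgt_single contract_def)
qed

text \<open>\<open>TD \<phi>\<close> is \<open>(id \<otimes> \<phi>) \<Delta>\<close> on representatives.\<close>

definition TD :: "(('w generator list \<Rightarrow>\<^sub>0 complex) \<Rightarrow> complex) \<Rightarrow> ('w generator list \<Rightarrow>\<^sub>0 complex) \<Rightarrow>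
   ('w generator list \<Rightarrow>\<^sub>0 complex)" where
  "TD \<phi> p = contract \<phi> (Dl p)"

lemma lmap_TD [intro!, simp]: "lmap (TD \<phi>)"
  unfolding TD_def[abs_def] by (rule lmap_comp[OF lmap_contract lmap_Dl])

lemma TD_one: "TD \<phi> 1 = \<phi> 1 *\<^sub>C 1"
  by (simp add: TD_def one_word_pair contract_def flip: one_word)
    (simp add: one_word)

text \<open>The coproduct is multiplicative, so a leading letter can be split off: the part in the
  first leg comes out in front, the part in the second leg is absorbed into the functional. All
  contractions of monomials follow from this and its analogues.\<close>

lemma TD_E: "functional \<phi> \<Longrightarrow> TD \<phi> (lE \<alpha> * p) = lE \<alpha> * TD \<phi> p + lK \<alpha> * TD (\<lambda>p. \<phi> (lE \<alpha> * p)) p"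
  by (simp add: TD_def Dl_mult distrib_right lmap_add[OF lmap_contract] contract_Lft contract_Rgt mult.assoc)

lemma TD_F: "functional \<phi> \<Longrightarrow>
    TD \<phi> (lF \<alpha> * p) = lF \<alpha> * TD (\<lambda>p. \<phi> (lK (- \<alpha>) * p)) p + TD (\<lambda>p. \<phi> (lF \<alpha> * p)) p"
  by (simp add: TD_def Dl_mult distrib_right lmap_add[OF lmap_contract] contract_Lft contract_Rgt mult.assoc)

lemma TD_K: "functional \<phi> \<Longrightarrow> TD \<phi> (lK \<mu> * p) = lK \<mu> * TD (\<lambda>p. \<phi> (lK \<mu> * p)) p"
  by (simp add: TD_def Dl_mult contract_Lft contract_Rgt mult.assoc)

lemma TD_zero_fun: "TD (\<lambda>_. 0) p = 0"
proof -
  have "contract (\<lambda>_. 0) z = 0" for z :: "'w generator list \<times> 'w generator list \<Rightarrow>\<^sub>0 complex"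
    unfolding contract_def by (simp add: lin_def case_prod_beta)
  then show ?thesis by (simp add: TD_def)
qed

subsection \<open>Right coideals are stable under contraction\<close>

definition rep :: "('w generator list \<Rightarrow>\<^sub>0 complex) set \<Rightarrow> ('w generator list \<Rightarrow>\<^sub>0 complex)" where
  "rep u = (SOME p. cl p = u)"

lemma cl_rep: "u \<in> carrier Uq \<Longrightarrow> cl (rep u) = u"
  unfolding rep_def carrier_Uq by (rule someI_ex) auto

text \<open>The map id \<otimes> \<phi> on formal combinations of pairs of classes, with chosen
  representatives; different choices agree modulo \<open>cl_ideal\<close>.\<close>

definition Theta where
  "Theta \<phi> = lin (\<lambda>(a, b). \<phi> (rep b) *\<^sub>C rep a)"

lemma lmap_Theta [intro!, simp]: "lmap (Theta \<phi>)" by (simp add: Theta_def)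

lemma lsub_cl_ideal: "lsub cl_ideal"
proof -
  interpret C: cong_ideal cl_ideal by (rule cong_ideal_cl_ideal)
  show ?thesis by (simp add: lsub_def C.zero_mem C.add_mem C.sc_mem)
qed

lemma functional_rep: "functional \<phi> \<Longrightarrow> \<phi> (rep (cl p)) = \<phi> p"
  by (rule functional_cl) (simp_all add: cl_rep)

lemma Theta_khat: "functional \<phi> \<Longrightarrow> cl (Theta \<phi> (khat z)) = cl (contract \<phi> z)"
proof -
  assume \<phi>: "functional \<phi>"
  have "lin (\<lambda>k. Theta \<phi> (khat (single k 1)) - contract \<phi> (single k 1)) z \<in> cl_ideal"
  proof (rule lsub_lin[OF lsub_cl_ideal])
    fix k :: "'w generator list \<times> 'w generator list"
    obtain w w' where k: "k = (w, w')" by (cases k)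
    have "cl (Theta \<phi> (khat (single k 1))) = cl (contract \<phi> (single k 1))"
      by (simp add: k khat_def Theta_def contract_def functional_rep[OF \<phi>] cl_sc cl_rep)
        (simp flip: cl_sc)
    then show "Theta \<phi> (khat (single k 1)) - contract \<phi> (single k 1) \<in> cl_ideal"
      by (simp only: cl_eq_iff_ideal)
  qed
  also have "lin (\<lambda>k. Theta \<phi> (khat (single k 1)) - contract \<phi> (single k 1)) z = Theta \<phi> (khat z) - contract \<phi> z"
    by (rule lmap_conv_lin[OF lmap_minus[OF lmap_comp[OF lmap_Theta lmap_khat] lmap_contract], symmetric])
  finally show ?thesis by (simp only: cl_eq_iff_ideal)
qed

lemma functional_right: "functional \<phi> \<Longrightarrow> functional (\<lambda>p. \<phi> (p * a))"
  by (auto simp: functional_def distrib_right cl_mult intro: functional_cl[of \<phi>])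

text \<open>Contraction is well defined on the tensor square: bilinearity relations contract into
  \<open>cl_ideal\<close>.\<close>

lemma Theta_Idl:
  assumes "z \<in> Idl\<^bsub>monoid_algebra UU\<^esub> bil" "functional \<phi>"
  shows "Theta \<phi> z \<in> cl_ideal"
proof -
  interpret U: ring Uq by (rule ring_Uq)
  interpret T: monoid_algebra_quotient UU bil by (rule TU_quotient)
  interpret C: cong_ideal cl_ideal by (rule cong_ideal_cl_ideal)
  \<comment> \<open>All functionals are treated at once, since multiplying by a pair (a, b) replaces
    \<phi> by \<phi> composed with multiplication by b.\<close>
  have "Idl\<^bsub>T.MA\<^esub> bil \<subseteq> {z. \<forall>\<phi>. functional \<phi> \<longrightarrow> Theta \<phi> z \<in> cl_ideal}"
  proof (rule T.Idl_minimal)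
    fix a x assume x: "x \<in> {z. \<forall>\<phi>. functional \<phi> \<longrightarrow> Theta \<phi> z \<in> cl_ideal}"
      and a: "a \<in> carrier T.MA" and xc: "x \<in> carrier T.MA"
    have "Theta \<phi> (a \<otimes>\<^bsub>T.MA\<^esub> x) \<in> cl_ideal" if \<phi>: "functional \<phi>" for \<phi>
      unfolding monoid_algebra_mult lmap_lin_comp[OF lmap_Theta]
    proof (rule lsub_lin[OF lsub_cl_ideal])
      fix k assume "k \<in> keys a"
      then obtain a0 b0 where k: "k = (a0, b0)" "a0 \<in> carrier Uq" "b0 \<in> carrier Uq" using a by auto
      let ?\<phi> = "\<lambda>p. \<phi> (rep b0 * p)"
      have A: "C.eqv (lin (\<lambda>l. Theta \<phi> (single (k \<otimes>\<^bsub>UU\<^esub> l) 1)) x) (lin (\<lambda>l. rep a0 * Theta ?\<phi> (single l 1)) x)"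
        unfolding C.eqv_def lin_fun_diff[symmetric]
      proof (rule lsub_lin[OF lsub_cl_ideal])
        fix l assume "l \<in> keys x"
        then obtain a1 b1 where l: "l = (a1, b1)" "a1 \<in> carrier Uq" "b1 \<in> carrier Uq" using xc by auto
        have 1: "\<phi> (rep (b0 \<otimes>\<^bsub>Uq\<^esub> b1)) = \<phi> (rep b0 * rep b1)"
          by (rule functional_cl[OF \<phi>]) (simp add: cl_rep cl_mult k l)
        have 2: "cl (rep (a0 \<otimes>\<^bsub>Uq\<^esub> a1)) = cl (rep a0 * rep a1)"
          by (simp add: cl_rep cl_mult k l)
        show "Theta \<phi> (single (k \<otimes>\<^bsub>UU\<^esub> l) 1) - rep a0 * Theta ?\<phi> (single l 1) \<in> cl_ideal"
          unfolding cl_eq_iff_ideal[symmetric] using 2 by (simp add: k l Theta_def 1 cl_sc)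
      qed
      have B: "lin (\<lambda>l. rep a0 * Theta ?\<phi> (single l 1)) x = rep a0 * Theta ?\<phi> x"
        by (rule lmap_conv_lin[OF lmap_comp[OF lmap_mult_left lmap_Theta], symmetric])
      have D: "rep a0 * Theta ?\<phi> x \<in> cl_ideal"
        using x functional_left[OF \<phi>] by (intro C.left_mem) blast
      show "lin (\<lambda>l. Theta \<phi> (single (k \<otimes>\<^bsub>UU\<^esub> l) 1)) x \<in> cl_ideal"
        using C.eqv_trans[OF A[unfolded B], of 0] D by (simp add: C.eqv_zero_iff)
    qed
    then show "a \<otimes>\<^bsub>T.MA\<^esub> x \<in> {z. \<forall>\<phi>. functional \<phi> \<longrightarrow> Theta \<phi> z \<in> cl_ideal}" by blast
    have "Theta \<phi> (x \<otimes>\<^bsub>T.MA\<^esub> a) \<in> cl_ideal" if \<phi>: "functional \<phi>" for \<phi>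
    proof -
      have swap: "x \<otimes>\<^bsub>T.MA\<^esub> a = lin (\<lambda>l. lin (\<lambda>k. single (k \<otimes>\<^bsub>UU\<^esub> l) 1) x) a"
      proof -
        have "lmap (\<lambda>a. lin (\<lambda>k. lin (\<lambda>l. single (k \<otimes>\<^bsub>UU\<^esub> l) 1) a) x)"
          by (simp add: lmap_def lin_fun_add lin_fun_sc)
        from lmap_conv_lin[OF this, of a] show ?thesis by (simp add: monoid_algebra_mult)
      qed
      show ?thesis
        unfolding swap lmap_lin_comp[OF lmap_Theta]
      proof (rule lsub_lin[OF lsub_cl_ideal])
        fix k assume "k \<in> keys a"
        then obtain a0 b0 where k: "k = (a0, b0)" "a0 \<in> carrier Uq" "b0 \<in> carrier Uq" using a by auto
        let ?\<phi> = "\<lambda>p. \<phi> (p * rep b0)"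
        have A: "C.eqv (lin (\<lambda>l. Theta \<phi> (single (l \<otimes>\<^bsub>UU\<^esub> k) 1)) x) (lin (\<lambda>l. Theta ?\<phi> (single l 1) * rep a0) x)"
          unfolding C.eqv_def lin_fun_diff[symmetric]
        proof (rule lsub_lin[OF lsub_cl_ideal])
          fix l assume "l \<in> keys x"
          then obtain a1 b1 where l: "l = (a1, b1)" "a1 \<in> carrier Uq" "b1 \<in> carrier Uq" using xc by auto
          have 1: "\<phi> (rep (b1 \<otimes>\<^bsub>Uq\<^esub> b0)) = \<phi> (rep b1 * rep b0)"
            by (rule functional_cl[OF \<phi>]) (simp add: cl_rep cl_mult k l)
          have 2: "cl (rep (a1 \<otimes>\<^bsub>Uq\<^esub> a0)) = cl (rep a1 * rep a0)"
            by (simp add: cl_rep cl_mult k l)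
          show "Theta \<phi> (single (l \<otimes>\<^bsub>UU\<^esub> k) 1) - Theta ?\<phi> (single l 1) * rep a0 \<in> cl_ideal"
            unfolding cl_eq_iff_ideal[symmetric] using 2 by (simp add: k l Theta_def 1 cl_sc)
        qed
        have B: "lin (\<lambda>l. Theta ?\<phi> (single l 1) * rep a0) x = Theta ?\<phi> x * rep a0"
          by (rule lmap_conv_lin[OF lmap_comp[OF lmap_mult_right lmap_Theta], symmetric])
        have D: "Theta ?\<phi> x * rep a0 \<in> cl_ideal"
          using x functional_right[OF \<phi>] by (intro C.right_mem) blast
        show "lin (\<lambda>l. Theta \<phi> (single (l \<otimes>\<^bsub>UU\<^esub> k) 1)) x \<in> cl_ideal"
          using C.eqv_trans[OF A[unfolded B], of 0] D by (simp add: C.eqv_zero_iff)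
      qed
    qed
    then show "x \<otimes>\<^bsub>T.MA\<^esub> a \<in> {z. \<forall>\<phi>. functional \<phi> \<longrightarrow> Theta \<phi> z \<in> cl_ideal}" by blast
  next
    show "bil \<subseteq> {z. \<forall>\<phi>. functional \<phi> \<longrightarrow> Theta \<phi> z \<in> cl_ideal}"
    proof (intro subsetI CollectI allI impI)
      fix z \<phi> assume z: "z \<in> bil" and \<phi>: "functional \<phi>"
      have sm: "c \<odot>\<^bsub>Uq\<^esub> a \<in> carrier Uq" if "a \<in> carrier Uq" for a c
        using that carrier_Uq by (auto simp flip: cl_sc)
      have th: "Theta \<phi> (single (a, b) c) = (c * \<phi> (rep b)) *\<^sub>C rep a" for a b c by (simp add: Theta_def)
      have f_add: "\<phi> (rep (b \<oplus>\<^bsub>Uq\<^esub> b')) = \<phi> (rep b) + \<phi> (rep b')" if "b \<in> carrier Uq" "b' \<in> carrier Uq" for b b'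
        unfolding functional_add[OF \<phi>, symmetric] by (rule functional_cl[OF \<phi>]) (simp add: that cl_rep cl_add)
      have f_sc: "\<phi> (rep (c \<odot>\<^bsub>Uq\<^esub> b)) = c * \<phi> (rep b)" if "b \<in> carrier Uq" for b c
        unfolding functional_sc[OF \<phi>, symmetric] by (rule functional_cl[OF \<phi>]) (simp add: that cl_rep cl_sc sm)
      consider a a' b where "z = single (a \<oplus>\<^bsub>Uq\<^esub> a', b) 1 - single (a, b) 1 - single (a', b) 1"
          "a \<in> carrier Uq" "a' \<in> carrier Uq" "b \<in> carrier Uq"
        | a b b' where "z = single (a, b \<oplus>\<^bsub>Uq\<^esub> b') 1 - single (a, b) 1 - single (a, b') 1"
          "a \<in> carrier Uq" "b \<in> carrier Uq" "b' \<in> carrier Uq"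
        | c a b where "z = single (c \<odot>\<^bsub>Uq\<^esub> a, b) 1 - single (a, b) c" "a \<in> carrier Uq" "b \<in> carrier Uq"
        | c a b where "z = single (a, c \<odot>\<^bsub>Uq\<^esub> b) 1 - single (a, b) c" "a \<in> carrier Uq" "b \<in> carrier Uq"
        using z unfolding bilinear_relations_def Let_def by blast
      then show "Theta \<phi> z \<in> cl_ideal"
      proof cases
        case 1
        have "rep (a \<oplus>\<^bsub>Uq\<^esub> a') - (rep a + rep a') \<in> cl_ideal"
          unfolding cl_eq_iff_ideal[symmetric] using 1 by (simp add: cl_rep cl_add)
        from C.sc_mem[OF this, of "\<phi> (rep b)"] show ?thesis
          by (simp add: 1 lmap_diff[OF lmap_Theta] lmap_add[OF lmap_Theta] th diff_diff_eq)
      next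
        case 2
        then show ?thesis
          by (simp add: lmap_diff[OF lmap_Theta] th f_add sc_add_left C.zero_mem)
      next
        case 3
        have "rep (c \<odot>\<^bsub>Uq\<^esub> a) - c *\<^sub>C rep a \<in> cl_ideal"
          unfolding cl_eq_iff_ideal[symmetric] using 3 by (simp add: cl_rep cl_sc sm)
        from C.sc_mem[OF this, of "\<phi> (rep b)"] show ?thesis
          by (simp add: 3 lmap_diff[OF lmap_Theta] th mult.commute)
      next
        case 4
        then show ?thesis
          by (simp add: lmap_diff[OF lmap_Theta] th f_sc C.zero_mem)
      qed
    qed
  qed (auto simp: lmap_zero[OF lmap_Theta] lmap_add[OF lmap_Theta] C.zero_mem C.add_mem)
  then show ?thesis using assms by blast
qed

text \<open>The coproduct of p lies in C \<otimes> U, and id \<otimes> \<phi> maps C \<otimes> U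
  into C.\<close>

lemma coideal_contract:
  assumes C: "right_coideal_subalgebra C" and p: "cl p \<in> C" "p \<in> carrier (free_algebra generators)"
    and \<phi>: "functional \<phi>"
  shows "cl (TD \<phi> p) \<in> C"
proof -
  interpret U: ring Uq by (rule ring_Uq)
  interpret T: monoid_algebra_quotient UU bil by (rule TU_quotient)
  have sub: "subalgebra Uq C" using C by (simp add: right_coideal_subalgebra_def)
  have C_add: "cl (a + b) \<in> C" if "cl a \<in> C" "cl b \<in> C" for a b
    using sub that by (auto simp: subalgebra_def cl_add)
  have C_sc: "cl (c *\<^sub>C a) \<in> C" if "cl a \<in> C" for a c
    using sub that by (auto simp: subalgebra_def cl_sc)
  have "0 *\<^sub>C 1 = (0 :: 'w generator list \<Rightarrow>\<^sub>0 complex)" by simp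
  moreover have "cl 1 \<in> C" using sub by (simp add: subalgebra_def cl_one)
  ultimately have C_zero: "cl 0 \<in> C" using C_sc[of 1 0] by simp
  \<comment> \<open>Tensors with at least one representative that contracts into C. They form a
    subspace containing all a \<otimes> b with a in C, hence the coproduct of p; by
    \<open>Theta_Idl\<close> the choice of representative is then irrelevant.\<close>
  define V where "V = {t. \<exists>Z \<in> carrier T.MA. t = T.cls Z \<and> cl (Theta \<phi> Z) \<in> C}"
  have "linear_subspace TU V"
    unfolding linear_subspace_def
  proof (intro conjI ballI allI)
    show "V \<subseteq> carrier TU" unfolding V_def tensor_algebra_def using T.cls_closed by auto
    show "\<zero>\<^bsub>TU\<^esub> \<in> V" unfolding V_def tensor_algebra_def T.cls_zero
      using C_zero by (intro CollectI bexI[of _ 0]) (simp_all add: lmap_zero[OF lmap_Theta])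
    fix x assume "x \<in> V"
    then obtain X where X: "X \<in> carrier T.MA" "x = T.cls X" "cl (Theta \<phi> X) \<in> C" by (auto simp: V_def)
    show "c \<odot>\<^bsub>TU\<^esub> x \<in> V" for c
      unfolding V_def
    proof (intro CollectI bexI conjI)
      show "c *\<^sub>C X \<in> carrier T.MA" using X lsub_sc[OF lsub_carrier_monoid_algebra] by blast
      show "c \<odot>\<^bsub>TU\<^esub> x = T.cls (c *\<^sub>C X)" using T.cls_sc[OF X(1)] X(2) by (simp add: tensor_algebra_def)
      show "cl (Theta \<phi> (c *\<^sub>C X)) \<in> C" using C_sc X by (simp add: lmap_sc[OF lmap_Theta])
    qed
    fix y assume "y \<in> V"
    then obtain Y where Y: "Y \<in> carrier T.MA" "y = T.cls Y" "cl (Theta \<phi> Y) \<in> C" by (auto simp: V_def)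
    show "x \<oplus>\<^bsub>TU\<^esub> y \<in> V"
      unfolding V_def
    proof (intro CollectI bexI conjI)
      show "X + Y \<in> carrier T.MA" using X Y lsub_add[OF lsub_carrier_monoid_algebra] by blast
      show "x \<oplus>\<^bsub>TU\<^esub> y = T.cls (X + Y)" using T.cls_add[OF X(1) Y(1)] X(2) Y(2) by (simp add: tensor_algebra_def)
      show "cl (Theta \<phi> (X + Y)) \<in> C" using C_add X Y by (simp add: lmap_add[OF lmap_Theta])
    qed
  qed
  moreover have "{a \<otimes>\<^sub>U b | a b. a \<in> C \<and> b \<in> carrier Uq} \<subseteq> V"
  proof clarify
    fix a b assume a: "a \<in> C" and b: "b \<in> carrier Uq"
    have a': "a \<in> carrier Uq" using a sub by (auto simp: subalgebra_def)
    have "cl (Theta \<phi> (single (a, b) 1)) \<in> C"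
      using C_sc[of "rep a" "\<phi> (rep b)"] a a' by (simp add: Theta_def cl_rep)
    then show "a \<otimes>\<^sub>U b \<in> V" unfolding V_def pure_tensor_def using a' b
      by (intro CollectI bexI[of _ "single (a, b) 1"]) simp_all
  qed
  ultimately have "tensor_subspace Uq Uq C (carrier Uq) \<subseteq> V"
    unfolding tensor_subspace_def linear_span_def by blast
  then have "kap (Dl p) \<in> V"
    using C p coproduct_eq[OF p(2)] by (auto simp: right_coideal_subalgebra_def)
  then obtain Z where Z: "Z \<in> carrier T.MA" "T.cls (khat (Dl p)) = T.cls Z" "cl (Theta \<phi> Z) \<in> C"
    by (auto simp: V_def kap_def)
  have "khat (Dl p) - Z \<in> Idl\<^bsub>T.MA\<^esub> bil" using Z T.cls_eq_iff[OF khat_carrier Z(1)] by blast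
  from Theta_Idl[OF this \<phi>] have "cl (Theta \<phi> (khat (Dl p))) = cl (Theta \<phi> Z)"
    by (simp add: cl_eq_iff_ideal lmap_diff[OF lmap_Theta])
  then show ?thesis using Z(3) Theta_khat[OF \<phi>] by (simp add: TD_def)
qed

end

subsection \<open>Contractions of PBW monomials\<close>

context qgroup
begin

abbreviation Fw where "Fw v \<equiv> single (map F_gen v) (1::complex)"
abbreviation Ew where "Ew w \<equiv> single (map E_gen w) (1::complex)"

lemma functional_eqv:
  assumes "functional \<phi>" "cong_ideal.eqv cl_ideal x y"
  shows "\<phi> x = \<phi> y"
proof -
  interpret C: cong_ideal cl_ideal by (rule cong_ideal_cl_ideal)
  show ?thesis using assms(2) by (intro functional_cl[OF assms(1)]) (simp add: C.eqv_def cl_eq_iff_ideal)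
qed

lemma functional_K_EKF:
  assumes "functional \<phi>" "w \<in> lists S" "\<nu> \<in> Q" "\<kappa> \<in> Q"
  shows "\<phi> (lK \<kappa> * EKF w \<nu> v) = chr \<kappa> (wt w) * \<phi> (EKF w (\<kappa> + \<nu>) v)"
proof -
  interpret C: qrel S form q ht cl_ideal by (rule qrel_cl_ideal)
  show ?thesis
    using functional_eqv[OF assms(1) C.K_EKF[OF assms(2-4)]] by (simp only: functional_sc[OF assms(1)])
qed

lemma functional_F_EKF:
  assumes "functional \<phi>" "\<nu> \<in> Q" "\<beta> \<in> S" "v \<in> lists S"
  shows "\<phi> (lF \<beta> * EKF [] \<nu> v) = chr \<beta> \<nu> * \<phi> (EKF [] \<nu> (\<beta> # v))"
proof -
  interpret C: qrel S form q ht cl_ideal by (rule qrel_cl_ideal)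
  have "C.eqv (lF \<beta> * EKF [] \<nu> v) (chr \<beta> \<nu> *\<^sub>C EKF [] \<nu> (\<beta> # v))"
    using C.F_EKF[of "[]" \<nu> v \<beta>] assms by (simp add: sig_single)
  from functional_eqv[OF assms(1) this] show ?thesis by (simp only: functional_sc[OF assms(1)])
qed

lemma functional_Fw:
  assumes "functional \<phi>"
  shows "\<phi> (Fw v) = \<phi> (EKF [] 0 v)"
proof -
  interpret C: qrel S form q ht cl_ideal by (rule qrel_cl_ideal)
  have "C.eqv (EKF [] 0 v) (1 * Fw v)"
    using C.eqv_right[OF C.K_zero, of "Fw v"] by (simp add: EKF_def)
  from functional_eqv[OF assms this] show ?thesis by simp
qed

lemma Fw_Cons: "Fw (\<beta> # v) = lF \<beta> * Fw v" by simp

lemma EKF_Nil: "EKF [] \<nu> v = lK \<nu> * Fw v" by (simp add: EKF_def)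

text \<open>Only the summand of \<open>\<Delta>(F\<^sub>v)\<close> whose second leg has the full degree survives.\<close>

lemma TD_Fw:
  assumes "functional \<phi>" "\<And>\<kappa> u. \<kappa> \<in> Q \<Longrightarrow> u \<in> lists S \<Longrightarrow> length u < N \<Longrightarrow> \<phi> (EKF [] \<kappa> u) = 0"
    and "v \<in> lists S" "length v \<le> N"
  shows "TD \<phi> (Fw v) = (if length v = N then \<phi> (Fw v) else 0) *\<^sub>C 1"
  using assms
proof (induction v arbitrary: \<phi> N)
  case Nil
  have "\<phi> 1 = \<phi> (EKF [] 0 [])" using functional_Fw[OF Nil(1), of "[]"] by (simp flip: one_word)
  then show ?case using Nil(2)[of 0 "[]"] TD_one[of \<phi>] by (simp add: Q_closed flip: one_word)
next
  case (Cons \<beta> v)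
  have \<beta>: "\<beta> \<in> S" "v \<in> lists S" using Cons.prems by auto
  let ?\<phi>1 = "\<lambda>p. \<phi> (lK (- \<beta>) * p)" and ?\<phi>2 = "\<lambda>p. \<phi> (lF \<beta> * p)"
  have f: "functional ?\<phi>1" "functional ?\<phi>2" using Cons.prems(1) by (simp_all add: functional_left)
  have 1: "TD ?\<phi>1 (Fw v) = 0"
  proof -
    have "?\<phi>1 (EKF [] \<kappa> u) = 0" if "\<kappa> \<in> Q" "u \<in> lists S" "length u < N" for \<kappa> u
      using functional_K_EKF[OF Cons.prems(1), of "[]" \<kappa> "- \<beta>" u] Cons.prems(2)[of "- \<beta> + \<kappa>" u] that \<beta>
      by (simp only: lists.Nil Q_closed) simp
    from Cons.IH[OF f(1) this \<beta>(2)] show ?thesis using Cons.prems(4) by simp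
  qed
  have 2: "TD ?\<phi>2 (Fw v) = (if length v = N - 1 then ?\<phi>2 (Fw v) else 0) *\<^sub>C 1"
  proof (rule Cons.IH[OF f(2) _ \<beta>(2)])
    show "?\<phi>2 (EKF [] \<kappa> u) = 0" if "\<kappa> \<in> Q" "u \<in> lists S" "length u < N - 1" for \<kappa> u
      using functional_F_EKF[OF Cons.prems(1), of \<kappa> \<beta> u] Cons.prems(2)[of \<kappa> "\<beta> # u"] that \<beta> by auto
    show "length v \<le> N - 1" using Cons.prems(4) by simp
  qed
  have eq: "length v = N - 1 \<longleftrightarrow> length (\<beta> # v) = N" using Cons.prems(4) by auto
  show ?case unfolding Fw_Cons TD_F[OF Cons.prems(1)] 1 2 eq by simp
qed

lemma TD_EKF_Nil:
  assumes "functional \<phi>" "\<And>\<kappa> u. \<kappa> \<in> Q \<Longrightarrow> u \<in> lists S \<Longrightarrow> length u < N \<Longrightarrow> \<phi> (EKF [] \<kappa> u) = 0"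
    and "v \<in> lists S" "length v \<le> N" "\<nu> \<in> Q"
  shows "TD \<phi> (EKF [] \<nu> v) = (if length v = N then \<phi> (EKF [] \<nu> v) else 0) *\<^sub>C EKF [] \<nu> []"
proof -
  let ?\<phi> = "\<lambda>p. \<phi> (lK \<nu> * p)"
  have "?\<phi> (EKF [] \<kappa> u) = 0" if "\<kappa> \<in> Q" "u \<in> lists S" "length u < N" for \<kappa> u
    using functional_K_EKF[OF assms(1), of "[]" \<kappa> \<nu> u] assms(2)[of "\<nu> + \<kappa>" u] that assms
    by (simp only: lists.Nil Q_closed) simp
  from TD_Fw[OF functional_left[OF assms(1)] this assms(3,4)]
  show ?thesis unfolding EKF_Nil[of \<nu> v] TD_K[OF assms(1)] by (simp add: EKF_def mult.commute del: mult_word)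
qed

text \<open>Taken with a degree bound above the length of v, so that no summand survives.\<close>

lemma TD_EKF_Nil_zero:
  assumes "functional \<phi>" "\<And>\<kappa> u. \<kappa> \<in> Q \<Longrightarrow> u \<in> lists S \<Longrightarrow> \<phi> (EKF [] \<kappa> u) = 0"
    and "v \<in> lists S" "\<nu> \<in> Q"
  shows "TD \<phi> (EKF [] \<nu> v) = 0"
  using TD_EKF_Nil[OF assms(1) assms(2) assms(3), of "Suc (length v)" \<nu>] assms by simp

text \<open>The opposite extreme: a functional that vanishes as soon as an F-letter is present sees
  only the summand with all of \<open>F_v\<close> in the first leg and \<open>K_-wt(v)\<close> in
  the second.\<close>

lemma TD_Fw_top:
  assumes "functional \<phi>" "\<And>\<kappa> u. \<kappa> \<in> Q \<Longrightarrow> u \<in> lists S \<Longrightarrow> u \<noteq> [] \<Longrightarrow> \<phi> (EKF [] \<kappa> u) = 0" "v \<in> lists S"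
  shows "TD \<phi> (Fw v) = \<phi> (lK (- wt v)) *\<^sub>C Fw v"
  using assms
proof (induction v arbitrary: \<phi>)
  case Nil
  have "\<phi> 1 = \<phi> (lK 0)" using functional_Fw[OF Nil(1), of "[]"] by (simp add: EKF_def flip: one_word)
  then show ?case using TD_one[of \<phi>] by (simp flip: one_word)
next
  case (Cons \<beta> v)
  interpret C: qrel S form q ht cl_ideal by (rule qrel_cl_ideal)
  have \<beta>: "\<beta> \<in> S" "v \<in> lists S" using Cons.prems by auto
  let ?\<phi>1 = "\<lambda>p. \<phi> (lK (- \<beta>) * p)" and ?\<phi>2 = "\<lambda>p. \<phi> (lF \<beta> * p)"
  have f: "functional ?\<phi>1" "functional ?\<phi>2" using Cons.prems(1) by (simp_all add: functional_left)
  have "?\<phi>1 (EKF [] \<kappa> u) = 0" if "\<kappa> \<in> Q" "u \<in> lists S" "u \<noteq> []" for \<kappa> u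
    using functional_K_EKF[OF Cons.prems(1), of "[]" \<kappa> "- \<beta>" u] Cons.prems(2)[of "- \<beta> + \<kappa>" u] that \<beta>
    by (simp only: lists.Nil Q_closed) simp
  from Cons.IH[OF f(1) this \<beta>(2)]
  have 1: "TD ?\<phi>1 (Fw v) = \<phi> (lK (- \<beta>) * lK (- wt v)) *\<^sub>C Fw v" .
  have 2: "TD ?\<phi>2 (Fw v) = 0"
  proof -
    have "?\<phi>2 (EKF [] \<kappa> u) = 0" if "\<kappa> \<in> Q" "u \<in> lists S" "length u < Suc (length v)" for \<kappa> u
      using functional_F_EKF[OF Cons.prems(1), of \<kappa> \<beta> u] Cons.prems(2)[of \<kappa> "\<beta> # u"] that \<beta> by auto
    from TD_Fw[OF f(2) this \<beta>(2)] show ?thesis by simp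
  qed
  have "- \<beta> + - wt v = - wt (\<beta> # v)" by simp
  then have 3: "\<phi> (lK (- \<beta>) * lK (- wt v)) = \<phi> (lK (- wt (\<beta> # v)))"
    using functional_eqv[OF Cons.prems(1) C.K_mult[of "- \<beta>" "- wt v"]] \<beta> by (simp only: Q_closed wt_Q)
  show ?case unfolding Fw_Cons TD_F[OF Cons.prems(1)] 1 2 3 by simp
qed

lemma TD_EKF_top:
  assumes "functional \<phi>" "\<And>\<kappa> u. \<kappa> \<in> Q \<Longrightarrow> u \<in> lists S \<Longrightarrow> u \<noteq> [] \<Longrightarrow> \<phi> (EKF [] \<kappa> u) = 0"
    "v \<in> lists S" "\<nu> \<in> Q"
  shows "TD \<phi> (EKF [] \<nu> v) = \<phi> (EKF [] (\<nu> - wt v) []) *\<^sub>C EKF [] \<nu> v"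
proof -
  interpret C: qrel S form q ht cl_ideal by (rule qrel_cl_ideal)
  let ?\<phi> = "\<lambda>p. \<phi> (lK \<nu> * p)"
  have "?\<phi> (EKF [] \<kappa> u) = 0" if "\<kappa> \<in> Q" "u \<in> lists S" "u \<noteq> []" for \<kappa> u
    unfolding functional_K_EKF[OF assms(1) lists.Nil that(1) assms(4)]
    using assms(2)[OF Q_add[OF assms(4) that(1)] that(2,3)] by simp
  from TD_Fw_top[OF functional_left[OF assms(1)] this assms(3)]
  have 1: "TD ?\<phi> (Fw v) = \<phi> (lK \<nu> * lK (- wt v)) *\<^sub>C Fw v" .
  have "\<nu> + - wt v = \<nu> - wt v" by simp
  then have 2: "\<phi> (lK \<nu> * lK (- wt v)) = \<phi> (lK (\<nu> - wt v))"
    using functional_eqv[OF assms(1) C.K_mult[of \<nu> "- wt v"]] assms by (simp only: Q_closed wt_Q)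
  have 3: "EKF [] (\<nu> - wt v) [] = lK (\<nu> - wt v)" by (simp add: EKF_def)
  show ?thesis unfolding EKF_Nil[of \<nu> v] TD_K[OF assms(1)] 1 2 3 by simp
qed

text \<open>The second leg of the coproduct carries only E-weights that are at most wt w. A
  functional supported in E-weight \<mu> not below wt w therefore gives zero.\<close>

lemma TD_EKF_lower:
  assumes "functional \<psi>" "\<And>w \<kappa> u. w \<in> lists S \<Longrightarrow> \<kappa> \<in> Q \<Longrightarrow> u \<in> lists S \<Longrightarrow> wt w \<noteq> \<mu> \<Longrightarrow> \<psi> (EKF w \<kappa> u) = 0"
    and "wt w - \<mu> \<notin> Q_pos" "w \<in> lists S" "\<nu> \<in> Q" "v \<in> lists S"
  shows "TD \<psi> (EKF w \<nu> v) = 0"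
  using assms
proof (induction w arbitrary: \<psi> \<mu>)
  case Nil
  have "0 \<noteq> \<mu>" using Nil.prems(3) pos_lattice.zero[of S] by auto
  then show ?case using Nil.prems(2)[of "[]"] Nil.prems by (intro TD_EKF_Nil_zero) auto
next
  case (Cons \<alpha> w)
  have \<alpha>: "\<alpha> \<in> S" "w \<in> lists S" using Cons.prems by auto
  let ?\<psi> = "\<lambda>p. \<psi> (lE \<alpha> * p)"
  have "wt w - \<mu> \<notin> Q_pos"
  proof
    assume "wt w - \<mu> \<in> Q_pos"
    then have "wt w - \<mu> + \<alpha> \<in> Q_pos" using \<alpha> by (intro pos_lattice.add_simple)
    then show False using Cons.prems(3) by (simp add: algebra_simps)
  qed
  then have 1: "TD \<psi> (EKF w \<nu> v) = 0" using Cons.prems \<alpha> by (intro Cons.IH[of _ \<mu>]) auto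
  have "?\<psi> (EKF u \<kappa> u') = 0" if "u \<in> lists S" "\<kappa> \<in> Q" "u' \<in> lists S" "wt u \<noteq> \<mu> - \<alpha>" for u \<kappa> u'
    unfolding EKF_Cons[symmetric] using that \<alpha> by (intro Cons.prems(2)) (auto simp: algebra_simps)
  moreover have "wt w - (\<mu> - \<alpha>) \<notin> Q_pos" using Cons.prems(3) by (simp add: algebra_simps)
  ultimately have 2: "TD ?\<psi> (EKF w \<nu> v) = 0"
    using Cons.prems \<alpha> functional_left by (intro Cons.IH[of _ "\<mu> - \<alpha>"]) auto
  show ?case unfolding EKF_Cons TD_E[OF Cons.prems(1)] 1 2 by simp
qed

text \<open>When the weights agree, all E-letters must go to the second leg, each leaving its K in
  the first. Keeping even one E in the first leg is excluded by \<open>TD_EKF_lower\<close>.\<close>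

lemma TD_EKF_weight:
  assumes "functional \<psi>" "\<And>w \<kappa> u. w \<in> lists S \<Longrightarrow> \<kappa> \<in> Q \<Longrightarrow> u \<in> lists S \<Longrightarrow> wt w \<noteq> \<mu> \<Longrightarrow> \<psi> (EKF w \<kappa> u) = 0"
    and "wt w = \<mu>" "w \<in> lists S" "\<nu> \<in> Q" "v \<in> lists S"
  shows "TD \<psi> (EKF w \<nu> v) = single (map K_gen w) 1 * TD (\<lambda>p. \<psi> (Ew w * p)) (EKF [] \<nu> v)"
  using assms
proof (induction w arbitrary: \<psi> \<mu>)
  case Nil
  then show ?case by (simp flip: one_word)
next
  case (Cons \<alpha> w)
  have \<alpha>: "\<alpha> \<in> S" "w \<in> lists S" using Cons.prems by auto
  let ?\<psi> = "\<lambda>p. \<psi> (lE \<alpha> * p)"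
  have 1: "TD \<psi> (EKF w \<nu> v) = 0"
    using neg_simple_not_pos[OF \<alpha>(1)] Cons.prems \<alpha> by (intro TD_EKF_lower[of _ \<mu>]) auto
  have "?\<psi> (EKF u \<kappa> u') = 0" if "u \<in> lists S" "\<kappa> \<in> Q" "u' \<in> lists S" "wt u \<noteq> \<mu> - \<alpha>" for u \<kappa> u'
    unfolding EKF_Cons[symmetric] using that \<alpha> by (intro Cons.prems(2)) (auto simp: algebra_simps)
  from Cons.IH[OF functional_left[OF Cons.prems(1)] this] 
  have 2: "TD ?\<psi> (EKF w \<nu> v) = single (map K_gen w) 1 * TD (\<lambda>p. \<psi> (lE \<alpha> * (Ew w * p))) (EKF [] \<nu> v)"
    using Cons.prems \<alpha> by auto
  show ?case unfolding EKF_Cons TD_E[OF Cons.prems(1)] 1 2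
    by (simp flip: mult.assoc)
qed

lemma K_word_eqv:
  assumes "w \<in> lists S"
  shows "cl (single (map K_gen w) 1) = cl (lK (wt w))"
  using assms
proof (induction w)
  case Nil
  interpret C: qrel S form q ht cl_ideal by (rule qrel_cl_ideal)
  show ?case using C.eqv_sym[OF C.K_zero] by (simp add: cl_eq_iff_ideal C.eqv_def flip: one_word)
next
  case (Cons \<alpha> w)
  interpret C: qrel S form q ht cl_ideal by (rule qrel_cl_ideal)
  have w: "\<alpha> \<in> S" "w \<in> lists S" using Cons by auto
  have "cl (single (map K_gen (\<alpha> # w)) 1) = cl (lK \<alpha> * single (map K_gen w) 1)" by simp
  also have "\<dots> = cl (lK \<alpha> * lK (wt w))" using Cons by (simp add: cl_mult del: mult_word)
  also have "\<dots> = cl (lK (\<alpha> + wt w))"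
    using C.K_mult[of \<alpha> "wt w"] w by (simp add: cl_eq_iff_ideal C.eqv_def Q_closed wt_Q del: mult_word)
  finally show ?case by simp
qed

subsection \<open>Coordinate functionals\<close>

definition coord :: "'w list \<times> 'w \<times> 'w list \<Rightarrow> ('w generator list \<Rightarrow>\<^sub>0 complex) \<Rightarrow> complex" where
  "coord k p = lookup (cf p) k"

lemma functional_coord: "functional (coord k)"
  by (auto simp: functional_def coord_def lmap_add[OF lmap_cf] lmap_sc[OF lmap_cf] lookup_add cl_eq_iff)

lemma coord_EKF:
  assumes "w \<in> lists S" "\<nu> \<in> Q" "v \<in> lists S"
  shows "coord (w0, \<nu>0, v0) (EKF w \<nu> v) =
    (if \<nu> = \<nu>0 then lookup (nf (single w 1)) w0 * lookup (nf (single v 1)) v0 else 0)"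
  by (simp add: coord_def cf_EKF[OF assms] lookup_tens3)

lemma lookup_nf_wt: "wt w \<noteq> wt w0 \<Longrightarrow> lookup (nf (single w 1)) w0 = 0"
  using nf_wt[of w0 w] by (auto simp: in_keys_iff)

lemma lookup_nf_length: "length w \<noteq> length w0 \<Longrightarrow> lookup (nf (single w 1)) w0 = 0"
  using nf_length[of w0 w] by (auto simp: in_keys_iff)

text \<open>Left multiplication by E makes every E-word nonempty and \<open>nf\<close> preserves
  length, so coordinates at the empty E-word vanish.\<close>

lemma coord_E:
  assumes "\<alpha> \<in> S"
  shows "coord ([], \<nu>, v) (lE \<alpha> * p) = 0"
proof -
  have k: "([], \<nu>, v) \<notin> keys (NF (actE \<alpha> (single k 1)))" for k
    using lookup_nf_length[of "\<alpha> # fst k" "[]"]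
    by (cases k) (simp add: NF_single in_keys_iff lookup_tens3)
  have "([], \<nu>, v) \<notin> keys (NF (actE \<alpha> z))" for z
  proof
    assume "([], \<nu>, v) \<in> keys (NF (actE \<alpha> z))"
    then have "([], \<nu>, v) \<in> keys (lin (\<lambda>k. NF (actE \<alpha> (single k 1))) z)"
      by (simp only: lmap_conv_lin[OF lmap_comp[OF lmap_NF lmap_actE], of \<alpha> z])
    then obtain k where "([], \<nu>, v) \<in> keys (NF (actE \<alpha> (single k 1)))"
      by (rule UN_E[OF subsetD[OF keys_lin]])
    then show False using k by blast
  qed
  then show ?thesis using assms by (simp add: coord_def cf_def act_mult in_keys_iff)
qed

lemma TD_coord_E:
  assumes "w \<in> lists S"
  shows "TD (coord ([], \<nu>0, v0)) (EKF w \<nu> v) = Ew w * TD (coord ([], \<nu>0, v0)) (EKF [] \<nu> v)"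
  using assms
proof (induction w)
  case Nil
  then show ?case by (simp flip: one_word)
next
  case (Cons \<alpha> w)
  have "TD (\<lambda>p. coord ([], \<nu>0, v0) (lE \<alpha> * p)) (EKF w \<nu> v) = 0"
    using coord_E[of \<alpha>] Cons by (simp add: TD_zero_fun)
  then show ?case
    unfolding EKF_Cons TD_E[OF functional_coord] using Cons by (simp flip: mult.assoc)
qed

text \<open>All E-letters stay in the first leg by \<open>coord_E\<close>. As v is no longer than
  v0, all F-letters must go to the second leg to reach the coordinate at v0.\<close>

lemma TD_coord_F:
  assumes "w \<in> lists S" "\<nu> \<in> Q" "v \<in> lists S" "length v \<le> length v0"
  shows "TD (coord ([], \<nu>0, v0)) (EKF w \<nu> v) =
    (if \<nu> = \<nu>0 then lookup (nf (single v 1)) v0 else 0) *\<^sub>C EKF w \<nu> []"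
proof -
  let ?\<phi> = "coord ([], \<nu>0, v0)"
  have "?\<phi> (EKF [] \<kappa> u) = 0" if "\<kappa> \<in> Q" "u \<in> lists S" "length u < length v0" for \<kappa> u
    using that lookup_nf_length[of u v0] by (simp add: coord_EKF del: in_lists_conv_set)
  from TD_EKF_Nil[OF functional_coord this assms(3,4,2)]
  have "TD ?\<phi> (EKF [] \<nu> v) = (if length v = length v0 then ?\<phi> (EKF [] \<nu> v) else 0) *\<^sub>C EKF [] \<nu> []" .
  also have "(if length v = length v0 then ?\<phi> (EKF [] \<nu> v) else 0) = (if \<nu> = \<nu>0 then lookup (nf (single v 1)) v0 else 0)"
    unfolding coord_EKF[OF lists.Nil assms(2,3)] using lookup_nf_length[of v v0] by simp
  finally show ?thesis
    unfolding TD_coord_E[OF assms(1), of \<nu>0 v0 \<nu> v] by (simp add: EKF_def)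
qed

lemma TD_coord_lower:
  assumes "wt w - wt w0 \<notin> Q_pos" "w \<in> lists S" "\<nu> \<in> Q" "v \<in> lists S"
  shows "TD (coord (w0, \<kappa>0, [])) (EKF w \<nu> v) = 0"
  by (rule TD_EKF_lower[OF functional_coord _ assms])
    (use lookup_nf_wt in \<open>simp add: coord_EKF del: in_lists_conv_set\<close>)

text \<open>All E-letters go to the second leg and all F-letters stay in the first, so the second
  leg is \<open>E_w K_(\<nu> - wt v)\<close>. The coordinate thus selects the monomials with \<nu> -
  wt v = \<kappa>0, which is why \<open>rows\<close> uses this difference.\<close>

lemma TD_coord_weight:
  assumes "wt w = wt w0" "w \<in> lists S" "\<nu> \<in> Q" "v \<in> lists S"
  shows "cl (TD (coord (w0, \<kappa>0, [])) (EKF w \<nu> v)) =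
    cl ((if \<nu> = \<kappa>0 + wt v then lookup (nf (single w 1)) w0 else 0) *\<^sub>C EKF [] (wt w + \<nu>) v)"
proof -
  interpret C: qrel S form q ht cl_ideal by (rule qrel_cl_ideal)
  let ?\<psi> = "\<lambda>p. coord (w0, \<kappa>0, []) (Ew w * p)"
  have E: "Ew w * EKF [] \<kappa> u = EKF w \<kappa> u" for \<kappa> u by (simp add: EKF_def)
  have "?\<psi> (EKF [] \<kappa> u) = 0" if "\<kappa> \<in> Q" "u \<in> lists S" "u \<noteq> []" for \<kappa> u
    unfolding E using that assms lookup_nf_length[of u "[]"] by (simp add: coord_EKF del: in_lists_conv_set)
  from TD_EKF_top[OF functional_left[OF functional_coord] this assms(4,3)]
  have 1: "TD ?\<psi> (EKF [] \<nu> v) = coord (w0, \<kappa>0, []) (EKF w (\<nu> - wt v) []) *\<^sub>C EKF [] \<nu> v" unfolding E .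
  have 2: "coord (w0, \<kappa>0, []) (EKF w (\<nu> - wt v) []) = (if \<nu> = \<kappa>0 + wt v then lookup (nf (single w 1)) w0 else 0)"
    using assms by (simp add: coord_EKF Q_closed wt_Q algebra_simps del: in_lists_conv_set)
  have 3: "TD (coord (w0, \<kappa>0, [])) (EKF w \<nu> v) = single (map K_gen w) 1 * TD ?\<psi> (EKF [] \<nu> v)"
    by (rule TD_EKF_weight[OF functional_coord _ assms])
      (use lookup_nf_wt in \<open>simp add: coord_EKF del: in_lists_conv_set\<close>)
  have "cl (single (map K_gen w) 1 * EKF [] \<nu> v) = cl (lK (wt w) * EKF [] \<nu> v)"
    by (simp add: cl_mult K_word_eqv[OF assms(2)])
  also have "\<dots> = cl (EKF [] (wt w + \<nu>) v)"
    using C.K_EKF[OF lists.Nil assms(3) wt_Q[OF assms(2)], of v]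
    by (simp add: cl_eq_iff_ideal C.eqv_def wt_Q[OF assms(2)] chr_zero_right del: in_lists_conv_set)
  finally show ?thesis unfolding 3 1 2 by (simp add: cl_sc)
qed

end

section \<open>The triangular decomposition\<close>

lemma subalgebra_generated:
  assumes "subalgebra A B" "X \<subseteq> B"
  shows "subalgebra A (generated_subalgebra A X)"
  unfolding subalgebra_def
proof (intro conjI)
  show "generated_subalgebra A X \<subseteq> carrier A"
    using assms unfolding generated_subalgebra_def subalgebra_def by blast
qed (auto simp: generated_subalgebra_def subalgebra_def)

lemma generated_subalgebra_superset: "X \<subseteq> generated_subalgebra A X"
  by (auto simp: generated_subalgebra_def)

lemma generated_subalgebra_minimal: "subalgebra A B \<Longrightarrow> X \<subseteq> B \<Longrightarrow> generated_subalgebra A X \<subseteq> B"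
  by (auto simp: generated_subalgebra_def)

lemma linear_subspace_span:
  assumes "linear_subspace A V" "X \<subseteq> V"
  shows "linear_subspace A (linear_span A X)"
  unfolding linear_subspace_def
proof (intro conjI)
  show "linear_span A X \<subseteq> carrier A"
    using assms unfolding linear_span_def linear_subspace_def by blast
qed (auto simp: linear_span_def linear_subspace_def)

lemma linear_span_superset: "X \<subseteq> linear_span A X"
  by (auto simp: linear_span_def)

lemma linear_span_minimal: "linear_subspace A V \<Longrightarrow> X \<subseteq> V \<Longrightarrow> linear_span A X \<subseteq> V"
  by (auto simp: linear_span_def)

context qgroup
begin

lemma cl_finsum: "finite X \<Longrightarrow> (\<Oplus>\<^bsub>Uq\<^esub>i\<in>X. cl (f i)) = cl (sum f X)"
proof -
  interpret U: ring Uq by (rule ring_Uq)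
  assume "finite X"
  then show ?thesis
    by (rule finsum_hom[OF U.abelian_monoid_axioms, where V = UNIV])
      (simp_all add: cl_zero cl_add lsub_def)
qed

lemma subalgebra_Uq: "subalgebra Uq (carrier Uq)"
proof -
  interpret U: ring Uq by (rule ring_Uq)
  have "c \<odot>\<^bsub>Uq\<^esub> a \<in> carrier Uq" if "a \<in> carrier Uq" for a c
    using that carrier_Uq by (auto simp flip: cl_sc)
  then show ?thesis by (simp add: subalgebra_def)
qed

lemma linear_subspace_Uq: "linear_subspace Uq (carrier Uq)"
  using subalgebra_Uq ring.ring_simprules(2)[OF ring_Uq] by (simp add: subalgebra_def linear_subspace_def)

lemma lsub_linear_subspace: "linear_subspace Uq V \<Longrightarrow> lsub {p. cl p \<in> V}"
  by (simp add: lsub_def linear_subspace_def cl_zero cl_add cl_sc)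

lemma linear_subspace_image:
  assumes "lsub V"
  shows "linear_subspace Uq (cl ` V)"
  unfolding linear_subspace_def
proof (intro conjI ballI allI)
  show "cl ` V \<subseteq> carrier Uq" by auto
  show "\<zero>\<^bsub>Uq\<^esub> \<in> cl ` V" using lsub_zero[OF assms] cl_zero by force
  show "x \<oplus>\<^bsub>Uq\<^esub> y \<in> cl ` V" if "x \<in> cl ` V" "y \<in> cl ` V" for x y
    using that lsub_add[OF assms] by (auto simp flip: cl_add)
  show "c \<odot>\<^bsub>Uq\<^esub> x \<in> cl ` V" if "x \<in> cl ` V" for c x
    using that lsub_sc[OF assms] by (auto simp flip: cl_sc)
qed

lemma subalgebra_image:
  assumes "lsub V" "1 \<in> V" "\<And>x y. x \<in> V \<Longrightarrow> y \<in> V \<Longrightarrow> x * y \<in> V"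
  shows "subalgebra Uq (cl ` V)"
proof -
  have "x \<otimes>\<^bsub>Uq\<^esub> y \<in> cl ` V" if "x \<in> cl ` V" "y \<in> cl ` V" for x y
    using that assms(3) by (auto simp flip: cl_mult)
  moreover have "\<one>\<^bsub>Uq\<^esub> \<in> cl ` V" using assms(2) cl_one by force
  ultimately show ?thesis
    using linear_subspace_image[OF assms(1)] by (simp add: subalgebra_def linear_subspace_def)
qed

subsection \<open>Weights\<close>

lemma conj_EKF:
  assumes w: "w \<in> lists S" and \<nu>: "\<nu> \<in> Q" and v: "v \<in> lists S" and \<kappa>: "\<kappa> \<in> Q"
  shows "cl (lK \<kappa> * EKF w \<nu> v * lK (- \<kappa>)) = cl (chr \<kappa> (wt w - wt v) *\<^sub>C EKF w \<nu> v)"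
proof -
  interpret C: qrel S form q ht cl_ideal by (rule qrel_cl_ideal)
  have FK: "C.eqv (Fw u * lK (- \<kappa>)) (inverse (chr \<kappa> (wt u)) *\<^sub>C (lK (- \<kappa>) * Fw u))" if "u \<in> lists S" for u
    using that
  proof (induction u)
    case Nil
    then show ?case using \<kappa> by (simp add: chr_zero_right flip: one_word)
  next
    case (Cons \<beta> u)
    have u: "\<beta> \<in> S" "u \<in> lists S" using Cons by auto
    have c: "C.eqv (lF \<beta> * lK (- \<kappa>)) (inverse (chr \<kappa> \<beta>) *\<^sub>C (lK (- \<kappa>) * lF \<beta>))"
      using C.eqv_sym[OF C.eqv_sc[OF C.K_neg_F[OF \<kappa> u(1)], of "inverse (chr \<kappa> \<beta>)"]] by simp
    have "Fw (\<beta> # u) * lK (- \<kappa>) = lF \<beta> * (Fw u * lK (- \<kappa>))" by simp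
    also have "C.eqv \<dots> (lF \<beta> * (inverse (chr \<kappa> (wt u)) *\<^sub>C (lK (- \<kappa>) * Fw u)))"
      using Cons by (intro C.eqv_left) auto
    also have "\<dots> = inverse (chr \<kappa> (wt u)) *\<^sub>C ((lF \<beta> * lK (- \<kappa>)) * Fw u)"
      by (simp only: sc_mult_right mult.assoc)
    also have "C.eqv \<dots> (inverse (chr \<kappa> (wt u)) *\<^sub>C ((inverse (chr \<kappa> \<beta>) *\<^sub>C (lK (- \<kappa>) * lF \<beta>)) * Fw u))"
      by (intro C.eqv_sc C.eqv_right c)
    also have "\<dots> = inverse (chr \<kappa> (wt (\<beta> # u))) *\<^sub>C (lK (- \<kappa>) * Fw (\<beta> # u))"
      using u \<kappa> by (simp add: chr_add_right Q_closed wt_Q mult.commute del: in_lists_conv_set)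
    finally show ?case .
  qed
  have Q: "wt w \<in> Q" "wt v \<in> Q" using w v by (simp_all only: wt_Q)
  have chr_eq: "chr \<kappa> (wt w) * inverse (chr \<kappa> (wt v)) = chr \<kappa> (wt w - wt v)"
    using chr_add_right[OF \<kappa> Q(1), of "- wt v"] Q \<kappa> by (simp add: Q_closed chr_uminus_right)
  have "C.eqv (lK \<kappa> * EKF w \<nu> v * lK (- \<kappa>)) ((chr \<kappa> (wt w) *\<^sub>C EKF w (\<kappa> + \<nu>) v) * lK (- \<kappa>))"
    by (intro C.eqv_right C.K_EKF w \<nu> \<kappa>)
  also have "\<dots> = chr \<kappa> (wt w) *\<^sub>C (Ew w * lK (\<kappa> + \<nu>) * (Fw v * lK (- \<kappa>)))"
    by (simp only: EKF_mult sc_mult_left mult.assoc)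
  also have "C.eqv \<dots> (chr \<kappa> (wt w) *\<^sub>C (Ew w * lK (\<kappa> + \<nu>) * (inverse (chr \<kappa> (wt v)) *\<^sub>C (lK (- \<kappa>) * Fw v))))"
    by (intro C.eqv_sc C.eqv_left FK v)
  also have "\<dots> = chr \<kappa> (wt w - wt v) *\<^sub>C (Ew w * (lK (\<kappa> + \<nu>) * lK (- \<kappa>)) * Fw v)"
    unfolding chr_eq[symmetric] by (simp only: sc_mult_right mult.assoc sc_sc)
  also have "C.eqv \<dots> (chr \<kappa> (wt w - wt v) *\<^sub>C (Ew w * lK (\<kappa> + \<nu> + - \<kappa>) * Fw v))"
    using \<nu> \<kappa> by (intro C.eqv_sc C.eqv_left C.eqv_right C.K_mult) (simp_all only: Q_closed)
  also have "\<dots> = chr \<kappa> (wt w - wt v) *\<^sub>C EKF w \<nu> v" by (simp add: EKF_mult)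
  finally show ?thesis by (simp only: cl_eq_iff_ideal C.eqv_def)
qed

lemma cf_sig_reduced:
  assumes "\<And>w \<nu> v. (w, \<nu>, v) \<in> keys z \<Longrightarrow> w \<in> lists S \<and> \<nu> \<in> Q \<and> v \<in> lists S \<and>
     nf (single w 1) = single w 1 \<and> nf (single v 1) = single v 1"
  shows "cf (sig z) = z"
  by (rule lmap_eqI[OF lmap_comp[OF lmap_cf lmap_sig] lmap_id])
    (use assms in \<open>force simp: sig_single cf_EKF simp del: in_lists_conv_set\<close>)

lemma cf_keep: "cf (sig (keep P (cf p))) = keep P (cf p)"
proof (rule cf_sig_reduced)
  fix w \<nu> v assume "(w, \<nu>, v) \<in> keys (keep P (cf p))"
  then have "(w, \<nu>, v) \<in> keys (cf p)" by simp
  then show "w \<in> lists S \<and> \<nu> \<in> Q \<and> v \<in> lists S \<and> nf (single w 1) = single w 1 \<and> nf (single v 1) = single v 1"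
    using cf_valid cf_reduced by blast
qed

lemma K_gen_eq: "\<mu> \<in> Q \<Longrightarrow> K \<mu> = cl (lK \<mu>)" by (simp add: gen_eq)

text \<open>Conjugation by \<open>K_\<kappa>\<close> scales each coordinate by its own character.
  Uniqueness of coordinates gives equality of characters, and \<open>chr_separates\<close> equality
  of weights.\<close>

lemma weight_space_cf:
  assumes p: "cl p \<in> weight_space \<mu>" and \<mu>: "\<mu> \<in> Q" and k: "(w, \<nu>, v) \<in> keys (cf p)"
  shows "wt w - wt v = \<mu>"
proof (rule chr_separates)
  have wv: "w \<in> lists S" "\<nu> \<in> Q" "v \<in> lists S" using cf_valid[OF k] by auto
  then show "wt w - wt v \<in> Q" by (simp only: Q_closed wt_Q)
  fix \<kappa> assume \<kappa>: "\<kappa> \<in> Q"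
  let ?s = "\<lambda>(w, \<nu>, v). single (w, \<nu>, v) (chr \<kappa> (wt w - wt v))"
  define z where "z = lin ?s (cf p)"
  have lz: "lookup z (w, \<nu>, v) = chr \<kappa> (wt w - wt v) * lookup (cf p) (w, \<nu>, v)" for w \<nu> v
  proof -
    have "lookup z (w, \<nu>, v) = (\<Sum>k\<in>keys (cf p). if k = (w, \<nu>, v) then chr \<kappa> (wt w - wt v) * lookup (cf p) (w, \<nu>, v) else 0)"
      unfolding z_def lookup_lin by (rule sum.cong) (auto simp: lookup_single when_def split: if_splits)
    then show ?thesis by (auto simp: in_keys_iff)
  qed
  have "cl (lK \<kappa> * p * lK (- \<kappa>)) = cl (lK \<kappa> * sig (cf p) * lK (- \<kappa>))"
    by (simp add: cl_mult cl_sig_cf)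
  also have "\<dots> = cl (sig z)"
  proof -
    have "lin (\<lambda>k. lK \<kappa> * sig (single k 1) * lK (- \<kappa>) - sig (?s k)) (cf p) \<in> cl_ideal"
    proof (rule lsub_lin[OF lsub_cl_ideal])
      fix k assume k: "k \<in> keys (cf p)"
      obtain w \<nu> v where "k = (w, \<nu>, v)" by (cases k)
      then show "lK \<kappa> * sig (single k 1) * lK (- \<kappa>) - sig (?s k) \<in> cl_ideal"
        using conj_EKF[of w \<nu> v \<kappa>] cf_valid[of w \<nu> v p] k \<kappa>
        by (simp add: sig_single cl_eq_iff_ideal[symmetric] del: in_lists_conv_set)
    qed
    also have "lin (\<lambda>k. lK \<kappa> * sig (single k 1) * lK (- \<kappa>) - sig (?s k)) (cf p)
       = lK \<kappa> * sig (cf p) * lK (- \<kappa>) - sig z"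
      unfolding z_def lmap_lin_comp[OF lmap_sig] lin_fun_diff
      by (subst lmap_conv_lin[OF lmap_comp[OF lmap_mult_right lmap_comp[OF lmap_mult_left lmap_sig]]]) simp
    finally show ?thesis by (simp only: cl_eq_iff_ideal)
  qed
  finally have 1: "cl (lK \<kappa> * p * lK (- \<kappa>)) = cl (sig z)" .
  have "cl (lK \<kappa> * p * lK (- \<kappa>)) = cl (chr \<kappa> \<mu> *\<^sub>C p)"
    using p \<kappa> by (simp add: weight_space_def K_gen_eq Q_closed cl_mult cl_sc chr_def)
  then have "cf (sig z) = chr \<kappa> \<mu> *\<^sub>C cf p"
    using 1 cl_eq_iff by (simp add: lmap_sc[OF lmap_cf])
  moreover have "cf (sig z) = z"
  proof (rule cf_sig_reduced)
    fix w \<nu> v assume "(w, \<nu>, v) \<in> keys z"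
    then have "(w, \<nu>, v) \<in> keys (cf p)" by (auto simp: in_keys_iff lz)
    then show "w \<in> lists S \<and> \<nu> \<in> Q \<and> v \<in> lists S \<and>
     nf (single w 1) = single w 1 \<and> nf (single v 1) = single v 1"
      using cf_valid cf_reduced by blast
  qed
  ultimately have "lookup z (w, \<nu>, v) = chr \<kappa> \<mu> * lookup (cf p) (w, \<nu>, v)" by simp
  then show "chr \<kappa> (wt w - wt v) = chr \<kappa> \<mu>"
    using k by (simp add: lz in_keys_iff)
qed (rule \<mu>)

lemma cl_EKF_zero: "cl (EKF w 0 v) = cl (Ew w * Fw v)"
proof -
  interpret C: qrel S form q ht cl_ideal by (rule qrel_cl_ideal)
  show ?thesis
    using C.eqv_right[OF C.eqv_left[OF C.K_zero, of "Ew w"], of "Fw v"]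
    by (simp only: EKF_mult cl_eq_iff_ideal C.eqv_def mult_1_right)
qed

lemma weight_Ew_Fw:
  assumes "w \<in> lists S" "v \<in> lists S"
  shows "cl (Ew w * Fw v) \<in> weight_space (wt w - wt v)"
proof -
  interpret U: ring Uq by (rule ring_Uq)
  show ?thesis using assms conj_EKF[OF assms(1) Q_zero assms(2)]
  by (simp add: weight_space_def K_gen_eq Q_closed chr_def cl_mult cl_sc flip: cl_EKF_zero del: mult_word)
    (simp add: cl_EKF_zero cl_mult del: mult_word)
qed

subsection \<open>The positive and the negative part\<close>

lemma gen_word_mem:
  assumes "w \<in> lists X" "subalgebra Uq B" "\<And>x. x \<in> X \<Longrightarrow> cl (ltr (g x)) \<in> B"
  shows "cl (single (map g w) 1) \<in> B"
  using assms(1)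
proof (induction w)
  case Nil
  then show ?case using assms(2) by (simp add: subalgebra_def cl_one flip: one_word)
next
  case (Cons x w)
  have "cl (single (map g (x # w)) 1) = cl (ltr (g x)) \<otimes>\<^bsub>Uq\<^esub> cl (single (map g w) 1)"
    by (simp flip: cl_mult)
  then show ?case using Cons assms(2,3) by (simp add: subalgebra_def)
qed

lemma subalgebra_U_parts: "subalgebra Uq U_plus" "subalgebra Uq U_minus" "subalgebra Uq U_zero"
  unfolding U_plus_def U_minus_def U_zero_def
  by (rule subalgebra_generated[OF subalgebra_Uq], use gen_eq Q_closed in force)+

lemma Ew_U_plus: "w \<in> lists S \<Longrightarrow> cl (Ew w) \<in> U_plus"
  by (rule gen_word_mem[OF _ subalgebra_U_parts(1)])
    (use generated_subalgebra_superset[of "E ` S" Uq] in \<open>auto simp: U_plus_def gen_eq\<close>)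

lemma Fw_U_minus: "w \<in> lists S \<Longrightarrow> cl (Fw w) \<in> U_minus"
  by (rule gen_word_mem[OF _ subalgebra_U_parts(2)])
    (use generated_subalgebra_superset[of "F ` S" Uq] in \<open>auto simp: U_minus_def gen_eq\<close>)

lemma K_U_zero: "\<mu> \<in> Q \<Longrightarrow> cl (lK \<mu>) \<in> U_zero"
  using generated_subalgebra_superset[of "K ` Q" Uq] by (auto simp: U_zero_def gen_eq)

text \<open>Elements of the subalgebra generated by the E's, or by the F's, have representatives
  built from words in these letters alone; the classes of such representatives already form a
  subalgebra.\<close>

lemma generated_words:
  assumes "\<And>x. x \<in> S \<Longrightarrow> X x \<in> generators" "inj X"
    and u: "u \<in> generated_subalgebra Uq ((\<lambda>\<alpha>. gen (X \<alpha>)) ` S)"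
  obtains a where "keys a \<subseteq> lists S" "u = cl (relabel X a)"
proof -
  let ?V = "relabel X ` {a. keys a \<subseteq> lists S}"
  have V: "lsub ?V"
    unfolding lsub_def
  proof (intro conjI ballI allI)
    show "0 \<in> ?V" by (rule image_eqI[of _ _ 0]) (simp_all add: lmap_zero[OF lmap_relabel])
    show "x + y \<in> ?V" if "x \<in> ?V" "y \<in> ?V" for x y
      using that lsub_add[OF lsub_keys[of "lists S"]] by (auto simp flip: lmap_add[OF lmap_relabel])
    show "c *\<^sub>C x \<in> ?V" if "x \<in> ?V" for c x
      using that lsub_sc[OF lsub_keys[of "lists S"]] by (auto simp flip: lmap_sc[OF lmap_relabel])
  qed
  have A: "subalgebra Uq (cl ` ?V)"
  proof (rule subalgebra_image[OF V])
    show "1 \<in> ?V" by (rule image_eqI[of _ _ 1]) (simp_all add: one_word)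
    fix x y assume "x \<in> ?V" "y \<in> ?V"
    then obtain a b where ab: "x = relabel X a" "y = relabel X b" "keys a \<subseteq> lists S" "keys b \<subseteq> lists S" by blast
    have "keys (a * b) \<subseteq> lists S"
      using Poly_Mapping.keys_mult[of a b] ab(3,4) by (force simp: plus_list_def)
    then show "x * y \<in> ?V" unfolding ab relabel_mult[symmetric] by blast
  qed
  have B: "(\<lambda>\<alpha>. gen (X \<alpha>)) ` S \<subseteq> cl ` ?V"
  proof clarify
    fix \<alpha> assume a: "\<alpha> \<in> S"
    have "gen (X \<alpha>) = cl (relabel X (ltr \<alpha>))" using assms(1)[OF a] by (simp add: gen_eq)
    moreover have "keys (ltr \<alpha> :: 'w list \<Rightarrow>\<^sub>0 complex) \<subseteq> lists S" using a by simp
    ultimately show "gen (X \<alpha>) \<in> cl ` ?V" by blast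
  qed
  show ?thesis using subsetD[OF generated_subalgebra_minimal[OF A B] u] that by blast
qed

lemma cf_relabel:
  assumes "keys a \<subseteq> lists S" "keys b \<subseteq> lists S" "\<nu> \<in> Q"
  shows "cf (relabel E_gen a * lK \<nu> * relabel F_gen b) = tens3 (nf a) \<nu> (nf b)"
proof -
  have "keys (tens3 a \<nu> b) \<subseteq> {k. valid k}"
    using keys_tens3[of a \<nu> b] assms by (force simp: valid_def)
  then show ?thesis
    using cf_sig[of "tens3 a \<nu> b"] by (simp add: PBW_def sig_tens3 NF_tens3)
qed

lemma cl_relabel: 
  shows "cl (relabel E_gen a) = cl (relabel E_gen a * lK 0 * relabel F_gen 1)"
    "cl (relabel F_gen b) = cl (relabel E_gen 1 * lK 0 * relabel F_gen b)"
proof -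
  interpret C: qrel S form q ht cl_ideal by (rule qrel_cl_ideal)
  interpret U: ring Uq by (rule ring_Uq)
  have "relabel X 1 = 1" for X :: "'w \<Rightarrow> 'w generator" by (simp add: one_word)
  moreover have "cl (lK 0) = cl 1" using C.K_zero by (simp only: cl_eq_iff_ideal C.eqv_def)
  ultimately show "cl (relabel E_gen a) = cl (relabel E_gen a * lK 0 * relabel F_gen 1)"
    "cl (relabel F_gen b) = cl (relabel E_gen 1 * lK 0 * relabel F_gen b)"
    by (simp_all add: cl_mult cl_one)
qed

text \<open>The weights of the E-factor and of the F-factor are detected separately, before
  multiplying; the total weight of the product would determine only their difference.\<close>

lemma triangular_space_cf:
  assumes "u \<in> triangular_space \<mu> \<nu> \<gamma>" and \<mu>: "\<mu> \<in> Q_pos" and \<nu>: "\<nu> \<in> Q" and \<gamma>: "\<gamma> \<in> Q_pos"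
  obtains p where "u = cl p" "\<And>w \<nu>' v. (w, \<nu>', v) \<in> keys (cf p) \<Longrightarrow> wt w = \<mu> \<and> \<nu>' = \<nu> \<and> wt v = \<gamma>"
proof -
  let ?V = "{p. cf p \<in> {z. keys z \<subseteq> {(w, \<nu>', v). wt w = \<mu> \<and> \<nu>' = \<nu> \<and> wt v = \<gamma>}}}"
  have V: "lsub ?V" by (rule lsub_vimage[OF lmap_cf lsub_keys])
  have "{x \<otimes>\<^bsub>Uq\<^esub> K \<nu> \<otimes>\<^bsub>Uq\<^esub> y | x y. x \<in> U_plus \<inter> weight_space \<mu> \<and> y \<in> U_minus \<inter> weight_space (- \<gamma>)} \<subseteq> cl ` ?V"
  proof clarify
    fix x y assume x: "x \<in> U_plus" "x \<in> weight_space \<mu>" and y: "y \<in> U_minus" "y \<in> weight_space (- \<gamma>)"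
    obtain a where a: "keys a \<subseteq> lists S" "x = cl (relabel E_gen a)"
      by (rule generated_words[of E_gen x]) (use x in \<open>auto simp: U_plus_def inj_def\<close>)
    obtain b where b: "keys b \<subseteq> lists S" "y = cl (relabel F_gen b)"
      by (rule generated_words[of F_gen y]) (use y in \<open>auto simp: U_minus_def inj_def\<close>)
    \<comment> \<open>Written with \<open>K_0\<close> and trivial F-factor, x has coordinates (w, 0,
      []), whose total weight is wt w.\<close>
    have wa: "wt w = \<mu>" if "w \<in> keys (nf a)" for w
    proof -
      have "(w, 0, []) \<in> keys (tens3 (nf a) 0 (nf 1))" using that by (simp add: in_keys_iff lookup_tens3 one_word)
      then have "(w, 0, []) \<in> keys (cf (relabel E_gen a * lK 0 * relabel F_gen 1))"
        using a by (subst cf_relabel) (simp_all add: one_word Q_closed)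
      moreover have "cl (relabel E_gen a * lK 0 * relabel F_gen 1) \<in> weight_space \<mu>" using x a cl_relabel by simp
      ultimately show ?thesis using weight_space_cf \<mu> by (fastforce simp: Q_pos_sub)
    qed
    have wb: "wt v = \<gamma>" if "v \<in> keys (nf b)" for v
    proof -
      have "([], 0, v) \<in> keys (tens3 (nf 1) 0 (nf b))" using that by (simp add: in_keys_iff lookup_tens3 one_word)
      then have "([], 0, v) \<in> keys (cf (relabel E_gen 1 * lK 0 * relabel F_gen b))"
        using b by (subst cf_relabel) (simp_all add: one_word Q_closed)
      moreover have "cl (relabel E_gen 1 * lK 0 * relabel F_gen b) \<in> weight_space (- \<gamma>)" using y b cl_relabel by simp
      ultimately have "wt [] - wt v = - \<gamma>" using weight_space_cf \<gamma> by (blast intro: Q_uminus Q_pos_sub)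
      then show ?thesis by simp
    qed
    let ?p = "relabel E_gen a * lK \<nu> * relabel F_gen b"
    have "x \<otimes>\<^bsub>Uq\<^esub> K \<nu> \<otimes>\<^bsub>Uq\<^esub> y = cl ?p" using a b \<nu> by (simp add: cl_mult K_gen_eq)
    moreover have "?p \<in> ?V"
      unfolding mem_Collect_eq cf_relabel[OF a(1) b(1) \<nu>]
      using keys_tens3[of "nf a" \<nu> "nf b"] wa wb by fastforce
    ultimately show "x \<otimes>\<^bsub>Uq\<^esub> K \<nu> \<otimes>\<^bsub>Uq\<^esub> y \<in> cl ` ?V" by blast
  qed
  then have "triangular_space \<mu> \<nu> \<gamma> \<subseteq> cl ` ?V"
    unfolding triangular_space_def by (rule linear_span_minimal[OF linear_subspace_image[OF V]])
  then obtain p where "u = cl p" "p \<in> ?V" using assms(1) by blast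
  then show ?thesis using that by blast
qed

lemma EKF_triangular:
  assumes "w \<in> lists S" "\<nu> \<in> Q" "v \<in> lists S"
  shows "cl (EKF w \<nu> v) \<in> triangular_space (wt w) \<nu> (wt v)"
proof -
  have "cl (EKF w \<nu> v) = cl (Ew w) \<otimes>\<^bsub>Uq\<^esub> K \<nu> \<otimes>\<^bsub>Uq\<^esub> cl (Fw v)"
    using assms by (simp add: EKF_mult cl_mult K_gen_eq del: mult_word)
  moreover have "cl (Ew w) \<in> weight_space (wt w)" "cl (Fw v) \<in> weight_space (- wt v)"
    using weight_Ew_Fw[OF assms(1) lists.Nil] weight_Ew_Fw[OF lists.Nil assms(3)] by (simp_all flip: one_word)
  ultimately show ?thesis
    unfolding triangular_space_def using Ew_U_plus[OF assms(1)] Fw_U_minus[OF assms(3)]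
    by (intro subsetD[OF linear_span_superset]) blast
qed

lemma linear_subspace_triangular: "\<nu> \<in> Q \<Longrightarrow> linear_subspace Uq (triangular_space \<mu> \<nu> \<gamma>)"
proof -
  interpret U: ring Uq by (rule ring_Uq)
  assume "\<nu> \<in> Q"
  then show ?thesis unfolding triangular_space_def
    by (intro linear_subspace_span[OF linear_subspace_Uq]) (auto simp: weight_space_def K_gen_eq)
qed

subsection \<open>Homogeneous components\<close>

definition wpart :: "'w \<times> 'w \<times> 'w \<Rightarrow> 'w pbw \<Rightarrow> 'w pbw" where
  "wpart i = keep (\<lambda>(w, \<nu>, v). (wt w, \<nu>, wt v) = i)"

lemma lmap_wpart [intro!, simp]: "lmap (wpart i)" by (simp add: wpart_def)

text \<open>A representative of the homogeneous component: the coordinates of p are cut down to the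
  index i and turned back into an element.\<close>

definition pcomp :: "('w generator list \<Rightarrow>\<^sub>0 complex) \<Rightarrow> 'w \<times> 'w \<times> 'w \<Rightarrow> ('w generator list \<Rightarrow>\<^sub>0 complex)" where
  "pcomp p i = sig (wpart i (cf p))"

lemma cf_pcomp: "cf (pcomp p i) = wpart i (cf p)"
  unfolding pcomp_def wpart_def by (rule cf_keep)

lemma cl_zero_iff: "cl p = \<zero>\<^bsub>Uq\<^esub> \<longleftrightarrow> cf p = 0"
  unfolding cl_zero[symmetric] cl_eq_iff by (simp add: lmap_zero[OF lmap_cf])

lemma pcomp_nonzero_iff: "cl (pcomp p i) \<noteq> \<zero>\<^bsub>Uq\<^esub> \<longleftrightarrow> (\<exists>(w, \<nu>, v)\<in>keys (cf p). (wt w, \<nu>, wt v) = i)"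
proof -
  have "wpart i (cf p) \<noteq> 0 \<longleftrightarrow> keys (wpart i (cf p)) \<noteq> {}" by simp
  then show ?thesis unfolding cl_zero_iff cf_pcomp by (auto simp: wpart_def)
qed

lemma sum_wpart:
  assumes "finite X" "(\<lambda>(w, \<nu>, v). (wt w, \<nu>, wt v)) ` keys z \<subseteq> X"
  shows "(\<Sum>i\<in>X. wpart i z) = z"
proof (rule poly_mapping_eqI)
  fix k :: "'w list \<times> 'w \<times> 'w list"
  obtain w \<nu> v where k: "k = (w, \<nu>, v)" by (cases k)
  have "lookup (\<Sum>i\<in>X. wpart i z) k = (\<Sum>i\<in>X. if i = (wt w, \<nu>, wt v) then lookup z k else 0)"
    unfolding lookup_sum by (rule sum.cong) (auto simp: wpart_def k)
  moreover have "(wt w, \<nu>, wt v) \<in> X" if "k \<in> keys z"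
    using assms(2) that by (force simp: k)
  ultimately show "lookup (\<Sum>i\<in>X. wpart i z) k = lookup z k"
    using assms(1) by (auto simp: in_keys_iff)
qed

lemma triangular_decomposition_exists: "triangular_decomposition (cl p) (\<lambda>i. cl (pcomp p i))"
  unfolding triangular_decomposition_def
proof (intro conjI allI)
  fix \<mu> \<nu> \<gamma>
  show "if \<mu> \<in> Q_pos \<and> \<nu> \<in> Q \<and> \<gamma> \<in> Q_pos then cl (pcomp p (\<mu>, \<nu>, \<gamma>)) \<in> triangular_space \<mu> \<nu> \<gamma>
     else cl (pcomp p (\<mu>, \<nu>, \<gamma>)) = \<zero>\<^bsub>Uq\<^esub>"
  proof (cases "\<mu> \<in> Q_pos \<and> \<nu> \<in> Q \<and> \<gamma> \<in> Q_pos")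
    case True
    have "sig (wpart (\<mu>, \<nu>, \<gamma>) (cf p)) \<in> {p. cl p \<in> triangular_space \<mu> \<nu> \<gamma>}"
      unfolding sig_def
    proof (rule lsub_lin[OF lsub_linear_subspace[OF linear_subspace_triangular]])
      fix k assume k: "k \<in> keys (wpart (\<mu>, \<nu>, \<gamma>) (cf p))"
      obtain w \<nu>' v where k': "k = (w, \<nu>', v)" by (cases k)
      have "(w, \<nu>', v) \<in> keys (cf p)" "wt w = \<mu>" "\<nu>' = \<nu>" "wt v = \<gamma>" using k by (auto simp: k' wpart_def)
      then show "(case k of (w, \<nu>, v) \<Rightarrow> EKF w \<nu> v) \<in> {p. cl p \<in> triangular_space \<mu> \<nu> \<gamma>}"
        using EKF_triangular[of w \<nu>' v] cf_valid[of w \<nu>' v p] by (auto simp: k' simp del: in_lists_conv_set)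
    qed (use True in simp)
    then show ?thesis using True by (simp add: pcomp_def)
  next
    case False
    have "(wt w, \<nu>', wt v) \<noteq> (\<mu>, \<nu>, \<gamma>)" if "(w, \<nu>', v) \<in> keys (cf p)" for w \<nu>' v
      using False cf_valid[OF that] wt_Q_pos by auto
    then have "\<not> (cl (pcomp p (\<mu>, \<nu>, \<gamma>)) \<noteq> \<zero>\<^bsub>Uq\<^esub>)" unfolding pcomp_nonzero_iff by blast
    then show ?thesis unfolding if_not_P[OF False] by blast
  qed
next
  let ?X = "{i. cl (pcomp p i) \<noteq> \<zero>\<^bsub>Uq\<^esub>}"
  have X: "?X = (\<lambda>(w, \<nu>, v). (wt w, \<nu>, wt v)) ` keys (cf p)"
    unfolding pcomp_nonzero_iff by force
  then show fin: "finite ?X" by simp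
  have "(\<Sum>i\<in>?X. wpart i (cf p)) = cf p" by (rule sum_wpart[OF fin]) (simp only: X order_refl)
  then have "(\<Sum>i\<in>?X. pcomp p i) = sig (cf p)"
    using lmap_sum[OF lmap_sig, of "\<lambda>i. wpart i (cf p)" ?X] by (simp only: pcomp_def)
  then show "cl p = (\<Oplus>\<^bsub>Uq\<^esub>i\<in>?X. cl (pcomp p i))"
    using cl_finsum[OF fin, of "pcomp p"] cl_sig_cf by simp
qed

text \<open>Each summand has coordinates of its own index only, so projecting the coordinates of the
  sum to an index recovers that summand.\<close>

lemma triangular_decomposition_unique:
  assumes "triangular_decomposition (cl p) c"
  shows "c = (\<lambda>i. cl (pcomp p i))"
proof -
  have c: "if \<mu> \<in> Q_pos \<and> \<nu> \<in> Q \<and> \<gamma> \<in> Q_pos then c (\<mu>, \<nu>, \<gamma>) \<in> triangular_space \<mu> \<nu> \<gamma>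
     else c (\<mu>, \<nu>, \<gamma>) = \<zero>\<^bsub>Uq\<^esub>" for \<mu> \<nu> \<gamma>
    using assms unfolding triangular_decomposition_def by blast
  have "\<exists>r. c i = cl r \<and> wpart i (cf r) = cf r" for i
  proof -
    obtain \<mu> \<nu> \<gamma> where i: "i = (\<mu>, \<nu>, \<gamma>)" by (cases i)
    show ?thesis
    proof (cases "\<mu> \<in> Q_pos \<and> \<nu> \<in> Q \<and> \<gamma> \<in> Q_pos")
      case True
      then have "c i \<in> triangular_space \<mu> \<nu> \<gamma>" using c i by simp
      then obtain r where r: "c i = cl r" "\<And>w \<nu>' v. (w, \<nu>', v) \<in> keys (cf r) \<Longrightarrow> wt w = \<mu> \<and> \<nu>' = \<nu> \<and> wt v = \<gamma>"
        using triangular_space_cf True by metis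
      have "wpart i (cf r) = cf r" unfolding wpart_def by (rule keep_all) (use r(2) i in auto)
      then show ?thesis using r(1) by blast
    next
      case False
      then have "c i = cl 0" using c[of \<mu> \<nu> \<gamma>] i cl_zero by presburger
      then show ?thesis by (intro exI[of _ 0]) (simp add: lmap_zero[OF lmap_cf] lmap_zero[OF lmap_wpart])
    qed
  qed
  then obtain r where r: "\<And>i. c i = cl (r i)" "\<And>i. wpart i (cf (r i)) = cf (r i)" by metis
  let ?X = "{i. c i \<noteq> \<zero>\<^bsub>Uq\<^esub>}"
  have fin: "finite ?X" using assms unfolding triangular_decomposition_def by blast
  have wp: "wpart j (wpart i z) = (if i = j then wpart i z else 0)" for i j z
    unfolding wpart_def by (rule poly_mapping_eqI) auto
  have "cl p = (\<Oplus>\<^bsub>Uq\<^esub>i\<in>?X. c i)" using assms unfolding triangular_decomposition_def by blast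
  also have "\<dots> = cl (\<Sum>i\<in>?X. r i)" unfolding r(1) using cl_finsum fin r(1) by simp
  finally have "cf p = cf (\<Sum>i\<in>?X. r i)" by (simp add: cl_eq_iff)
  then have cfp: "cf p = (\<Sum>i\<in>?X. cf (r i))" by (simp add: lmap_sum[OF lmap_cf])
  show ?thesis
  proof
    fix j
    have "wpart j (cf p) = (\<Sum>i\<in>?X. wpart j (wpart i (cf (r i))))"
      unfolding cfp lmap_sum[OF lmap_wpart] r(2) ..
    also have "\<dots> = (\<Sum>i\<in>?X. if i = j then cf (r j) else 0)"
      unfolding wp by (intro sum.cong refl) (simp add: r(2))
    also have "\<dots> = cf (r j)"
      using fin cl_zero_iff[of "r j"] by (simp add: r(1))
    finally have "cf (pcomp p j) = cf (r j)" by (simp add: cf_pcomp)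
    then show "c j = cl (pcomp p j)" using r(1) by (simp add: cl_eq_iff)
  qed
qed

lemma component_eq: "component (cl p) = (\<lambda>i. cl (pcomp p i))"
  unfolding component_def
  using triangular_decomposition_exists triangular_decomposition_unique by (rule the_equality)

end

section \<open>Lowering the leading terms\<close>

lemma lin_keep: "lin f (keep P p) = lin (\<lambda>k. if P k then f k else 0) p"
proof -
  have "lin f (keep P p) = (\<Sum>k\<in>keys p. lookup (keep P p) k *\<^sub>C f k)"
    by (rule lin_superset) auto
  then show ?thesis unfolding lin_def by (auto intro!: sum.cong)
qed

context qgroup
begin

lemma lin_cl_cong:
  assumes "\<And>k. k \<in> keys p \<Longrightarrow> cl (f k) = cl (g k)"
  shows "cl (lin f p) = cl (lin g p)"
  using lsub_lin[OF lsub_cl_ideal, of p "\<lambda>k. f k - g k"] assms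
  by (simp add: cl_eq_iff_ideal lin_fun_diff)

definition nonpos_pbw :: "'w pbw set" where
  "nonpos_pbw = {z \<in> PBW. \<forall>(w, \<nu>, v)\<in>keys z. w = []}"

text \<open>The combinations of monomials without \<open>E\<close>-letters, recognised by their action.\<close>

definition nonpos :: "('w generator list \<Rightarrow>\<^sub>0 complex) set" where
  "nonpos = {p. \<forall>z\<in>nonpos_pbw. act p z \<in> nonpos_pbw}"

lemma lsub_nonpos_pbw: "lsub nonpos_pbw"
proof -
  have "nonpos_pbw = {z. keys z \<subseteq> {k. valid k \<and> fst k = []}}"
    by (auto simp: nonpos_pbw_def PBW_def)
  then show ?thesis by (simp only: lsub_keys)
qed

lemma lsub_nonpos: "lsub nonpos"
  using lsub_nonpos_pbw unfolding lsub_def nonpos_def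
  by (auto simp: act_add act_sc lmap_zero[OF lmap_act_left])

lemma nonpos_mult: "x \<in> nonpos \<Longrightarrow> y \<in> nonpos \<Longrightarrow> x * y \<in> nonpos"
  by (auto simp: nonpos_def act_mult)

lemma nonpos_one: "1 \<in> nonpos" by (simp add: nonpos_def)

lemma nonpos_pbw_map:
  assumes "z \<in> nonpos_pbw" "lmap g" "\<And>\<nu> v. \<nu> \<in> Q \<Longrightarrow> v \<in> lists S \<Longrightarrow> g (single ([], \<nu>, v) 1) \<in> nonpos_pbw"
  shows "g z \<in> nonpos_pbw"
proof (subst lmap_conv_lin[OF assms(2)], rule lsub_lin[OF lsub_nonpos_pbw])
  fix k assume k: "k \<in> keys z"
  obtain w \<nu> v where "k = (w, \<nu>, v)" by (cases k)
  then have "w = []" "\<nu> \<in> Q" "v \<in> lists S" "k = (w, \<nu>, v)"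
    using k assms(1) by (auto simp: nonpos_pbw_def PBW_def valid_def)
  then show "g (single k 1) \<in> nonpos_pbw" using assms(3) by simp
qed

lemma single_nonpos_pbw: "\<nu> \<in> Q \<Longrightarrow> v \<in> lists S \<Longrightarrow> single ([], \<nu>, v) c \<in> nonpos_pbw"
  using single_PBW[of "[]" \<nu> v c] by (auto simp: nonpos_pbw_def)

lemma nonpos_K:
  assumes "\<kappa> \<in> Q"
  shows "lK \<kappa> \<in> nonpos"
proof -
  have "actK \<kappa> z \<in> nonpos_pbw" if "z \<in> nonpos_pbw" for z
    by (rule nonpos_pbw_map[OF that lmap_actK]) (simp add: single_nonpos_pbw Q_add[OF assms])
  then show ?thesis using assms by (simp add: nonpos_def act_ltr_def)
qed

lemma nonpos_F:
  assumes "\<beta> \<in> S"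
  shows "lF \<beta> \<in> nonpos"
proof -
  have "actF \<beta> z \<in> nonpos_pbw" if "z \<in> nonpos_pbw" for z
    by (rule nonpos_pbw_map[OF that lmap_actF]) (simp add: single_nonpos_pbw assms)
  then show ?thesis using assms by (simp add: nonpos_def act_ltr_def)
qed

lemma nonpos_EKF: "\<nu> \<in> Q \<Longrightarrow> v \<in> lists S \<Longrightarrow> EKF [] \<nu> v \<in> nonpos"
proof -
  assume \<nu>: "\<nu> \<in> Q" and v: "v \<in> lists S"
  have "Fw v \<in> nonpos" using v
  proof (induction v)
    case Nil
    then show ?case using nonpos_one by (simp add: one_word)
  next
    case (Cons \<beta> v)
    then show ?case unfolding Fw_Cons by (intro nonpos_mult nonpos_F)
  qed
  then show ?thesis unfolding EKF_Nil by (intro nonpos_mult nonpos_K \<nu>)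
qed

lemma nonpos_TD:
  assumes "functional \<phi>" "\<nu> \<in> Q" "v \<in> lists S"
  shows "TD \<phi> (EKF [] \<nu> v) \<in> nonpos"
proof -
  have *: "TD \<phi> (Fw v) \<in> nonpos" if "functional \<phi>" for \<phi>
    using assms(3) that
  proof (induction v arbitrary: \<phi>)
    case Nil
    then show ?case using lsub_sc[OF lsub_nonpos nonpos_one, of "\<phi> 1"] TD_one[of \<phi>] by (simp add: one_word)
  next
    case (Cons \<beta> v)
    then show ?case
      unfolding Fw_Cons TD_F[OF Cons.prems(1)]
      by (intro lsub_add[OF lsub_nonpos] nonpos_mult nonpos_F Cons.IH functional_left)
  qed
  show ?thesis
    unfolding EKF_Nil TD_K[OF assms(1)] using *[OF functional_left[OF assms(1)]] assms
    by (intro nonpos_mult nonpos_K)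
qed

text \<open>Applied to \<open>e0\<close>, z produces no E-letters, and then w is simply prefixed. So
  E-weights of such products can be read off without reordering z.\<close>

lemma cf_Ew_nonpos:
  assumes "w \<in> lists S" "z \<in> nonpos" "(a, \<nu>, v) \<in> keys (cf (Ew w * z))"
  shows "wt a = wt w"
proof -
  have e: "act z e0 \<in> nonpos_pbw"
    using assms(2) by (simp add: nonpos_def e0_def single_nonpos_pbw Q_closed)
  let ?X = "{k. wt (fst k) = wt w} :: ('w list \<times> 'w \<times> 'w list) set"
  have "NF (foldr act_ltr (map E_gen w) (act z e0)) \<in> {u. keys u \<subseteq> ?X}"
  proof (subst lmap_conv_lin[OF lmap_comp[OF lmap_NF lmap_foldr_act]], rule lsub_lin[OF lsub_keys])
    fix k assume k: "k \<in> keys (act z e0)"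
    obtain \<nu> v where k: "k = ([], \<nu>, v)" "v \<in> lists S" "\<nu> \<in> Q"
      using k e by (cases k) (force simp: nonpos_pbw_def PBW_def valid_def simp del: in_lists_conv_set)
    have "wt (fst i) = wt w" if "i \<in> keys (tens3 (nf (single w 1)) \<nu> (nf (single v 1)))" for i
      using subsetD[OF keys_tens3 that] nf_wt[of _ w] by auto
    then show "NF (foldr act_ltr (map E_gen w) (single k 1)) \<in> {u. keys u \<subseteq> ?X}"
      using assms(1) unfolding k(1) foldr_act_E[OF assms(1)] NF_single by auto
  qed
  then show ?thesis using assms(3) by (auto simp: cf_def act_mult act_single)
qed

lemma cf_EKF_reduced:
  assumes "w \<in> lists S" "\<nu> \<in> Q" "v \<in> lists S" "nf (single w 1) = single w 1" "nf (single v 1) = single v 1"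
  shows "cf (EKF w \<nu> v) = single (w, \<nu>, v) 1"
  using assms by (simp add: cf_EKF del: in_lists_conv_set)

section \<open>Leading weights and rows in PBW coordinates\<close>

definition E_wts :: "('w generator list \<Rightarrow>\<^sub>0 complex) \<Rightarrow> 'w set" where
  "E_wts p = (\<lambda>(w, \<nu>, v). wt w) ` keys (cf p) - {0}"

definition good :: "'w \<Rightarrow> ('w generator list \<Rightarrow>\<^sub>0 complex) \<Rightarrow> bool" where
  "good \<mu> p \<longleftrightarrow> (\<forall>(w, \<nu>, v)\<in>keys (cf p). wt w = \<mu> \<longrightarrow> v = [])"

definition leading :: "('w generator list \<Rightarrow>\<^sub>0 complex) \<Rightarrow> 'w set" where
  "leading p = {\<mu> \<in> E_wts p. \<forall>\<mu>'\<in>E_wts p. weight_le S \<mu> \<mu>' \<longrightarrow> \<mu>' = \<mu>}"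

definition bad :: "('w generator list \<Rightarrow>\<^sub>0 complex) \<Rightarrow> 'w set" where
  "bad p = {\<mu> \<in> leading p. \<not> good \<mu> p}"

text \<open>The index records the E-word and \<nu> - wt v. A contraction with the coordinate of
  \<open>E_a K_\<kappa>\<close> sees one such class of monomials, and elimination removes one class
  at a time.\<close>

definition rows :: "('w generator list \<Rightarrow>\<^sub>0 complex) \<Rightarrow> 'w \<Rightarrow> ('w list \<times> 'w) set" where
  "rows p \<mu> = (\<lambda>(w, \<nu>, v). (w, \<nu> - wt v)) ` {(w, \<nu>, v) \<in> keys (cf p). wt w = \<mu>}"

lemma E_wts_iff: "\<mu> \<in> E_wts p \<longleftrightarrow> \<mu> \<noteq> 0 \<and> (\<exists>w \<nu> v. (w, \<nu>, v) \<in> keys (cf p) \<and> wt w = \<mu>)"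
  by (force simp: E_wts_def)

lemma rows_iff: "(a, \<kappa>) \<in> rows p \<mu> \<longleftrightarrow> wt a = \<mu> \<and> (\<exists>v. (a, \<kappa> + wt v, v) \<in> keys (cf p))"
proof
  assume "(a, \<kappa>) \<in> rows p \<mu>"
  then obtain w \<nu> v where k: "(w, \<nu>, v) \<in> keys (cf p)" "wt w = \<mu>" "a = w" "\<kappa> = \<nu> - wt v"
    by (auto simp: rows_def)
  then have "(a, \<kappa> + wt v, v) \<in> keys (cf p)" by simp
  then show "wt a = \<mu> \<and> (\<exists>v. (a, \<kappa> + wt v, v) \<in> keys (cf p))" using k by blast
next
  assume "wt a = \<mu> \<and> (\<exists>v. (a, \<kappa> + wt v, v) \<in> keys (cf p))"
  then show "(a, \<kappa>) \<in> rows p \<mu>" unfolding rows_def by force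
qed

lemma finite_E_wts: "finite (E_wts p)" by (simp add: E_wts_def)
lemma finite_bad: "finite (bad p)"
  using finite_subset[OF _ finite_E_wts[of p]] by (auto simp: bad_def leading_def)
lemma finite_rows: "finite (rows p \<mu>)"
  unfolding rows_def by (rule finite_imageI) (rule finite_subset[OF _ finite_keys[of "cf p"]], auto)

lemma E_weights_eq: "E_weights (cl p) = E_wts p"
proof -
  have "\<mu> \<in> E_wts p" if "\<mu> \<in> E_weights (cl p)" for \<mu>
    using that unfolding E_weights_def component_eq pcomp_nonzero_iff E_wts_iff by blast
  moreover have "\<mu> \<in> E_weights (cl p)" if "\<mu> \<in> E_wts p" for \<mu>
  proof -
    obtain w \<nu> v where k: "(w, \<nu>, v) \<in> keys (cf p)" "\<mu> = wt w" "\<mu> \<noteq> 0" using \<open>\<mu> \<in> E_wts p\<close> unfolding E_wts_iff by blast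
    then have "cl (pcomp p (\<mu>, \<nu>, wt v)) \<noteq> \<zero>\<^bsub>Uq\<^esub>" unfolding pcomp_nonzero_iff by blast
    moreover have "\<mu> \<in> Q_pos" "\<nu> \<in> Q" "wt v \<in> Q_pos" using cf_valid[OF k(1)] wt_Q_pos k(2) by blast+
    ultimately show ?thesis unfolding E_weights_def component_eq using k(3) by blast
  qed
  ultimately show ?thesis by blast
qed

lemma E_leading_weights_eq: "E_leading_weights (cl p) = leading p"
  by (simp add: E_leading_weights_def leading_def E_weights_eq)

lemma good_leading_term:
  assumes "good \<mu> p"
  shows "E_leading_term \<mu> (cl p) \<in> U_geq"
proof -
  let ?I = "{i. fst i = \<mu> \<and> cl (pcomp p i) \<noteq> \<zero>\<^bsub>Uq\<^esub>}"
  interpret U: ring Uq by (rule ring_Uq)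
  have sub: "linear_subspace Uq U_geq"
    unfolding U_geq_def using subalgebra_U_parts
    by (intro linear_subspace_span[OF linear_subspace_Uq]) (auto simp: subalgebra_def)
  have "?I \<subseteq> (\<lambda>(w, \<nu>, v). (wt w, \<nu>, wt v)) ` keys (cf p)"
    unfolding pcomp_nonzero_iff by force
  then have fin: "finite ?I" by (rule finite_subset) simp
  have "pcomp p i \<in> {p. cl p \<in> U_geq}" if i: "i \<in> ?I" for i
    unfolding pcomp_def sig_def
  proof (rule lsub_lin[OF lsub_linear_subspace[OF sub]])
    fix k assume k: "k \<in> keys (wpart i (cf p))"
    obtain w \<nu> v where k': "k = (w, \<nu>, v)" by (cases k)
    have 1: "(w, \<nu>, v) \<in> keys (cf p)" "wt w = \<mu>" using k i by (auto simp: k' wpart_def)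
    then have v: "v = []" using assms by (auto simp: good_def)
    have "cl (EKF w \<nu> v) = cl (Ew w) \<otimes>\<^bsub>Uq\<^esub> cl (lK \<nu>)"
      by (simp add: v EKF_def flip: cl_mult)
    moreover have "cl (Ew w) \<otimes>\<^bsub>Uq\<^esub> cl (lK \<nu>) \<in> U_geq"
      unfolding U_geq_def using cf_valid[OF 1(1)] Ew_U_plus K_U_zero
      by (intro subsetD[OF linear_span_superset]) blast
    ultimately show "(case k of (w, \<nu>, v) \<Rightarrow> EKF w \<nu> v) \<in> {p. cl p \<in> U_geq}" by (simp add: k')
  qed
  then have "sum (pcomp p) ?I \<in> {p. cl p \<in> U_geq}" by (rule lsub_sum[OF lsub_linear_subspace[OF sub]])
  moreover have "E_leading_term \<mu> (cl p) = cl (sum (pcomp p) ?I)"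
    unfolding E_leading_term_def component_eq by (rule cl_finsum[OF fin])
  ultimately show ?thesis by simp
qed

lemma EKF_carrier:
  "w \<in> lists S \<Longrightarrow> \<nu> \<in> Q \<Longrightarrow> v \<in> lists S \<Longrightarrow> EKF w \<nu> v \<in> carrier (free_algebra generators)"
  by (auto simp: EKF_def free_algebra_def monoid_algebra_def word_monoid_def)

lemma lsub_carrier: "lsub (carrier (free_algebra generators))"
  using lsub_keys[of "lists generators"] by (simp add: free_algebra_def monoid_algebra_def word_monoid_def)

lemma sig_carrier: "sig (cf p) \<in> carrier (free_algebra generators)"
  unfolding sig_def
proof (rule lsub_lin[OF lsub_carrier])
  fix k assume k: "k \<in> keys (cf p)"
  obtain w \<nu> v where k': "k = (w, \<nu>, v)" by (cases k)
  then show "(case k of (w, \<nu>, v) \<Rightarrow> EKF w \<nu> v) \<in> carrier (free_algebra generators)"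
    using EKF_carrier[of w \<nu> v] cf_valid[of w \<nu> v p] k by simp
qed

lemma TD_sig: "TD \<phi> (sig m) = lin (\<lambda>(w, \<nu>, v). TD \<phi> (EKF w \<nu> v)) m"
  unfolding sig_def lmap_lin_comp[OF lmap_TD] by (rule lin_cong) auto

lemma K_EKF_Nil: "\<kappa> \<in> Q \<Longrightarrow> \<nu> \<in> Q \<Longrightarrow> cl (lK \<kappa> * EKF [] \<nu> v) = cl (EKF [] (\<kappa> + \<nu>) v)"
proof -
  interpret C: qrel S form q ht cl_ideal by (rule qrel_cl_ideal)
  assume "\<kappa> \<in> Q" "\<nu> \<in> Q"
  then show ?thesis
    using C.K_EKF[of "[]" \<nu> \<kappa> v] by (simp add: cl_eq_iff_ideal C.eqv_def chr_zero_right)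
qed

definition row :: "'w list \<Rightarrow> 'w \<Rightarrow> 'w pbw \<Rightarrow> 'w pbw" where
  "row a \<kappa> = keep (\<lambda>(w, \<nu>, v). w = a \<and> \<nu> = \<kappa> + wt v)"

text \<open>Turns maximality among the nonzero E-weights into the hypothesis of
  \<open>TD_coord_lower\<close>. Weight 0 is no exception, as \<open>Q_pos\<close> is
  pointed.\<close>

lemma leading_maximal:
  assumes "\<mu> \<in> leading p" "(w, \<nu>, v) \<in> keys (cf p)" "wt w \<noteq> \<mu>"
  shows "wt w - \<mu> \<notin> Q_pos"
proof
  assume le: "wt w - \<mu> \<in> Q_pos"
  have \<mu>: "\<mu> \<in> Q_pos" "\<mu> \<noteq> 0"
    using assms(1) cf_valid[of _ _ _ p] wt_Q_pos by (auto simp: leading_def E_wts_iff)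
  have "wt w \<noteq> 0" using Q_pos_pointed[OF \<mu>(1)] \<mu>(2) le by auto
  then have "wt w \<in> E_wts p" using assms(2) unfolding E_wts_iff by blast
  then show False using assms le by (simp add: leading_def weight_le_def)
qed

text \<open>The row of the pivot as an element of C, with its K-factors shifted so that the pivot
  itself becomes \<open>F_j0\<close> without K. The shift is by an inverse K, which is where the
  Hopf hypothesis enters.\<close>

lemma coideal_row:
  assumes C: "right_coideal_subalgebra C" and H: "hopf_subalgebra (C \<inter> U_zero)" and p: "cl p \<in> C"
    and i0: "wt i0 \<in> leading p" and k0: "(i0, \<nu>0, j0) \<in> keys (cf p)"
    and max: "\<And>\<nu> v. (i0, \<nu>, v) \<in> keys (cf p) \<Longrightarrow> length v \<le> length j0"
  shows "cl (lin (\<lambda>(w, \<nu>, v). EKF [] (\<nu> - \<nu>0) v) (row i0 (\<nu>0 - wt j0) (cf p))) \<in> C"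
proof -
  define Y where "Y = row i0 (\<nu>0 - wt j0) (cf p)"
  define y where "y = lin (\<lambda>(w, \<nu>, v). EKF [] (wt i0 + \<nu>) v) Y"
  note v0 = cf_valid[OF k0]
  have \<mu>: "wt i0 \<in> Q" "wt i0 + \<nu>0 \<in> Q" "- (wt i0 + \<nu>0) \<in> Q" using v0 by (simp_all only: Q_closed wt_Q)
  have Yk: "(w, \<nu>, v) \<in> keys Y \<longleftrightarrow> (w, \<nu>, v) \<in> keys (cf p) \<and> w = i0 \<and> \<nu> = \<nu>0 - wt j0 + wt v" for w \<nu> v
    by (simp add: Y_def row_def)
  have yC: "cl y \<in> C"
  proof -
    \<comment> \<open>This coordinate selects the row of the pivot among the monomials of its
      weight; other E-weights contribute nothing because the weight is leading.\<close>
    let ?\<phi> = "coord (i0, \<nu>0 - wt j0, [])"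
    have "cl (TD ?\<phi> (sig (cf p))) \<in> C"
      using p by (intro coideal_contract[OF C _ sig_carrier functional_coord]) (simp add: cl_sig_cf)
    also have "cl (TD ?\<phi> (sig (cf p))) = cl y"
      unfolding TD_sig y_def Y_def row_def lin_keep
    proof (rule lin_cl_cong)
      fix k assume k: "k \<in> keys (cf p)"
      obtain w \<nu> v where k': "k = (w, \<nu>, v)" by (cases k)
      then have k: "(w, \<nu>, v) \<in> keys (cf p)" using k by simp
      note v = cf_valid[OF k]
      show "cl (case k of (w, \<nu>, v) \<Rightarrow> TD ?\<phi> (EKF w \<nu> v)) =
        cl (if case k of (w, \<nu>, v) \<Rightarrow> w = i0 \<and> \<nu> = \<nu>0 - wt j0 + wt v
            then case k of (w, \<nu>, v) \<Rightarrow> EKF [] (wt i0 + \<nu>) v else 0)"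
      proof (cases "wt w = wt i0")
        case True
        have "cl (TD ?\<phi> (EKF w \<nu> v)) = cl ((if \<nu> = \<nu>0 - wt j0 + wt v then lookup (single w 1) i0 else 0) *\<^sub>C
            EKF [] (wt w + \<nu>) v)"
          using TD_coord_weight[OF True, of \<nu> v] v by (simp only: cf_reduced[OF k])
        then show ?thesis using True by (auto simp: k' lookup_single when_def)
      next
        case False
        then have "TD ?\<phi> (EKF w \<nu> v) = 0"
          using v by (intro TD_coord_lower leading_maximal[OF i0 k]) auto
        then show ?thesis using False by (auto simp: k')
      qed
    qed
    finally show ?thesis .
  qed
  have yc: "y \<in> carrier (free_algebra generators)"
    unfolding y_def
  proof (rule lsub_lin[OF lsub_carrier])
    fix k assume k: "k \<in> keys Y"
    obtain w \<nu> v where k': "k = (w, \<nu>, v)" by (cases k)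
    have "(w, \<nu>, v) \<in> keys (cf p)" using k unfolding k' by (rule Yk[THEN iffD1, THEN conjunct1])
    then show "(case k of (w, \<nu>, v) \<Rightarrow> EKF [] (wt i0 + \<nu>) v) \<in> carrier (free_algebra generators)"
      unfolding k' using EKF_carrier[of "[]" "wt i0 + \<nu>" v] cf_valid Q_add[OF \<mu>(1)] by simp
  qed
  have "lK (- (wt i0 + \<nu>0)) \<in> {z. cl z \<in> C}"
  proof -
    \<comment> \<open>By the maximal length of j0 and since all words are reduced, only the pivot
      survives. The result is its nonzero coefficient times a K, so this K lies in C.\<close>
    let ?\<phi> = "coord ([], wt i0 + \<nu>0, j0)" and ?c = "lookup (cf p) (i0, \<nu>0, j0)"
    have "cl (TD ?\<phi> y) \<in> C" by (rule coideal_contract[OF C yC yc functional_coord])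
    also have "TD ?\<phi> y = lin (\<lambda>k. if k = (i0, \<nu>0, j0) then lK (wt i0 + \<nu>0) else 0) Y"
      unfolding y_def lmap_lin_comp[OF lmap_TD]
    proof (rule lin_cong[OF refl])
      fix k assume k: "k \<in> keys Y"
      obtain w \<nu> v where k': "k = (w, \<nu>, v)" by (cases k)
      have "(w, \<nu>, v) \<in> keys (cf p) \<and> w = i0 \<and> \<nu> = \<nu>0 - wt j0 + wt v" using k unfolding k' by (rule Yk[THEN iffD1])
      then have k: "(i0, \<nu>, v) \<in> keys (cf p)" "w = i0" by auto
      note v = cf_valid[OF k(1)]
      have "TD ?\<phi> (EKF [] (wt i0 + \<nu>) v) =
         (if wt i0 + \<nu> = wt i0 + \<nu>0 then lookup (single v 1) j0 else 0) *\<^sub>C EKF [] (wt i0 + \<nu>) []"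
        using TD_coord_F[of "[]" "wt i0 + \<nu>" v j0] v max[OF k(1)] Q_add[OF \<mu>(1)]
        by (simp only: cf_reduced[OF k(1)] lists.Nil)
      then show "TD ?\<phi> (case k of (w, \<nu>, v) \<Rightarrow> EKF [] (wt i0 + \<nu>) v) = (if k = (i0, \<nu>0, j0) then lK (wt i0 + \<nu>0) else 0)"
        using k(2) by (auto simp: k' EKF_def lookup_single when_def)
    qed
    also have "\<dots> = ?c *\<^sub>C lK (wt i0 + \<nu>0)"
    proof -
      have "(i0, \<nu>0, j0) \<in> keys Y" "lookup Y (i0, \<nu>0, j0) = ?c" using k0 by (simp_all add: Yk) (simp add: Y_def row_def)
      then show ?thesis unfolding lin_def by (subst sum.remove[OF finite_keys]) auto
    qed
    finally have "cl (?c *\<^sub>C lK (wt i0 + \<nu>0)) \<in> C" .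
    moreover have c: "?c \<noteq> 0" using k0 by (simp add: in_keys_iff)
    moreover have "subalgebra Uq C" using C by (simp add: right_coideal_subalgebra_def)
    ultimately have "inverse ?c \<odot>\<^bsub>Uq\<^esub> cl (?c *\<^sub>C lK (wt i0 + \<nu>0)) \<in> C" unfolding subalgebra_def by blast
    then have "cl (lK (wt i0 + \<nu>0)) \<in> C" using c by (simp flip: cl_sc)
    then have "antipode (cl (lK (wt i0 + \<nu>0))) \<in> C"
      using H K_U_zero[OF \<mu>(2)] unfolding hopf_subalgebra_def by blast
    then show ?thesis by (simp add: antipode_K[OF \<mu>(2)])
  qed
  then have "cl (lK (- (wt i0 + \<nu>0)) * y) \<in> C"
    using C yC by (simp add: cl_mult right_coideal_subalgebra_def subalgebra_def)
  also have "cl (lK (- (wt i0 + \<nu>0)) * y) = cl (lin (\<lambda>(w, \<nu>, v). EKF [] (\<nu> - \<nu>0) v) Y)"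
    unfolding y_def lmap_lin_comp[OF lmap_mult_left]
  proof (rule lin_cl_cong)
    fix k assume k: "k \<in> keys Y"
    obtain w \<nu> v where k': "k = (w, \<nu>, v)" by (cases k)
    have "(w, \<nu>, v) \<in> keys (cf p)" using k unfolding k' by (rule Yk[THEN iffD1, THEN conjunct1])
    then have "\<nu> \<in> Q" using cf_valid by blast
    then have "cl (lK (- (wt i0 + \<nu>0)) * EKF [] (wt i0 + \<nu>) v) = cl (EKF [] (- (wt i0 + \<nu>0) + (wt i0 + \<nu>)) v)"
      using \<mu> by (intro K_EKF_Nil Q_add)
    also have "- (wt i0 + \<nu>0) + (wt i0 + \<nu>) = \<nu> - \<nu>0" by simp
    finally show "cl (lK (- (wt i0 + \<nu>0)) * (case k of (w, \<nu>, v) \<Rightarrow> EKF [] (wt i0 + \<nu>) v)) =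
       cl (case k of (w, \<nu>, v) \<Rightarrow> EKF [] (\<nu> - \<nu>0) v)" by (simp add: k')
  qed
  finally show ?thesis unfolding Y_def .
qed

text \<open>\<open>E_w K_\<nu>0\<close> times the shifted row undoes the shift: the row of i0
  reappears with i0 replaced by w and unchanged coefficients.\<close>

lemma cf_row_shift:
  assumes w: "w \<in> lists S" "nf (single w 1) = single w 1" and \<nu>0: "\<nu>0 \<in> Q"
  shows "lookup (cf (Ew w * (EKF [] \<nu>0 [] * lin (\<lambda>(w, \<nu>, v). EKF [] (\<nu> - \<nu>0) v) (row i0 \<kappa> (cf p))))) (a, \<nu>, v) =
    (if a = w \<and> \<nu> = \<kappa> + wt v then lookup (cf p) (i0, \<nu>, v) else 0)"
proof -
  define Y where "Y = row i0 \<kappa> (cf p)"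
  have Yk: "k \<in> keys Y \<Longrightarrow> k \<in> keys (cf p) \<and> fst k = i0" for k by (auto simp: Y_def row_def)
  have "cl (Ew w * (EKF [] \<nu>0 [] * lin (\<lambda>(w, \<nu>, v). EKF [] (\<nu> - \<nu>0) v) Y)) = cl (lin (\<lambda>k. EKF w (fst (snd k)) (snd (snd k))) Y)"
    unfolding lmap_lin_comp[OF lmap_comp[OF lmap_mult_left lmap_mult_left]]
  proof (rule lin_cl_cong)
    fix k assume k: "k \<in> keys Y"
    obtain i \<nu> v where k': "k = (i, \<nu>, v)" by (cases k)
    have "\<nu> \<in> Q" using Yk[OF k] cf_valid k' by blast
    then have "cl (lK \<nu>0 * EKF [] (\<nu> - \<nu>0) v) = cl (EKF [] (\<nu>0 + (\<nu> - \<nu>0)) v)"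
      by (intro K_EKF_Nil \<nu>0 Q_diff)
    then have "cl (Ew w * (lK \<nu>0 * EKF [] (\<nu> - \<nu>0) v)) = cl (Ew w * EKF [] \<nu> v)"
      by (simp add: cl_mult del: mult_word)
    then show "cl (Ew w * (EKF [] \<nu>0 [] * (case k of (w, \<nu>, v) \<Rightarrow> EKF [] (\<nu> - \<nu>0) v))) =
      cl (EKF w (fst (snd k)) (snd (snd k)))"
      by (simp add: k' EKF_def)
  qed
  then have "cf (Ew w * (EKF [] \<nu>0 [] * lin (\<lambda>(w, \<nu>, v). EKF [] (\<nu> - \<nu>0) v) Y)) =
      lin (\<lambda>k. cf (EKF w (fst (snd k)) (snd (snd k)))) Y"
    unfolding cl_eq_iff lmap_lin_comp[OF lmap_cf] .
  also have "\<dots> = lin (\<lambda>k. single (w, snd k) 1) Y"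
  proof (rule lin_cong[OF refl])
    fix k assume k: "k \<in> keys Y"
    obtain i \<nu> v where k': "k = (i, \<nu>, v)" by (cases k)
    have "(i, \<nu>, v) \<in> keys (cf p)" using Yk[OF k] k' by blast
    then show "cf (EKF w (fst (snd k)) (snd (snd k))) = single (w, snd k) 1"
      unfolding k' fst_conv snd_conv using w cf_valid cf_reduced(2) by (intro cf_EKF_reduced) blast+
  qed
  also have "lookup \<dots> (a, \<nu>, v) = (\<Sum>k\<in>keys Y. if k = (i0, \<nu>, v) then (if a = w then lookup Y k else 0) else 0)"
    unfolding lookup_lin using Yk by (intro sum.cong refl) (auto simp: lookup_single when_def)
  also have "\<dots> = (if a = w \<and> \<nu> = \<kappa> + wt v then lookup (cf p) (i0, \<nu>, v) else 0)"
    by (auto simp: Y_def row_def in_keys_iff)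
  finally show ?thesis unfolding Y_def .
qed

text \<open>One elimination step. The conclusions are tailored to the induction: y has no E-weights,
  x becomes good at \<mu> and loses all weights good for p, and r has fewer rows in \<mu> without
  spoiling good weights.\<close>

lemma lower_bad_row:
  assumes C: "right_coideal_subalgebra C" and H: "hopf_subalgebra (C \<inter> U_zero)" and p: "cl p \<in> C"
    and \<mu>: "\<mu> \<in> bad p"
  obtains x y r where "cl x \<in> C" "cl y \<in> C" "cl r \<in> C" "cl p = cl (r + x * y)"
    "E_wts y = {}" "E_wts x \<subseteq> E_wts p" "good \<mu> x" "\<And>\<mu>'. good \<mu>' p \<Longrightarrow> \<mu>' \<notin> E_wts x"
    "E_wts r \<subseteq> E_wts p" "\<And>\<mu>'. good \<mu>' p \<Longrightarrow> good \<mu>' r" "rows r \<mu> \<subset> rows p \<mu>"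
proof -
  define X where "X = {k \<in> keys (cf p). wt (fst k) = \<mu>}"
  have X: "finite X" by (simp add: X_def)
  have lead: "\<mu> \<in> leading p" using \<mu> by (simp add: bad_def)
  have "\<not> good \<mu> p" using \<mu> by (simp add: bad_def)
  then obtain w1 \<nu>1 v1 where "(w1, \<nu>1, v1) \<in> keys (cf p)" "wt w1 = \<mu>" "v1 \<noteq> []"
    unfolding good_def by blast
  then obtain k1 where k1: "k1 \<in> X" "snd (snd k1) \<noteq> []"
    using that[of "(w1, \<nu>1, v1)"] by (simp add: X_def)
  \<comment> \<open>The maximum runs over all monomials of weight \<mu>, not only those with one
    E-word. This is what removes every F-letter from the weight \<mu> part of x.\<close>
  obtain k0 where k0: "k0 \<in> X" "\<And>k. k \<in> X \<Longrightarrow> length (snd (snd k)) \<le> length (snd (snd k0))"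
    using Max_in[of "(\<lambda>k. length (snd (snd k))) ` X"] Max_ge[of "(\<lambda>k. length (snd (snd k))) ` X"] X k1(1)
    by (metis (no_types, lifting) empty_iff finite_imageI image_iff)
  obtain i0 \<nu>0 j0 where k0': "k0 = (i0, \<nu>0, j0)" by (cases k0)
  have key0: "(i0, \<nu>0, j0) \<in> keys (cf p)" and wt0: "wt i0 = \<mu>" using k0(1) by (simp_all add: X_def k0')
  have max: "length v \<le> length j0" if "(w, \<nu>, v) \<in> keys (cf p)" "wt w = \<mu>" for w \<nu> v
    using k0(2)[of "(w, \<nu>, v)"] \<open>(w, \<nu>, v) \<in> keys (cf p)\<close> \<open>wt w = \<mu>\<close> by (simp add: X_def k0')
  have j0: "j0 \<noteq> []" using k0(2)[OF k1(1)] k1(2) by (auto simp: k0')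
  note v0 = cf_valid[OF key0]
  define \<kappa>0 where "\<kappa>0 = \<nu>0 - wt j0"
  \<comment> \<open>The contraction of the KF-part of a monomial. E-words are untouched by it, so x
    is the sum of the \<open>E_w\<close> times z.\<close>
  define z where "z = (\<lambda>k :: 'w list \<times> 'w \<times> 'w list. TD (coord ([], \<nu>0, j0)) (EKF [] (fst (snd k)) (snd (snd k))))"
  define x where "x = lin (\<lambda>k. Ew (fst k) * z k) (cf p)"
  define y where "y = lin (\<lambda>(w, \<nu>, v). EKF [] (\<nu> - \<nu>0) v) (row i0 \<kappa>0 (cf p))"
  define m0 where "m0 = lookup (cf p) (i0, \<nu>0, j0)"
  define D where "D = cf (x * y)"
  have m0: "m0 \<noteq> 0" using key0 by (simp add: m0_def in_keys_iff)
  have yC: "cl y \<in> C"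
    unfolding y_def \<kappa>0_def using lead max wt0 by (intro coideal_row[OF C H p _ key0]) auto
  have xC: "cl x \<in> C"
  proof -
    have "cl (TD (coord ([], \<nu>0, j0)) (sig (cf p))) \<in> C"
      using p by (intro coideal_contract[OF C _ sig_carrier functional_coord]) (simp add: cl_sig_cf)
    also have "TD (coord ([], \<nu>0, j0)) (sig (cf p)) = x"
      unfolding TD_sig x_def
    proof (rule lin_cong[OF refl])
      fix k assume k: "k \<in> keys (cf p)"
      obtain w \<nu> v where k': "k = (w, \<nu>, v)" by (cases k)
      then have "w \<in> lists S" using cf_valid k by blast
      then show "(case k of (w, \<nu>, v) \<Rightarrow> TD (coord ([], \<nu>0, j0)) (EKF w \<nu> v)) = Ew (fst k) * z k"
        unfolding k' z_def prod.case fst_conv snd_conv by (rule TD_coord_E)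
    qed
    finally show ?thesis .
  qed
  have z_nonpos: "z k \<in> nonpos" if "k \<in> keys (cf p)" for k
    using that cf_valid[of "fst k" "fst (snd k)" "snd (snd k)" p] unfolding z_def
    by (intro nonpos_TD functional_coord) auto
  have z_eq: "z (w, \<nu>, v) = (if \<nu> = \<nu>0 \<and> v = j0 then EKF [] \<nu> [] else 0)"
    if k: "(w, \<nu>, v) \<in> keys (cf p)" "length v \<le> length j0" for w \<nu> v
  proof -
    have "z (w, \<nu>, v) = (if \<nu> = \<nu>0 then lookup (single v 1) j0 else 0) *\<^sub>C EKF [] \<nu> []"
      using TD_coord_F[of "[]" \<nu> v j0 \<nu>0] cf_valid[OF k(1)] k(2)
      by (simp only: z_def fst_conv snd_conv cf_reduced[OF k(1)] lists.Nil)
    then show ?thesis by (auto simp: lookup_single when_def)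
  qed
  \<comment> \<open>In a good weight v is empty, hence shorter than j0, and the contraction kills
    the monomial.\<close>
  have z_good: "z (w, \<nu>, v) = 0" if "(w, \<nu>, v) \<in> keys (cf p)" "good (wt w) p" for w \<nu> v
    using z_eq[of w \<nu> v] that j0 by (auto simp: good_def)
  have y_nonpos: "y \<in> nonpos"
    unfolding y_def
  proof (rule lsub_lin[OF lsub_nonpos])
    fix k assume k: "k \<in> keys (row i0 \<kappa>0 (cf p))"
    obtain w \<nu> v where k': "k = (w, \<nu>, v)" by (cases k)
    have "(w, \<nu>, v) \<in> keys (cf p)" using k unfolding k' row_def keys_keep by (rule CollectE) (rule conjunct1)
    then show "(case k of (w, \<nu>, v) \<Rightarrow> EKF [] (\<nu> - \<nu>0) v) \<in> nonpos"
      unfolding k' using cf_valid[of w \<nu> v p] v0 by (auto intro!: nonpos_EKF Q_diff simp del: in_lists_conv_set)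
  qed
  \<comment> \<open>For u without E-letters, E-weights of x u come from weights of p that are not
    good. Taken with u = 1 and u = y this controls x and x y.\<close>
  have keysI: "\<exists>w \<nu>' v'. (w, \<nu>', v') \<in> keys (cf p) \<and> wt w = wt a \<and> \<not> good (wt w) p \<and> (a, \<nu>, v) \<in> keys (cf (Ew w * (z (w, \<nu>', v') * u)))"
    if "(a, \<nu>, v) \<in> keys (cf (lin (\<lambda>k. Ew (fst k) * (z k * u)) (cf p)))" "u \<in> nonpos" for a \<nu> v u
  proof -
    obtain k where k: "k \<in> keys (cf p)" "(a, \<nu>, v) \<in> keys (cf (Ew (fst k) * (z k * u)))"
      using \<open>(a, \<nu>, v) \<in> _\<close> unfolding lmap_lin_comp[OF lmap_cf] by (rule UN_E[OF subsetD[OF keys_lin]])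
    obtain w \<nu>' v' where k': "k = (w, \<nu>', v')" by (cases k)
    have "wt a = wt w"
      using cf_valid[of w \<nu>' v' p] k k' nonpos_mult[OF z_nonpos[OF k(1)] that(2)] by (intro cf_Ew_nonpos) auto
    moreover have "\<not> good (wt w) p"
      using z_good[of w \<nu>' v'] k by (auto simp: k' lmap_zero[OF lmap_cf])
    ultimately show ?thesis using k unfolding k' by auto
  qed
  have x1: "x = lin (\<lambda>k. Ew (fst k) * (z k * 1)) (cf p)" by (simp add: x_def)
  have xy: "x * y = lin (\<lambda>k. Ew (fst k) * (z k * y)) (cf p)"
    unfolding x_def lmap_lin_comp[OF lmap_mult_right] by (simp add: mult.assoc)
  have Dkey: "\<exists>w \<nu>' v'. (w, \<nu>', v') \<in> keys (cf p) \<and> wt w = wt a \<and> \<not> good (wt w) p"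
    if "(a, \<nu>, v) \<in> keys D" for a \<nu> v
    using keysI[of a \<nu> v y] that y_nonpos unfolding D_def xy by blast
  \<comment> \<open>In weight \<mu> the product x y has rank one: the column of the pivot times the
    row of the pivot.\<close>
  have Dlookup: "lookup D (a, \<nu>, v) = lookup (cf p) (a, \<nu>0, j0) * (if \<nu> = \<kappa>0 + wt v then lookup (cf p) (i0, \<nu>, v) else 0)"
    if a: "wt a = \<mu>" for a \<nu> v
  proof -
    let ?c = "if \<nu> = \<kappa>0 + wt v then lookup (cf p) (i0, \<nu>, v) else 0"
    have "lookup (cf (Ew (fst k) * (z k * y))) (a, \<nu>, v) = (if k = (a, \<nu>0, j0) then ?c else 0)"
      if k: "k \<in> keys (cf p)" for k
    proof -
      obtain w \<nu>' v' where k': "k = (w, \<nu>', v')" by (cases k)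
      have key: "(w, \<nu>', v') \<in> keys (cf p)" using k k' by simp
      show ?thesis
      proof (cases "wt w = \<mu>")
        case True
        have z: "z (w, \<nu>', v') = (if \<nu>' = \<nu>0 \<and> v' = j0 then EKF [] \<nu>' [] else 0)"
          by (rule z_eq[OF key max[OF key True]])
        have "lookup (cf (Ew w * (EKF [] \<nu>0 [] * y))) (a, \<nu>, v) = (if a = w then ?c else 0)"
          unfolding y_def using cf_row_shift[of w \<nu>0 i0 \<kappa>0 p a \<nu> v] cf_valid[OF key] cf_reduced(1)[OF key] v0 by auto
        then show ?thesis by (auto simp: k' z lmap_zero[OF lmap_cf])
      next
        case False
        have "(a, \<nu>, v) \<notin> keys (cf (Ew w * (z k * y)))"
          using cf_Ew_nonpos[of w "z k * y" a \<nu> v] cf_valid[OF key] nonpos_mult[OF z_nonpos[OF k] y_nonpos] a False by auto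
        then show ?thesis using a False by (auto simp: k' in_keys_iff)
      qed
    qed
    then have "lookup D (a, \<nu>, v) = (\<Sum>k\<in>keys (cf p). if k = (a, \<nu>0, j0) then lookup (cf p) (a, \<nu>0, j0) * ?c else 0)"
      unfolding D_def xy lmap_lin_comp[OF lmap_cf] lookup_lin by (intro sum.cong refl) auto
    then show ?thesis by (auto simp: in_keys_iff)
  qed
  \<comment> \<open>Elimination with pivot coefficient \<open>m0\<close>: the row of i0 and
    \<kappa>0 is cleared completely.\<close>
  define r where "r = p - inverse m0 *\<^sub>C (x * y)"
  have r: "lookup (cf r) k = lookup (cf p) k - inverse m0 * lookup D k" for k
    by (simp add: r_def D_def lmap_diff[OF lmap_cf] lmap_sc[OF lmap_cf] lookup_minus)
  have rkey: "(a, \<nu>, v) \<in> keys (cf p) \<or> (a, \<nu>, v) \<in> keys D" if "(a, \<nu>, v) \<in> keys (cf r)" for a \<nu> v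
    using that by (auto simp: in_keys_iff r)
  show ?thesis
  proof (rule that[of "inverse m0 *\<^sub>C x" y r])
    have sub: "subalgebra Uq C" using C by (simp add: right_coideal_subalgebra_def)
    then show "cl (inverse m0 *\<^sub>C x) \<in> C" using xC by (simp add: cl_sc subalgebra_def)
    show "cl y \<in> C" by (rule yC)
    have "cl (p + (- inverse m0) *\<^sub>C (x * y)) \<in> C"
      using sub xC yC p unfolding cl_add cl_sc cl_mult subalgebra_def by blast
    then show "cl r \<in> C" by (simp add: r_def sc_minus_one)
    show "cl p = cl (r + inverse m0 *\<^sub>C x * y)" by (simp add: r_def)
    show "E_wts y = {}"
    proof -
      have "wt a = 0" if "(a, \<nu>, v) \<in> keys (cf y)" for a \<nu> v
        using cf_Ew_nonpos[of "[]" y a \<nu> v] y_nonpos that by (simp flip: one_word)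
      then show ?thesis by (auto simp: E_wts_iff)
    qed
    have xkeys: "(a, \<nu>, v) \<in> keys (cf (inverse m0 *\<^sub>C x)) \<Longrightarrow> (a, \<nu>, v) \<in> keys (cf x)" for a \<nu> v
      using keys_sc[of "inverse m0" "cf x"] by (auto simp: lmap_sc[OF lmap_cf])
    have xkey: "\<exists>w \<nu>' v'. (w, \<nu>', v') \<in> keys (cf p) \<and> wt w = wt a \<and> \<not> good (wt w) p \<and> (a, \<nu>, v) \<in> keys (cf (Ew w * (z (w, \<nu>', v') * 1)))"
      if "(a, \<nu>, v) \<in> keys (cf (inverse m0 *\<^sub>C x))" for a \<nu> v
      by (rule keysI[OF _ nonpos_one]) (use xkeys[OF that] in \<open>simp only: x1[symmetric]\<close>)
    show "E_wts (inverse m0 *\<^sub>C x) \<subseteq> E_wts p"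
      using xkey by (fastforce simp: E_wts_iff)
    show "\<mu>' \<notin> E_wts (inverse m0 *\<^sub>C x)" if "good \<mu>' p" for \<mu>'
      using xkey that by (fastforce simp: E_wts_iff)
    show "good \<mu> (inverse m0 *\<^sub>C x)"
      unfolding good_def
    proof clarify
      fix a \<nu> v assume k: "(a, \<nu>, v) \<in> keys (cf (inverse m0 *\<^sub>C x))" and a: "\<mu> = wt a"
      obtain w \<nu>' v' where w: "(w, \<nu>', v') \<in> keys (cf p)" "wt w = \<mu>" "(a, \<nu>, v) \<in> keys (cf (Ew w * (z (w, \<nu>', v') * 1)))"
        using xkey[OF k] a by auto
      have "z (w, \<nu>', v') = (if \<nu>' = \<nu>0 \<and> v' = j0 then EKF [] \<nu>' [] else 0)"
        by (rule z_eq[OF w(1) max[OF w(1,2)]])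
      moreover have "Ew w * EKF [] \<nu>' [] = EKF w \<nu>' []" by (simp add: EKF_def)
      moreover have "cf (EKF w \<nu>' []) = single (w, \<nu>', []) 1"
        using cf_valid[OF w(1)] cf_reduced(1)[OF w(1)] by (intro cf_EKF_reduced) auto
      ultimately show "v = []" using w(3) by (auto simp: lmap_zero[OF lmap_cf] split: if_splits)
    qed
    show "E_wts r \<subseteq> E_wts p"
      using rkey Dkey by (fastforce simp: E_wts_iff)
    show "good \<mu>' r" if g: "good \<mu>' p" for \<mu>'
      unfolding good_def
    proof clarify
      fix a \<nu> v assume k: "(a, \<nu>, v) \<in> keys (cf r)" and a: "\<mu>' = wt a"
      then have "(a, \<nu>, v) \<notin> keys D" using Dkey[of a \<nu> v] g by auto
      then have "(a, \<nu>, v) \<in> keys (cf p)" using rkey[OF k] by blast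
      then show "v = []" using g a by (auto simp: good_def)
    qed
    show "rows r \<mu> \<subset> rows p \<mu>"
    proof
      show "rows r \<mu> \<subseteq> rows p \<mu>"
      proof clarify
        fix a \<kappa> assume "(a, \<kappa>) \<in> rows r \<mu>"
        then obtain v where a: "wt a = \<mu>" "(a, \<kappa> + wt v, v) \<in> keys (cf r)" by (auto simp: rows_iff)
        have "\<exists>v. (a, \<kappa> + wt v, v) \<in> keys (cf p)"
        proof (cases "(a, \<kappa> + wt v, v) \<in> keys (cf p)")
          \<comment> \<open>A term contributed only by x y has \<kappa> = \<kappa>0 and its E-word a
            in the pivot column, so the entry (a, \<nu>0, j0) of p already belongs to the same
            row.\<close>
          case False
          then have "(a, \<kappa> + wt v, v) \<in> keys D" using rkey[OF a(2)] by blast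
          then have "lookup (cf p) (a, \<nu>0, j0) \<noteq> 0" "\<kappa> = \<kappa>0"
            using Dlookup[OF a(1), of "\<kappa> + wt v" v] by (auto simp: in_keys_iff split: if_splits)
          then have "(a, \<kappa> + wt j0, j0) \<in> keys (cf p)" by (simp add: in_keys_iff \<kappa>0_def)
          then show ?thesis by blast
        qed blast
        then show "(a, \<kappa>) \<in> rows p \<mu>" using a(1) by (simp add: rows_iff)
      qed
      have "(i0, \<kappa>0) \<in> rows p \<mu>"
        unfolding rows_iff using key0 wt0 by (intro conjI exI[of _ j0]) (simp_all add: \<kappa>0_def)
      moreover have "(i0, \<kappa>0 + wt v, v) \<notin> keys (cf r)" for v
        using m0 by (simp add: in_keys_iff r Dlookup[OF wt0] flip: m0_def)
      then have "(i0, \<kappa>0) \<notin> rows r \<mu>" by (simp add: rows_iff)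
      ultimately show "rows r \<mu> \<noteq> rows p \<mu>" by blast
    qed
  qed
qed

text \<open>Z is taken as large as possible, namely all elements of C whose leading terms lie in
  \<open>U_geq\<close>; it remains to reach every element of C by elimination.\<close>

theorem generated_by_good_leading_terms:
  assumes C: "right_coideal_subalgebra C" and H: "hopf_subalgebra (C \<inter> U_zero)"
  shows "\<exists>Z\<subseteq>C. generated_subalgebra Uq Z = C \<and> (\<forall>X\<in>Z. \<forall>\<mu>\<in>E_leading_weights X. E_leading_term \<mu> X \<in> U_geq)"
proof -
  define Z where "Z = {X \<in> C. \<forall>\<mu>\<in>E_leading_weights X. E_leading_term \<mu> X \<in> U_geq}"
  have sub: "subalgebra Uq C" using C by (simp add: right_coideal_subalgebra_def)
  have gen: "subalgebra Uq (generated_subalgebra Uq Z)"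
    by (rule subalgebra_generated[OF sub]) (simp add: Z_def)
  \<comment> \<open>The weight \<mu> in which rows are counted is part of the induction variable. It
    is kept while the set of bad weights stays the same and may be chosen anew when that set
    shrinks; it is arbitrary if there are no bad weights.\<close>
  have main: "cl p \<in> generated_subalgebra Uq Z" if "cl p \<in> C" "bad p = {} \<or> \<mu> \<in> bad p" for p \<mu>
    using that
  proof (induction "(p, \<mu>)" arbitrary: p \<mu>
      rule: wf_induct_rule[OF wf_measures[of "[\<lambda>(p, \<mu>). card (E_wts p), \<lambda>(p, \<mu>). card (bad p), \<lambda>(p, \<mu>). card (rows p \<mu>)]"]])
    case (1 p \<mu>)
    have IH: "cl p' \<in> generated_subalgebra Uq Z"
      if "cl p' \<in> C" "bad p' = {} \<or> \<mu>' \<in> bad p'"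
        "E_wts p' \<subset> E_wts p \<or> E_wts p' = E_wts p \<and> (bad p' \<subset> bad p \<or> bad p' = bad p \<and> \<mu>' = \<mu> \<and> rows p' \<mu> \<subset> rows p \<mu>)" for p' \<mu>'
    proof (rule 1(1)[OF _ that(1,2)])
      show "((p', \<mu>'), p, \<mu>) \<in> measures [\<lambda>(p, \<mu>). card (E_wts p), \<lambda>(p, \<mu>). card (bad p), \<lambda>(p, \<mu>). card (rows p \<mu>)]"
        using that(3) psubset_card_mono[OF finite_E_wts, of "E_wts p'" p] psubset_card_mono[OF finite_bad, of "bad p'" p]
          psubset_card_mono[OF finite_rows, of "rows p' \<mu>" p \<mu>] by auto
    qed
    have IH1: "cl p' \<in> generated_subalgebra Uq Z"
      if "cl p' \<in> C" "E_wts p' \<subset> E_wts p \<or> E_wts p' = E_wts p \<and> bad p' \<subset> bad p" for p'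
    proof (cases "bad p' = {}")
      case True
      then show ?thesis using IH[of p' undefined] that by blast
    next
      case False
      then obtain \<mu>' where "\<mu>' \<in> bad p'" by blast
      then show ?thesis using IH[of p' \<mu>'] that by blast
    qed
    show ?case
    proof (cases "bad p = {}")
      case True
      have "E_leading_term \<nu> (cl p) \<in> U_geq" if "\<nu> \<in> E_leading_weights (cl p)" for \<nu>
        using that True by (intro good_leading_term) (auto simp: E_leading_weights_eq bad_def)
      then have "cl p \<in> Z" using 1(2) by (simp add: Z_def)
      then show ?thesis by (rule subsetD[OF generated_subalgebra_superset])
    next
      case False
      then have \<mu>: "\<mu> \<in> bad p" using 1(3) by blast
      obtain x y r where cl: "cl x \<in> C" "cl y \<in> C" "cl r \<in> C" "cl p = cl (r + x * y)"
        and y: "E_wts y = {}" and x: "E_wts x \<subseteq> E_wts p" "good \<mu> x" "\<And>\<mu>'. good \<mu>' p \<Longrightarrow> \<mu>' \<notin> E_wts x"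
        and r: "E_wts r \<subseteq> E_wts p" "\<And>\<mu>'. good \<mu>' p \<Longrightarrow> good \<mu>' r" "rows r \<mu> \<subset> rows p \<mu>"
        by (rule lower_bad_row[OF C H 1(2) \<mu>]) blast
      have \<mu>p: "\<mu> \<in> E_wts p" using \<mu> by (simp add: bad_def leading_def)
      have "cl y \<in> generated_subalgebra Uq Z"
        using \<mu>p y by (intro IH1 cl) auto
      moreover have "cl x \<in> generated_subalgebra Uq Z"
      proof (rule IH1[OF cl(1)])
        have "bad x \<subset> bad p" if "E_wts x = E_wts p"
        \<comment> \<open>With the same E-weights, x has the same leading weights as p. Those good
          for p do not occur in x at all, and \<mu> has become good.\<close>
        proof -
          have "leading x = leading p" using that by (simp add: leading_def)
          then have "bad x \<subseteq> bad p" using x(3) that by (auto simp: bad_def leading_def)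
          moreover have "\<mu> \<notin> bad x" using x(2) by (simp add: bad_def)
          ultimately show ?thesis using \<mu> by blast
        qed
        then show "E_wts x \<subset> E_wts p \<or> E_wts x = E_wts p \<and> bad x \<subset> bad p" using x(1) by blast
      qed
      moreover have "cl r \<in> generated_subalgebra Uq Z"
      proof (cases "E_wts r = E_wts p")
        case True
        then have "leading r = leading p" by (simp add: leading_def)
        then have "bad r \<subseteq> bad p" using r(2) by (auto simp: bad_def)
        then consider "bad r \<subset> bad p" | "bad r = bad p" by blast
        then show ?thesis
        proof cases
          case 1
          then show ?thesis using True by (intro IH1[OF cl(3)]) blast
        next
          case 2
          then show ?thesis using True r(3) \<mu> by (intro IH[OF cl(3), of \<mu>]) blast+
        qed
      next
        case False
        then show ?thesis using r(1) by (intro IH1[OF cl(3)]) blast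
      qed
      ultimately show ?thesis using gen unfolding cl(4) cl_add cl_mult subalgebra_def by blast
    qed
  qed
  have "C \<subseteq> generated_subalgebra Uq Z"
  proof
    fix X assume X: "X \<in> C"
    then obtain p where p: "X = cl p" using sub carrier_Uq by (auto simp: subalgebra_def)
    show "X \<in> generated_subalgebra Uq Z"
    proof (cases "bad p = {}")
      case True
      then show ?thesis using main[of p undefined] X p by blast
    next
      case False
      then obtain \<mu> where "\<mu> \<in> bad p" by blast
      then show ?thesis using main[of p \<mu>] X p by blast
    qed
  qed
  moreover have "generated_subalgebra Uq Z \<subseteq> C"
    by (rule generated_subalgebra_minimal[OF sub]) (simp add: Z_def)
  ultimately show ?thesis by (intro exI[of _ Z]) (auto simp: Z_def)
qed

end

section \<open>Integrality of the invariant form\<close>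

definition rsc :: "real \<Rightarrow> ('g \<Rightarrow> complex) \<Rightarrow> ('g \<Rightarrow> complex)" where
  "rsc c \<alpha> = (\<lambda>x. complex_of_real c * \<alpha> x)"

lemma rsc_eq: "(\<lambda>(c::real) (\<alpha> :: 'g \<Rightarrow> complex) x. complex_of_real c * \<alpha> x) = rsc"
  by (simp add: rsc_def fun_eq_iff)

text \<open>Real functionals with prescribed values on the simple roots. They provide the height and
  the coefficients with respect to the simple roots.\<close>

lemma real_functional:
  fixes S :: "('g \<Rightarrow> complex) set" and f :: "('g \<Rightarrow> complex) \<Rightarrow> real"
  assumes "\<not> module.dependent (\<lambda>(c::real) (\<alpha> :: 'g \<Rightarrow> complex) x. complex_of_real c * \<alpha> x) S"
  obtains L where "\<And>x y. L (x + y) = L x + L y" "\<And>c x. L (rsc c x) = c * L x" "\<And>\<alpha>. \<alpha> \<in> S \<Longrightarrow> L \<alpha> = f \<alpha>"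
proof -
  interpret V: vector_space_pair "rsc :: real \<Rightarrow> ('g \<Rightarrow> complex) \<Rightarrow> ('g \<Rightarrow> complex)" "(*) :: real \<Rightarrow> real \<Rightarrow> real"
    by unfold_locales (auto simp: rsc_def fun_eq_iff algebra_simps)
  obtain L where L: "Vector_Spaces.linear rsc (*) L" "\<forall>\<alpha>\<in>S. L \<alpha> = f \<alpha>"
    using V.linear_independent_extend[of S f] assms unfolding rsc_eq by blast
  interpret L: Vector_Spaces.linear rsc "(*)" L by (rule L(1))
  show ?thesis using that[of L] L(2) L.add L.scale by blast
qed

locale root_form =
  fixes \<Phi> S :: "('g \<Rightarrow> complex) set" and form :: "('g \<Rightarrow> complex) \<Rightarrow> ('g \<Rightarrow> complex) \<Rightarrow> int"
  assumes simple: "simple_roots \<Phi> S" and invariant: "invariant_form \<Phi> S form"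
    and zero_no_root: "0 \<notin> \<Phi>"
begin

abbreviation Q where "Q \<equiv> lattice_of S"

lemma root_Q: "\<beta> \<in> \<Phi> \<Longrightarrow> \<beta> \<in> Q"
  using simple pos_lattice_subset[of \<beta> S] pos_lattice_subset[of "- \<beta>" S] lattice_of_uminus[of "- \<beta>" S]
  by (auto simp: simple_roots_def)

lemma simple_root: "\<alpha> \<in> S \<Longrightarrow> \<alpha> \<in> \<Phi>" using simple by (auto simp: simple_roots_def)
lemma simple_Q: "\<alpha> \<in> S \<Longrightarrow> \<alpha> \<in> Q" by (intro root_Q simple_root)

lemma Q_diff: "\<mu> \<in> Q \<Longrightarrow> \<nu> \<in> Q \<Longrightarrow> \<mu> - \<nu> \<in> Q"
  using lattice_of_add[of \<mu> S "- \<nu>"] lattice_of_uminus[of \<nu> S] by simp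

lemma form_sym: "\<mu> \<in> Q \<Longrightarrow> \<nu> \<in> Q \<Longrightarrow> form \<mu> \<nu> = form \<nu> \<mu>"
  using invariant by (simp add: invariant_form_def)

lemma form_add: "\<mu> \<in> Q \<Longrightarrow> \<mu>' \<in> Q \<Longrightarrow> \<nu> \<in> Q \<Longrightarrow> form (\<mu> + \<mu>') \<nu> = form \<mu> \<nu> + form \<mu>' \<nu>"
  using invariant by (simp add: invariant_form_def)

lemma form_pos: "\<mu> \<in> Q \<Longrightarrow> \<mu> \<noteq> 0 \<Longrightarrow> form \<mu> \<mu> > 0"
  using invariant by (simp add: invariant_form_def)

lemma form_root_pos: "\<beta> \<in> \<Phi> \<Longrightarrow> form \<beta> \<beta> > 0"
  using form_pos[OF root_Q] zero_no_root by metis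

lemma reflection_root:
  "\<alpha> \<in> \<Phi> \<Longrightarrow> \<beta> \<in> \<Phi> \<Longrightarrow> \<beta> - rsc (2 * real_of_int (form \<alpha> \<beta>) / real_of_int (form \<alpha> \<alpha>)) \<alpha> \<in> \<Phi>"
  using invariant by (simp add: invariant_form_def rsc_def fun_diff_def)

lemma form_zero: "\<nu> \<in> Q \<Longrightarrow> form 0 \<nu> = 0"
  using form_add[of 0 0 \<nu>] pos_lattice_subset[OF pos_lattice.zero, of S] by simp

lemma form_diff: "\<mu> \<in> Q \<Longrightarrow> \<mu>' \<in> Q \<Longrightarrow> \<nu> \<in> Q \<Longrightarrow> form (\<mu> - \<mu>') \<nu> = form \<mu> \<nu> - form \<mu>' \<nu>"
  using form_add[of "\<mu> - \<mu>'" \<mu>' \<nu>] Q_diff[of \<mu> \<mu>'] by simp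

text \<open>Reflections involve quotients of form values, while \<open>form\<close> is known to be
  additive only on the lattice. Integer multiples suffice once denominators are cleared.\<close>

lemma form_scale:
  assumes "\<mu> \<in> Q"
  shows "rsc (real_of_int n) \<mu> \<in> Q \<and> (\<forall>\<nu>\<in>Q. form (rsc (real_of_int n) \<mu>) \<nu> = n * form \<mu> \<nu>)"
proof (induction n rule: int_induct[where k = 0])
  case base
  have z: "rsc (real_of_int 0) \<mu> = 0" by (simp add: rsc_def fun_eq_iff)
  show ?case unfolding z mult_zero_left using form_zero pos_lattice_subset[OF pos_lattice.zero, of S] by blast
next
  case (step1 n)
  have e: "rsc (real_of_int (n + 1)) \<mu> = rsc (real_of_int n) \<mu> + \<mu>" by (simp add: rsc_def fun_eq_iff algebra_simps)
  show ?case
    unfolding e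
  proof (intro conjI ballI)
    show "rsc (real_of_int n) \<mu> + \<mu> \<in> Q" using step1 assms by (intro lattice_of_add) auto
    fix \<nu> assume \<nu>: "\<nu> \<in> Q"
    then have "form (rsc (real_of_int n) \<mu> + \<mu>) \<nu> = form (rsc (real_of_int n) \<mu>) \<nu> + form \<mu> \<nu>"
      using step1 assms by (intro form_add) auto
    then show "form (rsc (real_of_int n) \<mu> + \<mu>) \<nu> = (n + 1) * form \<mu> \<nu>"
      using step1 \<nu> by (simp only: distrib_right mult_1_left)
  qed
next
  case (step2 n)
  have e: "rsc (real_of_int (n - 1)) \<mu> = rsc (real_of_int n) \<mu> - \<mu>" by (simp add: rsc_def fun_eq_iff algebra_simps)
  show ?case
    unfolding e
  proof (intro conjI ballI)
    show "rsc (real_of_int n) \<mu> - \<mu> \<in> Q" using step2 assms by (intro Q_diff) auto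
    fix \<nu> assume \<nu>: "\<nu> \<in> Q"
    then have "form (rsc (real_of_int n) \<mu> - \<mu>) \<nu> = form (rsc (real_of_int n) \<mu>) \<nu> - form \<mu> \<nu>"
      using step2 assms by (intro form_diff) auto
    then show "form (rsc (real_of_int n) \<mu> - \<mu>) \<nu> = (n - 1) * form \<mu> \<nu>"
      using step2 \<nu> by (simp only: left_diff_distrib mult_1_left)
  qed
qed

lemmas scale_Q = form_scale[THEN conjunct1]
lemmas form_scale_left = form_scale[THEN conjunct2, rule_format]

lemma form_scale_diff:
  assumes "\<mu> \<in> Q" "\<nu> \<in> Q"
  shows "form (rsc (real_of_int m) \<mu> - rsc (real_of_int n) \<nu>) (rsc (real_of_int m) \<mu> - rsc (real_of_int n) \<nu>) =
    m * m * form \<mu> \<mu> - 2 * m * n * form \<mu> \<nu> + n * n * form \<nu> \<nu>"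
proof -
  let ?a = "rsc (real_of_int m) \<mu>" and ?b = "rsc (real_of_int n) \<nu>"
  note Q = assms scale_Q[OF assms(1), of m] scale_Q[OF assms(2), of n]
  have s: "form \<kappa> ?a = m * form \<kappa> \<mu>" "form \<kappa> ?b = n * form \<kappa> \<nu>" if "\<kappa> \<in> Q" for \<kappa>
    using form_sym[OF that Q(3)] form_sym[OF that Q(4)] form_sym[OF that assms(1)] form_sym[OF that assms(2)]
      form_scale_left[OF assms(1) that] form_scale_left[OF assms(2) that] by simp_all
  have "form (?a - ?b) (?a - ?b) = form ?a (?a - ?b) - form ?b (?a - ?b)"
    using Q by (intro form_diff Q_diff)
  also have "form ?a (?a - ?b) = form ?a ?a - form ?b ?a"
    using Q form_sym[of ?a "?a - ?b"] by (simp add: form_diff Q_diff)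
  also have "form ?b (?a - ?b) = form ?a ?b - form ?b ?b"
    using Q form_sym[of ?b "?a - ?b"] by (simp add: form_diff Q_diff)
  finally have e: "form (?a - ?b) (?a - ?b) = form ?a ?a - form ?b ?a - (form ?a ?b - form ?b ?b)" .
  show ?thesis
    unfolding e using Q form_sym[OF assms] by (simp add: s form_scale_left algebra_simps)
qed

lemma coordinate:
  assumes "\<alpha> \<in> S"
  obtains L where "\<And>x y. L (x - y) = L x - L y" "\<And>c x. L (rsc c x) = c * L x" "L \<alpha> = 1"
    "\<And>\<beta>. \<beta> \<in> S \<Longrightarrow> \<beta> \<noteq> \<alpha> \<Longrightarrow> L \<beta> = (0::real)"
    "\<And>\<mu>. \<mu> \<in> pos_lattice S \<Longrightarrow> L \<mu> \<in> \<nat>" "\<And>\<mu>. \<mu> \<in> Q \<Longrightarrow> L \<mu> \<in> \<int>"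
proof -
  have ind: "\<not> module.dependent (\<lambda>(c::real) (\<alpha> :: 'g \<Rightarrow> complex) x. complex_of_real c * \<alpha> x) S"
    using simple by (simp add: simple_roots_def)
  obtain L where L: "\<And>x y. L (x + y) = L x + L y" "\<And>c x. L (rsc c x) = c * L x"
    "\<And>\<beta>. \<beta> \<in> S \<Longrightarrow> L \<beta> = (if \<beta> = \<alpha> then 1 else 0)"
    by (rule real_functional[OF ind, of "\<lambda>\<beta>. if \<beta> = \<alpha> then 1 else 0"]) blast
  have diff: "L (x - y) = L x - L y" for x y using L(1)[of "x - y" y] by simp
  have nat: "L \<mu> \<in> \<nat>" if "\<mu> \<in> pos_lattice S" for \<mu>
    using that
  proof (induction rule: pos_lattice.induct)
    case zero
    have "L 0 = 0" using L(1)[of 0 0] by simp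
    then show ?case by (metis Nats_0)
  next
    case (add_simple \<mu> \<beta>)
    then show ?case unfolding L(1) by (simp add: L(3))
  qed
  have "L \<mu> \<in> \<int>" if \<mu>: "\<mu> \<in> Q" for \<mu>
  proof -
    obtain a b where "\<mu> = a - b" "a \<in> pos_lattice S" "b \<in> pos_lattice S" using \<mu> by (auto simp: lattice_of_def)
    then show ?thesis using nat Nats_subset_Ints by (auto simp: diff intro!: Ints_diff)
  qed
  then show ?thesis using that[of L] diff L nat assms by auto
qed

text \<open>The reflected root \<beta> - c \<alpha> has coefficient 1 at \<beta>, so it is a
  positive root, and its coefficient -c at \<alpha> is a natural number.\<close>

lemma cartan_integer:
  assumes "\<alpha> \<in> S" "\<beta> \<in> S" "\<alpha> \<noteq> \<beta>"
  shows "\<exists>m::nat. 2 * form \<alpha> \<beta> = - int m * form \<alpha> \<alpha>"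
proof -
  let ?c = "2 * real_of_int (form \<alpha> \<beta>) / real_of_int (form \<alpha> \<alpha>)"
  let ?\<gamma> = "\<beta> - rsc ?c \<alpha>"
  have pos: "form \<alpha> \<alpha> > 0" using assms by (intro form_root_pos simple_root)
  have "?\<gamma> \<in> \<Phi>" using assms by (intro reflection_root simple_root)
  then have \<gamma>: "?\<gamma> \<in> pos_lattice S \<or> - ?\<gamma> \<in> pos_lattice S" using simple unfolding simple_roots_def by blast
  obtain L where L: "\<And>x y. L (x - y) = L x - L y" "\<And>c x. L (rsc c x) = c * L x" "L \<beta> = 1"
    "\<And>\<gamma>. \<gamma> \<in> S \<Longrightarrow> \<gamma> \<noteq> \<beta> \<Longrightarrow> L \<gamma> = (0::real)" "\<And>\<mu>. \<mu> \<in> pos_lattice S \<Longrightarrow> L \<mu> \<in> \<nat>"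
    by (rule coordinate[OF assms(2)]) blast
  have "L ?\<gamma> = 1" using assms by (simp add: L)
  moreover have "L (- ?\<gamma>) = - L ?\<gamma>" using L(1)[of 0 ?\<gamma>] L(1)[of 0 0] by simp
  ultimately have "- ?\<gamma> \<notin> pos_lattice S" using L(5)[of "- ?\<gamma>"] by (auto elim!: Nats_cases)
  then have \<gamma>: "?\<gamma> \<in> pos_lattice S" using \<gamma> by blast
  obtain L where L: "\<And>x y. L (x - y) = L x - L y" "\<And>c x. L (rsc c x) = c * L x" "L \<alpha> = 1"
    "\<And>\<gamma>. \<gamma> \<in> S \<Longrightarrow> \<gamma> \<noteq> \<alpha> \<Longrightarrow> L \<gamma> = (0::real)" "\<And>\<mu>. \<mu> \<in> pos_lattice S \<Longrightarrow> L \<mu> \<in> \<nat>"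
    by (rule coordinate[OF assms(1)]) blast
  have "L ?\<gamma> = - ?c" using assms L(4)[of \<beta>] by (simp add: L(1-3))
  then obtain m where m: "- ?c = real m" using L(5)[OF \<gamma>] by (auto elim: Nats_cases)
  then have "2 * real_of_int (form \<alpha> \<beta>) = - real m * real_of_int (form \<alpha> \<alpha>)" using pos by (simp add: field_simps)
  then have "real_of_int (2 * form \<alpha> \<beta>) = real_of_int (- int m * form \<alpha> \<alpha>)" by simp
  then show ?thesis by (intro exI[of _ m]) (simp only: of_int_eq_iff)
qed

text \<open>Reflecting along the chain moves a root of square length \<open>2\<close> until it is not orthogonal to
  the given root.\<close>

lemma linked_short:
  assumes "linked \<Phi> form \<gamma> \<beta>" "\<beta> \<in> \<Phi>" "form \<beta> \<beta> = 2"
  shows "\<exists>\<beta>'\<in>\<Phi>. form \<beta>' \<beta>' = 2 \<and> form \<beta>' \<gamma> \<noteq> 0"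
  using assms(1) unfolding linked_def
proof (induction rule: converse_rtranclp_induct)
  case base
  then show ?case using assms by auto
next
  case (step \<gamma> \<delta>)
  then obtain \<beta>' where b: "\<beta>' \<in> \<Phi>" "form \<beta>' \<beta>' = 2" "form \<beta>' \<delta> \<noteq> 0" by blast
  have g: "\<gamma> \<in> \<Phi>" "\<delta> \<in> \<Phi>" "form \<gamma> \<delta> \<noteq> 0" using step by auto
  note Q = root_Q[OF b(1)] root_Q[OF g(1)] root_Q[OF g(2)]
  show ?case
  proof (cases "form \<beta>' \<gamma> = 0")
    case True
    let ?D = "form \<delta> \<delta>" and ?k = "form \<delta> \<beta>'"
    let ?\<beta> = "\<beta>' - rsc (2 * real_of_int ?k / real_of_int ?D) \<delta>"
    have D: "?D > 0" by (rule form_root_pos[OF g(2)])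
    have \<beta>: "?\<beta> \<in> \<Phi>" by (rule reflection_root[OF g(2) b(1)])
    then have \<beta>Q: "?\<beta> \<in> Q" by (rule root_Q)
    \<comment> \<open>Multiplying the reflected root by (\<delta>, \<delta>) clears the denominator,
      so its products can be computed inside the lattice.\<close>
    have eq: "rsc (real_of_int ?D) ?\<beta> = rsc (real_of_int ?D) \<beta>' - rsc (real_of_int (2 * ?k)) \<delta>"
      using D by (simp add: rsc_def fun_eq_iff algebra_simps)
    have "?D * form ?\<beta> \<gamma> = form (rsc (real_of_int ?D) ?\<beta>) \<gamma>"
      using form_scale_left[OF \<beta>Q Q(2)] by simp
    also have "\<dots> = ?D * form \<beta>' \<gamma> - 2 * ?k * form \<delta> \<gamma>"
      unfolding eq using Q by (simp only: form_diff scale_Q form_scale_left)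
    finally have "form ?\<beta> \<gamma> \<noteq> 0" using True b(3) g(3) form_sym[OF Q(1,3)] form_sym[OF Q(2,3)] by auto
    moreover have "form ?\<beta> ?\<beta> = 2"
    proof -
      have "?D * ?D * form ?\<beta> ?\<beta> = form (rsc (real_of_int ?D) ?\<beta>) (rsc (real_of_int ?D) ?\<beta>)"
        using form_scale_left[OF \<beta>Q scale_Q[OF \<beta>Q]] form_sym[OF \<beta>Q scale_Q[OF \<beta>Q]] form_scale_left[OF \<beta>Q \<beta>Q] by simp
      also have "\<dots> = ?D * ?D * form \<beta>' \<beta>' - 2 * ?D * (2 * ?k) * form \<beta>' \<delta> + (2 * ?k) * (2 * ?k) * form \<delta> \<delta>"
        unfolding eq by (rule form_scale_diff[OF Q(1,3)])
      also have "\<dots> = ?D * ?D * 2" using form_sym[OF Q(1,3)] b(2) by (simp add: algebra_simps)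
      finally show ?thesis using D by simp
    qed
    ultimately show ?thesis using \<beta> by blast
  qed (use b in blast)
qed

text \<open>The shortest root of the component has square length 2. A root \<beta>' of that length
  not orthogonal to \<alpha> exists by \<open>linked_short\<close>, and 2 (\<alpha>, \<beta>') /
  (\<alpha>, \<alpha>) is an integer; Cauchy-Schwarz then leaves few cases.\<close>

lemma simple_even:
  assumes "\<alpha> \<in> S"
  shows "even (form \<alpha> \<alpha>)"
proof -
  have root: "\<beta> \<in> \<Phi>" if "linked \<Phi> form \<alpha> \<beta>" for \<beta>
    using that simple_root[OF assms] unfolding linked_def by (induction rule: rtranclp_induct) auto
  have refl: "linked \<Phi> form \<alpha> \<alpha>" by (simp add: linked_def)
  \<comment> \<open>The shortest root linked to \<alpha>. Chains compose, so it is also shortest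
    among the roots linked to itself, which makes it a short root.\<close>
  define \<beta> where "\<beta> = arg_min (\<lambda>\<beta>. nat (form \<beta> \<beta>)) (linked \<Phi> form \<alpha>)"
  have \<beta>: "linked \<Phi> form \<alpha> \<beta>" "\<And>\<gamma>. linked \<Phi> form \<alpha> \<gamma> \<Longrightarrow> nat (form \<beta> \<beta>) \<le> nat (form \<gamma> \<gamma>)"
    unfolding \<beta>_def by (rule arg_min_natI[of "linked \<Phi> form \<alpha>", OF refl])
      (rule arg_min_nat_le[of "linked \<Phi> form \<alpha>" _ "\<lambda>\<beta>. nat (form \<beta> \<beta>)"])
  have le: "form \<beta> \<beta> \<le> form \<gamma> \<gamma>" if "linked \<Phi> form \<alpha> \<gamma>" for \<gamma>
    using \<beta>(2)[OF that] form_root_pos[OF root[OF that]] by simp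
  have "short_root \<Phi> form \<beta>"
    unfolding short_root_def
  proof (intro conjI allI impI)
    show "\<beta> \<in> \<Phi>" by (rule root[OF \<beta>(1)])
    show "form \<beta> \<beta> \<le> form \<gamma> \<gamma>" if "linked \<Phi> form \<beta> \<gamma>" for \<gamma>
      using \<beta>(1) that by (intro le) (simp add: linked_def)
  qed
  then have two: "form \<beta> \<beta> = 2" using invariant by (simp add: invariant_form_def)
  obtain \<beta>' where b: "\<beta>' \<in> \<Phi>" "form \<beta>' \<beta>' = 2" "form \<beta>' \<alpha> \<noteq> 0"
    using linked_short[OF \<beta>(1) root[OF \<beta>(1)] two] by blast
  define N k where "N = form \<alpha> \<alpha>" and "k = form \<alpha> \<beta>'"
  note Q = simple_Q[OF assms] root_Q[OF b(1)]
  have k: "k \<noteq> 0" using b(3) form_sym[OF Q] by (simp add: k_def)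
  have N: "N \<ge> 2" using le[OF refl] two by (simp add: N_def)
  obtain a where a: "a * N = 2 * k"
  proof -
    obtain L where L: "\<And>x y. L (x - y) = L x - L y" "\<And>c x. L (rsc c x) = c * L x" "L \<alpha> = (1::real)"
      "\<And>\<mu>. \<mu> \<in> Q \<Longrightarrow> L \<mu> \<in> \<int>"
      by (rule coordinate[OF assms]) blast
    let ?c = "2 * real_of_int k / real_of_int N"
    have "\<beta>' - rsc ?c \<alpha> \<in> \<Phi>"
      unfolding k_def N_def by (rule reflection_root[OF simple_root[OF assms] b(1)])
    then have "L \<beta>' - L (\<beta>' - rsc ?c \<alpha>) \<in> \<int>" using L(4) root_Q b(1) by (intro Ints_diff) blast+
    then have "?c \<in> \<int>" unfolding L(1-3) by simp
    then obtain a where "?c = real_of_int a" by (auto elim: Ints_cases)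
    then have "real_of_int (a * N) = real_of_int (2 * k)" using N by (simp add: field_simps)
    then show ?thesis using that by (simp only: of_int_eq_iff)
  qed
  \<comment> \<open>Cauchy-Schwarz for \<alpha> and \<beta>', from the nonnegative square length of
    N \<beta>' - k \<alpha>, which equals N (2 N - k^2).\<close>
  have CS: "k * k \<le> 2 * N"
  proof -
    have "form (rsc (real_of_int N) \<beta>' - rsc (real_of_int k) \<alpha>) (rsc (real_of_int N) \<beta>' - rsc (real_of_int k) \<alpha>) \<ge> 0"
      using form_pos[OF Q_diff[OF scale_Q[OF Q(2), of N] scale_Q[OF Q(1), of k]]]
        form_zero[OF pos_lattice_subset[OF pos_lattice.zero]] by force
    also have "form (rsc (real_of_int N) \<beta>' - rsc (real_of_int k) \<alpha>) (rsc (real_of_int N) \<beta>' - rsc (real_of_int k) \<alpha>) =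
        N * N * 2 - 2 * N * k * k + k * k * N"
      unfolding form_scale_diff[OF Q(2,1)] using b(2) form_sym[OF Q] by (simp add: N_def k_def)
    also have "\<dots> = N * (2 * N - k * k)" by (simp add: algebra_simps)
    finally show ?thesis using N by (simp add: zero_le_mult_iff)
  qed
  have "a * a * N * N = 4 * (k * k)" using arg_cong2[OF a a, of "(*)"] by (simp add: mult_ac)
  also have "\<dots> \<le> 8 * N" using CS by simp
  finally have "a * a * N \<le> 8" using N by (simp add: mult_le_cancel_right)
  then have "a * a * 2 \<le> 8" using N mult_left_mono[of 2 N "a * a"] by simp
  then have "\<bar>a\<bar> \<le> 2" using abs_le_square_iff[of a 2] by (simp add: power2_eq_square)
  moreover have "a \<noteq> 0" using a k by auto
  \<comment> \<open>If a is 1 or -1 then N is 2 k up to sign, hence even. If a is 2 or -2 then a^2 N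
    \<le> 8 gives N \<le> 2, so N = 2.\<close>
  ultimately consider "\<bar>a\<bar> = 1" | "\<bar>a\<bar> = 2" by linarith
  then have "even N"
  proof cases
    case 1
    then have "N = 2 * k \<or> N = 2 * (- k)" using a by (auto simp: abs_if split: if_splits)
    then show ?thesis by (metis dvd_triv_left)
  next
    case 2
    then have "a = 2 \<or> a = - 2" by linarith
    then have "a * a = 4" by auto
    then have "N \<le> 2" using \<open>a * a * N \<le> 8\<close> by simp
    then show ?thesis using N by simp
  qed
  then show ?thesis by (simp add: N_def)
qed

end

theorem theorem3p8:
  fixes scale :: "complex \<Rightarrow> 'g::ab_group_add \<Rightarrow> 'g"
    and bracket :: "'g \<Rightarrow> 'g \<Rightarrow> 'g"
    and H :: "'g set"
    and S :: "('g \<Rightarrow> complex) set"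
    and form :: "('g \<Rightarrow> complex) \<Rightarrow> ('g \<Rightarrow> complex) \<Rightarrow> int"
    and q :: complex
    and C :: "(('g \<Rightarrow> complex) generator list \<Rightarrow>\<^sub>0 complex) set set"
  assumes "complex_lie_algebra scale bracket"
    and "complex_lie_algebra.finite_dimensional scale"
    and "complex_lie_algebra.semisimple scale bracket"
    and "complex_lie_algebra.cartan_subalgebra scale bracket H"
    and "simple_roots (complex_lie_algebra.roots scale bracket H) S"
    and "invariant_form (complex_lie_algebra.roots scale bracket H) S form"
    and "q \<noteq> 0" and "\<forall>n>0. q ^ n \<noteq> 1"
    and "quantum_group.right_coideal_subalgebra S form q C"
    and "quantum_group.hopf_subalgebra S form q (C \<inter> quantum_group.U_zero S form q)"
  shows "\<exists>Z\<subseteq>C. generated_subalgebra (quantum_group.Uq S form q) Z = C \<and>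
           (\<forall>X\<in>Z. \<forall>\<mu>\<in>quantum_group.E_leading_weights S form q X.
              quantum_group.E_leading_term S form q \<mu> X \<in> quantum_group.U_geq S form q)"
proof -
  interpret R: root_form "complex_lie_algebra.roots scale bracket H" S form
    using assms(5,6) by unfold_locales (simp_all add: complex_lie_algebra.roots_def[OF assms(1)])
  have ind: "\<not> module.dependent (\<lambda>(c::real) (\<alpha> :: 'g \<Rightarrow> complex) x. complex_of_real c * \<alpha> x) S"
    using assms(5) by (simp add: simple_roots_def)
  \<comment> \<open>The height exists because simple roots are linearly independent over the
    reals.\<close>
  obtain ht :: "('g \<Rightarrow> complex) \<Rightarrow> real" where ht: "\<And>x y. ht (x + y) = ht x + ht y" "\<And>\<alpha>. \<alpha> \<in> S \<Longrightarrow> ht \<alpha> = 1"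
    by (rule real_functional[OF ind, of "\<lambda>_. 1"]) blast
  interpret qgroup S form q ht
    by unfold_locales
      (fact R.form_sym R.form_add R.form_pos ht R.cartan_integer R.simple_even assms(7) assms(8)[rule_format])+
  show ?thesis by (rule generated_by_good_leading_terms[OF assms(9,10)])
qed

end
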